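(* Let $\Omega\subset\mathbb R^n$ be a bounded open set with $C^2$ boundary, let $L,F,G$ satisfy the assumptions below, $H$ as below, and let $(u,m)$ be a mild solution of the constrained MFG problem in $\overline\Omega$. Then $u$ is a constrained viscosity solution of $$-\partial_tu+H(x,Du)=F(x,m(t))\ \text{ in }(0,T)\times\overline\Omega,\qquad u(T,x)=G(x,m(T))\ \text{ in }\overline\Omega.$$ Moreover, $u$ is differentiable at every $(t,x)\in Q_m$ with $-\partial_tu(t,x)+H(x,Du(t,x))=F(x,m(t))$ there, while at every $(t,x)\in\partial Q_m$ the time derivative $\partial_tu(t,x)$ exists and $-\partial_tu(t,x)+H^\tau(x,D^\tau_xu(t,x))=F(x,m(t))$.
   Context: $T>0$; $U\supset\overline\Omega$ open; $\nu(x)$ outward unit normal at $x\in\partial\Omega$. $\mathcal P(\overline\Omega)$ with the Kantorovich–Rubinstein distance $d_1$. Assumptions: (D1) $|F(x,m_1)-F(x,m_2)|+|G(x,m_1)-G(x,m_2)|\le\kappa d_1(m_1,m_2)$; (D2) $F(\cdot,m),G(\cdot,m)\in C^1_b(U)$, $|D_xF|+|D_xG|\le\kappa$; (D3) $x\mapsto F(x,m)$ semiconcave with linear modulus uniformly in $m$; (L0) $L\in C^1(U\times\mathbb R^n)$, $|L(x,0)|+|D_xL(x,0)|+|D_vL(x,0)|\le M$; (L1) $D_vL$ differentiable, $I/\mu\le D^2_{vv}L\le\mu I$, $\|D^2_{vx}L(x,v)\|\le\mu(1+|v|)$; (L2) $|D_xL(x,v)-D_xL(x,w)|\le C(R)|v-w|$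 for $v,w\in B_R$; (L3) $x\mapsto L(x,v)$ semiconcave with linear modulus uniformly in $v\in B_R$. $H(x,p)=\sup_v\{-\langle p,v\rangle-L(x,v)\}$; $H^\tau(x,p)=\sup\{-\langle p,v\rangle-L(x,v):\langle v,\nu(x)\rangle=0\}$ for $x\in\partial\Omega$. $\Gamma$: absolutely continuous curves $[0,T]\to\overline\Omega$; $\Gamma_t[x]=\{\gamma:\gamma(t)=x\}$; $e_t(\gamma)=\gamma(t)$; $m^\eta(t)=e_t\sharp\eta$; $J_\eta[\gamma]=\int_0^T[L(\gamma,\dot\gamma)+F(\gamma,m^\eta(t))]dt+G(\gamma(T),m^\eta(T))$; $\Gamma^\eta[x]$ minimizers of $J_\eta$ over $\Gamma_0[x]$. Constrained MFG equilibrium for $m_0$: Borel probability $\eta$ on $\Gamma$ with $e_0\sharp\eta=m_0$ and $\mathrm{supp}\,\eta\subset\bigcup_x\Gamma^\eta[x]$. Mild solution: $(u,m)\in C([0,T]\times\overline\Omega)\times C([0,T];\mathcal P(\overline\Omega))$ with, for some equilibrium $\eta$, $m(t)=e_t\sharp\eta$ and $u(t,x)=\inf_{\gamma\in\Gamma_t[x]}\{\int_t^T[L(\gamma,\dot\gamma)+F(\gamma(s),m(s))]ds+G(\gamma(T),m(T))\}$. $Q_m=\{(t,x)\in(0,T)\times\Omega:x\in\mathrm{supp}(m(t))\}$, $\partial Q_m=\{(t,x)\in(0,T)\times\partial\Omega:x\in\mathrm{supp}(m(t))\}$. For $(t,x)\in\partial Q_m$, $D^\tau_xu(t,x)$ denotes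 the common tangential component $p-\langle p,\nu(x)\rangle\nu(x)$ of all $p$ in $D^+_xu(t,x)=\{p:\limsup_{y\to x,y\in\overline\Omega}\frac{u(t,y)-u(t,x)-\langle p,y-x\rangle}{|y-x|}\le0\}$. Constrained viscosity solution of the equation: $u$ is a subsolution in $(0,T)\times\Omega$ (whenever $\phi\in C^1(\mathbb R^{n+1})$ and $u-\phi$ has a local max relative to $(0,T)\times\Omega$ at $(t,x)\in(0,T)\times\Omega$, $-\partial_t\phi+H(x,D\phi)\le F(x,m(t))$ at $(t,x)$) and a supersolution in $(0,T)\times\overline\Omega$ (whenever $u-\phi$ has a local min relative to $(0,T)\times\overline\Omega$ at $(t,x)\in(0,T)\times\overline\Omega$, $-\partial_t\phi+H(x,D\phi)\ge F(x,m(t))$ at $(t,x)$). *)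

theory Defs
  imports "HOL-Probability.Probability"
begin

definition local_C2_defining ::
  "'a::euclidean_space set \<Rightarrow> 'a \<Rightarrow> real \<Rightarrow> ('a \<Rightarrow> real) \<Rightarrow> ('a \<Rightarrow> 'a) \<Rightarrow> ('a \<Rightarrow> 'a \<Rightarrow> 'a) \<Rightarrow> bool"
  where "local_C2_defining \<Omega> x0 r \<psi> \<psi>' \<psi>'' \<longleftrightarrow>
     (\<forall>x\<in>ball x0 r. (\<psi> has_derivative (\<lambda>h. \<psi>' x \<bullet> h)) (at x)
                   \<and> (\<psi>' has_derivative \<psi>'' x) (at x) \<and> \<psi>' x \<noteq> 0)
   \<and> (\<forall>h. continuous_on (ball x0 r) (\<lambda>x. \<psi>'' x h))
   \<and> \<Omega> \<inter> ball x0 r = {x\<in>ball x0 r. \<psi> x < 0}"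

definition C2_boundary :: "'a::euclidean_space set \<Rightarrow> bool"
  where "C2_boundary \<Omega> \<longleftrightarrow>
    (\<forall>x0\<in>frontier \<Omega>. \<exists>r>0. \<exists>\<psi> \<psi>' \<psi>''. local_C2_defining \<Omega> x0 r \<psi> \<psi>' \<psi>'')"

definition outward_normal :: "'a::euclidean_space set \<Rightarrow> 'a \<Rightarrow> 'a"
  where "outward_normal \<Omega> x = (SOME \<nu>. \<exists>r>0. \<exists>\<psi> \<psi>' \<psi>''.
     local_C2_defining \<Omega> x r \<psi> \<psi>' \<psi>'' \<and> \<nu> = \<psi>' x /\<^sub>R norm (\<psi>' x))"

definition prob_on :: "'a::euclidean_space set \<Rightarrow> 'a measure \<Rightarrow> bool"
  where "prob_on K \<mu> \<longleftrightarrow> prob_space \<mu> \<and> sets \<mu> = sets borel \<and> emeasure \<mu> K = 1"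

definition KR_dist :: "'a::euclidean_space set \<Rightarrow> 'a measure \<Rightarrow> 'a measure \<Rightarrow> real"
  where "KR_dist K \<mu>1 \<mu>2 =
    (SUP f\<in>{f::'a \<Rightarrow> real. 1-lipschitz_on K f}.
        set_lebesgue_integral \<mu>1 K f - set_lebesgue_integral \<mu>2 K f)"

definition measure_path_cont :: "'a::euclidean_space set \<Rightarrow> real \<Rightarrow> (real \<Rightarrow> 'a measure) \<Rightarrow> bool"
  where "measure_path_cont K T m \<longleftrightarrow>
    (\<forall>t\<in>{0..T}. prob_on K (m t)) \<and>
    (\<forall>t\<in>{0..T}. \<forall>\<epsilon>>0. \<exists>\<delta>>0. \<forall>s\<in>{0..T}. \<bar>s - t\<bar> < \<delta> \<longrightarrow> KR_dist K (m s) (m t) < \<epsilon>)"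

definition msupp :: "'a::metric_space measure \<Rightarrow> 'a set"
  where "msupp \<mu> = {x. \<forall>r>0. emeasure \<mu> (ball x r) > 0}"

definition abs_cont_on :: "real \<Rightarrow> real \<Rightarrow> (real \<Rightarrow> 'a::real_normed_vector) \<Rightarrow> bool"
  where "abs_cont_on a b \<gamma> \<longleftrightarrow>
    (\<forall>\<epsilon>>0. \<exists>\<delta>>0. \<forall>(n::nat) (s::nat \<Rightarrow> real) (t::nat \<Rightarrow> real).
        (\<forall>i<n. a \<le> s i \<and> s i \<le> t i \<and> t i \<le> b) \<and>
        (\<forall>i<n. \<forall>j<n. i \<noteq> j \<longrightarrow> t i \<le> s j \<or> t j \<le> s i) \<and>
        (\<Sum>i<n. t i - s i) < \<delta>
        \<longrightarrow> (\<Sum>i<n. norm (\<gamma> (t i) - \<gamma> (s i))) < \<epsilon>)"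

text \<open>The space \<Gamma> of absolutely continuous curves [0,T] \<rightarrow> closure \<Omega>, with the uniform
  topology. A curve is represented by its constant extension outside [0,T], as an element of
  the space of bounded continuous functions R \<rightarrow> R^n (sup-norm), so that the Borel structure
  of \<Gamma> is the one induced by the uniform metric on [0,T].\<close>
definition curves :: "real \<Rightarrow> 'a::euclidean_space set \<Rightarrow> (real \<Rightarrow>\<^sub>C 'a) set"
  where "curves T \<Omega> = {\<gamma>. (\<forall>t. apply_bcontfun \<gamma> t = apply_bcontfun \<gamma> (min T (max 0 t)))
        \<and> abs_cont_on 0 T (apply_bcontfun \<gamma>)
        \<and> (\<forall>t\<in>{0..T}. apply_bcontfun \<gamma> t \<in> closure \<Omega>)}"

definition flow :: "(real \<Rightarrow>\<^sub>C 'a::euclidean_space) measure \<Rightarrow> real \<Rightarrow> 'a measure"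
  where "flow \<eta> t = distr \<eta> borel (\<lambda>\<gamma>. apply_bcontfun \<gamma> t)"

definition ext_lint :: "real set \<Rightarrow> (real \<Rightarrow> real) \<Rightarrow> ereal"
  where "ext_lint A f =
    enn2ereal (\<integral>\<^sup>+ s. ennreal (f s) * indicator A s \<partial>lebesgue)
  - enn2ereal (\<integral>\<^sup>+ s. ennreal (- f s) * indicator A s \<partial>lebesgue)"

definition cost ::
  "('a::euclidean_space \<Rightarrow> 'a \<Rightarrow> real) \<Rightarrow> ('a \<Rightarrow> 'a measure \<Rightarrow> real) \<Rightarrow> ('a \<Rightarrow> 'a measure \<Rightarrow> real)
   \<Rightarrow> (real \<Rightarrow> 'a measure) \<Rightarrow> real \<Rightarrow> real \<Rightarrow> (real \<Rightarrow> 'a) \<Rightarrow> ereal"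
  where "cost L F G m T t \<gamma> =
    ext_lint {t..T} (\<lambda>s. L (\<gamma> s) (vector_derivative \<gamma> (at s)) + F (\<gamma> s) (m s))
    + ereal (G (\<gamma> T) (m T))"

definition optimal_curves ::
  "('a::euclidean_space \<Rightarrow> 'a \<Rightarrow> real) \<Rightarrow> ('a \<Rightarrow> 'a measure \<Rightarrow> real) \<Rightarrow> ('a \<Rightarrow> 'a measure \<Rightarrow> real)
   \<Rightarrow> real \<Rightarrow> 'a set \<Rightarrow> (real \<Rightarrow>\<^sub>C 'a) measure \<Rightarrow> 'a \<Rightarrow> (real \<Rightarrow>\<^sub>C 'a) set"
  where "optimal_curves L F G T \<Omega> \<eta> x =
    {\<gamma>\<in>curves T \<Omega>. apply_bcontfun \<gamma> 0 = x \<and>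
       (\<forall>\<gamma>'\<in>curves T \<Omega>. apply_bcontfun \<gamma>' 0 = x \<longrightarrow>
          cost L F G (flow \<eta>) T 0 (apply_bcontfun \<gamma>) \<le> cost L F G (flow \<eta>) T 0 (apply_bcontfun \<gamma>'))}"

definition supp_in :: "'b::topological_space set \<Rightarrow> 'b measure \<Rightarrow> 'b set"
  where "supp_in S \<eta> = {x\<in>S. \<forall>N. open N \<and> x \<in> N \<longrightarrow> emeasure \<eta> N > 0}"

definition MFG_equilibrium ::
  "('a::euclidean_space \<Rightarrow> 'a \<Rightarrow> real) \<Rightarrow> ('a \<Rightarrow> 'a measure \<Rightarrow> real) \<Rightarrow> ('a \<Rightarrow> 'a measure \<Rightarrow> real)
   \<Rightarrow> real \<Rightarrow> 'a set \<Rightarrow> 'a measure \<Rightarrow> (real \<Rightarrow>\<^sub>C 'a) measure \<Rightarrow> bool"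
  where "MFG_equilibrium L F G T \<Omega> m0 \<eta> \<longleftrightarrow>
    prob_space \<eta> \<and> sets \<eta> = sets borel \<and> emeasure \<eta> (curves T \<Omega>) = 1 \<and>
    flow \<eta> 0 = m0 \<and>
    supp_in (curves T \<Omega>) \<eta> \<subseteq> (\<Union>x\<in>closure \<Omega>. optimal_curves L F G T \<Omega> \<eta> x)"

definition mild_solution ::
  "('a::euclidean_space \<Rightarrow> 'a \<Rightarrow> real) \<Rightarrow> ('a \<Rightarrow> 'a measure \<Rightarrow> real) \<Rightarrow> ('a \<Rightarrow> 'a measure \<Rightarrow> real)
   \<Rightarrow> real \<Rightarrow> 'a set \<Rightarrow> 'a measure \<Rightarrow> (real \<Rightarrow> 'a \<Rightarrow> real) \<Rightarrow> (real \<Rightarrow> 'a measure) \<Rightarrow> bool"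
  where "mild_solution L F G T \<Omega> m0 u m \<longleftrightarrow>
    continuous_on ({0..T} \<times> closure \<Omega>) (\<lambda>(t,x). u t x) \<and>
    measure_path_cont (closure \<Omega>) T m \<and>
    (\<exists>\<eta>. MFG_equilibrium L F G T \<Omega> m0 \<eta> \<and>
       (\<forall>t\<in>{0..T}. m t = flow \<eta> t) \<and>
       (\<forall>t\<in>{0..T}. \<forall>x\<in>closure \<Omega>.
          ereal (u t x) = (INF \<gamma>\<in>{\<gamma>\<in>curves T \<Omega>. apply_bcontfun \<gamma> t = x}.
                              cost L F G m T t (apply_bcontfun \<gamma>))))"

definition Ham :: "('a::euclidean_space \<Rightarrow> 'a \<Rightarrow> real) \<Rightarrow> 'a \<Rightarrow> 'a \<Rightarrow> real"
  where "Ham L x p = (SUP v. - (p \<bullet> v) - L x v)"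

definition Ham_tau :: "('a::euclidean_space \<Rightarrow> 'a \<Rightarrow> real) \<Rightarrow> 'a set \<Rightarrow> 'a \<Rightarrow> 'a \<Rightarrow> real"
  where "Ham_tau L \<Omega> x p = (SUP v\<in>{v. v \<bullet> outward_normal \<Omega> x = 0}. - (p \<bullet> v) - L x v)"

text \<open>Semiconcavity on S with linear modulus \<omega>(r) = C r.\<close>
definition semiconcave_lin :: "'a::euclidean_space set \<Rightarrow> real \<Rightarrow> ('a \<Rightarrow> real) \<Rightarrow> bool"
  where "semiconcave_lin S C f \<longleftrightarrow>
    (\<forall>x y l. closed_segment x y \<subseteq> S \<and> 0 \<le> l \<and> l \<le> 1 \<longrightarrow>
       l * f x + (1 - l) * f y - f (l *\<^sub>R x + (1 - l) *\<^sub>R y) \<le> C * l * (1 - l) * (norm (x - y))\<^sup>2)"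

definition C1_test :: "(real \<Rightarrow> 'a::euclidean_space \<Rightarrow> real) \<Rightarrow> (real \<Rightarrow> 'a \<Rightarrow> real) \<Rightarrow> (real \<Rightarrow> 'a \<Rightarrow> 'a) \<Rightarrow> bool"
  where "C1_test \<phi> \<phi>t \<phi>x \<longleftrightarrow>
    (\<forall>t x. ((\<lambda>(s,y). \<phi> s y) has_derivative (\<lambda>(ds,dy). \<phi>t t x * ds + \<phi>x t x \<bullet> dy)) (at (t,x))) \<and>
    continuous_on UNIV (\<lambda>(t,x). \<phi>t t x) \<and> continuous_on UNIV (\<lambda>(t,x). \<phi>x t x)"

definition visc_subsol ::
  "('a::euclidean_space \<Rightarrow> 'a \<Rightarrow> real) \<Rightarrow> ('a \<Rightarrow> 'a measure \<Rightarrow> real) \<Rightarrow> real \<Rightarrow> 'a set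
   \<Rightarrow> (real \<Rightarrow> 'a measure) \<Rightarrow> (real \<Rightarrow> 'a \<Rightarrow> real) \<Rightarrow> bool"
  where "visc_subsol L F T S m u \<longleftrightarrow>
    (\<forall>\<phi> \<phi>t \<phi>x t x. C1_test \<phi> \<phi>t \<phi>x \<and> t \<in> {0<..<T} \<and> x \<in> S \<and>
       (\<exists>r>0. \<forall>s y. s \<in> {0<..<T} \<and> y \<in> S \<and> \<bar>s - t\<bar> < r \<and> dist y x < r \<longrightarrow>
                    u s y - \<phi> s y \<le> u t x - \<phi> t x)
       \<longrightarrow> - \<phi>t t x + Ham L x (\<phi>x t x) \<le> F x (m t))"

definition visc_supersol ::
  "('a::euclidean_space \<Rightarrow> 'a \<Rightarrow> real) \<Rightarrow> ('a \<Rightarrow> 'a measure \<Rightarrow> real) \<Rightarrow> real \<Rightarrow> 'a set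
   \<Rightarrow> (real \<Rightarrow> 'a measure) \<Rightarrow> (real \<Rightarrow> 'a \<Rightarrow> real) \<Rightarrow> bool"
  where "visc_supersol L F T S m u \<longleftrightarrow>
    (\<forall>\<phi> \<phi>t \<phi>x t x. C1_test \<phi> \<phi>t \<phi>x \<and> t \<in> {0<..<T} \<and> x \<in> S \<and>
       (\<exists>r>0. \<forall>s y. s \<in> {0<..<T} \<and> y \<in> S \<and> \<bar>s - t\<bar> < r \<and> dist y x < r \<longrightarrow>
                    u s y - \<phi> s y \<ge> u t x - \<phi> t x)
       \<longrightarrow> - \<phi>t t x + Ham L x (\<phi>x t x) \<ge> F x (m t))"

definition constrained_visc_sol ::
  "('a::euclidean_space \<Rightarrow> 'a \<Rightarrow> real) \<Rightarrow> ('a \<Rightarrow> 'a measure \<Rightarrow> real) \<Rightarrow> real \<Rightarrow> 'a set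
   \<Rightarrow> (real \<Rightarrow> 'a measure) \<Rightarrow> (real \<Rightarrow> 'a \<Rightarrow> real) \<Rightarrow> bool"
  where "constrained_visc_sol L F T \<Omega> m u \<longleftrightarrow>
    visc_subsol L F T \<Omega> m u \<and> visc_supersol L F T (closure \<Omega>) m u"

definition superdiff_x :: "'a::euclidean_space set \<Rightarrow> (real \<Rightarrow> 'a \<Rightarrow> real) \<Rightarrow> real \<Rightarrow> 'a \<Rightarrow> 'a set"
  where "superdiff_x \<Omega> u t x = {p. \<forall>\<epsilon>>0. \<exists>\<delta>>0. \<forall>y\<in>closure \<Omega>. 0 < dist y x \<and> dist y x < \<delta> \<longrightarrow>
            (u t y - u t x - p \<bullet> (y - x)) / norm (y - x) \<le> \<epsilon>}"

definition tangential :: "'a::euclidean_space \<Rightarrow> 'a \<Rightarrow> 'a"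
  where "tangential \<nu> p = p - (p \<bullet> \<nu>) *\<^sub>R \<nu>"

end

theory Submission
  imports Defs "HOL-Complex_Analysis.Great_Picard"
begin

text \<open>Let \<open>\<gamma>\<close> be an optimal curve through \<open>x\<close> at time \<open>t\<close>. A segment joining two points of the closed
  domain close to \<open>x\<close> can be pushed back into the domain by a correction that is quadratic in its
  length. Comparing \<open>\<gamma>\<close> with such corrected segments and using the strong convexity of \<open>L\<close> in the
  velocity bounds the variance of \<open>\<gamma>'\<close> on an interval of length \<open>h\<close> around \<open>t\<close> by a power of \<open>h\<close>,
  so \<open>\<gamma>\<close> is differentiable at \<open>t\<close>, with velocity \<open>v\<close> say. Corrected segments from nearby points
  \<open>(s, y)\<close> to points of \<open>\<gamma>\<close> slightly after \<open>t\<close>, and from points slightly before \<open>t\<close> to \<open>(s, y)\<close>,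
  then bound \<open>u(s, y)\<close> from above and below, and both bounds have the first order expansion
  \<open>u(t, x) + (q v - L(x, v) - F) (s - t) - q (y - x)\<close> with \<open>q = D\<^sub>v L(x, v)\<close>, relative to the closed
  domain. At an interior point this is differentiability together with the equation, since
  \<open>H(x, -q) = q v - L(x, v)\<close>; at a boundary point \<open>v\<close> is tangential, so the same duality gives
  \<open>H\<^sup>\<tau>\<close>. The viscosity inequalities only need one step of dynamic programming.\<close>

section \<open>Absolutely continuous functions\<close>

hide_const (open) Polynomial.content

text \<open>The definitions offer epsilon-delta absolute continuity and a pointwise
  \<open>vector_derivative\<close>, so differentiability almost everywhere and the fundamental
  theorem for such curves must precede any control theory. Of an optimal curve only finite energy is
  known at the outset, that is, Hoelder exponent 1/2. This is just enough: during a time h the curve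
  stays within \<rho> = O(h^(1/2)) of x, freezing x costs O(\<rho>) per unit time, so the mean
  square deviation of the velocity is O(h^(1/2)), and mean velocities at successive scales differ by
  O(h^(1/4)), a geometric series. A quadratic boundary correction is harmless because its velocity
  is |w| times the length of the segment, again O(\<rho>). For the expansion, a point at distance k
  from (t, x) is joined to the curve after a time \<delta> = k/\<epsilon>: long against k, so that
  velocities hardly change, but short enough for errors of order \<delta>^2 to be small against k.
  Finally, an equilibrium speaks of a support inside a function space that is not separable;
  separability of the set of curves and compactness of the optimal ones supply an optimal curve
  through each point of the support of m(t).\<close>

lemma abs_cont_onE:
  assumes "abs_cont_on a b f" "e > 0"
  obtains d where "d > 0"
    "\<And>(n::nat) s t. \<lbrakk>\<And>i. i < n \<Longrightarrow> a \<le> s i; \<And>i. i < n \<Longrightarrow> s i \<le> t i; \<And>i. i < n \<Longrightarrow> t i \<le> b;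
        \<And>i j. \<lbrakk>i < n; j < n; i \<noteq> j\<rbrakk> \<Longrightarrow> t i \<le> s j \<or> t j \<le> s i; (\<Sum>i<n. t i - s i) < d\<rbrakk>
        \<Longrightarrow> (\<Sum>i<n. norm (f (t i) - f (s i))) < e"
proof -
  from assms(1)[unfolded abs_cont_on_def, rule_format, OF assms(2)] obtain d where "d > 0"
    and d: "\<forall>(n::nat) s t. (\<forall>i<n. a \<le> s i \<and> s i \<le> t i \<and> t i \<le> b) \<and>
        (\<forall>i<n. \<forall>j<n. i \<noteq> j \<longrightarrow> t i \<le> s j \<or> t j \<le> s i) \<and> (\<Sum>i<n. t i - s i) < d
        \<longrightarrow> (\<Sum>i<n. norm (f (t i) - f (s i))) < e"
    by (elim exE conjE)
  show thesis
    by (rule that[OF \<open>d > 0\<close>], rule d[rule_format]) auto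
qed

lemma abs_cont_on_imp_continuous_on:
  assumes "abs_cont_on a b f"
  shows "continuous_on {a..b} f"
proof (rule continuous_on_iff[THEN iffD2], intro ballI allI impI)
  fix x and e :: real assume x: "x \<in> {a..b}" and "0 < e"
  from abs_cont_onE[OF assms \<open>0 < e\<close>] obtain d where "d > 0" and
    d: "\<And>(n::nat) s t. \<lbrakk>\<And>i. i < n \<Longrightarrow> a \<le> s i; \<And>i. i < n \<Longrightarrow> s i \<le> t i; \<And>i. i < n \<Longrightarrow> t i \<le> b;
        \<And>i j. \<lbrakk>i < n; j < n; i \<noteq> j\<rbrakk> \<Longrightarrow> t i \<le> s j \<or> t j \<le> s i; (\<Sum>i<n. t i - s i) < d\<rbrakk>
        \<Longrightarrow> (\<Sum>i<n. norm (f (t i) - f (s i))) < e" by blast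
  have "dist (f y) (f x) < e" if y: "y \<in> {a..b}" "dist y x < d" for y
  proof (cases "x \<le> y")
    case True
    then show ?thesis using d[of 1 "\<lambda>_. x" "\<lambda>_. y"] x y by (simp add: dist_norm)
  next
    case False
    then show ?thesis using d[of 1 "\<lambda>_. y" "\<lambda>_. x"] x y by (simp add: dist_norm norm_minus_commute)
  qed
  then show "\<exists>d>0. \<forall>y\<in>{a..b}. dist y x < d \<longrightarrow> dist (f y) (f x) < e"
    using \<open>d > 0\<close> by blast
qed

section \<open>Increments over divisions and the fundamental theorem of calculus\<close>

text \<open>Gauge integrals and Vitali families supply sets of intervals rather than indexed
  endpoints. Only pieces of positive content are passed to the definition: a division may contain a
  single point in the middle of another piece, which violates the separation condition of
  \<open>abs_cont_on\<close>, but the increment over it is zero.\<close>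

lemma abs_cont_on_division:
  assumes "abs_cont_on a b f" and "e > 0"
  obtains d where "d > 0"
    "\<And>p. \<lbrakk>p division_of \<Union>p; \<Union>p \<subseteq> {a..b}; (\<Sum>K\<in>p. content K) < d\<rbrakk>
        \<Longrightarrow> (\<Sum>K\<in>p. norm (f (Sup K) - f (Inf K))) < e"
proof -
  from abs_cont_onE[OF assms] obtain d where "d > 0" and
    d: "\<And>(n::nat) s t. \<lbrakk>\<And>i. i < n \<Longrightarrow> a \<le> s i; \<And>i. i < n \<Longrightarrow> s i \<le> t i; \<And>i. i < n \<Longrightarrow> t i \<le> b;
        \<And>i j. \<lbrakk>i < n; j < n; i \<noteq> j\<rbrakk> \<Longrightarrow> t i \<le> s j \<or> t j \<le> s i; (\<Sum>i<n. t i - s i) < d\<rbrakk>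
        \<Longrightarrow> (\<Sum>i<n. norm (f (t i) - f (s i))) < e" by blast
  have "(\<Sum>K\<in>p. norm (f (Sup K) - f (Inf K))) < e"
    if p: "p division_of \<Union>p" and sub: "\<Union>p \<subseteq> {a..b}" and small: "(\<Sum>K\<in>p. content K) < d" for p
  proof -
    define P where "P = {K\<in>p. content K > 0}"
    have "finite p" using p by blast
    then have "finite P" by (simp add: P_def)
    have K: "\<exists>l r. K = {l..r} \<and> l < r \<and> a \<le> l \<and> r \<le> b \<and> content K = r - l \<and> Sup K = r \<and> Inf K = l"
      if "K \<in> P" for K
    proof -
      have KP: "K \<in> p" "content K > 0" using that by (auto simp: P_def)
      obtain l r where lr: "K = cbox l r" using division_ofD(4)[OF p KP(1)] by blast
      then have "l < r" using KP(2) by (cases "l < r") (auto simp: content_real_if split: if_splits)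
      moreover have "K \<subseteq> {a..b}" using that sub by (auto simp: P_def)
      ultimately show ?thesis using lr by auto
    qed
    obtain h where h: "bij_betw h {..<card P} P"
      using ex_bij_betw_nat_finite[OF \<open>finite P\<close>] by (auto simp: atLeast0LessThan)
    have hP: "h i \<in> P" if "i < card P" for i using h that by (auto simp: bij_betw_def)
    have disj: "Sup K \<le> Inf K' \<or> Sup K' \<le> Inf K" if "K \<in> P" "K' \<in> P" "K \<noteq> K'" for K K'
    proof (rule ccontr)
      assume *: "\<not> (Sup K \<le> Inf K' \<or> Sup K' \<le> Inf K)"
      note K1 = K[OF that(1)] and K2 = K[OF that(2)]
      obtain l r where lr: "K = {l..r}" "l < r" "Sup K = r" "Inf K = l" using K1 by blast
      obtain l' r' where lr': "K' = {l'..r'}" "l' < r'" "Sup K' = r'" "Inf K' = l'" using K2 by blast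
      have "interior K \<inter> interior K' = {}" using p that by (auto simp: P_def dest: division_ofD(5))
      moreover have "(max l l' + min r r') / 2 \<in> interior K \<inter> interior K'"
        using * lr lr' by (auto simp: interior_atLeastAtMost_real)
      ultimately show False by blast
    qed
    have "(\<Sum>K\<in>P. norm (f (Sup K) - f (Inf K))) = (\<Sum>i<card P. norm (f (Sup (h i)) - f (Inf (h i))))"
      by (rule sum.reindex_bij_betw[OF h, symmetric])
    also have "\<dots> < e"
    proof (rule d)
      fix i assume "i < card P"
      from K[OF hP[OF this]] show "a \<le> Inf (h i)" "Inf (h i) \<le> Sup (h i)" "Sup (h i) \<le> b" by auto
    next
      fix i j assume "i < card P" "j < card P" "i \<noteq> j"
      moreover from this h have "h i \<noteq> h j" by (auto simp: bij_betw_def inj_on_def)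
      ultimately show "Sup (h i) \<le> Inf (h j) \<or> Sup (h j) \<le> Inf (h i)"
        by (intro disj hP)
    next
      have "(\<Sum>i<card P. Sup (h i) - Inf (h i)) = (\<Sum>K\<in>P. Sup K - Inf K)"
        by (rule sum.reindex_bij_betw[OF h])
      also have "\<dots> = (\<Sum>K\<in>P. content K)" by (rule sum.cong) (use K in auto)
      also have "\<dots> \<le> (\<Sum>K\<in>p. content K)"
        by (rule sum_mono2) (use \<open>finite p\<close> in \<open>auto simp: P_def\<close>)
      finally show "(\<Sum>i<card P. Sup (h i) - Inf (h i)) < d" using small by simp
    qed
    also have "(\<Sum>K\<in>P. norm (f (Sup K) - f (Inf K))) = (\<Sum>K\<in>p. norm (f (Sup K) - f (Inf K)))"
    proof (rule sum.mono_neutral_left[OF \<open>finite p\<close>])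
      show "\<forall>K\<in>p - P. norm (f (Sup K) - f (Inf K)) = 0"
      proof
        fix K assume K: "K \<in> p - P"
        then obtain l r where lr: "K = {l..r}" "l \<le> r" using p
          by (metis DiffD1 atLeastatMost_empty_iff2 box_real(2) division_ofD(3,4))
        then have "content K = 0" using K by (auto simp: P_def)
        with lr have "l = r" by simp
        with lr show "norm (f (Sup K) - f (Inf K)) = 0" by simp
      qed
    qed (auto simp: P_def)
    finally show ?thesis .
  qed
  with \<open>d > 0\<close> that show ?thesis by blast
qed

text \<open>The gauge treats two kinds of tags. At a tag outside \<open>N\<close>, differentiability
  makes the increment agree with the Riemann term up to e times the length. Tags in \<open>N\<close>
  are confined to an open set of measure below \<delta>, where absolute continuity bounds the sum of
  all increments.\<close>

lemma has_integral_abs_cont_deriv: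
  fixes f :: "real \<Rightarrow> 'a::banach"
  assumes ab: "a \<le> b" and f: "abs_cont_on a b f" and N: "negligible N"
    and vecd: "\<And>x. x \<in> {a..b} - N \<Longrightarrow> (f has_vector_derivative f' x) (at x within {a..b})"
  shows "(f' has_integral (f b - f a)) {a..b}"
proof -
  \<comment> \<open>Zero on \<open>N\<close>, so that tags there contribute no Riemann term and
    leave only their increments to estimate; the values on the null set are restored at the
    end.\<close>
  define g where "g x = (if x \<in> N then 0 else f' x)" for x
  have "(g has_integral (f b - f a)) {a..b}"
    unfolding has_integral_real
  proof (intro allI impI)
    fix e0 :: real assume "e0 > 0"
    define e where "e = e0 / (2 * (b - a + 1))"
    have "e > 0" using \<open>e0 > 0\<close> ab by (simp add: e_def)
    have ee: "e * (b - a) < e0 / 2" using \<open>e0 > 0\<close> ab by (simp add: e_def field_simps)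
    have "\<forall>x. \<exists>d>0. x \<in> {a..b} - N \<longrightarrow>
         (\<forall>y\<in>{a..b}. norm (y-x) < d \<longrightarrow> norm (f y - f x - (y-x) *\<^sub>R f' x) \<le> e * norm (y-x))"
      using vecd[unfolded has_vector_derivative_def has_derivative_within_alt] \<open>e > 0\<close> by (meson zero_less_one)
    then obtain d where d: "\<And>x. 0 < d x"
      "\<And>x y. \<lbrakk>x \<in> {a..b} - N; y \<in> {a..b}; norm (y-x) < d x\<rbrakk>
                        \<Longrightarrow> norm (f y - f x - (y-x) *\<^sub>R f' x) \<le> e * norm (y-x)"
      by metis
    obtain \<delta> where "\<delta> > 0" and \<delta>: "\<And>p. \<lbrakk>p division_of \<Union>p; \<Union>p \<subseteq> {a..b}; (\<Sum>K\<in>p. content K) < \<delta>\<rbrakk>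
        \<Longrightarrow> (\<Sum>K\<in>p. norm (f (Sup K) - f (Inf K))) < e0 / 2"
      using abs_cont_on_division[OF f half_gt_zero[OF \<open>e0 > 0\<close>]] by blast
    obtain O' where O': "open O'" "N \<subseteq> O'" "O' \<in> lmeasurable" "measure lebesgue O' < \<delta>"
    proof -
      have "N \<in> lmeasurable" "measure lebesgue N = 0"
        using N by (auto simp: negligible_iff_measure)
      then obtain W where W: "open W" "N \<subseteq> W" "W - N \<in> lmeasurable" "emeasure lebesgue (W - N) < ennreal \<delta>"
        using sets_lebesgue_outer_open[of N \<delta>] \<open>\<delta> > 0\<close> by blast
      have W': "W = (W - N) \<union> N" using W by auto
      have "measure lebesgue W = measure lebesgue (W - N)"
        by (rule measure_negligible_symdiff) (use N W in \<open>auto intro: negligible_subset\<close>)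
      also have "\<dots> < \<delta>" using W \<open>\<delta> > 0\<close>
        by (metis emeasure_eq_measure2 ennreal_less_iff fmeasurableD2 measure_nonneg)
      finally have "measure lebesgue W < \<delta>" .
      moreover have "W \<in> lmeasurable"
        using \<open>N \<in> lmeasurable\<close> W(3) W' by (metis fmeasurable.Un)
      ultimately show ?thesis using W that by blast
    qed
    have "\<forall>x. \<exists>r>0. x \<in> N \<longrightarrow> ball x r \<subseteq> O'" using O' by (meson openE subsetD zero_less_one)
    then obtain r where r: "\<And>x. 0 < r x" "\<And>x. x \<in> N \<Longrightarrow> ball x (r x) \<subseteq> O'" by metis
    define G where "G x = ball x (min (d x) (r x))" for x
    show "\<exists>\<gamma>. gauge \<gamma> \<and> (\<forall>\<D>. \<D> tagged_division_of {a..b} \<and> \<gamma> fine \<D> \<longrightarrow>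
      norm ((\<Sum>(x,K) \<in> \<D>. content K *\<^sub>R g x) - (f b - f a)) < e0)"
    proof (intro exI[of _ G] conjI allI impI; (elim conjE)?)
      show "gauge G" unfolding G_def using d(1) r(1) by (intro gauge_ball_dependent) auto
    next
      fix p assume ptag: "p tagged_division_of {a..b}" and fine: "G fine p"
      then have "finite p" by blast
      have ba: "b - a = (\<Sum>(x,K)\<in>p. Sup K - Inf K)" "f b - f a = (\<Sum>(x,K)\<in>p. f(Sup K) - f(Inf K))"
        using additive_tagged_division_1[where f= "\<lambda>x. x"] additive_tagged_division_1[where f= f] ab ptag by auto
      have pK: "\<exists>u v. K = {u..v} \<and> u \<le> x \<and> x \<le> v \<and> K \<subseteq> {a..b} \<and> K \<subseteq> G x \<and> Sup K = v \<and> Inf K = u"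
        if "(x,K) \<in> p" for x K
      proof -
        from tagged_division_ofD(2,3,4)[OF ptag that]
        have "x \<in> K" "K \<subseteq> {a..b}" "\<exists>u v. K = cbox u v" by auto
        then obtain u v where "K = {u..v}" "u \<le> x" "x \<le> v" by auto
        with \<open>K \<subseteq> {a..b}\<close> fine that show ?thesis by (intro exI[of _ u] exI[of _ v]) (auto simp: fine_def)
      qed
      define p1 where "p1 = {(x,K)\<in>p. x \<notin> N}"
      define p2 where "p2 = {(x,K)\<in>p. x \<in> N}"
      have pp: "p = p1 \<union> p2" "p1 \<inter> p2 = {}" "finite p1" "finite p2"
        using \<open>finite p\<close> by (auto simp: p1_def p2_def intro: finite_subset)
      define t where "t z = (case z of (x,K) \<Rightarrow> content K *\<^sub>R g x - (f (Sup K) - f (Inf K)))" for z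
      have "norm (\<Sum>z\<in>p1. t z) \<le> (\<Sum>z\<in>p1. e * (case z of (x, k) \<Rightarrow> Sup k - Inf k))"
      proof (rule sum_norm_le)
        fix z assume "z \<in> p1"
        obtain x K where z: "z = (x,K)" by fastforce
        then have "(x,K) \<in> p" "x \<notin> N" using \<open>z \<in> p1\<close> by (auto simp: p1_def)
        from pK[OF this(1)] obtain u v where uv: "K = {u..v}" "u \<le> x" "x \<le> v" "K \<subseteq> {a..b}"
          "K \<subseteq> G x" "Sup K = v" "Inf K = u" by blast
        have xin: "x \<in> {a..b} - N" using uv \<open>x \<notin> N\<close> by auto
        have u: "u \<in> {a..b}" "norm (u - x) < d x" and v: "v \<in> {a..b}" "norm (v - x) < d x"
          using uv by (auto simp: G_def subset_iff dist_real_def dest: spec[of _ u] spec[of _ v])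
        have "norm ((v - u) *\<^sub>R f' x - (f v - f u)) = norm (f u - f x - (u - x) *\<^sub>R f' x - (f v - f x - (v - x) *\<^sub>R f' x))"
          by (auto simp: algebra_simps)
        also have "\<dots> \<le> norm (f u - f x - (u - x) *\<^sub>R f' x) + norm (f v - f x - (v - x) *\<^sub>R f' x)"
          by (rule norm_triangle_ineq4)
        also have "\<dots> \<le> e * norm (u - x) + e * norm (v - x)"
          by (intro add_mono d(2) xin u v)
        also have "\<dots> = e * (v - u)" using uv by (simp add: algebra_simps)
        finally show "norm (t z) \<le> e * (case z of (x, k) \<Rightarrow> Sup k - Inf k)"
          using uv \<open>x \<notin> N\<close> z by (simp add: t_def g_def)
      qed
      also have "\<dots> \<le> (\<Sum>z\<in>p. e * (case z of (x, k) \<Rightarrow> Sup k - Inf k))"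
        by (rule sum_mono2) (use \<open>finite p\<close> \<open>e > 0\<close> pp in \<open>auto dest!: pK\<close>)
      also have "\<dots> = e * (b - a)" unfolding ba sum_distrib_left ..
      finally have 1: "norm (\<Sum>z\<in>p1. t z) < e0 / 2" using ee by simp
      have "norm (\<Sum>z\<in>p2. t z) \<le> (\<Sum>z\<in>p2. norm (f (Sup (snd z)) - f (Inf (snd z))))"
        by (rule sum_norm_le) (auto simp: t_def g_def p2_def norm_minus_commute)
      also have "\<dots> = (\<Sum>(x,K)\<in>p2. norm (f (Sup K) - f (Inf K)))" by (simp add: case_prod_unfold)
      also have "\<dots> = (\<Sum>K\<in>snd ` p2. norm (f (Sup K) - f (Inf K)))"
      proof -
        \<comment> \<open>Passing from tagged pieces to their intervals requires a summand that
          vanishes on every degenerate box, including the empty one, where \<open>Sup\<close> and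
          \<open>Inf\<close> are unspecified.\<close>
        define h where "h K = (if K = {} then 0 else norm (f (Sup K) - f (Inf K)))" for K
        have p2p: "p2 tagged_partial_division_of {a..b}"
          using ptag by (rule tagged_partial_division_subset[OF tagged_division_of_def[THEN iffD1, THEN conjunct1]]) (auto simp: p2_def)
        have hK: "norm (f (Sup K) - f (Inf K)) = h K" if "(x, K) \<in> p2" for x K
          using tagged_partial_division_ofD(2)[OF p2p that] by (auto simp: h_def)
        have "p2 tagged_division_of \<Union>(snd ` p2)"
          using tagged_partial_division_of_Union_self[OF p2p] by simp
        then have "(\<Sum>(x,K)\<in>p2. h K) = (\<Sum>K\<in>snd ` p2. h K)"
          by (rule sum.over_tagged_division_lemma) (auto simp: h_def le_less split: if_splits)
        moreover have "(\<Sum>(x,K)\<in>p2. norm (f (Sup K) - f (Inf K))) = (\<Sum>(x,K)\<in>p2. h K)"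
          by (rule sum.cong) (use hK in auto)
        moreover have "(\<Sum>K\<in>snd ` p2. norm (f (Sup K) - f (Inf K))) = (\<Sum>K\<in>snd ` p2. h K)"
          by (rule sum.cong) (use hK in auto)
        ultimately show ?thesis by simp
      qed
      also have "\<dots> < e0 / 2"
      proof (rule \<delta>)
        have p2p: "p2 tagged_partial_division_of {a..b}"
          using ptag by (rule tagged_partial_division_subset[OF tagged_division_of_def[THEN iffD1, THEN conjunct1]]) (auto simp: p2_def)
        show dv: "snd ` p2 division_of \<Union>(snd ` p2)" by (rule partial_division_of_tagged_division[OF p2p])
        show "\<Union>(snd ` p2) \<subseteq> {a..b}" by (auto simp: p2_def dest!: pK)
        have sub: "\<Union>(snd ` p2) \<subseteq> O'" using r(2) by (fastforce simp: p2_def G_def dest!: pK)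
        have "(\<Sum>K\<in>snd ` p2. content K) = (\<Sum>K\<in>snd ` p2. measure lebesgue K)"
          by (rule sum.cong) (auto dest!: division_ofD(4)[OF dv])
        also have "\<dots> = measure lebesgue (\<Union>(snd ` p2))"
          by (rule content_division[OF dv])
        also have "\<dots> \<le> measure lebesgue O'"
          using sub O' lmeasurable_division[OF dv] by (intro measure_mono_fmeasurable) auto
        finally show "(\<Sum>K\<in>snd ` p2. content K) < \<delta>" using O' by simp
      qed
      finally have 2: "norm (\<Sum>z\<in>p2. t z) < e0 / 2" .
      have "(\<Sum>(x,K) \<in> p. content K *\<^sub>R g x) - (f b - f a) = (\<Sum>z\<in>p. t z)"
        unfolding ba(2) sum_subtractf[symmetric] by (rule sum.cong) (auto simp: t_def)
      also have "\<dots> = (\<Sum>z\<in>p1. t z) + (\<Sum>z\<in>p2. t z)"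
        unfolding pp(1) by (rule sum.union_disjoint) (use pp in auto)
      finally show "norm ((\<Sum>(x,K) \<in> p. content K *\<^sub>R g x) - (f b - f a)) < e0"
        using 1 2 norm_triangle_ineq[of "\<Sum>z\<in>p1. t z" "\<Sum>z\<in>p2. t z"] by simp
    qed
  qed
  then show ?thesis
    by (rule has_integral_spike[OF N, rotated]) (auto simp: g_def)
qed

text \<open>Tagging each piece by its left endpoint reduces the telescoping to tagged
  divisions.\<close>

lemma division_sum_increment:
  fixes f :: "real \<Rightarrow> 'a::real_normed_vector"
  assumes "d division_of {a..b}" "a \<le> b"
  shows "(\<Sum>K\<in>d. f (Sup K) - f (Inf K)) = f b - f a"
proof -
  have dK: "\<exists>l r. K = {l..r} \<and> l \<le> r" if "K \<in> d" for K
    using division_ofD(3,4)[OF assms(1) that] by (metis atLeastatMost_empty_iff2 box_real(2))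
  define p where "p = (\<lambda>K. (Inf K, K)) ` d"
  have inj: "inj_on (\<lambda>K. (Inf K, K)) d" by (auto simp: inj_on_def)
  have "p tagged_division_of {a..b}"
    unfolding p_def
  proof (rule tagged_division_ofI)
    show "\<Union>{K. \<exists>x. (x, K) \<in> (\<lambda>K. (Inf K, K)) ` d} = {a..b}"
      using division_ofD(6)[OF assms(1)] by (auto simp: image_iff)
    fix x K assume xK: "(x, K) \<in> (\<lambda>K. (Inf K, K)) ` d"
    then have K: "K \<in> d" "x = Inf K" by auto
    show "x \<in> K" using dK[OF K(1)] K(2) by auto
    show "K \<subseteq> {a..b}" "\<exists>a b. K = cbox a b" using division_ofD[OF assms(1)] K by auto
    show "interior K \<inter> interior K' = {}"
      if "(x', K') \<in> (\<lambda>K. (Inf K, K)) ` d" "(x, K) \<noteq> (x', K')" for x' K'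
      using that K division_ofD(5)[OF assms(1) K(1), of K'] by auto
  qed (use division_ofD(1)[OF assms(1)] in simp)
  from additive_tagged_division_1[OF \<open>a \<le> b\<close> this, of f] show ?thesis
    by (simp add: p_def sum.reindex[OF inj])
qed

section \<open>Vitali coverings and differentiability almost everywhere\<close>

text \<open>Finite form of Vitali's covering theorem. A countable disjoint subfamily covers
  \<open>E\<close> up to a null set; since \<open>W\<close> has finite measure, finitely many
  members already exhaust its union up to measure e. The unexhausted part and the null set form
  \<open>B\<close>. The covering intervals contain x but need not be centred there.\<close>

lemma Vitali_finite_intervals:
  fixes E :: "real set"
  assumes W: "open W" "W \<in> lmeasurable" "E \<subseteq> W" and "e > 0"
    and fine: "\<And>x d. \<lbrakk>x \<in> E; 0 < d\<rbrakk> \<Longrightarrow> \<exists>l r. l < r \<and> l \<le> x \<and> x \<le> r \<and> r - l < d \<and> P l r"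
  obtains C B where "finite C" "\<And>l r. (l, r) \<in> C \<Longrightarrow> l < r \<and> {l..r} \<subseteq> W \<and> P l r"
    "pairwise (\<lambda>i j. disjnt {fst i..snd i} {fst j..snd j}) C"
    "B \<in> lmeasurable" "measure lebesgue B < e" "E \<subseteq> B \<union> (\<Union>i\<in>C. {fst i..snd i})"
proof -
  define K where "K = {(l,r). l < r \<and> {l..r} \<subseteq> W \<and> P l r}"
  define I where "I i = {fst i..snd i}" for i :: "real \<times> real"
  have cb: "cball ((fst i + snd i) / 2) ((snd i - fst i) / 2) = I i" for i :: "real \<times> real"
    by (auto simp: cball_eq_atLeastAtMost I_def field_simps)
  obtain C0 where C0: "countable C0" "C0 \<subseteq> K" "pairwise (\<lambda>i j. disjnt (I i) (I j)) C0"
    "negligible (E - (\<Union>i\<in>C0. I i))"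
  proof (rule Vitali_covering_theorem_cballs[of K "\<lambda>i. (snd i - fst i) / 2" E "\<lambda>i. (fst i + snd i) / 2", unfolded cb])
    show "0 < (snd i - fst i) / 2" if "i \<in> K" for i using that by (auto simp: K_def)
    fix x d :: real assume x: "x \<in> E" "0 < d"
    with W obtain r0 where "r0 > 0" "ball x r0 \<subseteq> W" by (meson openE subsetD)
    with fine[OF x(1), of "min d r0"] x obtain l r where lr: "l < r" "l \<le> x" "x \<le> r" "r - l < d" "r - l < r0" "P l r" by auto
    have "{l..r} \<subseteq> ball x r0" using lr by (auto simp: dist_real_def)
    then have "(l,r) \<in> K" using lr \<open>ball x r0 \<subseteq> W\<close> by (auto simp: K_def)
    then show "\<exists>i. i \<in> K \<and> x \<in> I i \<and> (snd i - fst i) / 2 < d"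
      using lr \<open>0 < d\<close> by (intro exI[of _ "(l,r)"]) (auto simp: I_def)
  qed (use that in blast)
  show thesis
  proof (cases "C0 = {}")
    case True
    show thesis
      by (rule that[of "{}" E]) (use True C0 \<open>e > 0\<close> in \<open>auto simp: negligible_iff_measure\<close>)
  next
    case False
    define A where "A n = (\<Union>i\<le>n. I (from_nat_into C0 i))" for n :: nat
    define V where "V = (\<Union>i\<in>C0. I i)"
    have UA: "(\<Union>n. A n) = V"
    proof
      show "(\<Union>n. A n) \<subseteq> V" unfolding A_def V_def using from_nat_into[OF False] by blast
      show "V \<subseteq> (\<Union>n. A n)"
      proof
        fix x assume "x \<in> V"
        then obtain i where "i \<in> C0" "x \<in> I i" by (auto simp: V_def)
        then obtain n where "i = from_nat_into C0 n" using from_nat_into_surj[OF C0(1)] by metis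
        then show "x \<in> (\<Union>n. A n)" using \<open>x \<in> I i\<close> by (auto simp: A_def)
      qed
    qed
    have I_leb: "I i \<in> sets lebesgue" for i by (simp add: I_def)
    have A_leb: "A n \<in> sets lebesgue" for n unfolding A_def by (intro sets.finite_UN) (auto simp: I_leb)
    have "V \<subseteq> W" using C0(2) by (force simp: V_def I_def K_def)
    have V_leb: "V \<in> sets lebesgue" unfolding UA[symmetric] using A_leb by blast
    have V: "V \<in> lmeasurable" by (rule fmeasurableI2[OF W(2) \<open>V \<subseteq> W\<close> V_leb])
    have AV: "A n \<subseteq> V" for n using UA by blast
    have A: "A n \<in> lmeasurable" for n by (rule fmeasurableI2[OF V AV A_leb])
    have "(\<lambda>n. measure lebesgue (A n)) \<longlonglongrightarrow> measure lebesgue (\<Union>n. A n)"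
    proof (rule Lim_measure_incseq)
      show "incseq A" by (fastforce simp: incseq_def A_def)
      show "emeasure lebesgue (\<Union>n. A n) \<noteq> \<infinity>" unfolding UA infinity_ennreal_def by (rule fmeasurableD2[OF V])
    qed (use A_leb in auto)
    then obtain n where n: "measure lebesgue V - measure lebesgue (A n) < e"
      using \<open>e > 0\<close> unfolding UA
      by (metis (no_types, lifting) LIMSEQ_iff abs_less_iff le_refl minus_diff_eq real_norm_def)
    define C where "C = from_nat_into C0 ` {..n}"
    have CC: "C \<subseteq> C0" using from_nat_into[OF False] by (auto simp: C_def)
    define B where "B = (V - A n) \<union> (E - V)"
    have nE: "negligible (E - V)" using C0 by (simp add: V_def)
    then have nE': "E - V \<in> lmeasurable" "measure lebesgue (E - V) = 0" by (auto simp: negligible_iff_measure)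
    show thesis
    proof (rule that)
      show "finite C" by (simp add: C_def)
      show "l < r \<and> {l..r} \<subseteq> W \<and> P l r" if "(l, r) \<in> C" for l r
        using that CC C0(2) by (auto simp: K_def)
      show "pairwise (\<lambda>i j. disjnt {fst i..snd i} {fst j..snd j}) C"
        using pairwise_subset[OF C0(3) CC] by (simp add: I_def)
      show "B \<in> lmeasurable" unfolding B_def by (rule fmeasurable.Un[OF fmeasurable.Diff[OF V A] nE'(1)])
      have "measure lebesgue B \<le> measure lebesgue (V - A n) + measure lebesgue (E - V)"
        unfolding B_def using V A nE' by (intro measure_Un_le) auto
      also have "\<dots> = measure lebesgue V - measure lebesgue (A n)"
        using measurable_measure_Diff[OF V _ AV[of n]] A_leb nE' by simp
      finally show "measure lebesgue B < e" using n by simp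
      show "E \<subseteq> B \<union> (\<Union>i\<in>C. {fst i..snd i})" by (auto simp: B_def C_def A_def I_def)
    qed
  qed
qed

text \<open>Nest intervals of slope at least \<open>q\<close> inside intervals of slope at most \<open>p\<close>, both families nearly
  exhausting \<open>E\<close>: the gaps then have small total length but a large total increment, which absolute
  continuity excludes.\<close>

lemma abs_cont_on_dini_negligible:
  fixes f :: "real \<Rightarrow> real"
  assumes f: "abs_cont_on a b f" and "p < q" and E: "E \<subseteq> {a<..<b}"
    and lo: "\<And>x d. \<lbrakk>x \<in> E; 0 < d\<rbrakk> \<Longrightarrow> \<exists>l r. l < r \<and> l \<le> x \<and> x \<le> r \<and> r - l < d \<and> f r - f l \<le> p * (r - l)"
    and up: "\<And>x d. \<lbrakk>x \<in> E; 0 < d\<rbrakk> \<Longrightarrow> \<exists>l r. l < r \<and> l \<le> x \<and> x \<le> r \<and> r - l < d \<and> q * (r - l) \<le> f r - f l"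
  shows "negligible E"
proof (rule ccontr)
  assume "\<not> negligible E"
  then obtain e0 where "e0 > 0" and e0: "\<And>A. \<lbrakk>A \<in> lmeasurable; E \<subseteq> A\<rbrakk> \<Longrightarrow> e0 \<le> measure lebesgue A"
    unfolding negligible_outer by (metis linorder_not_less)
  \<comment> \<open>The outer measure of \<open>E\<close>, whose measurability is not known.\<close>
  define m where "m = Inf (measure lebesgue ` {A\<in>lmeasurable. E \<subseteq> A})"
  have ab: "{a<..<b} \<in> {A\<in>lmeasurable. E \<subseteq> A}" using E by (auto simp: lmeasurable_box simp flip: box_real)
  have "m > 0"
  proof -
    have "e0 \<le> m" unfolding m_def by (rule cInf_greatest) (use ab e0 in auto)
    then show ?thesis using \<open>e0 > 0\<close> by simp
  qed
  have m: "m \<le> measure lebesgue A" if "A \<in> lmeasurable" "E \<subseteq> A" for A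
    unfolding m_def by (rule cInf_lower) (use that in \<open>auto intro!: bdd_belowI[of _ 0]\<close>)
  obtain d where "d > 0" and d: "\<And>D. \<lbrakk>D division_of \<Union>D; \<Union>D \<subseteq> {a..b}; (\<Sum>K\<in>D. content K) < d\<rbrakk>
        \<Longrightarrow> (\<Sum>K\<in>D. norm (f (Sup K) - f (Inf K))) < (q - p) * m / 4"
  proof -
    have "(q - p) * m / 4 > 0" using \<open>p < q\<close> \<open>m > 0\<close> by simp
    from abs_cont_on_division[OF f this] that show thesis by blast
  qed
  \<comment> \<open>The three bounds serve in turn to keep the inner intervals of total length at
    least 3m/4, to keep the total length of the gaps, below 4e, under the threshold d of absolute
    continuity, and to absorb the term p times the gap length.\<close>
  define e where "e = min (m/8) (min (d/4) ((q - p) * m / (16 * (\<bar>p\<bar> + 1))))"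
  have "e > 0" and e: "e \<le> m/8" "4 * e \<le> d" and ep: "4 * \<bar>p\<bar> * e \<le> (q - p) * m / 4"
  proof -
    show "e \<le> m/8" unfolding e_def by (rule min.cobounded1)
    have "e \<le> d/4" unfolding e_def by (meson min.cobounded1 min.cobounded2 order_trans)
    then show "4 * e \<le> d" by simp
    have "(q - p) * m / (16 * (\<bar>p\<bar> + 1)) > 0"
      by (intro divide_pos_pos mult_pos_pos) (use \<open>m > 0\<close> \<open>p < q\<close> in auto)
    then show "e > 0" using \<open>m > 0\<close> \<open>d > 0\<close> unfolding e_def by (simp only: min_less_iff_conj) simp
    have "4 * \<bar>p\<bar> * e \<le> 4 * (\<bar>p\<bar> + 1) * e" using \<open>e > 0\<close> by simp
    also have "\<dots> \<le> 4 * (\<bar>p\<bar> + 1) * ((q - p) * m / (16 * (\<bar>p\<bar> + 1)))"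
      by (rule mult_left_mono) (auto simp: e_def)
    also have "\<dots> = (q - p) * m / 4" by (simp add: field_simps)
    finally show "4 * \<bar>p\<bar> * e \<le> (q - p) * m / 4" .
  qed
  obtain A where A: "A \<in> lmeasurable" "E \<subseteq> A" "measure lebesgue A < m + e"
  proof -
    have "Inf (measure lebesgue ` {A\<in>lmeasurable. E \<subseteq> A}) < m + e" using \<open>e > 0\<close> m_def by simp
    from cInf_lessD[OF _ this] ab that show thesis by blast
  qed
  obtain W0 where W0: "open W0" "A \<subseteq> W0" "W0 - A \<in> lmeasurable" "emeasure lebesgue (W0 - A) < ennreal e"
    using sets_lebesgue_outer_open[of A e] \<open>e > 0\<close> A by blast
  define W where "W = W0 \<inter> {a<..<b}"
  have "open W" "E \<subseteq> W" "W \<subseteq> {a<..<b}" using W0 A E by (auto simp: W_def)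
  have W: "W \<in> lmeasurable"
    using \<open>open W\<close> \<open>W \<subseteq> {a<..<b}\<close> bounded_subset[of "box a b" W] by (intro lmeasurable_open) auto
  have mW: "measure lebesgue W < m + 2 * e"
  proof -
    have "measure lebesgue (W0 - A) < e" using W0 \<open>e > 0\<close>
      by (metis emeasure_eq_measure2 ennreal_less_iff measure_nonneg)
    moreover have "measure lebesgue W \<le> measure lebesgue (A \<union> (W0 - A))"
      using W A(1) W0(2,3) by (intro measure_mono_fmeasurable fmeasurable.Un fmeasurableD[OF W]) (auto simp: W_def)
    moreover have "\<dots> \<le> measure lebesgue A + measure lebesgue (W0 - A)"
      using A W0 by (intro measure_Un_le) auto
    ultimately show ?thesis using A by simp
  qed
  define I where "I i = {fst i..snd i}" for i :: "real \<times> real"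
  define J where "J i = {fst i<..<snd i}" for i :: "real \<times> real"
  obtain C1 B1 where C1: "finite C1" "\<And>l r. (l, r) \<in> C1 \<Longrightarrow> l < r \<and> {l..r} \<subseteq> W \<and> f r - f l \<le> p * (r - l)"
    "pairwise (\<lambda>i j. disjnt (I i) (I j)) C1"
    "B1 \<in> lmeasurable" "measure lebesgue B1 < e" "E \<subseteq> B1 \<union> (\<Union>i\<in>C1. I i)"
    unfolding I_def
    by (rule Vitali_finite_intervals[OF \<open>open W\<close> W \<open>E \<subseteq> W\<close> \<open>e > 0\<close> lo]) blast+
  \<comment> \<open>The inner intervals are sought in the interiors of the outer ones, so that each
    lies inside a single outer interval. The endpoints lost this way are finitely many and reappear
    below as the null set \<open>V\<close>.\<close>
  define W2 where "W2 = (\<Union>i\<in>C1. J i)"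
  have "open W2" by (auto simp: W2_def J_def)
  have "W2 \<subseteq> W" using C1(2) by (force simp: W2_def J_def)
  have W2: "W2 \<in> lmeasurable"
    by (rule fmeasurableI2[OF W \<open>W2 \<subseteq> W\<close>]) (use \<open>open W2\<close> in auto)
  have up2: "\<exists>l r. l < r \<and> l \<le> x \<and> x \<le> r \<and> r - l < d \<and> (q * (r - l) \<le> f r - f l \<and> (\<exists>i\<in>C1. {l..r} \<subseteq> J i))"
    if x: "x \<in> E \<inter> W2" and "0 < d" for x d
  proof -
    obtain i where i: "i \<in> C1" "x \<in> J i" using x by (auto simp: W2_def)
    then obtain r0 where "r0 > 0" "ball x r0 \<subseteq> J i" by (metis J_def open_greaterThanLessThan openE)
    with up[of x "min d r0"] x \<open>0 < d\<close> obtain l r where lr: "l < r" "l \<le> x" "x \<le> r" "r - l < d" "r - l < r0" "q * (r - l) \<le> f r - f l" by auto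
    have "{l..r} \<subseteq> ball x r0" using lr by (auto simp: dist_real_def)
    with \<open>ball x r0 \<subseteq> J i\<close> lr i show ?thesis by blast
  qed
  obtain C2 B2 where C2: "finite C2" "\<And>l r. (l, r) \<in> C2 \<Longrightarrow> l < r \<and> {l..r} \<subseteq> W2 \<and> (q * (r - l) \<le> f r - f l \<and> (\<exists>i\<in>C1. {l..r} \<subseteq> J i))"
    "pairwise (\<lambda>i j. disjnt (I i) (I j)) C2"
    "B2 \<in> lmeasurable" "measure lebesgue B2 < e" "E \<inter> W2 \<subseteq> B2 \<union> (\<Union>i\<in>C2. I i)"
    unfolding I_def
    by (rule Vitali_finite_intervals[OF \<open>open W2\<close> W2 Int_lower2 \<open>e > 0\<close> up2]) blast+
  define len where "len i = snd i - fst i" for i :: "real \<times> real"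
  define inc where "inc i = f (snd i) - f (fst i)" for i :: "real \<times> real"
  have I_meas: "I i \<in> lmeasurable" for i by (simp add: I_def)
  have lt1: "fst i < snd i" if "i \<in> C1" for i using C1(2)[of "fst i" "snd i"] that by simp
  have lt2: "fst i < snd i" if "i \<in> C2" for i using C2(2)[of "fst i" "snd i"] that by simp
  have mI: "measure lebesgue (\<Union>i\<in>C. I i) = (\<Sum>i\<in>C. len i)"
    if "finite C" "pairwise (\<lambda>i j. disjnt (I i) (I j)) C" "\<And>i. i \<in> C \<Longrightarrow> fst i < snd i" for C
  proof -
    have "measure lebesgue (\<Union>i\<in>C. I i) = (\<Sum>i\<in>C. measure lebesgue (I i))"
    proof (rule measure_finite_Union[OF that(1)])
      show "I ` C \<subseteq> sets lebesgue" using I_meas by blast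
      show "disjoint_family_on I C" using that(2) by (simp add: disjoint_family_on_def pairwise_def disjnt_def)
      show "emeasure lebesgue (I i) \<noteq> \<infinity>" for i
        unfolding infinity_ennreal_def by (rule fmeasurableD2[OF I_meas])
    qed
    also have "\<dots> = (\<Sum>i\<in>C. len i)" by (rule sum.cong) (use that(3) in \<open>force simp: I_def len_def\<close>)+
    finally show ?thesis .
  qed
  define S1 where "S1 = (\<Sum>i\<in>C1. len i)"
  define S2 where "S2 = (\<Sum>i\<in>C2. len i)"
  have S1: "S1 < m + 2 * e"
  proof -
    have "S1 = measure lebesgue (\<Union>i\<in>C1. I i)" using mI[OF C1(1,3) lt1] by (simp add: S1_def)
    also have "\<dots> \<le> measure lebesgue W"
      using C1(1,2) I_meas by (intro measure_mono_fmeasurable W sets.finite_UN) (auto simp: I_def subset_iff)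
    finally show ?thesis using mW by simp
  qed
  have S2: "S2 \<ge> m - 2 * e"
  proof -
    define V where "V = fst ` C1 \<union> snd ` C1"
    have "finite V" using C1(1) by (simp add: V_def)
    then have V: "V \<in> lmeasurable" "measure lebesgue V = 0"
      using negligible_finite negligible_iff_measure by blast+
    have U2: "(\<Union>i\<in>C2. I i) \<in> lmeasurable" using C2(1) I_meas by (intro fmeasurable.finite_UN) auto
    have "E \<subseteq> (B1 \<union> B2) \<union> (V \<union> (\<Union>i\<in>C2. I i))"
    proof
      fix x assume "x \<in> E"
      show "x \<in> (B1 \<union> B2) \<union> (V \<union> (\<Union>i\<in>C2. I i))"
      proof (cases "x \<in> W2 \<or> x \<in> B1")
        case True then show ?thesis using \<open>x \<in> E\<close> C2(6) by blast
      next
        case False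
        then obtain i where i: "i \<in> C1" "x \<in> I i" using C1(6) \<open>x \<in> E\<close> by blast
        with False have "x = fst i \<or> x = snd i" by (force simp: W2_def I_def J_def)
        then show ?thesis using i by (auto simp: V_def)
      qed
    qed
    then have "m \<le> measure lebesgue ((B1 \<union> B2) \<union> (V \<union> (\<Union>i\<in>C2. I i)))"
      by (intro m) (use C1 C2 V U2 in auto)
    also have "\<dots> \<le> measure lebesgue (B1 \<union> B2) + measure lebesgue (V \<union> (\<Union>i\<in>C2. I i))"
      using C1 C2 V U2 by (intro measure_Un_le) auto
    also have "\<dots> \<le> (measure lebesgue B1 + measure lebesgue B2) + (measure lebesgue V + measure lebesgue (\<Union>i\<in>C2. I i))"
      using C1 C2 V U2 by (intro add_mono measure_Un_le) auto
    also have "\<dots> \<le> 2 * e + S2" using C1 C2 V mI[OF C2(1,3) lt2] by (simp add: S2_def)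
    finally show ?thesis by simp
  qed
  have "\<exists>\<phi>. \<forall>j\<in>C2. \<phi> j \<in> C1 \<and> I j \<subseteq> J (\<phi> j)"
    using C2(2) by (intro bchoice) (force simp: I_def)
  then obtain \<phi> where \<phi>: "\<And>j. j \<in> C2 \<Longrightarrow> \<phi> j \<in> C1" "\<And>j. j \<in> C2 \<Longrightarrow> I j \<subseteq> J (\<phi> j)" by blast
  define P where "P i = I ` {j\<in>C2. \<phi> j = i}" for i
  have injI: "inj_on I C2"
  proof (rule inj_onI, rule ccontr)
    fix i j assume ij: "i \<in> C2" "j \<in> C2" "I i = I j" "i \<noteq> j"
    then have "disjnt (I i) (I j)" using pairwiseD[OF C2(3) ij(1,2,4)] by simp
    then show False using ij lt2[of i] by (auto simp: disjnt_def I_def)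
  qed
  have JI: "J i \<subseteq> I i" for i by (auto simp: I_def J_def)
  have P_div: "P i division_of \<Union>(P i)" for i
  proof (rule division_ofI)
    show "finite (P i)" using C2(1) by (simp add: P_def)
    fix K assume "K \<in> P i"
    then obtain j where j: "j \<in> C2" "\<phi> j = i" "K = I j" by (auto simp: P_def)
    then show "K \<subseteq> \<Union>(P i)" "K \<noteq> {}" "\<exists>a b. K = cbox a b"
      using lt2[of j] by (auto simp: P_def I_def intro!: exI[of _ "fst j"] exI[of _ "snd j"])
    fix K' assume "K' \<in> P i" "K \<noteq> K'"
    then obtain j' where j': "j' \<in> C2" "K' = I j'" by (auto simp: P_def)
    then have "disjnt K K'" using C2(3) j \<open>K \<noteq> K'\<close> by (auto simp: pairwise_def)
    then show "interior K \<inter> interior K' = {}" using interior_subset by (fastforce simp: disjnt_def)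
  qed simp
  have P_sub: "\<Union>(P i) \<subseteq> J i" for i unfolding P_def using \<phi>(2) by blast
  have "\<exists>Q. P i \<subseteq> Q \<and> Q division_of I i" for i
  proof -
    have "\<Union>(P i) \<subseteq> cbox (fst i) (snd i)" using P_sub[of i] JI[of i] by (auto simp: I_def)
    from partial_division_extend_interval[OF P_div this] show ?thesis
      by (metis I_def box_real(2))
  qed
  then obtain Q where Q: "\<And>i. P i \<subseteq> Q i" "\<And>i. Q i division_of I i" by metis
  \<comment> \<open>\<open>Q i\<close> completes the inner intervals \<open>P i\<close> to a
    division of the outer interval \<open>I i\<close>; the added pieces are the gaps.\<close>
  define G where "G = (\<Union>i\<in>C1. Q i - P i)"
  have finQ: "finite (Q i)" for i using Q(2) by blast
  have Qd: "K = K'" if "i \<in> C1" "j \<in> C1" "i \<noteq> j" "K \<in> Q i" "K' \<in> Q j" "K \<inter> K' \<noteq> {}" for i j K K'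
  proof -
    have "disjnt (I i) (I j)" using C1(3) that by (auto simp: pairwise_def)
    then show ?thesis using division_ofD(2)[OF Q(2) that(4)] division_ofD(2)[OF Q(2) that(5)] that(6)
      by (auto simp: disjnt_def)
  qed
  \<comment> \<open>Stated for an arbitrary function: with the identity it measures the gaps, with
    \<open>f\<close> it computes the increments over them.\<close>
  have sumG: "(\<Sum>K\<in>G. h (Sup K) - h (Inf K)) = (\<Sum>i\<in>C1. h (snd i) - h (fst i)) - (\<Sum>j\<in>C2. h (snd j) - h (fst j))"
    for h :: "real \<Rightarrow> real"
  proof -
    let ?h = "\<lambda>K. h (Sup K) - h (Inf K)"
    have "(\<Sum>K\<in>G. ?h K) = (\<Sum>i\<in>C1. \<Sum>K\<in>Q i - P i. ?h K)"
      unfolding G_def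
    proof (rule sum.UNION_disjoint[OF C1(1)])
      show "\<forall>i\<in>C1. \<forall>j\<in>C1. i \<noteq> j \<longrightarrow> (Q i - P i) \<inter> (Q j - P j) = {}"
      proof (intro ballI impI, rule ccontr)
        fix i j assume ij: "i \<in> C1" "j \<in> C1" "i \<noteq> j" "(Q i - P i) \<inter> (Q j - P j) \<noteq> {}"
        then obtain K where K: "K \<in> Q i" "K \<in> Q j" by blast
        have "disjnt (I i) (I j)" using C1(3) ij by (auto simp: pairwise_def)
        then show False using division_ofD(2,3)[OF Q(2) K(1)] division_ofD(2)[OF Q(2) K(2)]
          by (auto simp: disjnt_def)
      qed
    qed (use finQ in auto)
    also have "\<dots> = (\<Sum>i\<in>C1. (\<Sum>K\<in>Q i. ?h K) - (\<Sum>K\<in>P i. ?h K))"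
      by (intro sum.cong sum_diff finQ Q refl)
    also have "\<dots> = (\<Sum>i\<in>C1. h (snd i) - h (fst i)) - (\<Sum>i\<in>C1. \<Sum>j\<in>{j\<in>C2. \<phi> j = i}. h (snd j) - h (fst j))"
      unfolding sum_subtractf[symmetric]
    proof (rule sum.cong[OF refl])
      fix i assume i: "i \<in> C1"
      have "(\<Sum>K\<in>Q i. ?h K) = h (snd i) - h (fst i)"
        using division_sum_increment[of "Q i" "fst i" "snd i" h] Q(2)[of i] lt1[OF i] by (simp add: I_def)
      moreover have "(\<Sum>K\<in>P i. ?h K) = (\<Sum>j\<in>{j\<in>C2. \<phi> j = i}. ?h (I j))"
        unfolding P_def by (rule sum.reindex_cong[OF inj_on_subset[OF injI]]) auto
      moreover have "\<dots> = (\<Sum>j\<in>{j\<in>C2. \<phi> j = i}. h (snd j) - h (fst j))"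
        by (rule sum.cong) (use lt2 in \<open>force simp: I_def\<close>)+
      ultimately show "(\<Sum>K\<in>Q i. ?h K) - (\<Sum>K\<in>P i. ?h K) = h (snd i) - h (fst i) - (\<Sum>j\<in>{j\<in>C2. \<phi> j = i}. h (snd j) - h (fst j))"
        by simp
    qed
    also have "(\<Sum>i\<in>C1. \<Sum>j\<in>{j\<in>C2. \<phi> j = i}. h (snd j) - h (fst j)) = (\<Sum>j\<in>C2. h (snd j) - h (fst j))"
      by (rule sum.group[OF C2(1) C1(1)]) (use \<phi> in auto)
    finally show ?thesis .
  qed
  have GK: "\<exists>l r. K = {l..r} \<and> l \<le> r \<and> content K = Sup K - Inf K" if "K \<in> G" for K
  proof -
    obtain i where "K \<in> Q i" using \<open>K \<in> G\<close> by (auto simp: G_def)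
    from division_ofD(3,4)[OF Q(2) this] obtain l r where "K = {l..r}" "l \<le> r"
      by (metis atLeastatMost_empty_iff2 box_real(2))
    then show ?thesis by auto
  qed
  have "(\<Sum>K\<in>G. norm (f (Sup K) - f (Inf K))) < (q - p) * m / 4"
  proof (rule d)
    show "G division_of \<Union>G"
    proof (rule division_ofI)
      show "finite G" using C1(1) finQ by (simp add: G_def)
      fix K assume K: "K \<in> G"
      from GK[OF K] show "K \<subseteq> \<Union>G" "K \<noteq> {}" "\<exists>a b. K = cbox a b" using K by auto
      fix K' assume K': "K' \<in> G" "K \<noteq> K'"
      from K K' obtain i j where ij: "i \<in> C1" "j \<in> C1" "K \<in> Q i" "K' \<in> Q j" by (auto simp: G_def)
      show "interior K \<inter> interior K' = {}"
      proof (cases "i = j")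
        case True then show ?thesis using division_ofD(5)[OF Q(2) ij(3)] ij K' by auto
      next
        case False then show ?thesis using Qd[OF ij(1,2) False ij(3,4)] K' interior_subset[of K] interior_subset[of K'] by blast
      qed
    qed simp
    have "\<Union>G \<subseteq> (\<Union>i\<in>C1. I i)" using division_ofD(2)[OF Q(2)] by (fastforce simp: G_def)
    also have "\<dots> \<subseteq> W" using C1(2) by (force simp: I_def)
    also note \<open>W \<subseteq> {a<..<b}\<close>
    also have "{a<..<b} \<subseteq> {a..b}" by auto
    finally show "\<Union>G \<subseteq> {a..b}" .
    have "(\<Sum>K\<in>G. content K) = (\<Sum>K\<in>G. Sup K - Inf K)" by (rule sum.cong) (use GK in auto)
    also have "\<dots> = S1 - S2" using sumG[of "\<lambda>x. x"] by (simp add: S1_def S2_def len_def)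
    finally show "(\<Sum>K\<in>G. content K) < d" using S1 S2 e by simp
  qed
  moreover have "- (\<Sum>K\<in>G. norm (f (Sup K) - f (Inf K))) \<le> (\<Sum>K\<in>G. f (Sup K) - f (Inf K))"
    unfolding sum_negf[symmetric] by (rule sum_mono) auto
  moreover have "(\<Sum>K\<in>G. f (Sup K) - f (Inf K)) \<le> p * S1 - q * S2"
  proof -
    have "(\<Sum>i\<in>C1. f (snd i) - f (fst i)) \<le> p * S1"
      unfolding S1_def sum_distrib_left by (rule sum_mono) (use C1(2) in \<open>force simp: len_def\<close>)
    moreover have "q * S2 \<le> (\<Sum>j\<in>C2. f (snd j) - f (fst j))"
      unfolding S2_def sum_distrib_left by (rule sum_mono) (use C2(2) in \<open>force simp: len_def\<close>)
    ultimately show ?thesis using sumG[of f] by simp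
  qed
  \<comment> \<open>The increment over the gaps is therefore at most (q - p)m/4 - 3(q - p)m/4 = -(q
    - p)m/2, whereas absolute continuity keeps it above -(q - p)m/4.\<close>
  moreover have "p * S1 - q * S2 = p * (S1 - S2) - (q - p) * S2" by (simp add: algebra_simps)
  moreover have "p * (S1 - S2) \<le> 4 * \<bar>p\<bar> * e"
  proof -
    have "S2 \<le> S1"
    proof -
      have "0 \<le> (\<Sum>K\<in>G. Sup K - Inf K)" by (rule sum_nonneg) (use GK in fastforce)
      then show ?thesis using sumG[of "\<lambda>x. x"] by (simp add: S1_def S2_def len_def)
    qed
    have "p * (S1 - S2) \<le> \<bar>p\<bar> * (S1 - S2)" using \<open>S2 \<le> S1\<close> by (intro mult_right_mono) auto
    also have "\<dots> \<le> \<bar>p\<bar> * (4 * e)" using S1 S2 by (intro mult_left_mono) auto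
    finally show ?thesis by (simp add: algebra_simps)
  qed
  moreover have "(q - p) * S2 \<ge> (q - p) * (m * 3 / 4)"
    using S2 e \<open>p < q\<close> by (intro mult_left_mono) auto
  moreover have "(q - p) * m > 0" using \<open>p < q\<close> \<open>m > 0\<close> by simp
  ultimately show False using ep by simp
qed

text \<open>Inside a window of length d/2, disjoint intervals have total length below d and hence
  total increment below 1; if all their slopes are at least 2/e, their total length is below e/2.
  Together with the uncovered remainder this makes the set null in every window, and negligibility
  is a local property.\<close>

lemma abs_cont_on_infinite_dini_negligible:
  fixes f :: "real \<Rightarrow> real"
  assumes f: "abs_cont_on a b f" and E: "E \<subseteq> {a<..<b}"
    and up: "\<And>q x d. \<lbrakk>x \<in> E; 0 < d\<rbrakk> \<Longrightarrow> \<exists>l r. l < r \<and> l \<le> x \<and> x \<le> r \<and> r - l < d \<and> q * (r - l) \<le> f r - f l"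
  shows "negligible E"
proof -
  obtain d where "d > 0" and d: "\<And>D. \<lbrakk>D division_of \<Union>D; \<Union>D \<subseteq> {a..b}; (\<Sum>K\<in>D. content K) < d\<rbrakk>
        \<Longrightarrow> (\<Sum>K\<in>D. norm (f (Sup K) - f (Inf K))) < 1"
    using abs_cont_on_division[OF f zero_less_one] by blast
  have "negligible (E \<inter> {c - d/4<..<c + d/4})" for c
    unfolding negligible_outer_le
  proof (intro allI impI)
    fix e :: real assume "e > 0"
    define W where "W = {a<..<b} \<inter> {c - d/4<..<c + d/4}"
    define q where "q = 2 / e"
    define I where "I i = {fst i..snd i}" for i :: "real \<times> real"
    have W: "open W" "W \<in> lmeasurable" "E \<inter> {c - d/4<..<c + d/4} \<subseteq> W"
      using E bounded_subset[of "box a b" W] by (auto simp: W_def intro!: lmeasurable_open)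
    have up': "\<exists>l r. l < r \<and> l \<le> x \<and> x \<le> r \<and> r - l < d' \<and> q * (r - l) \<le> f r - f l"
      if "x \<in> E \<inter> {c - d/4<..<c + d/4}" "0 < d'" for x d' using up that by blast
    have "e / 2 > 0" using \<open>e > 0\<close> by simp
    obtain C B where C: "finite C" "\<And>l r. (l, r) \<in> C \<Longrightarrow> l < r \<and> {l..r} \<subseteq> W \<and> q * (r - l) \<le> f r - f l"
      "pairwise (\<lambda>i j. disjnt (I i) (I j)) C"
      "B \<in> lmeasurable" "measure lebesgue B < e / 2" "E \<inter> {c - d/4<..<c + d/4} \<subseteq> B \<union> (\<Union>i\<in>C. I i)"
      unfolding I_def by (rule Vitali_finite_intervals[OF W \<open>e / 2 > 0\<close> up']) blast+
    have I_meas: "I i \<in> lmeasurable" for i by (simp add: I_def)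
    have ltC: "fst i < snd i" "I i \<subseteq> W" if "i \<in> C" for i using C(2)[of "fst i" "snd i"] that by (simp_all add: I_def)
    have U: "(\<Union>i\<in>C. I i) \<in> lmeasurable" using C(1) I_meas by (intro fmeasurable.finite_UN) auto
    have div: "I ` C division_of \<Union>(I ` C)"
    proof (rule division_ofI)
      fix K assume "K \<in> I ` C"
      then obtain j where j: "j \<in> C" "K = I j" by auto
      then show "K \<subseteq> \<Union>(I ` C)" "K \<noteq> {}" "\<exists>a b. K = cbox a b"
        using ltC[of j] by (auto simp: I_def intro!: exI[of _ "fst j"] exI[of _ "snd j"])
      fix K' assume "K' \<in> I ` C" "K \<noteq> K'"
      then obtain j' where j': "j' \<in> C" "K' = I j'" "j \<noteq> j'" using j by auto
      then have "disjnt K K'" using pairwiseD[OF C(3) j(1) j'(1)] j by simp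
      then show "interior K \<inter> interior K' = {}" using interior_subset by (fastforce simp: disjnt_def)
    qed (use C in auto)
    have cont: "content K = Sup K - Inf K" "q * content K \<le> norm (f (Sup K) - f (Inf K))" if "K \<in> I ` C" for K
    proof -
      obtain i where i: "i \<in> C" "K = I i" using \<open>K \<in> I ` C\<close> by auto
      show "content K = Sup K - Inf K" using ltC[OF i(1)] i by (simp add: I_def)
      show "q * content K \<le> norm (f (Sup K) - f (Inf K))" 
        using C(2)[of "fst i" "snd i"] i by (auto simp: I_def)
    qed
    have mU: "measure lebesgue (\<Union>i\<in>C. I i) = (\<Sum>K\<in>I ` C. content K)"
      unfolding content_division[OF div, symmetric] by (rule sum.cong) (auto dest!: division_ofD(4)[OF div])
    have "measure lebesgue (\<Union>i\<in>C. I i) \<le> measure lebesgue {c - d/4..c + d/4}"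
    proof (rule measure_mono_fmeasurable)
      show "(\<Union>i\<in>C. I i) \<subseteq> {c - d/4..c + d/4}" using ltC(2) unfolding W_def by fastforce
    qed (use U in auto)
    then have "(\<Sum>K\<in>I ` C. content K) < d" using \<open>d > 0\<close> by (simp add: mU)
    moreover have "\<Union>(I ` C) \<subseteq> {a..b}" using ltC(2) by (force simp: W_def)
    ultimately have "(\<Sum>K\<in>I ` C. norm (f (Sup K) - f (Inf K))) < 1" by (intro d div)
    moreover have "q * (\<Sum>K\<in>I ` C. content K) \<le> (\<Sum>K\<in>I ` C. norm (f (Sup K) - f (Inf K)))"
      unfolding sum_distrib_left by (rule sum_mono) (use cont in blast)
    ultimately have "q * (\<Sum>K\<in>I ` C. content K) < 1" by linarith
    then have "measure lebesgue (\<Union>i\<in>C. I i) \<le> e / 2"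
      using \<open>e > 0\<close> by (simp add: mU q_def field_simps)
    moreover have "measure lebesgue B < e / 2" by (fact C(5))
    moreover have "measure lebesgue (B \<union> (\<Union>i\<in>C. I i)) \<le> measure lebesgue B + measure lebesgue (\<Union>i\<in>C. I i)"
      using C U by (intro measure_Un_le) auto
    ultimately show "\<exists>T. E \<inter> {c - d/4<..<c + d/4} \<subseteq> T \<and> T \<in> lmeasurable \<and> measure lebesgue T \<le> e"
      using C(4,6) U by (intro exI[of _ "B \<union> (\<Union>i\<in>C. I i)"]) auto
  qed
  then show ?thesis
    unfolding locally_negligible_alt[of E]
    using \<open>d > 0\<close> by (intro ballI, rule_tac x="E \<inter> {x - d/4<..<x + d/4}" in exI) (auto intro: openin_open_Int)
qed

lemma abs_cont_on_inner:
  fixes f :: "real \<Rightarrow> 'a::real_inner"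
  assumes "abs_cont_on a b f"
  shows "abs_cont_on a b (\<lambda>x. f x \<bullet> v)"
  unfolding abs_cont_on_def
proof (intro allI impI)
  fix e :: real assume "e > 0"
  then have "e / (norm v + 1) > 0" by (simp add: add_nonneg_pos)
  from abs_cont_onE[OF assms this] obtain d where "d > 0" and
    d: "\<And>(n::nat) s t. \<lbrakk>\<And>i. i < n \<Longrightarrow> a \<le> s i; \<And>i. i < n \<Longrightarrow> s i \<le> t i; \<And>i. i < n \<Longrightarrow> t i \<le> b;
        \<And>i j. \<lbrakk>i < n; j < n; i \<noteq> j\<rbrakk> \<Longrightarrow> t i \<le> s j \<or> t j \<le> s i; (\<Sum>i<n. t i - s i) < d\<rbrakk>
        \<Longrightarrow> (\<Sum>i<n. norm (f (t i) - f (s i))) < e / (norm v + 1)" by blast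
  show "\<exists>d>0. \<forall>(n::nat) s t. (\<forall>i<n. a \<le> s i \<and> s i \<le> t i \<and> t i \<le> b) \<and>
        (\<forall>i<n. \<forall>j<n. i \<noteq> j \<longrightarrow> t i \<le> s j \<or> t j \<le> s i) \<and> (\<Sum>i<n. t i - s i) < d
        \<longrightarrow> (\<Sum>i<n. norm (f (t i) \<bullet> v - f (s i) \<bullet> v)) < e"
  proof (intro exI[of _ d] conjI allI impI \<open>d > 0\<close>; elim conjE)
    fix n :: nat and s t assume *: "\<forall>i<n. a \<le> s i \<and> s i \<le> t i \<and> t i \<le> b"
        "\<forall>i<n. \<forall>j<n. i \<noteq> j \<longrightarrow> t i \<le> s j \<or> t j \<le> s i" "(\<Sum>i<n. t i - s i) < d"
    have "(\<Sum>i<n. norm (f (t i) \<bullet> v - f (s i) \<bullet> v)) \<le> (\<Sum>i<n. norm (f (t i) - f (s i)) * (norm v + 1))"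
    proof (rule sum_mono)
      fix i
      have "norm (f (t i) \<bullet> v - f (s i) \<bullet> v) \<le> norm (f (t i) - f (s i)) * norm v"
        by (simp add: Cauchy_Schwarz_ineq2 flip: inner_diff_left)
      also have "\<dots> \<le> norm (f (t i) - f (s i)) * (norm v + 1)" by (simp add: algebra_simps)
      finally show "norm (f (t i) \<bullet> v - f (s i) \<bullet> v) \<le> norm (f (t i) - f (s i)) * (norm v + 1)" .
    qed
    also have "\<dots> = (\<Sum>i<n. norm (f (t i) - f (s i))) * (norm v + 1)" by (simp add: sum_distrib_right)
    also have "\<dots> < e"
      using d[of n s t] * by (simp add: pos_less_divide_eq add_nonneg_pos)
    finally show "(\<Sum>i<n. norm (f (t i) \<bullet> v - f (s i) \<bullet> v)) < e" .
  qed
qed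

text \<open>\<open>dec q x d\<close> and \<open>inc q x d\<close> say that some interval around x
  shorter than d has slope at most, respectively at least, q. Off a null set the slopes of shrinking
  intervals stay bounded and no rationals p < q separate the small slopes from the large ones, so
  they converge. Intervals around x are what Vitali's theorem handles, and they include those that
  start or end at x.\<close>

lemma abs_cont_on_differentiable_ae:
  fixes f :: "real \<Rightarrow> real"
  assumes f: "abs_cont_on a b f"
  obtains N where "negligible N" "\<And>x. x \<in> {a<..<b} - N \<Longrightarrow> \<exists>D. (f has_real_derivative D) (at x)"
proof -
  define dec where "dec q x d \<longleftrightarrow> (\<exists>l r. l < r \<and> l \<le> x \<and> x \<le> r \<and> r - l < d \<and> f r - f l \<le> q * (r - l))" for q x d
  define inc where "inc q x d \<longleftrightarrow> (\<exists>l r. l < r \<and> l \<le> x \<and> x \<le> r \<and> r - l < d \<and> q * (r - l) \<le> f r - f l)" for q x d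
  define E where "E p q = {x\<in>{a<..<b}. \<forall>d>0. dec p x d \<and> inc q x d}" for p q
  define Ei where "Ei = {x\<in>{a<..<b}. \<forall>q. \<forall>d>0. inc q x d}"
  define Ed where "Ed = {x\<in>{a<..<b}. \<forall>q. \<forall>d>0. dec q x d}"
  define N where "N = (\<Union>p\<in>\<rat>. \<Union>q\<in>{q\<in>\<rat>. p < q}. E p q) \<union> (Ei \<union> Ed)"
  have nE: "negligible (E p q)" if "p < q" for p q
    by (rule abs_cont_on_dini_negligible[OF f that]) (auto simp: E_def dec_def inc_def)
  have nEi: "negligible Ei"
    by (rule abs_cont_on_infinite_dini_negligible[OF f]) (auto simp: Ei_def inc_def)
  have "abs_cont_on a b (\<lambda>x. - f x)"
    using abs_cont_on_inner[OF f, of "-1"] by simp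
  then have nEd: "negligible Ed"
  proof (rule abs_cont_on_infinite_dini_negligible)
    fix q x d :: real assume "x \<in> Ed" "0 < d"
    then have "dec (- q) x d" by (auto simp: Ed_def)
    then show "\<exists>l r. l < r \<and> l \<le> x \<and> x \<le> r \<and> r - l < d \<and> q * (r - l) \<le> - f r - - f l"
      unfolding dec_def by (elim exE conjE, rule_tac x=l in exI, rule_tac x=r in exI) (auto simp: algebra_simps)
  qed (auto simp: Ed_def)
  have cq: "countable {q\<in>\<rat>. p < q}" for p :: real
    by (rule countable_subset[OF _ countable_rat]) auto
  have "negligible N"
    unfolding N_def
    by (intro negligible_Un nEi nEd negligible_countable_Union countable_image countable_rat cq)
       (auto intro!: negligible_countable_Union countable_image cq nE)
  moreover have "\<exists>D. (f has_real_derivative D) (at x)" if x: "x \<in> {a<..<b} - N" for x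
  proof -
    from x obtain qi di where i: "di > 0" "\<not> inc qi x di" by (auto simp: N_def Ei_def)
    from x obtain qd dd where d: "dd > 0" "\<not> dec qd x dd" by (auto simp: N_def Ed_def)
    have ndec_mono: "\<not> dec p x e" if "\<not> dec p' x e'" "p \<le> p'" "e \<le> e'" for p p' e e'
    proof
      assume "dec p x e"
      then obtain l r where lr: "l < r" "l \<le> x" "x \<le> r" "r - l < e" "f r - f l \<le> p * (r - l)" by (auto simp: dec_def)
      moreover have "p * (r - l) \<le> p' * (r - l)" using lr \<open>p \<le> p'\<close> by (intro mult_right_mono) auto
      ultimately have "l < r \<and> l \<le> x \<and> x \<le> r \<and> r - l < e' \<and> f r - f l \<le> p' * (r - l)" using \<open>e \<le> e'\<close> by linarith
      then show False using that(1) unfolding dec_def by blast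
    qed
    \<comment> \<open>The supremum of \<open>A\<close> is the lower derivate at x: x avoids
      \<open>Ed\<close>, so \<open>A\<close> is nonempty, and it avoids \<open>Ei\<close>, so
      \<open>A\<close> is bounded above.\<close>
    define A where "A = {p. \<exists>e>0. \<not> dec p x e}"
    define s where "s = Sup A"
    have "qd \<in> A" using d by (auto simp: A_def)
    have bdd: "p \<le> qi" if "p \<in> A" for p
    proof (rule ccontr)
      assume "\<not> p \<le> qi"
      obtain e where e: "e > 0" "\<not> dec p x e" using \<open>p \<in> A\<close> by (auto simp: A_def)
      define h where "h = min e di / 2"
      have h: "h > 0" "h < e" "h < di" using e i by (auto simp: h_def)
      have "\<not> f (x + h) - f x \<le> p * h" 
      proof
        assume "f (x + h) - f x \<le> p * h"
        with h have "x < x + h \<and> x \<le> x \<and> x \<le> x + h \<and> x + h - x < e \<and> f (x + h) - f x \<le> p * (x + h - x)" by simp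
        with e(2) show False unfolding dec_def by blast
      qed
      moreover have "\<not> qi * h \<le> f (x + h) - f x" 
      proof
        assume "qi * h \<le> f (x + h) - f x"
        with h have "x < x + h \<and> x \<le> x \<and> x \<le> x + h \<and> x + h - x < di \<and> qi * (x + h - x) \<le> f (x + h) - f x" by simp
        with i(2) show False unfolding inc_def by blast
      qed
      moreover have "qi * h \<le> p * h" using h \<open>\<not> p \<le> qi\<close> by (intro mult_right_mono) auto
      ultimately show False by linarith
    qed
    then have bA: "bdd_above A" by (rule bdd_aboveI)
    have "(f has_real_derivative s) (at x)"
      unfolding has_field_derivative_def has_derivative_at_alt
    proof (intro conjI allI impI)
      show "bounded_linear ((*) s)" by (rule bounded_linear_mult_right)
      fix \<epsilon> :: real assume "0 < \<epsilon>"
      obtain p where p: "p \<in> A" "s - \<epsilon> < p" using less_cSupD[of A "s - \<epsilon>"] \<open>qd \<in> A\<close> \<open>0 < \<epsilon>\<close> s_def by auto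
      obtain e1 where e1: "e1 > 0" "\<not> dec p x e1" using p by (auto simp: A_def)
      \<comment> \<open>As p1 lies above the lower derivate, slopes at most p1 occur at every scale.
        Slopes of at least q1 at every scale would put x into \<open>E p1 q1\<close>, which
        \<open>N\<close> contains because both numbers are rational.\<close>
      obtain p1 where p1: "p1 \<in> \<rat>" "s < p1" "p1 < s + \<epsilon>" using Rats_dense_in_real[of s "s + \<epsilon>"] \<open>0 < \<epsilon>\<close> by auto
      obtain q1 where q1: "q1 \<in> \<rat>" "p1 < q1" "q1 < s + \<epsilon>" using Rats_dense_in_real[of p1 "s + \<epsilon>"] p1 by auto
      have "p1 \<notin> A" using p1 cSup_upper[OF _ bA] s_def by force
      moreover have "x \<notin> E p1 q1" using x p1 q1 by (auto simp: N_def)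
      ultimately obtain e2 where e2: "e2 > 0" "\<not> inc q1 x e2" using x by (auto simp: E_def A_def)
      have slope: "\<bar>f r - f l - s * (r - l)\<bar> \<le> \<epsilon> * (r - l)"
        if "l < r" "l \<le> x" "x \<le> r" "r - l < min e1 e2" for l r
      proof -
        have "\<not> f r - f l \<le> p * (r - l)" using e1(2) that unfolding dec_def by (metis min_less_iff_conj)
        moreover have "\<not> q1 * (r - l) \<le> f r - f l" using e2(2) that unfolding inc_def by (metis min_less_iff_conj)
        moreover have "(s - \<epsilon>) * (r - l) \<le> p * (r - l)" using p that by (intro mult_right_mono) auto
        moreover have "q1 * (r - l) \<le> (s + \<epsilon>) * (r - l)" using q1 that by (intro mult_right_mono) auto
        ultimately show ?thesis by (simp add: algebra_simps abs_le_iff)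
      qed
      have "norm (f y - f x - s * (y - x)) \<le> \<epsilon> * norm (y - x)" if "norm (y - x) < min e1 e2" for y
      proof -
        consider "x < y" | "y < x" | "x = y" by linarith
        then show ?thesis
        proof cases
          case 1 then show ?thesis using slope[of x y] that by simp
        next
          case 2
          have "f y - f x - s * (y - x) = - (f x - f y - s * (x - y))" by (simp add: algebra_simps)
          then have "\<bar>f y - f x - s * (y - x)\<bar> = \<bar>f x - f y - s * (x - y)\<bar>" by (metis abs_minus_cancel)
          then show ?thesis using slope[of y x] 2 that by simp
        qed simp
      qed
      then show "\<exists>d>0. \<forall>y. norm (y - x) < d \<longrightarrow> norm (f y - f x - s * (y - x)) \<le> \<epsilon> * norm (y - x)"
        using e1 e2 by (intro exI[of _ "min e1 e2"]) auto
    qed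
    then show ?thesis by blast
  qed
  ultimately show thesis by (rule that)
qed

proposition abs_cont_on_vector_derivative_ae:
  fixes f :: "real \<Rightarrow> 'a::euclidean_space"
  assumes f: "abs_cont_on a b f"
  obtains N where "negligible N" 
    "\<And>x. x \<in> {a<..<b} - N \<Longrightarrow> (f has_vector_derivative vector_derivative f (at x)) (at x)"
proof -
  have "\<exists>N. negligible N \<and> (\<forall>x\<in>{a<..<b} - N. \<exists>D. ((\<lambda>x. f x \<bullet> i) has_real_derivative D) (at x))" for i
    using abs_cont_on_differentiable_ae[OF abs_cont_on_inner[OF f]] by metis
  then obtain N where N: "\<And>i. negligible (N i)"
    "\<And>i x. x \<in> {a<..<b} - N i \<Longrightarrow> \<exists>D. ((\<lambda>x. f x \<bullet> i) has_real_derivative D) (at x)" by metis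
  show thesis
  proof
    show "negligible (\<Union>i\<in>Basis. N i)" using N(1) by (intro negligible_Union) auto
    fix x assume x: "x \<in> {a<..<b} - (\<Union>i\<in>Basis. N i)"
    then have "\<forall>i\<in>Basis. \<exists>D. ((\<lambda>x. f x \<bullet> i) has_real_derivative D) (at x)" using N(2) by blast
    then obtain D where D: "\<And>i. i \<in> Basis \<Longrightarrow> ((\<lambda>x. f x \<bullet> i) has_real_derivative D i) (at x)" by metis
    have "(f has_vector_derivative (\<Sum>i\<in>Basis. D i *\<^sub>R i)) (at x)"
      unfolding has_vector_derivative_def
      by (subst has_derivative_componentwise_within)
         (use D in \<open>auto simp: has_field_derivative_def inner_sum_left inner_Basis if_distrib sum.delta mult_commute_abs cong: if_cong\<close>)
    then show "(f has_vector_derivative vector_derivative f (at x)) (at x)"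
      by (metis vector_derivative_at)
  qed
qed

section \<open>Operations on absolutely continuous curves and criteria\<close>

lemma abs_cont_on_cong:
  assumes "\<And>x. x \<in> {a..b} \<Longrightarrow> f x = g x"
  shows "abs_cont_on a b f \<longleftrightarrow> abs_cont_on a b g"
proof -
  have *: "abs_cont_on a b g" if "abs_cont_on a b f" "\<And>x. x \<in> {a..b} \<Longrightarrow> f x = g x" for f g :: "real \<Rightarrow> 'a"
    unfolding abs_cont_on_def
  proof (intro allI impI)
    fix e :: real assume "e > 0"
    from abs_cont_onE[OF that(1) this] obtain d where "d > 0" and
      d: "\<And>(n::nat) s t. \<lbrakk>\<And>i. i < n \<Longrightarrow> a \<le> s i; \<And>i. i < n \<Longrightarrow> s i \<le> t i; \<And>i. i < n \<Longrightarrow> t i \<le> b;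
          \<And>i j. \<lbrakk>i < n; j < n; i \<noteq> j\<rbrakk> \<Longrightarrow> t i \<le> s j \<or> t j \<le> s i; (\<Sum>i<n. t i - s i) < d\<rbrakk>
          \<Longrightarrow> (\<Sum>i<n. norm (f (t i) - f (s i))) < e" by blast
    show "\<exists>d>0. \<forall>(n::nat) s t. (\<forall>i<n. a \<le> s i \<and> s i \<le> t i \<and> t i \<le> b) \<and>
        (\<forall>i<n. \<forall>j<n. i \<noteq> j \<longrightarrow> t i \<le> s j \<or> t j \<le> s i) \<and> (\<Sum>i<n. t i - s i) < d
        \<longrightarrow> (\<Sum>i<n. norm (g (t i) - g (s i))) < e"
    proof (intro exI[of _ d] conjI allI impI \<open>d > 0\<close>; elim conjE)
      fix n :: nat and s t assume *: "\<forall>i<n. a \<le> s i \<and> s i \<le> t i \<and> t i \<le> b"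
          "\<forall>i<n. \<forall>j<n. i \<noteq> j \<longrightarrow> t i \<le> s j \<or> t j \<le> s i" "(\<Sum>i<n. t i - s i) < d"
      have "(\<Sum>i<n. norm (g (t i) - g (s i))) = (\<Sum>i<n. norm (f (t i) - f (s i)))"
      proof (rule sum.cong[OF refl])
        fix i assume "i \<in> {..<n}"
        with * have "a \<le> s i" "s i \<le> t i" "t i \<le> b" by auto
        then show "norm (g (t i) - g (s i)) = norm (f (t i) - f (s i))" using that(2)[of "s i"] that(2)[of "t i"] by simp
      qed
      also have "\<dots> < e" using d[of n s t] * by blast
      finally show "(\<Sum>i<n. norm (g (t i) - g (s i))) < e" .
    qed
  qed
  show ?thesis using *[of f g] *[of g f] assms by metis
qed

lemma abs_cont_on_subinterval:
  assumes "abs_cont_on a b f" "a \<le> a'" "b' \<le> b"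
  shows "abs_cont_on a' b' f"
  unfolding abs_cont_on_def
proof (intro allI impI)
  fix e :: real assume "e > 0"
  from abs_cont_onE[OF assms(1) this] obtain d where "d > 0" and
    d: "\<And>(n::nat) s t. \<lbrakk>\<And>i. i < n \<Longrightarrow> a \<le> s i; \<And>i. i < n \<Longrightarrow> s i \<le> t i; \<And>i. i < n \<Longrightarrow> t i \<le> b;
        \<And>i j. \<lbrakk>i < n; j < n; i \<noteq> j\<rbrakk> \<Longrightarrow> t i \<le> s j \<or> t j \<le> s i; (\<Sum>i<n. t i - s i) < d\<rbrakk>
        \<Longrightarrow> (\<Sum>i<n. norm (f (t i) - f (s i))) < e" by blast
  show "\<exists>d>0. \<forall>(n::nat) s t. (\<forall>i<n. a' \<le> s i \<and> s i \<le> t i \<and> t i \<le> b') \<and>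
        (\<forall>i<n. \<forall>j<n. i \<noteq> j \<longrightarrow> t i \<le> s j \<or> t j \<le> s i) \<and> (\<Sum>i<n. t i - s i) < d
        \<longrightarrow> (\<Sum>i<n. norm (f (t i) - f (s i))) < e"
  proof (intro exI[of _ d] conjI allI impI \<open>d > 0\<close>; elim conjE)
    fix n :: nat and s t assume *: "\<forall>i<n. a' \<le> s i \<and> s i \<le> t i \<and> t i \<le> b'"
        "\<forall>i<n. \<forall>j<n. i \<noteq> j \<longrightarrow> t i \<le> s j \<or> t j \<le> s i" "(\<Sum>i<n. t i - s i) < d"
    show "(\<Sum>i<n. norm (f (t i) - f (s i))) < e"
    proof (rule d)
      show "a \<le> s i" "s i \<le> t i" "t i \<le> b" if "i < n" for i using *(1) that assms(2,3) by force+
    qed (use * in blast)+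
  qed
qed

lemma abs_cont_on_combine:
  assumes "abs_cont_on a b f" "abs_cont_on b c f"
  shows "abs_cont_on a c f"
  unfolding abs_cont_on_def
proof (intro allI impI)
  fix e :: real assume "e > 0"
  then have "e / 2 > 0" by simp
  from abs_cont_onE[OF assms(1) this] obtain d1 where "d1 > 0" and
    d1: "\<And>(n::nat) s t. \<lbrakk>\<And>i. i < n \<Longrightarrow> a \<le> s i; \<And>i. i < n \<Longrightarrow> s i \<le> t i; \<And>i. i < n \<Longrightarrow> t i \<le> b;
        \<And>i j. \<lbrakk>i < n; j < n; i \<noteq> j\<rbrakk> \<Longrightarrow> t i \<le> s j \<or> t j \<le> s i; (\<Sum>i<n. t i - s i) < d1\<rbrakk>
        \<Longrightarrow> (\<Sum>i<n. norm (f (t i) - f (s i))) < e / 2" by blast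
  from abs_cont_onE[OF assms(2) \<open>e / 2 > 0\<close>] obtain d2 where "d2 > 0" and
    d2: "\<And>(n::nat) s t. \<lbrakk>\<And>i. i < n \<Longrightarrow> b \<le> s i; \<And>i. i < n \<Longrightarrow> s i \<le> t i; \<And>i. i < n \<Longrightarrow> t i \<le> c;
        \<And>i j. \<lbrakk>i < n; j < n; i \<noteq> j\<rbrakk> \<Longrightarrow> t i \<le> s j \<or> t j \<le> s i; (\<Sum>i<n. t i - s i) < d2\<rbrakk>
        \<Longrightarrow> (\<Sum>i<n. norm (f (t i) - f (s i))) < e / 2" by blast
  show "\<exists>d>0. \<forall>(n::nat) s t. (\<forall>i<n. a \<le> s i \<and> s i \<le> t i \<and> t i \<le> c) \<and>
        (\<forall>i<n. \<forall>j<n. i \<noteq> j \<longrightarrow> t i \<le> s j \<or> t j \<le> s i) \<and> (\<Sum>i<n. t i - s i) < d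
        \<longrightarrow> (\<Sum>i<n. norm (f (t i) - f (s i))) < e"
  proof (intro exI[of _ "min d1 d2"] conjI allI impI; (elim conjE)?)
    fix n :: nat and s t assume *: "\<forall>i<n. a \<le> s i \<and> s i \<le> t i \<and> t i \<le> c"
        "\<forall>i<n. \<forall>j<n. i \<noteq> j \<longrightarrow> t i \<le> s j \<or> t j \<le> s i" "(\<Sum>i<n. t i - s i) < min d1 d2"
    have st: "a \<le> s i" "s i \<le> t i" "t i \<le> c" if "i < n" for i using *(1) that by auto
    consider "c \<le> b" | "b \<le> a" | "a \<le> b" "b \<le> c" by linarith
    then show "(\<Sum>i<n. norm (f (t i) - f (s i))) < e"
    proof cases
      case 1
      have "(\<Sum>i<n. norm (f (t i) - f (s i))) < e / 2"
        by (rule d1) (use st 1 * in \<open>force+\<close>)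
      then show ?thesis using \<open>e > 0\<close> by simp
    next
      case 2
      have "(\<Sum>i<n. norm (f (t i) - f (s i))) < e / 2"
        by (rule d2) (use st 2 * in \<open>force+\<close>)
      then show ?thesis using \<open>e > 0\<close> by simp
    next
      case 3
      have disj: "t i \<le> s j \<or> t j \<le> s i" if "i < n" "j < n" "i \<noteq> j" for i j using *(2) that by blast
      \<comment> \<open>An interval across b is cut there: clamping the endpoints by
        \<open>min\<close> and \<open>max\<close> gives one admissible family on each side, of no
        larger total length.\<close>
      have "(\<Sum>i<n. norm (f (min (t i) b) - f (min (s i) b))) < e / 2"
      proof (rule d1[of n "\<lambda>i. min (s i) b" "\<lambda>i. min (t i) b"])
        have "(\<Sum>i<n. min (t i) b - min (s i) b) \<le> (\<Sum>i<n. t i - s i)"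
          by (rule sum_mono) (use st in force)
        then show "(\<Sum>i<n. min (t i) b - min (s i) b) < d1" using * by simp
        show "min (t i) b \<le> min (s j) b \<or> min (t j) b \<le> min (s i) b" if "i < n" "j < n" "i \<noteq> j" for i j
          using disj[OF that] by (meson min.mono order_refl)
      qed (use st 3 in \<open>force+\<close>)
      moreover have "(\<Sum>i<n. norm (f (max (t i) b) - f (max (s i) b))) < e / 2"
      proof (rule d2[of n "\<lambda>i. max (s i) b" "\<lambda>i. max (t i) b"])
        have "(\<Sum>i<n. max (t i) b - max (s i) b) \<le> (\<Sum>i<n. t i - s i)"
          by (rule sum_mono) (use st in force)
        then show "(\<Sum>i<n. max (t i) b - max (s i) b) < d2" using * by simp
        show "max (t i) b \<le> max (s j) b \<or> max (t j) b \<le> max (s i) b" if "i < n" "j < n" "i \<noteq> j" for i j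
          using disj[OF that] by (meson max.mono order_refl)
      qed (use st 3 in \<open>force+\<close>)
      moreover have "(\<Sum>i<n. norm (f (t i) - f (s i))) \<le>
          (\<Sum>i<n. norm (f (min (t i) b) - f (min (s i) b)) + norm (f (max (t i) b) - f (max (s i) b)))"
      proof (rule sum_mono)
        fix i assume "i \<in> {..<n}"
        then have "s i \<le> t i" using st by simp
        then consider "t i \<le> b" "s i \<le> b" | "b \<le> s i" "b \<le> t i" | "s i \<le> b" "b \<le> t i" by linarith
        then show "norm (f (t i) - f (s i)) \<le> norm (f (min (t i) b) - f (min (s i) b)) + norm (f (max (t i) b) - f (max (s i) b))"
        proof cases
          case 3
          then show ?thesis using norm_triangle_ineq[of "f b - f (s i)" "f (t i) - f b"] by simp
        qed auto
      qed
      ultimately show ?thesis by (simp add: sum.distrib)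
    qed
  qed (use \<open>d1 > 0\<close> \<open>d2 > 0\<close> in simp)
qed

lemma abs_cont_on_lipschitz:
  fixes f :: "real \<Rightarrow> 'a::real_normed_vector"
  assumes "\<And>x y. \<lbrakk>x \<in> {a..b}; y \<in> {a..b}\<rbrakk> \<Longrightarrow> norm (f x - f y) \<le> C * \<bar>x - y\<bar>" "C > 0"
  shows "abs_cont_on a b f"
  unfolding abs_cont_on_def
proof (intro allI impI)
  fix e :: real assume "e > 0"
  show "\<exists>d>0. \<forall>(n::nat) s t. (\<forall>i<n. a \<le> s i \<and> s i \<le> t i \<and> t i \<le> b) \<and>
        (\<forall>i<n. \<forall>j<n. i \<noteq> j \<longrightarrow> t i \<le> s j \<or> t j \<le> s i) \<and> (\<Sum>i<n. t i - s i) < d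
        \<longrightarrow> (\<Sum>i<n. norm (f (t i) - f (s i))) < e"
  proof (intro exI[of _ "e / C"] conjI allI impI; (elim conjE)?)
    fix n :: nat and s t assume *: "\<forall>i<n. a \<le> s i \<and> s i \<le> t i \<and> t i \<le> b" "(\<Sum>i<n. t i - s i) < e / C"
    have "(\<Sum>i<n. norm (f (t i) - f (s i))) \<le> (\<Sum>i<n. C * (t i - s i))"
    proof (rule sum_mono)
      fix i assume "i \<in> {..<n}"
      then have "a \<le> s i" "s i \<le> t i" "t i \<le> b" using *(1) by auto
      then show "norm (f (t i) - f (s i)) \<le> C * (t i - s i)" using assms(1)[of "t i" "s i"] by simp
    qed
    also have "\<dots> = C * (\<Sum>i<n. t i - s i)" by (simp add: sum_distrib_left)
    also have "\<dots> < e" using *(2) \<open>C > 0\<close> by (simp add: field_simps)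
    finally show "(\<Sum>i<n. norm (f (t i) - f (s i))) < e" .
  qed (use \<open>e > 0\<close> \<open>C > 0\<close> in simp)
qed

text \<open>The hypothesis is a bound on kinetic energy in Young's form, with \<alpha> free to be
  chosen after e. It involves only finitely many values of the function at a time and so passes to
  pointwise limits, unlike absolute continuity itself.\<close>

lemma abs_cont_onI_energy:
  fixes f :: "real \<Rightarrow> 'a::real_normed_vector"
  assumes "E \<ge> 0" and sum: "\<And>(n::nat) s t \<alpha>. \<lbrakk>\<And>i. i < n \<Longrightarrow> a \<le> s i; \<And>i. i < n \<Longrightarrow> s i \<le> t i; \<And>i. i < n \<Longrightarrow> t i \<le> b;
        \<And>i j. \<lbrakk>i < n; j < n; i \<noteq> j\<rbrakk> \<Longrightarrow> t i \<le> s j \<or> t j \<le> s i; \<alpha> > 0\<rbrakk>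
        \<Longrightarrow> (\<Sum>i<n. norm (f (t i) - f (s i))) \<le> \<alpha> * E + (\<Sum>i<n. t i - s i) / \<alpha>"
  shows "abs_cont_on a b f"
  unfolding abs_cont_on_def
proof (intro allI impI)
  fix e :: real assume "e > 0"
  define \<alpha> where "\<alpha> = e / (2 * (E + 1))"
  have "\<alpha> > 0" using \<open>e > 0\<close> \<open>E \<ge> 0\<close> by (simp add: \<alpha>_def)
  have \<alpha>E: "\<alpha> * E \<le> e / 2" using \<open>e > 0\<close> \<open>E \<ge> 0\<close> by (simp add: \<alpha>_def field_simps)
  show "\<exists>d>0. \<forall>(n::nat) s t. (\<forall>i<n. a \<le> s i \<and> s i \<le> t i \<and> t i \<le> b) \<and>
        (\<forall>i<n. \<forall>j<n. i \<noteq> j \<longrightarrow> t i \<le> s j \<or> t j \<le> s i) \<and> (\<Sum>i<n. t i - s i) < d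
        \<longrightarrow> (\<Sum>i<n. norm (f (t i) - f (s i))) < e"
  proof (intro exI[of _ "\<alpha> * e / 2"] conjI allI impI; (elim conjE)?)
    fix n :: nat and s t assume *: "\<forall>i<n. a \<le> s i \<and> s i \<le> t i \<and> t i \<le> b"
        "\<forall>i<n. \<forall>j<n. i \<noteq> j \<longrightarrow> t i \<le> s j \<or> t j \<le> s i" "(\<Sum>i<n. t i - s i) < \<alpha> * e / 2"
    have "(\<Sum>i<n. norm (f (t i) - f (s i))) \<le> \<alpha> * E + (\<Sum>i<n. t i - s i) / \<alpha>"
      by (rule sum) (use * \<open>\<alpha> > 0\<close> in auto)
    also have "(\<Sum>i<n. t i - s i) / \<alpha> < e / 2" using * \<open>\<alpha> > 0\<close> by (simp add: field_simps)
    finally show "(\<Sum>i<n. norm (f (t i) - f (s i))) < e" using \<alpha>E by simp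
  qed (use \<open>e > 0\<close> \<open>\<alpha> > 0\<close> in simp)
qed

text \<open>The derivative predicates of both functions coincide, and hence so do the values chosen
  from them, even at points where no derivative exists.\<close>

lemma vector_derivative_cong_open:
  assumes "open S" "x \<in> S" "\<And>y. y \<in> S \<Longrightarrow> f y = g y"
  shows "vector_derivative f (at x) = vector_derivative g (at x)"
proof -
  have "(f has_vector_derivative D) (at x) \<longleftrightarrow> (g has_vector_derivative D) (at x)" for D
    using has_vector_derivative_transform_within_open[OF _ assms(1,2)] assms(3) by metis
  then show ?thesis by (simp add: vector_derivative_def)
qed

section \<open>The extended integral\<close>

lemma ext_lint_absolutely_integrable:
  assumes "f absolutely_integrable_on A"
  shows "ext_lint A f = ereal (integral A f)"
proof -
  have i: "integrable lebesgue (\<lambda>x. indicator A x * f x)" using assms by (simp add: set_integrable_def)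
  have e: "ennreal (f x) * indicator A x = ennreal (indicator A x * f x)"
    "ennreal (- f x) * indicator A x = ennreal (- (indicator A x * f x))" for x
    by (auto split: split_indicator)
  have fin: "(\<integral>\<^sup>+ x. ennreal (indicator A x * f x) \<partial>lebesgue) \<noteq> \<infinity>" "(\<integral>\<^sup>+ x. ennreal (- (indicator A x * f x)) \<partial>lebesgue) \<noteq> \<infinity>"
    using i by (auto simp: real_integrable_def)
  have "ereal (integral A f) = ereal (LINT x|lebesgue. indicator A x * f x)"
    using set_lebesgue_integral_eq_integral(2)[OF assms] by (simp add: set_lebesgue_integral_def)
  also have "\<dots> = ereal (enn2real (\<integral>\<^sup>+ x. ennreal (indicator A x * f x) \<partial>lebesgue)) - ereal (enn2real (\<integral>\<^sup>+ x. ennreal (- (indicator A x * f x)) \<partial>lebesgue))"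
    by (simp add: real_lebesgue_integral_def[OF i])
  also have "\<dots> = enn2ereal (\<integral>\<^sup>+ x. ennreal (indicator A x * f x) \<partial>lebesgue) - enn2ereal (\<integral>\<^sup>+ x. ennreal (- (indicator A x * f x)) \<partial>lebesgue)"
  proof -
    have "ereal (enn2real y) = enn2ereal y" if "y \<noteq> \<infinity>" for y using that by (cases y) auto
    then show ?thesis using fin by presburger
  qed
  finally show ?thesis by (simp add: ext_lint_def e)
qed

text \<open>A lower bound on a bounded interval makes the negative part finite, so the extended
  integral can avoid the value infinity only if the positive part is finite too.\<close>

lemma ext_lint_less_infinity:
  fixes f :: "real \<Rightarrow> real"
  assumes "f \<in> borel_measurable (lebesgue_on {a..b})" "\<And>x. x \<in> {a..b} \<Longrightarrow> - B \<le> f x" "ext_lint {a..b} f < \<infinity>"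
  shows "f absolutely_integrable_on {a..b}"
proof -
  have m: "(\<lambda>x. indicator {a..b} x * f x) \<in> borel_measurable lebesgue"
    using assms(1) by (simp add: borel_measurable_restrict_space_iff mult.commute)
  have e: "ennreal (f x) * indicator {a..b} x = ennreal (indicator {a..b} x * f x)"
    "ennreal (- f x) * indicator {a..b} x = ennreal (- (indicator {a..b} x * f x))" for x
    by (auto split: split_indicator)
  have "(\<integral>\<^sup>+ x. ennreal (- (indicator {a..b} x * f x)) \<partial>lebesgue) \<le> (\<integral>\<^sup>+ x. ennreal B * indicator {a..b} x \<partial>lebesgue)"
  proof (rule nn_integral_mono)
    fix x show "ennreal (- (indicator {a..b} x * f x)) \<le> ennreal B * indicator {a..b} x"
      using assms(2)[of x] by (auto split: split_indicator intro!: ennreal_leI)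
  qed
  also have "\<dots> = ennreal B * emeasure lebesgue {a..b}" by (rule nn_integral_cmult_indicator) auto
  also have "\<dots> < \<infinity>" by (auto simp: ennreal_mult_less_top emeasure_lborel_Icc_eq)
  finally have neg: "(\<integral>\<^sup>+ x. ennreal (- (indicator {a..b} x * f x)) \<partial>lebesgue) < \<infinity>" .
  have pos: "(\<integral>\<^sup>+ x. ennreal (indicator {a..b} x * f x) \<partial>lebesgue) \<noteq> \<infinity>"
  proof
    assume "(\<integral>\<^sup>+ x. ennreal (indicator {a..b} x * f x) \<partial>lebesgue) = \<infinity>"
    then have "ext_lint {a..b} f = \<infinity> - enn2ereal (\<integral>\<^sup>+ x. ennreal (- (indicator {a..b} x * f x)) \<partial>lebesgue)"
      by (simp add: ext_lint_def e)
    then show False using assms(3) neg by (cases "\<integral>\<^sup>+ x. ennreal (- (indicator {a..b} x * f x)) \<partial>lebesgue") auto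
  qed
  show ?thesis unfolding set_integrable_def real_integrable_def real_scaleR_def using m pos neg by simp
qed

section \<open>The control problem\<close>

text \<open>A discrete Gronwall argument. The steps are only small relative to 1 + |w|, so
  boundedness comes from the product of the factors 1 + b q^k, which is at most exp(b/(1 - q));
  after that the steps are summable. The sequence will be that of mean velocities on shrinking
  intervals.\<close>

lemma perturbed_geometric_convergent:
  fixes w :: "nat \<Rightarrow> 'a::banach"
  assumes "0 \<le> b" "0 \<le> q" "q < 1" and step: "\<And>k. norm (w (Suc k) - w k) \<le> b * q ^ k * (1 + norm (w k))"
  obtains v C where "w \<longlonglongrightarrow> v" "\<And>k. 1 + norm (w k) \<le> C"
proof -
  define C where "C = exp (b / (1 - q)) * (1 + norm (w 0))"
  have geo: "(\<Sum>i<k. q ^ i) \<le> 1 / (1 - q)" for k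
    using sum_le_suminf[OF summable_geometric[of q], of "{..<k}"] suminf_geometric[of q] assms by simp
  have "1 + norm (w k) \<le> exp (b * (\<Sum>i<k. q ^ i)) * (1 + norm (w 0))" for k
  proof (induction k)
    case (Suc k)
    have "1 + norm (w (Suc k)) \<le> 1 + norm (w k) + norm (w (Suc k) - w k)"
      using norm_triangle_ineq[of "w k" "w (Suc k) - w k"] by simp
    also have "\<dots> \<le> (1 + b * q ^ k) * (1 + norm (w k))" using step[of k] by (simp add: algebra_simps)
    also have "\<dots> \<le> exp (b * q ^ k) * (1 + norm (w k))"
      by (rule mult_right_mono[OF exp_ge_add_one_self]) (simp add: add_nonneg_nonneg)
    also have "\<dots> \<le> exp (b * q ^ k) * (exp (b * (\<Sum>i<k. q ^ i)) * (1 + norm (w 0)))"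
      by (rule mult_left_mono[OF Suc]) simp
    also have "\<dots> = exp (b * (\<Sum>i<Suc k. q ^ i)) * (1 + norm (w 0))"
      by (simp add: algebra_simps exp_add)
    finally show ?case .
  qed simp
  moreover have "exp (b * (\<Sum>i<k. q ^ i)) * (1 + norm (w 0)) \<le> C" for k
  proof -
    have "b * (\<Sum>i<k. q ^ i) \<le> b / (1 - q)" using mult_left_mono[OF geo \<open>0 \<le> b\<close>] by simp
    then show ?thesis unfolding C_def by (intro mult_right_mono) (auto simp: add_nonneg_nonneg)
  qed
  ultimately have C: "1 + norm (w k) \<le> C" for k by (meson order_trans)
  have "summable (\<lambda>k. w (Suc k) - w k)"
  proof (rule summable_comparison_test)
    show "summable (\<lambda>k. b * C * q ^ k)" using assms by (intro summable_mult summable_geometric) simp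
    have "norm (w (Suc k) - w k) \<le> b * C * q ^ k" for k
    proof -
      have "b * q ^ k * (1 + norm (w k)) \<le> b * q ^ k * C" using C assms by (intro mult_left_mono) auto
      then show ?thesis using step[of k] by (simp add: algebra_simps)
    qed
    then show "\<exists>N. \<forall>n\<ge>N. norm (w (Suc n) - w n) \<le> b * C * q ^ n" by blast
  qed
  then obtain l where "(\<lambda>n. \<Sum>k<n. w (Suc k) - w k) \<longlonglongrightarrow> l" unfolding summable_def sums_def by blast
  then have "(\<lambda>n. w n - w 0) \<longlonglongrightarrow> l" by (simp add: sum_lessThan_telescope)
  from tendsto_add[OF this tendsto_const[of "w 0"]] have "w \<longlonglongrightarrow> l + w 0" by simp
  with C show thesis using that by blast
qed

section \<open>Curves as plain functions\<close>

text \<open>The curves of \<open>curves\<close> freed from the type of bounded continuous functions,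
  so that they can be joined and reparametrised freely; the constant extension outside [0, T] is
  kept.\<close>

definition paths :: "real \<Rightarrow> 'a::euclidean_space set \<Rightarrow> (real \<Rightarrow> 'a) set"
  where "paths T \<Omega> = {\<gamma>. (\<forall>t. \<gamma> t = \<gamma> (min T (max 0 t))) \<and> abs_cont_on 0 T \<gamma> \<and> (\<forall>t\<in>{0..T}. \<gamma> t \<in> closure \<Omega>)}"

lemma paths_continuous:
  assumes "\<gamma> \<in> paths T \<Omega>" "0 \<le> T"
  shows "continuous_on UNIV \<gamma>"
proof -
  have "continuous_on UNIV (\<lambda>t. \<gamma> (min T (max 0 t)))"
    using assms by (intro continuous_on_compose2[OF abs_cont_on_imp_continuous_on[of 0 T \<gamma>]] continuous_intros)
      (auto simp: paths_def)
  moreover have "(\<lambda>t. \<gamma> (min T (max 0 t))) = \<gamma>" using assms(1) by (auto simp: paths_def)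
  ultimately show ?thesis by (rule back_subst[of "continuous_on UNIV"])
qed

lemma paths_eq_curves:
  assumes "0 \<le> T"
  shows "paths T \<Omega> = apply_bcontfun ` curves T \<Omega>"
proof
  show "apply_bcontfun ` curves T \<Omega> \<subseteq> paths T \<Omega>" by (auto simp: paths_def curves_def)
  show "paths T \<Omega> \<subseteq> apply_bcontfun ` curves T \<Omega>"
  proof
    fix \<gamma> assume \<gamma>: "\<gamma> \<in> paths T \<Omega>"
    have c: "continuous_on UNIV \<gamma>" by (rule paths_continuous[OF \<gamma> assms])
    have "bounded (\<gamma> ` {0..T})"
      by (intro compact_imp_bounded compact_continuous_image continuous_on_subset[OF c]) auto
    moreover have "range \<gamma> \<subseteq> \<gamma> ` {0..T}"
    proof
      fix y assume "y \<in> range \<gamma>"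
      then obtain t where "y = \<gamma> t" by auto
      also have "\<gamma> t = \<gamma> (min T (max 0 t))" using \<gamma> unfolding paths_def by blast
      finally show "y \<in> \<gamma> ` {0..T}" using assms by auto
    qed
    ultimately have "\<gamma> \<in> bcontfun" using c by (auto simp: bcontfun_def intro: bounded_subset)
    then have "apply_bcontfun (Bcontfun \<gamma>) = \<gamma>" by (rule Bcontfun_inverse)
    moreover from this have "Bcontfun \<gamma> \<in> curves T \<Omega>" using \<gamma> by (simp add: curves_def paths_def)
    ultimately show "\<gamma> \<in> apply_bcontfun ` curves T \<Omega>" by (metis imageI)
  qed
qed

lemma paths_join:
  assumes "c \<in> paths T \<Omega>" "\<gamma> \<in> paths T \<Omega>" "c e = \<gamma> e" "e \<in> {0..T}"
  shows "(\<lambda>r. if r \<le> e then c r else \<gamma> r) \<in> paths T \<Omega>" (is "?j \<in> _")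
proof -
  have cl: "c r = c (min T (max 0 r))" "\<gamma> r = \<gamma> (min T (max 0 r))" for r
    using assms unfolding paths_def by blast+
  have ac: "abs_cont_on 0 T c" "abs_cont_on 0 T \<gamma>" using assms by (auto simp: paths_def)
  have "abs_cont_on 0 e ?j"
    using abs_cont_on_subinterval[OF ac(1), of 0 e] assms(4) by (subst abs_cont_on_cong[of 0 e _ c]) auto
  moreover have "abs_cont_on e T ?j"
    using abs_cont_on_subinterval[OF ac(2), of e T] assms(3,4) by (subst abs_cont_on_cong[of e T _ \<gamma>]) auto
  ultimately have "abs_cont_on 0 T ?j" by (rule abs_cont_on_combine)
  moreover have "?j t = ?j (min T (max 0 t))" for t
  proof -
    \<comment> \<open>Beyond T the joined function follows \<gamma>, while for \<open>T = e\<close>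
      the clamped time falls into the branch of c; there the agreement
      \<open>c e = \<gamma> e\<close> reconciles the two.\<close>
    consider "t < 0" | "t > T" "T > e" | "t > T" "T = e" | "t \<in> {0..T}" using assms(4) by force
    then show ?thesis
    proof cases
      case 1
      then have "c t = c 0" using cl(1)[of t] assms(4) by simp
      then show ?thesis using 1 assms(4) by simp
    next
      case 2
      then have "\<gamma> t = \<gamma> T" using cl(2)[of t] assms(4) by simp
      then show ?thesis using 2 assms(4) by simp
    next
      case 3
      then have "\<gamma> t = \<gamma> T" using cl(2)[of t] assms(4) by simp
      then show ?thesis using 3 assms(3,4) by simp
    qed simp
  qed
  moreover have "?j t \<in> closure \<Omega>" if "t \<in> {0..T}" for t using assms(1,2) that by (auto simp: paths_def)
  ultimately show ?thesis unfolding paths_def by blast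
qed

section \<open>The control problem with the measure flow frozen\<close>

text \<open>Here \<open>f s x\<close> stands for F(x, m(s)) and \<open>g\<close> for the terminal
  cost. The Lagrangian is recorded through two quadratic bounds around every velocity, bounds at
  velocity 0, and a Lipschitz constant in x that grows quadratically in v. Boundary regularity
  enters through \<open>geometry\<close>: near each point, a segment between points of the closed
  domain becomes admissible after a shift by \<theta>(1 - \<theta>)|z - y|^2 along one fixed
  vector.\<close>

locale control =
  fixes \<Omega> U :: "'a::euclidean_space set" and T \<mu> K :: real
    and L :: "'a \<Rightarrow> 'a \<Rightarrow> real" and DvL :: "'a \<Rightarrow> 'a \<Rightarrow> 'a"
    and f :: "real \<Rightarrow> 'a \<Rightarrow> real" and g :: "'a \<Rightarrow> real" and u :: "real \<Rightarrow> 'a \<Rightarrow> real"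
  assumes T_pos: "0 < T" and U_open: "open U" and U_sup: "closure \<Omega> \<subseteq> U" and \<Omega>_bdd: "bounded \<Omega>"
    and \<mu>_pos: "0 < \<mu>" and K_nonneg: "0 \<le> K"
    and L_cont: "continuous_on (U \<times> UNIV) (\<lambda>(x,v). L x v)"
    and L_lower: "\<And>x v w. x \<in> U \<Longrightarrow> L x v + DvL x v \<bullet> (w - v) + (norm (w - v))\<^sup>2 / (2 * \<mu>) \<le> L x w"
    and L_upper: "\<And>x v w. x \<in> U \<Longrightarrow> L x w \<le> L x v + DvL x v \<bullet> (w - v) + \<mu> / 2 * (norm (w - v))\<^sup>2"
    and L_zero: "\<And>x. x \<in> U \<Longrightarrow> \<bar>L x 0\<bar> \<le> K \<and> norm (DvL x 0) \<le> K"
    and L_lip: "\<And>x y v. closed_segment x y \<subseteq> U \<Longrightarrow> \<bar>L x v - L y v\<bar> \<le> K * (1 + (norm v)\<^sup>2) * norm (x - y)"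
    and f_cont: "continuous_on ({0..T} \<times> closure \<Omega>) (\<lambda>(s,x). f s x)"
    and f_lip: "\<And>s x y. \<lbrakk>s \<in> {0..T}; closed_segment x y \<subseteq> U\<rbrakk> \<Longrightarrow> \<bar>f s x - f s y\<bar> \<le> K * norm (x - y)"
    and g_bdd: "bounded (g ` closure \<Omega>)"
    and geometry: "\<And>x. x \<in> closure \<Omega> \<Longrightarrow> \<exists>r>0. \<exists>n. \<forall>y\<in>closure \<Omega> \<inter> ball x r. \<forall>z\<in>closure \<Omega> \<inter> ball x r. \<forall>\<theta>\<in>{0..1}.
       y + \<theta> *\<^sub>R (z - y) - (\<theta> * (1 - \<theta>) * (norm (z - y))\<^sup>2) *\<^sub>R n \<in> closure \<Omega>"
    and val: "\<And>t x. \<lbrakk>t \<in> {0..T}; x \<in> closure \<Omega>\<rbrakk> \<Longrightarrow> ereal (u t x) = (INF \<gamma>\<in>{\<gamma>\<in>paths T \<Omega>. \<gamma> t = x}.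
        ext_lint {t..T} (\<lambda>s. L (\<gamma> s) (vector_derivative \<gamma> (at s)) + f s (\<gamma> s)) + ereal (g (\<gamma> T)))"
begin

definition vel :: "(real \<Rightarrow> 'a) \<Rightarrow> real \<Rightarrow> 'a"
  where "vel \<gamma> s = vector_derivative \<gamma> (at s)"

definition ell :: "(real \<Rightarrow> 'a) \<Rightarrow> real \<Rightarrow> real"
  where "ell \<gamma> s = L (\<gamma> s) (vel \<gamma> s) + f s (\<gamma> s)"

text \<open>Finite cost: the running cost along a curve is measurable and bounded below, so absolute
  integrability amounts to the extended integral not being infinite.\<close>

abbreviation "fin_cost t e \<gamma> \<equiv> ell \<gamma> absolutely_integrable_on {t..e}"

lemma compact_domain: "compact (closure \<Omega>)"
  using \<Omega>_bdd by simp

lemma path_in: "\<gamma> \<in> paths T \<Omega> \<Longrightarrow> s \<in> {0..T} \<Longrightarrow> \<gamma> s \<in> closure \<Omega>"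
  by (auto simp: paths_def)

lemma path_continuous: "\<gamma> \<in> paths T \<Omega> \<Longrightarrow> continuous_on A \<gamma>"
  using paths_continuous[of \<gamma> T \<Omega>] T_pos continuous_on_subset by fastforce

lemma f_bound: obtains B where "0 \<le> B" "\<And>s x. \<lbrakk>s \<in> {0..T}; x \<in> closure \<Omega>\<rbrakk> \<Longrightarrow> \<bar>f s x\<bar> \<le> B"
proof -
  have "compact ((\<lambda>(s,x). f s x) ` ({0..T} \<times> closure \<Omega>))"
    by (intro compact_continuous_image f_cont compact_Times compact_domain) auto
  then obtain B where B: "\<And>y. y \<in> (\<lambda>(s,x). f s x) ` ({0..T} \<times> closure \<Omega>) \<Longrightarrow> norm y \<le> B"
    using compact_imp_bounded bounded_iff by metis
  show thesis
  proof (rule that[of "max B 0"])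
    fix s x assume "s \<in> {0..T}" "x \<in> closure \<Omega>"
    then have "f s x \<in> (\<lambda>(s,x). f s x) ` ({0..T} \<times> closure \<Omega>)" by force
    from B[OF this] show "\<bar>f s x\<bar> \<le> max B 0" by simp
  qed simp
qed

section \<open>Velocities, coercivity and finite cost\<close>

lemma vel_has_integral:
  assumes "\<gamma> \<in> paths T \<Omega>" "0 \<le> a" "a \<le> b" "b \<le> T"
  shows "(vel \<gamma> has_integral (\<gamma> b - \<gamma> a)) {a..b}"
proof -
  have ac: "abs_cont_on 0 T \<gamma>" using assms by (simp add: paths_def)
  obtain N where N: "negligible N" "\<And>x. x \<in> {0<..<T} - N \<Longrightarrow> (\<gamma> has_vector_derivative vector_derivative \<gamma> (at x)) (at x)"
    using abs_cont_on_vector_derivative_ae[OF ac] by blast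
  show ?thesis
  proof (rule has_integral_abs_cont_deriv[OF assms(3)])
    show "abs_cont_on a b \<gamma>" by (rule abs_cont_on_subinterval[OF ac assms(2,4)])
    show "negligible (N \<union> {0, T})" using N(1) by (intro negligible_Un) auto
    show "(\<gamma> has_vector_derivative vel \<gamma> x) (at x within {a..b})" if "x \<in> {a..b} - (N \<union> {0, T})" for x
    proof -
      have "x \<in> {0<..<T} - N" using that assms(2-4) by auto
      from N(2)[OF this] show ?thesis unfolding vel_def by (rule has_vector_derivative_at_within)
    qed
  qed
qed

text \<open>\<open>vel\<close> is a pointwise choice without evident measurability; it inherits
  measurability from being Henstock-Kurzweil integrable on [0, T].\<close>

lemma vel_measurable:
  assumes "\<gamma> \<in> paths T \<Omega>" "0 \<le> a" "b \<le> T"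
  shows "vel \<gamma> \<in> borel_measurable (lebesgue_on {a..b})"
proof -
  have "vel \<gamma> integrable_on {0..T}" using vel_has_integral[OF assms(1), of 0 T] T_pos by auto
  then have "vel \<gamma> \<in> borel_measurable (lebesgue_on {0..T})" by (rule integrable_imp_measurable)
  then show ?thesis using assms by (elim measurable_restrict_mono) auto
qed

lemma ell_measurable:
  assumes "\<gamma> \<in> paths T \<Omega>" "0 \<le> a" "b \<le> T"
  shows "ell \<gamma> \<in> borel_measurable (lebesgue_on {a..b})"
proof -
  have sub: "\<gamma> s \<in> U" "\<gamma> s \<in> closure \<Omega>" if "s \<in> {a..b}" for s
    using path_in[OF assms(1), of s] that assms U_sup by auto
  have g: "\<gamma> \<in> borel_measurable (lebesgue_on {a..b})"
    by (intro continuous_imp_measurable_on_sets_lebesgue path_continuous assms) auto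
  have "(\<lambda>s. (\<gamma> s, vel \<gamma> s)) \<in> measurable (lebesgue_on {a..b}) (restrict_space borel (U \<times> UNIV))"
    using sub vel_measurable[OF assms] g by (intro measurable_restrict_space2 borel_measurable_Pair) (auto simp: space_restrict_space)
  moreover have "(\<lambda>(x,v). L x v) \<in> borel_measurable (restrict_space borel (U \<times> UNIV))"
    by (intro borel_measurable_continuous_on_restrict L_cont)
  ultimately have "(\<lambda>s. (\<lambda>(x,v). L x v) (\<gamma> s, vel \<gamma> s)) \<in> borel_measurable (lebesgue_on {a..b})"
    by (rule measurable_compose)
  moreover have "continuous_on {a..b} (\<lambda>s. (\<lambda>(s,x). f s x) (s, \<gamma> s))"
    by (rule continuous_on_compose2[OF f_cont]) (use assms sub in \<open>auto intro!: continuous_intros path_continuous\<close>)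
  then have "(\<lambda>s. f s (\<gamma> s)) \<in> borel_measurable (lebesgue_on {a..b})"
    by (intro continuous_imp_measurable_on_sets_lebesgue) auto
  ultimately show ?thesis unfolding ell_def by simp
qed

text \<open>Strong convexity at velocity 0; Young's inequality absorbs the linear term at the price
  of half of the quadratic coefficient 1/(2\<mu>).\<close>

lemma L_coercive: "x \<in> U \<Longrightarrow> (norm v)\<^sup>2 / (4 * \<mu>) - (K + \<mu> * K\<^sup>2) \<le> L x v"
proof -
  assume x: "x \<in> U"
  have "L x 0 + DvL x 0 \<bullet> v + (norm v)\<^sup>2 / (2 * \<mu>) \<le> L x v" using L_lower[OF x, of 0 v] by simp
  moreover have "- (K * norm v) \<le> DvL x 0 \<bullet> v"
  proof -
    have "\<bar>DvL x 0 \<bullet> v\<bar> \<le> norm (DvL x 0) * norm v" by (rule Cauchy_Schwarz_ineq2)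
    also have "\<dots> \<le> K * norm v" using L_zero[OF x] by (intro mult_right_mono) auto
    finally show ?thesis by simp
  qed
  moreover have "- K \<le> L x 0" using L_zero[OF x] by linarith
  moreover have "K * norm v \<le> (norm v)\<^sup>2 / (4 * \<mu>) + \<mu> * K\<^sup>2"
  proof -
    have "0 \<le> (norm v - 2 * \<mu> * K)\<^sup>2 / (4 * \<mu>)" using \<mu>_pos by simp
    also have "\<dots> = (norm v)\<^sup>2 / (4 * \<mu>) + \<mu> * K\<^sup>2 - K * norm v" using \<mu>_pos by (simp add: field_simps power2_eq_square)
    finally show ?thesis by simp
  qed
  moreover have "(norm v)\<^sup>2 / (2 * \<mu>) = (norm v)\<^sup>2 / (4 * \<mu>) + (norm v)\<^sup>2 / (4 * \<mu>)" by (simp add: field_simps)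
  ultimately show ?thesis by linarith
qed

text \<open>Convexity at w bounds the slope of L in the direction of its own gradient by a
  difference of values, which the two quadratic bounds at velocity 0 control. A test vector of
  length 1 + |w| balances the quadratic term against the linear ones.\<close>

lemma DvL_bound: "x \<in> U \<Longrightarrow> norm (DvL x w) \<le> (K + 2 * \<mu>) * (1 + norm w)"
proof -
  assume x: "x \<in> U"
  define D where "D = DvL x w"
  define t where "t = 1 + norm w"
  have t: "t > 0" "norm w \<le> t" by (auto simp: t_def add_pos_nonneg)
  show ?thesis
  proof (cases "D = 0")
    case True then show ?thesis using K_nonneg \<mu>_pos by (simp add: D_def)
  next
    case False
    define \<xi> where "\<xi> = (t / norm D) *\<^sub>R D"
    have n\<xi>: "norm \<xi> = t" using False t by (simp add: \<xi>_def)
    have D\<xi>: "D \<bullet> \<xi> = norm D * t" using False by (simp add: \<xi>_def power2_norm_eq_inner[symmetric] power2_eq_square)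
    have "L x w + D \<bullet> \<xi> \<le> L x (w + \<xi>)"
    proof -
      have "L x w + D \<bullet> \<xi> + (norm \<xi>)\<^sup>2 / (2 * \<mu>) \<le> L x (w + \<xi>)" using L_lower[OF x, of w "w + \<xi>"] by (simp add: D_def)
      moreover have "0 \<le> (norm \<xi>)\<^sup>2 / (2 * \<mu>)" using \<mu>_pos by simp
      ultimately show ?thesis by linarith
    qed
    moreover have "L x (w + \<xi>) \<le> L x 0 + DvL x 0 \<bullet> (w + \<xi>) + \<mu> / 2 * (norm (w + \<xi>))\<^sup>2"
      using L_upper[OF x, of "w + \<xi>" 0] by simp
    moreover have "L x 0 + DvL x 0 \<bullet> w \<le> L x w"
    proof -
      have "L x 0 + DvL x 0 \<bullet> w + (norm w)\<^sup>2 / (2 * \<mu>) \<le> L x w" using L_lower[OF x, of 0 w] by simp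
      moreover have "0 \<le> (norm w)\<^sup>2 / (2 * \<mu>)" using \<mu>_pos by simp
      ultimately show ?thesis by linarith
    qed
    ultimately have "D \<bullet> \<xi> \<le> DvL x 0 \<bullet> \<xi> + \<mu> / 2 * (norm (w + \<xi>))\<^sup>2"
      by (simp add: inner_add_right)
    moreover have "DvL x 0 \<bullet> \<xi> \<le> K * t"
    proof -
      have "DvL x 0 \<bullet> \<xi> \<le> norm (DvL x 0) * norm \<xi>" by (rule norm_cauchy_schwarz)
      also have "\<dots> \<le> K * t" using L_zero[OF x] t by (simp add: n\<xi> mult_right_mono)
      finally show ?thesis .
    qed
    moreover have "\<mu> / 2 * (norm (w + \<xi>))\<^sup>2 \<le> \<mu> / 2 * (2 * t)\<^sup>2"
      using norm_triangle_ineq[of w \<xi>] t n\<xi> \<mu>_pos by (intro mult_left_mono power_mono) auto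
    ultimately have "norm D * t \<le> (K + 2 * \<mu> * t) * t" unfolding D\<xi> by (simp add: power2_eq_square algebra_simps)
    then have "norm D \<le> K + 2 * \<mu> * t" using t by simp
    also have "\<dots> \<le> (K + 2 * \<mu>) * t"
    proof -
      have "K * 1 \<le> K * t" using K_nonneg by (intro mult_left_mono) (auto simp: t_def)
      then show ?thesis by (simp add: algebra_simps)
    qed
    finally show ?thesis by (simp add: D_def t_def)
  qed
qed

lemma ell_coercive:
  obtains B where "0 \<le> B" "\<And>\<gamma> s. \<lbrakk>\<gamma> \<in> paths T \<Omega>; s \<in> {0..T}\<rbrakk> \<Longrightarrow> (norm (vel \<gamma> s))\<^sup>2 / (4 * \<mu>) - B \<le> ell \<gamma> s"
proof -
  obtain Bf where Bf: "0 \<le> Bf" "\<And>s x. \<lbrakk>s \<in> {0..T}; x \<in> closure \<Omega>\<rbrakk> \<Longrightarrow> \<bar>f s x\<bar> \<le> Bf" using f_bound by blast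
  show thesis
  proof
    show "0 \<le> K + \<mu> * K\<^sup>2 + Bf" using K_nonneg \<mu>_pos Bf by simp
    fix \<gamma> s assume "\<gamma> \<in> paths T \<Omega>" "s \<in> {0..T}"
    then have "\<gamma> s \<in> closure \<Omega>" by (rule path_in)
    then show "(norm (vel \<gamma> s))\<^sup>2 / (4 * \<mu>) - (K + \<mu> * K\<^sup>2 + Bf) \<le> ell \<gamma> s"
      using L_coercive[of "\<gamma> s" "vel \<gamma> s"] Bf(2)[OF \<open>s \<in> {0..T}\<close>, of "\<gamma> s"] U_sup
      by (auto simp: ell_def)
  qed
qed

text \<open>The dichotomy behind all later uses of the extended cost: curves of finite cost have an
  ordinary integral, and all others are irrelevant to the infimum.\<close>

lemma fin_cost_iff:
  assumes "\<gamma> \<in> paths T \<Omega>" "0 \<le> t"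
  shows "ext_lint {t..T} (\<lambda>s. L (\<gamma> s) (vector_derivative \<gamma> (at s)) + f s (\<gamma> s)) =
     (if fin_cost t T \<gamma> then ereal (integral {t..T} (ell \<gamma>)) else \<infinity>)"
proof -
  have e: "(\<lambda>s. L (\<gamma> s) (vector_derivative \<gamma> (at s)) + f s (\<gamma> s)) = ell \<gamma>" by (simp add: ell_def vel_def fun_eq_iff)
  obtain B where B: "0 \<le> B" "\<And>\<gamma> s. \<lbrakk>\<gamma> \<in> paths T \<Omega>; s \<in> {0..T}\<rbrakk> \<Longrightarrow> (norm (vel \<gamma> s))\<^sup>2 / (4 * \<mu>) - B \<le> ell \<gamma> s"
    using ell_coercive by blast
  have lb: "- B \<le> ell \<gamma> s" if "s \<in> {t..T}" for s
  proof -
    have "0 \<le> (norm (vel \<gamma> s))\<^sup>2 / (4 * \<mu>)" using \<mu>_pos by simp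
    then show ?thesis using B(2)[OF assms(1), of s] that assms(2) by simp
  qed
  show ?thesis
  proof (cases "fin_cost t T \<gamma>")
    case False
    then have "\<not> ext_lint {t..T} (ell \<gamma>) < \<infinity>"
      using ext_lint_less_infinity[OF ell_measurable[OF assms order_refl] lb] by blast
    then show ?thesis using False by (simp add: e)
  qed (simp add: e ext_lint_absolutely_integrable)
qed

lemma speed_square_integrable:
  assumes "\<gamma> \<in> paths T \<Omega>" "0 \<le> a" "b \<le> T" "fin_cost a b \<gamma>"
  shows "(\<lambda>s. (norm (vel \<gamma> s))\<^sup>2) absolutely_integrable_on {a..b}"
proof -
  obtain B where B: "0 \<le> B" "\<And>\<gamma> s. \<lbrakk>\<gamma> \<in> paths T \<Omega>; s \<in> {0..T}\<rbrakk> \<Longrightarrow> (norm (vel \<gamma> s))\<^sup>2 / (4 * \<mu>) - B \<le> ell \<gamma> s"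
    using ell_coercive by blast
  show ?thesis
  proof (rule measurable_bounded_by_integrable_imp_absolutely_integrable)
    show "(\<lambda>s. (norm (vel \<gamma> s))\<^sup>2) \<in> borel_measurable (lebesgue_on {a..b})"
      using vel_measurable[OF assms(1-3)] by simp
    have "ell \<gamma> integrable_on {a..b}" using assms(4) by (rule set_lebesgue_integral_eq_integral(1))
    then show "(\<lambda>s. 4 * \<mu> * (ell \<gamma> s + B)) integrable_on {a..b}"
      by (intro integrable_on_mult_right integrable_add) auto
    fix s assume "s \<in> {a..b}"
    then have "(norm (vel \<gamma> s))\<^sup>2 / (4 * \<mu>) \<le> ell \<gamma> s + B" using B(2)[OF assms(1), of s] assms by simp
    then show "norm ((norm (vel \<gamma> s))\<^sup>2) \<le> 4 * \<mu> * (ell \<gamma> s + B)"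
      using \<mu>_pos by (simp add: divide_le_eq mult.commute)
  qed auto
qed

section \<open>Dynamic programming\<close>

lemma near_optimal:
  assumes "t \<in> {0..T}" "x \<in> closure \<Omega>" "0 < \<epsilon>"
  obtains \<gamma> where "\<gamma> \<in> paths T \<Omega>" "\<gamma> t = x" "fin_cost t T \<gamma>" "integral {t..T} (ell \<gamma>) + g (\<gamma> T) \<le> u t x + \<epsilon>"
proof -
  have "(INF \<gamma>\<in>{\<gamma>\<in>paths T \<Omega>. \<gamma> t = x}.
        ext_lint {t..T} (\<lambda>s. L (\<gamma> s) (vector_derivative \<gamma> (at s)) + f s (\<gamma> s)) + ereal (g (\<gamma> T))) < ereal (u t x + \<epsilon>)"
    using assms(3) by (simp flip: val[OF assms(1,2)])
  then obtain \<gamma> where \<gamma>: "\<gamma> \<in> paths T \<Omega>" "\<gamma> t = x" and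
    c: "ext_lint {t..T} (\<lambda>s. L (\<gamma> s) (vector_derivative \<gamma> (at s)) + f s (\<gamma> s)) + ereal (g (\<gamma> T)) < ereal (u t x + \<epsilon>)"
    unfolding INF_less_iff by blast
  show thesis
    using c fin_cost_iff[OF \<gamma>(1), of t] assms(1) that[OF \<gamma>] by (cases "fin_cost t T \<gamma>") auto
qed

lemma value_le_cost:
  assumes "\<gamma> \<in> paths T \<Omega>" "t \<in> {0..T}" "fin_cost t T \<gamma>"
  shows "u t (\<gamma> t) \<le> integral {t..T} (ell \<gamma>) + g (\<gamma> T)"
proof -
  have "ereal (u t (\<gamma> t)) \<le> ext_lint {t..T} (\<lambda>s. L (\<gamma> s) (vector_derivative \<gamma> (at s)) + f s (\<gamma> s)) + ereal (g (\<gamma> T))"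
    unfolding val[OF assms(2) path_in[OF assms(1,2)]] by (rule INF_lower) (use assms in auto)
  also have "\<dots> = ereal (integral {t..T} (ell \<gamma>) + g (\<gamma> T))" using fin_cost_iff[OF assms(1), of t] assms by simp
  finally show ?thesis by simp
qed

lemma fin_cost_sub: "fin_cost s e \<gamma> \<Longrightarrow> s \<le> s' \<Longrightarrow> e' \<le> e \<Longrightarrow> fin_cost s' e' \<gamma>"
  by (rule absolutely_integrable_on_subinterval) auto

lemma ell_integrable: "fin_cost s e \<gamma> \<Longrightarrow> ell \<gamma> integrable_on {s..e}"
  by (rule set_lebesgue_integral_eq_integral(1))

text \<open>From the end point of an arbitrary piece c one continues along an \<epsilon>-optimal
  curve; attainment of the infimum is not known here. The velocity of the joined curve agrees with
  that of its two pieces except perhaps at the single time e.\<close>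

lemma dpp_le:
  assumes c: "c \<in> paths T \<Omega>" and se: "0 \<le> s" "s \<le> e" "e \<le> T" and fin: "fin_cost s e c"
  shows "u s (c s) \<le> integral {s..e} (ell c) + u e (c e)"
proof (rule field_le_epsilon)
  fix \<epsilon> :: real assume "0 < \<epsilon>"
  have e: "e \<in> {0..T}" using se by simp
  obtain \<gamma> where \<gamma>: "\<gamma> \<in> paths T \<Omega>" "\<gamma> e = c e" "fin_cost e T \<gamma>" "integral {e..T} (ell \<gamma>) + g (\<gamma> T) \<le> u e (c e) + \<epsilon>"
    using near_optimal[OF e path_in[OF c e] \<open>0 < \<epsilon>\<close>] by blast
  define j where "j r = (if r \<le> e then c r else \<gamma> r)" for r
  have j: "j \<in> paths T \<Omega>" unfolding j_def by (rule paths_join[OF c \<gamma>(1) \<gamma>(2)[symmetric] e])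
  have e1: "ell j r = ell c r" if "r < e" for r
  proof -
    have "vel j r = vel c r" unfolding vel_def
      by (rule vector_derivative_cong_open[of "{..<e}"]) (use that in \<open>auto simp: j_def\<close>)
    then show ?thesis using that by (simp add: ell_def j_def)
  qed
  have e2: "ell j r = ell \<gamma> r" if "r > e" for r
  proof -
    have "vel j r = vel \<gamma> r" unfolding vel_def
      by (rule vector_derivative_cong_open[of "{e<..}"]) (use that in \<open>auto simp: j_def\<close>)
    then show ?thesis using that by (simp add: ell_def j_def)
  qed
  have i1: "(ell j has_integral integral {s..e} (ell c)) {s..e}"
    by (rule has_integral_spike[of "{e}" _ _ "ell c"]) (use e1 ell_integrable[OF fin] in \<open>auto simp: has_integral_integral\<close>)
  have i2: "(ell j has_integral integral {e..T} (ell \<gamma>)) {e..T}"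
    by (rule has_integral_spike[of "{e}" _ _ "ell \<gamma>"]) (use e2 ell_integrable[OF \<gamma>(3)] in \<open>auto simp: has_integral_integral\<close>)
  have i: "(ell j has_integral integral {s..e} (ell c) + integral {e..T} (ell \<gamma>)) {s..T}"
    by (rule has_integral_combine[OF se(2,3) i1 i2])
  have a1: "ell j absolutely_integrable_on {s..e}"
    by (rule absolutely_integrable_spike[OF fin, of "{e}"]) (use e1 in auto)
  have a2: "ell j absolutely_integrable_on {e..T}"
    by (rule absolutely_integrable_spike[OF \<gamma>(3), of "{e}"]) (use e2 in auto)
  have "fin_cost s T j"
    using set_integrable_Un[OF a1 a2] se by (simp add: ivl_disj_un_two_touch)
  from value_le_cost[OF j _ this] se have "u s (j s) \<le> integral {s..T} (ell j) + g (j T)" by simp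
  moreover have "j s = c s" using se by (simp add: j_def)
  moreover have "j T = \<gamma> T" using se \<gamma>(2) by (auto simp: j_def)
  ultimately show "u s (c s) \<le> integral {s..e} (ell c) + u e (c e) + \<epsilon>"
    using \<gamma>(4) integral_unique[OF i] by simp
qed

text \<open>The rest of \<gamma> after time e competes in the problem that starts at
  \<open>(e, \<gamma> e)\<close>; no optimality of \<gamma> enters.\<close>

lemma dpp_ge:
  assumes \<gamma>: "\<gamma> \<in> paths T \<Omega>" and se: "0 \<le> s" "s \<le> e" "e \<le> T" and fin: "fin_cost s T \<gamma>"
  shows "integral {s..e} (ell \<gamma>) + u e (\<gamma> e) \<le> integral {s..T} (ell \<gamma>) + g (\<gamma> T)"
proof -
  have "integral {s..e} (ell \<gamma>) + integral {e..T} (ell \<gamma>) = integral {s..T} (ell \<gamma>)"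
    by (rule Henstock_Kurzweil_Integration.integral_combine[OF se(2,3) ell_integrable[OF fin]])
  moreover have "u e (\<gamma> e) \<le> integral {e..T} (ell \<gamma>) + g (\<gamma> T)"
    by (rule value_le_cost[OF \<gamma>]) (use se fin_cost_sub[OF fin se(2)] in auto)
  ultimately show ?thesis by linarith
qed

text \<open>Explicit competitors are given on [s, e] alone. Resting at the end positions outside
  that interval turns them into Lipschitz curves on all of [0, T], whose velocity differs from c' on
  (s, e) nowhere.\<close>

lemma value_le_smooth:
  assumes se: "0 \<le> s" "s < e" "e \<le> T"
    and der: "\<And>r. r \<in> {s..e} \<Longrightarrow> (c has_vector_derivative c' r) (at r)" and cont: "continuous_on {s..e} c'"
    and "in": "\<And>r. r \<in> {s..e} \<Longrightarrow> c r \<in> closure \<Omega>"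
  shows "u s (c s) \<le> integral {s..e} (\<lambda>r. L (c r) (c' r) + f r (c r)) + u e (c e)"
    and "(\<lambda>r. L (c r) (c' r) + f r (c r)) integrable_on {s..e}"
proof -
  define k where "k r = c (min e (max s r))" for r
  have cc: "continuous_on {s..e} c"
    using der has_vector_derivative_continuous continuous_at_imp_continuous_on by blast
  obtain C where "C > 0" and C: "\<And>r. r \<in> {s..e} \<Longrightarrow> norm (c' r) \<le> C"
  proof -
    have "bounded (c' ` {s..e})" by (intro compact_imp_bounded compact_continuous_image cont) auto
    then show thesis using that unfolding bounded_pos by blast
  qed
  have lip: "norm (c x - c y) \<le> C * norm (x - y)" if "x \<in> {s..e}" "y \<in> {s..e}" for x y
  proof (rule differentiable_bound[of "{s..e}" c "\<lambda>r h. h *\<^sub>R c' r"])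
    fix r assume r: "r \<in> {s..e}"
    show "(c has_derivative (\<lambda>h. h *\<^sub>R c' r)) (at r within {s..e})"
      using der[OF r] unfolding has_vector_derivative_def by (rule has_derivative_at_withinI)
    show "onorm (\<lambda>h. h *\<^sub>R c' r) \<le> C"
    proof (rule onorm_le)
      fix h :: real
      have "\<bar>h\<bar> * norm (c' r) \<le> \<bar>h\<bar> * C" by (rule mult_left_mono[OF C[OF r]]) simp
      then show "norm (h *\<^sub>R c' r) \<le> C * norm h" by (simp add: mult.commute)
    qed
  qed (use that in auto)
  have k: "k \<in> paths T \<Omega>"
    unfolding paths_def
  proof (intro CollectI conjI allI ballI)
    show "k r = k (min T (max 0 r))" for r
    proof -
      have "min e (max s r) = min e (max s (min T (max 0 r)))" using se by (auto simp: min_def max_def)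
      then show ?thesis unfolding k_def by (rule arg_cong)
    qed
    show "abs_cont_on 0 T k"
    proof (rule abs_cont_on_lipschitz[OF _ \<open>C > 0\<close>])
      fix x y assume "x \<in> {0..T}" "y \<in> {0..T}"
      have "norm (k x - k y) \<le> C * norm (min e (max s x) - min e (max s y))"
        unfolding k_def by (rule lip) (use se in auto)
      also have "\<dots> \<le> C * \<bar>x - y\<bar>" using \<open>C > 0\<close> by (intro mult_left_mono) (auto simp: min_def max_def)
      finally show "norm (k x - k y) \<le> C * \<bar>x - y\<bar>" .
    qed
    show "k r \<in> closure \<Omega>" if "r \<in> {0..T}" for r using "in" se by (auto simp: k_def)
  qed
  have ek: "ell k r = L (c r) (c' r) + f r (c r)" if "r \<in> {s..e} - {s, e}" for r
  proof -
    have "vel k r = vector_derivative c (at r)" unfolding vel_def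
      by (rule vector_derivative_cong_open[of "{s<..<e}"]) (use that in \<open>auto simp: k_def\<close>)
    also have "\<dots> = c' r" using der[of r] that by (simp add: vector_derivative_at)
    finally show ?thesis using that by (simp add: ell_def k_def)
  qed
  have "continuous_on {s..e} (\<lambda>r. (\<lambda>(x,v). L x v) (c r, c' r))"
    by (rule continuous_on_compose2[OF L_cont]) (use "in" U_sup in \<open>auto intro!: continuous_intros cc cont\<close>)
  moreover have "continuous_on {s..e} (\<lambda>r. (\<lambda>(s,x). f s x) (r, c r))"
    by (rule continuous_on_compose2[OF f_cont]) (use "in" se in \<open>auto intro!: continuous_intros cc\<close>)
  ultimately have con: "continuous_on {s..e} (\<lambda>r. L (c r) (c' r) + f r (c r))" by (auto intro: continuous_on_add)
  then show int: "(\<lambda>r. L (c r) (c' r) + f r (c r)) integrable_on {s..e}" by (rule integrable_continuous_real)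
  have "(\<lambda>r. L (c r) (c' r) + f r (c r)) absolutely_integrable_on {s..e}"
    by (rule absolutely_integrable_continuous_real[OF con])
  then have "fin_cost s e k"
    by (rule absolutely_integrable_spike[of _ _ "{s,e}"]) (use ek in auto)
  from dpp_le[OF k _ _ _ this] se have "u s (k s) \<le> integral {s..e} (ell k) + u e (k e)" by simp
  moreover have "integral {s..e} (ell k) = integral {s..e} (\<lambda>r. L (c r) (c' r) + f r (c r))"
    by (rule integral_spike[of "{s,e}"]) (use ek in auto)
  ultimately show "u s (c s) \<le> integral {s..e} (\<lambda>r. L (c r) (c' r) + f r (c r)) + u e (c e)"
    using se by (simp add: k_def)
qed

lemma value_terminal:
  assumes "x \<in> closure \<Omega>" shows "u T x = g x"
proof -
  have T: "T \<in> {0..T}" using T_pos by simp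
  have fin: "fin_cost T T \<gamma>" for \<gamma>
    using absolutely_integrable_on_null[of T T "ell \<gamma>"] by simp
  have "(\<lambda>_. x) \<in> paths T \<Omega>" using assms unfolding paths_def
    by (auto intro!: abs_cont_on_lipschitz[of _ _ _ 1])
  from value_le_cost[OF this T fin] have "u T x \<le> g x" by simp
  moreover have "g x \<le> u T x"
  proof (rule field_le_epsilon)
    fix \<epsilon> :: real assume "0 < \<epsilon>"
    then obtain \<gamma> where "\<gamma> T = x" "integral {T..T} (ell \<gamma>) + g (\<gamma> T) \<le> u T x + \<epsilon>"
      using near_optimal[OF T assms] by metis
    then show "g x \<le> u T x + \<epsilon>" by simp
  qed
  ultimately show ?thesis by simp
qed

section \<open>Uniform energy bounds and optimality\<close>

lemma value_bounded_above: obtains B where "\<And>t x. \<lbrakk>t \<in> {0..T}; x \<in> closure \<Omega>\<rbrakk> \<Longrightarrow> u t x \<le> B"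
proof -
  obtain Bf where Bf: "0 \<le> Bf" "\<And>s x. \<lbrakk>s \<in> {0..T}; x \<in> closure \<Omega>\<rbrakk> \<Longrightarrow> \<bar>f s x\<bar> \<le> Bf" using f_bound by blast
  obtain Bg where Bg: "\<And>x. x \<in> closure \<Omega> \<Longrightarrow> \<bar>g x\<bar> \<le> Bg" using g_bdd by (auto simp: bounded_iff)
  show thesis
  proof (rule that[of "(K + Bf) * T + Bg"])
    fix t x assume t: "t \<in> {0..T}" and x: "x \<in> closure \<Omega>"
    show "u t x \<le> (K + Bf) * T + Bg"
    proof (cases "t = T")
      case True
      have "0 \<le> (K + Bf) * T" using T_pos K_nonneg Bf by simp
      then show ?thesis using value_terminal[OF x] Bg[OF x] True by simp
    next
      case False
      then have tT: "0 \<le> t" "t < T" using t by auto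
      note sm = value_le_smooth[of t T "\<lambda>_. x" "\<lambda>_. 0"]
      have "u t x \<le> integral {t..T} (\<lambda>r. L x 0 + f r x) + u T x" by (rule sm(1)) (use tT x in auto)
      moreover have "integral {t..T} (\<lambda>r. L x 0 + f r x) \<le> integral {t..T} (\<lambda>r. K + Bf)"
      proof (rule integral_le)
        show "(\<lambda>r. L x 0 + f r x) integrable_on {t..T}" by (rule sm(2)) (use tT x in auto)
        fix r assume "r \<in> {t..T}"
        then show "L x 0 + f r x \<le> K + Bf" using Bf(2)[of r x] x L_zero[of x] U_sup tT by force
      qed (rule integrable_const_ivl)
      moreover have "integral {t..T} (\<lambda>r. K + Bf) \<le> (K + Bf) * T"
      proof -
        have "(T - t) * (K + Bf) \<le> T * (K + Bf)" using tT K_nonneg Bf(1) by (intro mult_right_mono) auto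
        then show ?thesis using tT by (simp add: mult.commute)
      qed
      ultimately show ?thesis using value_terminal[OF x] Bg[OF x] by linarith
    qed
  qed
qed

lemma energy_bound:
  obtains E where "0 < E" "\<And>t s e \<gamma>. \<lbrakk>0 \<le> t; t \<le> s; s \<le> e; e \<le> T; \<gamma> \<in> paths T \<Omega>; fin_cost t T \<gamma>;
      integral {t..T} (ell \<gamma>) + g (\<gamma> T) \<le> u t (\<gamma> t) + 1\<rbrakk>
     \<Longrightarrow> integral {s..e} (\<lambda>r. (norm (vel \<gamma> r))\<^sup>2) \<le> E"
proof -
  obtain B where B: "0 \<le> B" "\<And>\<gamma> s. \<lbrakk>\<gamma> \<in> paths T \<Omega>; s \<in> {0..T}\<rbrakk> \<Longrightarrow> (norm (vel \<gamma> s))\<^sup>2 / (4 * \<mu>) - B \<le> ell \<gamma> s"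
    using ell_coercive by blast
  obtain Bu where Bu: "\<And>t x. \<lbrakk>t \<in> {0..T}; x \<in> closure \<Omega>\<rbrakk> \<Longrightarrow> u t x \<le> Bu" using value_bounded_above by blast
  obtain Bg where Bg: "\<And>x. x \<in> closure \<Omega> \<Longrightarrow> \<bar>g x\<bar> \<le> Bg" using g_bdd by (auto simp: bounded_iff)
  define E where "E = max 1 (4 * \<mu> * (Bu + Bg + 1 + B * T))"
  show thesis
  proof
    show "0 < E" by (simp add: E_def)
    fix t s e \<gamma> assume ts: "0 \<le> t" "t \<le> s" "s \<le> e" "e \<le> T" and \<gamma>: "\<gamma> \<in> paths T \<Omega>" and fin: "fin_cost t T \<gamma>"
      and c: "integral {t..T} (ell \<gamma>) + g (\<gamma> T) \<le> u t (\<gamma> t) + 1"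
    have sq: "(\<lambda>r. (norm (vel \<gamma> r))\<^sup>2) integrable_on {t..T}"
      by (rule set_lebesgue_integral_eq_integral(1)[OF speed_square_integrable[OF \<gamma> ts(1) order_refl fin]])
    have "integral {s..e} (\<lambda>r. (norm (vel \<gamma> r))\<^sup>2) \<le> integral {t..T} (\<lambda>r. (norm (vel \<gamma> r))\<^sup>2)"
      by (rule integral_subset_le[OF _ integrable_subinterval_real[OF sq] sq]) (use ts in auto)
    also have "\<dots> \<le> integral {t..T} (\<lambda>r. 4 * \<mu> * (ell \<gamma> r + B))"
    proof (rule integral_le[OF sq])
      show "(\<lambda>r. 4 * \<mu> * (ell \<gamma> r + B)) integrable_on {t..T}"
        using ell_integrable[OF fin] by (intro integrable_on_mult_right integrable_add) auto
      fix r assume "r \<in> {t..T}"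
      then have "(norm (vel \<gamma> r))\<^sup>2 / (4 * \<mu>) \<le> ell \<gamma> r + B" using B(2)[OF \<gamma>, of r] ts by simp
      then show "(norm (vel \<gamma> r))\<^sup>2 \<le> 4 * \<mu> * (ell \<gamma> r + B)"
        using \<mu>_pos by (simp add: divide_le_eq mult.commute)
    qed
    also have "\<dots> = 4 * \<mu> * (integral {t..T} (ell \<gamma>) + B * (T - t))"
    proof -
      have "integral {t..T} (\<lambda>r. ell \<gamma> r + B) = integral {t..T} (ell \<gamma>) + integral {t..T} (\<lambda>r. B)"
        by (rule Henstock_Kurzweil_Integration.integral_add[OF ell_integrable[OF fin] integrable_const_ivl])
      then show ?thesis using ts by (simp add: mult.commute)
    qed
    also have "\<dots> \<le> 4 * \<mu> * (Bu + Bg + 1 + B * T)"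
    proof (rule mult_left_mono)
      have "u t (\<gamma> t) \<le> Bu" "\<bar>g (\<gamma> T)\<bar> \<le> Bg" using Bu Bg path_in[OF \<gamma>] ts by auto
      moreover have "B * (T - t) \<le> B * T" using B(1) ts by (intro mult_left_mono) auto
      ultimately show "integral {t..T} (ell \<gamma>) + B * (T - t) \<le> Bu + Bg + 1 + B * T" using c by linarith
    qed (use \<mu>_pos in simp)
    finally show "integral {s..e} (\<lambda>r. (norm (vel \<gamma> r))\<^sup>2) \<le> E" by (simp add: E_def)
  qed
qed

text \<open>Minimality is imposed at time 0, as in the definition of an equilibrium;
  \<open>optimal_dpp\<close> carries it to later times. The reverse inequality holds for every curve
  of finite cost.\<close>

definition optimal :: "(real \<Rightarrow> 'a) \<Rightarrow> bool"
  where "optimal \<gamma> \<longleftrightarrow> \<gamma> \<in> paths T \<Omega> \<and> fin_cost 0 T \<gamma> \<and> integral {0..T} (ell \<gamma>) + g (\<gamma> T) \<le> u 0 (\<gamma> 0)"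

text \<open>The one-sided inequalities for [0, s], [s, e] and [e, T] add up to the equality for the
  whole curve, so none of them can be strict.\<close>

lemma optimal_dpp:
  assumes "optimal \<gamma>" and se: "0 \<le> s" "s \<le> e" "e \<le> T"
  shows "u s (\<gamma> s) = integral {s..e} (ell \<gamma>) + u e (\<gamma> e)"
proof -
  have \<gamma>: "\<gamma> \<in> paths T \<Omega>" and fin: "fin_cost 0 T \<gamma>" and c: "integral {0..T} (ell \<gamma>) + g (\<gamma> T) \<le> u 0 (\<gamma> 0)"
    using assms(1) by (auto simp: optimal_def)
  have "u s (\<gamma> s) \<le> integral {s..e} (ell \<gamma>) + u e (\<gamma> e)"
    by (rule dpp_le[OF \<gamma> se fin_cost_sub[OF fin]]) (use se in auto)
  moreover have "u 0 (\<gamma> 0) \<le> integral {0..s} (ell \<gamma>) + u s (\<gamma> s)"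
    by (rule dpp_le[OF \<gamma> _ _ _ fin_cost_sub[OF fin]]) (use se in auto)
  moreover have "integral {0..e} (ell \<gamma>) + u e (\<gamma> e) \<le> integral {0..T} (ell \<gamma>) + g (\<gamma> T)"
    by (rule dpp_ge[OF \<gamma> _ _ _ fin]) (use se in auto)
  moreover have "integral {0..s} (ell \<gamma>) + integral {s..e} (ell \<gamma>) = integral {0..e} (ell \<gamma>)"
    by (rule Henstock_Kurzweil_Integration.integral_combine)
      (use se ell_integrable[OF fin_cost_sub[OF fin]] in auto)
  ultimately show ?thesis using c by linarith
qed

section \<open>Variance of the velocity and comparison with segments\<close>

text \<open>Pythagoras in L^2: w is the mean velocity, hence anything linear in the deviation from w
  integrates to zero.\<close>

lemma speed_variance:
  assumes \<gamma>: "\<gamma> \<in> paths T \<Omega>" and se: "0 \<le> s" "s < e" "e \<le> T" and fin: "fin_cost s e \<gamma>"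
    and w: "w = (\<gamma> e - \<gamma> s) /\<^sub>R (e - s)"
  shows "(\<lambda>r. (norm (vel \<gamma> r - z))\<^sup>2) integrable_on {s..e}"
    and "integral {s..e} (\<lambda>r. (norm (vel \<gamma> r))\<^sup>2) = (e - s) * (norm w)\<^sup>2 + integral {s..e} (\<lambda>r. (norm (vel \<gamma> r - w))\<^sup>2)"
    and "((\<lambda>r. a \<bullet> (vel \<gamma> r - w)) has_integral 0) {s..e}"
proof -
  have v: "(vel \<gamma> has_integral (\<gamma> e - \<gamma> s)) {s..e}" by (rule vel_has_integral[OF \<gamma>]) (use se in auto)
  have in': "((\<lambda>r. a \<bullet> vel \<gamma> r) has_integral a \<bullet> (\<gamma> e - \<gamma> s)) {s..e}" for a
    using has_integral_linear[OF v bounded_linear_inner_right[of a]] by (simp add: o_def)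
  have ew: "(e - s) *\<^sub>R w = \<gamma> e - \<gamma> s" using se by (simp add: w)
  have c: "((\<lambda>r. y) has_integral (e - s) * y) {s..e}" for y :: real
    using has_integral_const_real[of y s e] se by simp
  show 3: "((\<lambda>r. a \<bullet> (vel \<gamma> r - w)) has_integral 0) {s..e}" for a
  proof -
    have "((\<lambda>r. a \<bullet> vel \<gamma> r - a \<bullet> w) has_integral a \<bullet> (\<gamma> e - \<gamma> s) - (e - s) * (a \<bullet> w)) {s..e}"
      by (rule has_integral_diff[OF in' c])
    then show ?thesis by (simp add: inner_diff_right flip: ew)
  qed
  have sq: "(\<lambda>r. (norm (vel \<gamma> r))\<^sup>2) integrable_on {s..e}"
    by (rule set_lebesgue_integral_eq_integral(1)[OF speed_square_integrable[OF \<gamma> se(1,3) fin]])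
  show 1: "(\<lambda>r. (norm (vel \<gamma> r - z))\<^sup>2) integrable_on {s..e}" for z
  proof -
    have "(\<lambda>r. (norm (vel \<gamma> r))\<^sup>2 - 2 * (z \<bullet> vel \<gamma> r) + (norm z)\<^sup>2) integrable_on {s..e}"
      using sq in'[of z] by (intro integrable_add integrable_diff integrable_on_mult_right) auto
    moreover have "(norm (vel \<gamma> r))\<^sup>2 - 2 * (z \<bullet> vel \<gamma> r) + (norm z)\<^sup>2 = (norm (vel \<gamma> r - z))\<^sup>2" for r
      by (simp add: power2_norm_eq_inner inner_diff_left inner_diff_right inner_commute)
    ultimately show ?thesis by simp
  qed
  have "((\<lambda>r. (norm w)\<^sup>2 + 2 * (w \<bullet> (vel \<gamma> r - w)) + (norm (vel \<gamma> r - w))\<^sup>2) has_integral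
      (e - s) * (norm w)\<^sup>2 + 2 * 0 + integral {s..e} (\<lambda>r. (norm (vel \<gamma> r - w))\<^sup>2)) {s..e}"
    by (intro has_integral_add has_integral_mult_right 3 c integrable_integral 1)
  moreover have "(norm w)\<^sup>2 + 2 * (w \<bullet> (vel \<gamma> r - w)) + (norm (vel \<gamma> r - w))\<^sup>2 = (norm (vel \<gamma> r))\<^sup>2" for r
    by (simp add: power2_norm_eq_inner inner_diff_left inner_diff_right inner_commute)
  ultimately show "integral {s..e} (\<lambda>r. (norm (vel \<gamma> r))\<^sup>2) = (e - s) * (norm w)\<^sup>2 + integral {s..e} (\<lambda>r. (norm (vel \<gamma> r - w))\<^sup>2)"
    by (simp add: integral_unique)
qed

lemma displacement_square:
  assumes \<gamma>: "\<gamma> \<in> paths T \<Omega>" and se: "0 \<le> s" "s \<le> e" "e \<le> T" and fin: "fin_cost s e \<gamma>"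
  shows "(norm (\<gamma> e - \<gamma> s))\<^sup>2 \<le> (e - s) * integral {s..e} (\<lambda>r. (norm (vel \<gamma> r))\<^sup>2)"
proof (cases "s = e")
  case False
  then have "s < e" using se by simp
  define w where "w = (\<gamma> e - \<gamma> s) /\<^sub>R (e - s)"
  have ew: "\<gamma> e - \<gamma> s = (e - s) *\<^sub>R w" using \<open>s < e\<close> by (simp add: w_def)
  have "0 \<le> integral {s..e} (\<lambda>r. (norm (vel \<gamma> r - w))\<^sup>2)"
    by (rule integral_nonneg[OF speed_variance(1)[OF \<gamma> se(1) \<open>s < e\<close> se(3) fin w_def]]) auto
  then have "(e - s) * (norm w)\<^sup>2 \<le> integral {s..e} (\<lambda>r. (norm (vel \<gamma> r))\<^sup>2)"
    using speed_variance(2)[OF \<gamma> se(1) \<open>s < e\<close> se(3) fin w_def] by simp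
  then have "(e - s) * ((e - s) * (norm w)\<^sup>2) \<le> (e - s) * integral {s..e} (\<lambda>r. (norm (vel \<gamma> r))\<^sup>2)"
    using se by (intro mult_left_mono) auto
  moreover have "(norm ((e - s) *\<^sub>R w))\<^sup>2 = (e - s) * ((e - s) * (norm w)\<^sup>2)"
    by (simp add: power_mult_distrib power2_eq_square[of "e - s"])
  ultimately show ?thesis unfolding ew by simp
qed simp

lemma f_path_integrable:
  assumes "x \<in> closure \<Omega>" "0 \<le> s" "e \<le> T"
  shows "continuous_on {s..e} (\<lambda>r. f r x)" "(\<lambda>r. f r x) integrable_on {s..e}"
proof -
  have "continuous_on {s..e} (\<lambda>r. (\<lambda>(s,x). f s x) (r, x))"
    by (rule continuous_on_compose2[OF f_cont]) (use assms in \<open>auto intro!: continuous_intros\<close>)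
  then show "continuous_on {s..e} (\<lambda>r. f r x)" by simp
  then show "(\<lambda>r. f r x) integrable_on {s..e}" by (rule integrable_continuous_real)
qed

text \<open>With the position frozen at x, the strong convexity of L at the mean velocity w bounds
  the cost below by that of constant speed plus a multiple of the variance. Freezing costs K\<rho>(1
  + |vel|^2); expanded around w this gives a constant, a linear term of mean zero, and K\<rho> times
  the variance, which weakens the coefficient 1/(2\<mu>).\<close>

lemma cost_lower:
  assumes \<gamma>: "\<gamma> \<in> paths T \<Omega>" and se: "0 \<le> s" "s < e" "e \<le> T" and fin: "fin_cost s e \<gamma>"
    and x: "x \<in> closure \<Omega>" and ball: "cball x \<rho> \<subseteq> U" and near: "\<And>r. r \<in> {s..e} \<Longrightarrow> norm (\<gamma> r - x) \<le> \<rho>"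
    and w: "w = (\<gamma> e - \<gamma> s) /\<^sub>R (e - s)"
  shows "integral {s..e} (\<lambda>r. f r x) + (e - s) * (L x w - 2 * K * \<rho> * (1 + (norm w)\<^sup>2))
      + (1 / (2 * \<mu>) - K * \<rho>) * integral {s..e} (\<lambda>r. (norm (vel \<gamma> r - w))\<^sup>2) \<le> integral {s..e} (ell \<gamma>)"
proof -
  note var = speed_variance[OF \<gamma> se fin w]
  have "0 \<le> \<rho>" by (rule order_trans[OF norm_ge_zero near[of s]]) (use se in auto)
  have xU: "x \<in> U" using x U_sup by blast
  \<comment> \<open>All terms linear in the deviation: the gradient at w and the cross term of
    -K\<rho>|vel|^2. Their integral vanishes.\<close>
  define a where "a = DvL x w - (2 * K * \<rho>) *\<^sub>R w"
  define lo where "lo r = f r x + (L x w - K * \<rho> * (2 + (norm w)\<^sup>2)) + a \<bullet> (vel \<gamma> r - w)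
      + (1 / (2 * \<mu>) - K * \<rho>) * (norm (vel \<gamma> r - w))\<^sup>2" for r
  have "(lo has_integral integral {s..e} (\<lambda>r. f r x) + (e - s) * (L x w - K * \<rho> * (2 + (norm w)\<^sup>2)) + 0
      + (1 / (2 * \<mu>) - K * \<rho>) * integral {s..e} (\<lambda>r. (norm (vel \<gamma> r - w))\<^sup>2)) {s..e}"
    unfolding lo_def
    using has_integral_const_real[of "L x w - K * \<rho> * (2 + (norm w)\<^sup>2)" s e] se
    by (intro has_integral_add has_integral_mult_right var(3) integrable_integral var(1) f_path_integrable x) auto
  moreover have "lo r \<le> ell \<gamma> r" if r: "r \<in> {s..e}" for r
  proof -
    have seg: "closed_segment (\<gamma> r) x \<subseteq> U"
    proof -
      have "\<gamma> r \<in> cball x \<rho>" using near[OF r] by (simp add: dist_norm norm_minus_commute)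
      then have "closed_segment (\<gamma> r) x \<subseteq> cball x \<rho>" using \<open>0 \<le> \<rho>\<close> by (intro closed_segment_subset) auto
      then show ?thesis using ball by blast
    qed
    define d where "d = vel \<gamma> r - w"
    have vw: "vel \<gamma> r = w + d" by (simp add: d_def)
    have "\<bar>f r (\<gamma> r) - f r x\<bar> \<le> K * norm (\<gamma> r - x)" by (rule f_lip[OF _ seg]) (use r se in auto)
    moreover have "K * norm (\<gamma> r - x) \<le> K * \<rho>" using near[OF r] K_nonneg by (intro mult_left_mono)
    moreover have "\<bar>L (\<gamma> r) (w + d) - L x (w + d)\<bar> \<le> K * (1 + (norm (w + d))\<^sup>2) * norm (\<gamma> r - x)" by (rule L_lip[OF seg])
    moreover have "K * (1 + (norm (w + d))\<^sup>2) * norm (\<gamma> r - x) \<le> K * (1 + (norm (w + d))\<^sup>2) * \<rho>"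
      using near[OF r] K_nonneg by (intro mult_left_mono) auto
    moreover have "K * (1 + (norm (w + d))\<^sup>2) * \<rho> = K * \<rho> * (1 + (norm w)\<^sup>2) + 2 * K * \<rho> * (w \<bullet> d) + K * \<rho> * (norm d)\<^sup>2"
      by (simp add: power2_norm_eq_inner inner_add_left inner_add_right inner_commute algebra_simps)
    moreover have "L x w + DvL x w \<bullet> d + (norm d)\<^sup>2 / (2 * \<mu>) \<le> L x (w + d)" using L_lower[OF xU, of w "w + d"] by simp
    moreover have "lo r = f r x + L x w - K * \<rho> * (1 + (norm w)\<^sup>2) - K * \<rho> + DvL x w \<bullet> d - 2 * K * \<rho> * (w \<bullet> d)
      + (norm d)\<^sup>2 / (2 * \<mu>) - K * \<rho> * (norm d)\<^sup>2"
      by (simp add: lo_def a_def inner_diff_left algebra_simps flip: d_def)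
    ultimately show ?thesis unfolding ell_def vw by linarith
  qed
  ultimately have "integral {s..e} (\<lambda>r. f r x) + (e - s) * (L x w - K * \<rho> * (2 + (norm w)\<^sup>2)) + 0
      + (1 / (2 * \<mu>) - K * \<rho>) * integral {s..e} (\<lambda>r. (norm (vel \<gamma> r - w))\<^sup>2) \<le> integral {s..e} (ell \<gamma>)"
    using ell_integrable[OF fin] by (intro has_integral_le[OF _ integrable_integral]) auto
  moreover have "(e - s) * (L x w - 2 * K * \<rho> * (1 + (norm w)\<^sup>2)) \<le> (e - s) * (L x w - K * \<rho> * (2 + (norm w)\<^sup>2))"
  proof (rule mult_left_mono)
    have "0 \<le> K * \<rho> * (norm w)\<^sup>2" using K_nonneg \<open>0 \<le> \<rho>\<close> by simp
    then show "L x w - 2 * K * \<rho> * (1 + (norm w)\<^sup>2) \<le> L x w - K * \<rho> * (2 + (norm w)\<^sup>2)" by (simp add: algebra_simps)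
  qed (use se in simp)
  ultimately show ?thesis by linarith
qed

text \<open>The competitor is the corrected segment at nearly constant speed. Its correction of size
  |z - y|^2, run through in time e - s, has velocity of order |w| |z - y| = O(\<rho>|w|), so the
  change in L is O(\<rho>(1 + |w|^2)) like the error of freezing x. This is the counterpart of
  \<open>cost_lower\<close>.\<close>

lemma cost_upper:
  assumes x: "x \<in> closure \<Omega>"
  obtains A \<rho>0 where "0 \<le> A" "0 < \<rho>0" "cball x \<rho>0 \<subseteq> U"
    "\<And>s e y z \<rho> w. \<lbrakk>0 \<le> s; s < e; e \<le> T; y \<in> closure \<Omega>; z \<in> closure \<Omega>; \<rho> \<le> \<rho>0; norm (y - x) \<le> \<rho>; norm (z - x) \<le> \<rho>;
        w = (z - y) /\<^sub>R (e - s)\<rbrakk>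
      \<Longrightarrow> u s y \<le> u e z + integral {s..e} (\<lambda>r. f r x) + (e - s) * (L x w + A * \<rho> * (1 + (norm w)\<^sup>2))"
proof -
  obtain r n where r: "r > 0" and geo: "\<And>y z \<theta>. \<lbrakk>y \<in> closure \<Omega> \<inter> ball x r; z \<in> closure \<Omega> \<inter> ball x r; \<theta> \<in> {0..1}\<rbrakk> \<Longrightarrow>
       y + \<theta> *\<^sub>R (z - y) - (\<theta> * (1 - \<theta>) * (norm (z - y))\<^sup>2) *\<^sub>R n \<in> closure \<Omega>"
    using geometry[OF x] by blast
  have xU: "x \<in> U" using x U_sup by blast
  obtain r1 where r1: "r1 > 0" "cball x r1 \<subseteq> U" using U_open xU open_contains_cball by blast
  define N where "N = 1 + norm n"
  have N: "N \<ge> 1" "norm n \<le> N" "N > 0" by (auto simp: N_def add_pos_nonneg)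
  \<comment> \<open>r/2 keeps both end points where the correction is admissible, 1/(4N) keeps the
    velocity of the correction below |w|, and r1/N keeps the arc, which strays at most N\<rho> from
    x, in a ball inside U.\<close>
  define \<rho>0 where "\<rho>0 = min (r / 2) (min (1 / (4 * N)) (r1 / N))"
  have \<rho>0: "\<rho>0 > 0" "\<rho>0 < r" "\<rho>0 \<le> 1 / (4 * N)" "\<rho>0 \<le> r1 / N"
    using r r1 N by (auto simp: \<rho>0_def min_less_iff_disj)
  have N\<rho>0: "4 * (N * \<rho>0) \<le> 1" "N * \<rho>0 \<le> r1" using \<rho>0 N by (auto simp: field_simps)
  have "\<rho>0 \<le> N * \<rho>0" using N \<rho>0 by simp
  \<comment> \<open>In units of N\<rho>(1 + |w|^2), the estimates below contribute K from f, 4K from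
    moving x in L, 4(K + 2\<mu>) from the gradient of L and \<mu> from its quadratic
    remainder.\<close>
  define A where "A = N * (9 * K + 9 * \<mu>)"
  show thesis
  proof
    show "0 \<le> A" "0 < \<rho>0" using N K_nonneg \<mu>_pos \<rho>0 by (auto simp: A_def)
    show "cball x \<rho>0 \<subseteq> U" using r1 N\<rho>0 \<open>\<rho>0 \<le> N * \<rho>0\<close> by (meson order_trans subset_cball)
    fix s e y z \<rho> w assume se: "0 \<le> s" "s < e" "e \<le> T" and y: "y \<in> closure \<Omega>" and z: "z \<in> closure \<Omega>" and "\<rho> \<le> \<rho>0"
      and yx: "norm (y - x) \<le> \<rho>" and zx: "norm (z - x) \<le> \<rho>" and w: "w = (z - y) /\<^sub>R (e - s)"
    have "0 \<le> \<rho>" using yx norm_ge_zero order_trans by blast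
    have \<rho>: "4 * (N * \<rho>) \<le> 1" "N * \<rho> \<le> r1" "\<rho> \<le> N * \<rho>"
    proof -
      have "N * \<rho> \<le> N * \<rho>0" using \<open>\<rho> \<le> \<rho>0\<close> N by simp
      then show "4 * (N * \<rho>) \<le> 1" "N * \<rho> \<le> r1" using N\<rho>0 by auto
      show "\<rho> \<le> N * \<rho>" using N \<open>0 \<le> \<rho>\<close> mult_right_mono[of 1 N \<rho>] by simp
    qed
    define D where "D = norm (z - y)"
    have D: "D \<le> 2 * \<rho>" "0 \<le> D"
      using norm_triangle_ineq4[of "z - x" "y - x"] yx zx by (auto simp: D_def)
    have Dw: "D = (e - s) * norm w" using se by (simp add: w D_def)
    define \<theta> where "\<theta> r = (r - s) / (e - s)" for r
    have \<theta>: "\<theta> r \<in> {0..1}" if "r \<in> {s..e}" for r using that se by (auto simp: \<theta>_def divide_le_eq)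
    define c where "c r = y + \<theta> r *\<^sub>R (z - y) - (\<theta> r * (1 - \<theta> r) * D\<^sup>2) *\<^sub>R n" for r
    define c' where "c' r = w - ((1 - 2 * \<theta> r) * (norm w * D)) *\<^sub>R n" for r
    have der: "(c has_vector_derivative c' r) (at r)" for r
    proof -
      have e1: "c = (\<lambda>r. y + ((r - s) / (e - s)) *\<^sub>R (z - y) - (((r - s) / (e - s)) * (1 - (r - s) / (e - s)) * D\<^sup>2) *\<^sub>R n)"
        by (simp add: c_def \<theta>_def fun_eq_iff)
      have d1: "((\<lambda>r. (r - s) / (e - s)) has_real_derivative 1 / (e - s)) (at r)"
        using se by (auto intro!: derivative_eq_intros)
      have d2: "((\<lambda>r. ((r - s) / (e - s)) * (1 - (r - s) / (e - s)) * D\<^sup>2) has_real_derivative (1 - 2 * \<theta> r) * (D\<^sup>2 / (e - s))) (at r)"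
        using DERIV_cmult_right[OF DERIV_mult[OF d1 DERIV_diff[OF DERIV_const[of 1] d1]], of "D\<^sup>2"]
        by (rule DERIV_cong) (simp add: \<theta>_def algebra_simps add_divide_distrib diff_divide_distrib)
      have "(c has_vector_derivative 0 + (1 / (e - s)) *\<^sub>R (z - y) - ((1 - 2 * \<theta> r) * (D\<^sup>2 / (e - s))) *\<^sub>R n) (at r)"
        unfolding e1
        by (intro has_vector_derivative_diff has_vector_derivative_add has_vector_derivative_const)
           (use has_vector_derivative_scaleR[OF d1 has_vector_derivative_const, of "z - y"]
             has_vector_derivative_scaleR[OF d2 has_vector_derivative_const, of n] in simp_all)
      moreover have "D\<^sup>2 / (e - s) = norm w * D" using se by (simp add: Dw power2_eq_square)
      ultimately show ?thesis by (simp add: c'_def w divide_inverse)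
    qed
    have in_cl: "c r' \<in> closure \<Omega>" if "r' \<in> {s..e}" for r'
      unfolding c_def D_def
    proof (rule geo)
      show "y \<in> closure \<Omega> \<inter> ball x r" "z \<in> closure \<Omega> \<inter> ball x r"
        using y z yx zx \<open>\<rho> \<le> \<rho>0\<close> \<rho>0(2) by (auto simp: dist_norm norm_minus_commute)
    qed (rule \<theta>[OF that])
    have "continuous_on {s..e} c'" unfolding c'_def \<theta>_def by (intro continuous_intros) (use se in auto)
    note sm = value_le_smooth[OF se der this in_cl]
    have cs: "c s = y" "c e = z" using se by (simp_all add: c_def \<theta>_def)
    have pt: "L (c r) (c' r) + f r (c r) \<le> f r x + (L x w + A * \<rho> * (1 + (norm w)\<^sup>2))" if r: "r \<in> {s..e}" for r
    proof -
      have th: "0 \<le> \<theta> r" "\<theta> r \<le> 1" using \<theta>[OF r] by auto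
      have th2: "\<theta> r * (1 - \<theta> r) \<le> 1 / 4" "0 \<le> \<theta> r * (1 - \<theta> r)"
      proof -
        have "0 \<le> (\<theta> r - 1/2)\<^sup>2" by simp
        then show "\<theta> r * (1 - \<theta> r) \<le> 1 / 4" by (simp add: power2_eq_square algebra_simps)
      qed (use th in simp)
      have cx: "norm (c r - x) \<le> N * \<rho>"
      proof -
        have "c r - x = (1 - \<theta> r) *\<^sub>R (y - x) + \<theta> r *\<^sub>R (z - x) - (\<theta> r * (1 - \<theta> r) * D\<^sup>2) *\<^sub>R n"
          by (simp add: c_def algebra_simps)
        also have "norm \<dots> \<le> norm ((1 - \<theta> r) *\<^sub>R (y - x)) + norm (\<theta> r *\<^sub>R (z - x)) + norm ((\<theta> r * (1 - \<theta> r) * D\<^sup>2) *\<^sub>R n)"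
          by (intro order_trans[OF norm_triangle_ineq4] add_mono norm_triangle_ineq) auto
        also have "\<dots> = (1 - \<theta> r) * norm (y - x) + \<theta> r * norm (z - x) + (\<theta> r * (1 - \<theta> r)) * D\<^sup>2 * norm n"
          using th th2(2) by (simp add: abs_mult)
        also have "\<dots> \<le> (1 - \<theta> r) * \<rho> + \<theta> r * \<rho> + (1 / 4) * (2 * \<rho>)\<^sup>2 * norm n"
          using th th2 yx zx D by (intro add_mono mult_mono mult_left_mono power_mono) auto
        also have "\<dots> = \<rho> + \<rho> * (\<rho> * norm n)" by (simp add: power2_eq_square algebra_simps)
        also have "\<dots> \<le> \<rho> + \<rho> * (1 * norm n)"
          using \<open>0 \<le> \<rho>\<close> \<rho> by (intro add_left_mono mult_left_mono mult_right_mono) auto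
        finally show ?thesis by (simp add: N_def algebra_simps)
      qed
      define d where "d = c' r - w"
      have nd: "norm d \<le> 2 * (N * \<rho>) * norm w"
      proof -
        have "norm d = \<bar>1 - 2 * \<theta> r\<bar> * (norm w * D) * norm n" using D by (simp add: d_def c'_def abs_mult)
        also have "\<dots> \<le> 1 * (norm w * (2 * \<rho>)) * N"
          using th D N \<open>0 \<le> \<rho>\<close> by (intro mult_mono mult_left_mono) auto
        finally show ?thesis by (simp add: algebra_simps)
      qed
      have nd2: "norm d \<le> norm w"
      proof -
        have "2 * (N * \<rho>) * norm w \<le> 1 * norm w" using \<rho> N \<open>0 \<le> \<rho>\<close> by (intro mult_right_mono) auto
        then show ?thesis using nd by simp
      qed
      have c'w: "c' r = w + d" by (simp add: d_def)
      have nc': "(norm (c' r))\<^sup>2 \<le> 4 * (norm w)\<^sup>2"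
      proof -
        have "norm (c' r) \<le> 2 * norm w" using norm_triangle_ineq[of w d] nd2 by (simp add: c'w)
        then have "(norm (c' r))\<^sup>2 \<le> (2 * norm w)\<^sup>2" by (intro power_mono) auto
        then show ?thesis by (simp add: power2_eq_square)
      qed
      have seg: "closed_segment (c r) x \<subseteq> U"
      proof -
        have "c r \<in> cball x r1" using cx \<rho> by (simp add: dist_norm norm_minus_commute)
        then have "closed_segment (c r) x \<subseteq> cball x r1" using r1 by (intro closed_segment_subset) auto
        then show ?thesis using r1 by blast
      qed
      define W where "W = 1 + (norm w)\<^sup>2"
      have W: "W \<ge> 1" by (simp add: W_def)
      have "\<bar>f r (c r) - f r x\<bar> \<le> K * norm (c r - x)" by (rule f_lip[OF _ seg]) (use r se in auto)
      also have "\<dots> \<le> K * (N * \<rho>)" using cx K_nonneg by (intro mult_left_mono)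
      also have "\<dots> = K * (N * \<rho>) * 1" by simp
      also have "\<dots> \<le> K * (N * \<rho>) * W" using W K_nonneg N \<open>0 \<le> \<rho>\<close> by (intro mult_left_mono) auto
      finally have 1: "f r (c r) \<le> f r x + K * (N * \<rho>) * W" by linarith
      have "\<bar>L (c r) (c' r) - L x (c' r)\<bar> \<le> K * (1 + (norm (c' r))\<^sup>2) * norm (c r - x)" by (rule L_lip[OF seg])
      also have "\<dots> \<le> K * (4 * W) * (N * \<rho>)"
        using nc' cx K_nonneg by (intro mult_mono mult_left_mono) (auto simp: W_def)
      finally have 2: "L (c r) (c' r) \<le> L x (c' r) + K * (4 * W) * (N * \<rho>)" by linarith
      have 3: "L x (c' r) \<le> L x w + DvL x w \<bullet> d + \<mu> / 2 * (norm d)\<^sup>2" using L_upper[OF xU, of "c' r" w] by (simp add: d_def)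
      have 4: "DvL x w \<bullet> d \<le> (K + 2 * \<mu>) * (4 * (N * \<rho>) * W)"
      proof -
        have "DvL x w \<bullet> d \<le> norm (DvL x w) * norm d" by (rule norm_cauchy_schwarz)
        also have "\<dots> \<le> ((K + 2 * \<mu>) * (1 + norm w)) * (2 * (N * \<rho>) * norm w)"
          using DvL_bound[OF xU, of w] nd K_nonneg \<mu>_pos by (intro mult_mono) auto
        also have "\<dots> = (K + 2 * \<mu>) * (2 * (N * \<rho>) * ((1 + norm w) * norm w))" by (simp add: algebra_simps)
        also have "\<dots> \<le> (K + 2 * \<mu>) * (2 * (N * \<rho>) * (2 * W))"
        proof -
          have "0 \<le> (norm w - 1)\<^sup>2" "0 \<le> norm w * norm w" by simp_all
          moreover have "(norm w - 1)\<^sup>2 = norm w * norm w - 2 * norm w + 1" "(1 + norm w) * norm w = norm w + norm w * norm w"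
            "2 * W = 2 + 2 * (norm w * norm w)" by (simp_all add: W_def power2_eq_square algebra_simps)
          ultimately have "(1 + norm w) * norm w \<le> 2 * W" by linarith
          then show ?thesis using K_nonneg \<mu>_pos N \<open>0 \<le> \<rho>\<close> by (intro mult_left_mono) auto
        qed
        finally show ?thesis by (simp add: algebra_simps)
      qed
      have 5: "\<mu> / 2 * (norm d)\<^sup>2 \<le> \<mu> * (N * \<rho>) * W"
      proof -
        have "(norm d)\<^sup>2 \<le> (2 * (N * \<rho>) * norm w) * norm w"
          unfolding power2_eq_square using nd nd2 N \<open>0 \<le> \<rho>\<close> by (intro mult_mono) auto
        also have "\<dots> \<le> 2 * (N * \<rho>) * W"
          using N \<open>0 \<le> \<rho>\<close> by (simp add: W_def power2_eq_square algebra_simps)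
        finally show ?thesis using \<mu>_pos by (simp add: mult_left_mono)
      qed
      have "L (c r) (c' r) + f r (c r) \<le> f r x + L x w + (9 * K + 9 * \<mu>) * ((N * \<rho>) * W)"
        using 1 2 3 4 5 by (simp add: algebra_simps)
      then show ?thesis by (simp add: A_def W_def algebra_simps)
    qed
    have "integral {s..e} (\<lambda>r. L (c r) (c' r) + f r (c r)) \<le> integral {s..e} (\<lambda>r. f r x + (L x w + A * \<rho> * (1 + (norm w)\<^sup>2)))"
      by (rule integral_le[OF sm(2)]) (use pt in \<open>auto intro!: integrable_add f_path_integrable x se\<close>)
    also have "\<dots> = integral {s..e} (\<lambda>r. f r x) + (e - s) * (L x w + A * \<rho> * (1 + (norm w)\<^sup>2))"
      using se x by (subst Henstock_Kurzweil_Integration.integral_add) (auto intro!: f_path_integrable)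
    finally show "u s y \<le> u e z + integral {s..e} (\<lambda>r. f r x) + (e - s) * (L x w + A * \<rho> * (1 + (norm w)\<^sup>2))"
      using sm(1) unfolding cs by linarith
  qed
qed

subsection \<open>Optimal curves\<close>

lemma optimalD:
  assumes "optimal \<gamma>" "0 \<le> s" "e \<le> T"
  shows "\<gamma> \<in> paths T \<Omega>" "fin_cost s e \<gamma>"
  using assms fin_cost_sub[of 0 T \<gamma> s e] by (auto simp: optimal_def)

text \<open>Jensen's inequality. With [s, e] a part of a longer interval and z the mean velocity
  there, it turns a variance bound on the long interval into a bound on the change of the
  mean.\<close>

lemma average_speed:
  assumes \<gamma>: "\<gamma> \<in> paths T \<Omega>" and se: "0 \<le> s" "s < e" "e \<le> T" and fin: "fin_cost s e \<gamma>"
    and w: "w = (\<gamma> e - \<gamma> s) /\<^sub>R (e - s)"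
  shows "(e - s) * (norm (w - z))\<^sup>2 \<le> integral {s..e} (\<lambda>r. (norm (vel \<gamma> r - z))\<^sup>2)"
proof -
  note var = speed_variance[OF \<gamma> se fin w]
  have "((\<lambda>r. (norm (w - z))\<^sup>2 + 2 * ((w - z) \<bullet> (vel \<gamma> r - w)) + (norm (vel \<gamma> r - w))\<^sup>2) has_integral
      (e - s) * (norm (w - z))\<^sup>2 + 2 * 0 + integral {s..e} (\<lambda>r. (norm (vel \<gamma> r - w))\<^sup>2)) {s..e}"
    using has_integral_const_real[of "(norm (w - z))\<^sup>2" s e] se
    by (intro has_integral_add has_integral_mult_right var(3) integrable_integral var(1)) auto
  moreover have "(norm (w - z))\<^sup>2 + 2 * ((w - z) \<bullet> (vel \<gamma> r - w)) + (norm (vel \<gamma> r - w))\<^sup>2 = (norm (vel \<gamma> r - z))\<^sup>2" for r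
    by (simp add: power2_norm_eq_inner inner_diff_left inner_diff_right inner_commute)
  ultimately have "integral {s..e} (\<lambda>r. (norm (vel \<gamma> r - z))\<^sup>2) = (e - s) * (norm (w - z))\<^sup>2 + integral {s..e} (\<lambda>r. (norm (vel \<gamma> r - w))\<^sup>2)"
    by (simp add: integral_unique)
  moreover have "0 \<le> integral {s..e} (\<lambda>r. (norm (vel \<gamma> r - w))\<^sup>2)" by (rule integral_nonneg[OF var(1)]) auto
  ultimately show ?thesis by simp
qed

text \<open>By dynamic programming the cost of \<gamma> on [s, e] is a difference of values, which
  \<open>cost_upper\<close> bounds above and \<open>cost_lower\<close> below with the same mean
  velocity w. The leading terms cancel and the variance is left against errors of order
  \<rho>.\<close>

lemma optimal_variance:
  assumes opt: "optimal \<gamma>" and x: "x \<in> closure \<Omega>"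
  obtains A \<rho>1 where "0 < A" "0 < \<rho>1"
    "\<And>s e \<rho> w. \<lbrakk>0 \<le> s; s < e; e \<le> T; \<rho> \<le> \<rho>1; \<And>r. r \<in> {s..e} \<Longrightarrow> norm (\<gamma> r - x) \<le> \<rho>; w = (\<gamma> e - \<gamma> s) /\<^sub>R (e - s)\<rbrakk>
      \<Longrightarrow> integral {s..e} (\<lambda>r. (norm (vel \<gamma> r - w))\<^sup>2) \<le> A * \<rho> * (e - s) * (1 + (norm w)\<^sup>2)"
proof -
  obtain A0 \<rho>0 where A0: "0 \<le> A0" "0 < \<rho>0" "cball x \<rho>0 \<subseteq> U" and
    up: "\<And>s e y z \<rho> w. \<lbrakk>0 \<le> s; s < e; e \<le> T; y \<in> closure \<Omega>; z \<in> closure \<Omega>; \<rho> \<le> \<rho>0; norm (y - x) \<le> \<rho>; norm (z - x) \<le> \<rho>;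
        w = (z - y) /\<^sub>R (e - s)\<rbrakk>
      \<Longrightarrow> u s y \<le> u e z + integral {s..e} (\<lambda>r. f r x) + (e - s) * (L x w + A0 * \<rho> * (1 + (norm w)\<^sup>2))"
    using cost_upper[OF x] by blast
  \<comment> \<open>The second bound reserves half of the convexity constant 1/(2\<mu>) for the
    variance.\<close>
  define \<rho>1 where "\<rho>1 = min \<rho>0 (1 / (4 * \<mu> * (K + 1)))"
  have \<rho>1: "0 < \<rho>1" "\<rho>1 \<le> \<rho>0" "K * \<rho>1 \<le> 1 / (4 * \<mu>)"
  proof -
    show "0 < \<rho>1" "\<rho>1 \<le> \<rho>0" using A0 \<mu>_pos K_nonneg by (auto simp: \<rho>1_def)
    have "K * \<rho>1 \<le> K * (1 / (4 * \<mu> * (K + 1)))" using K_nonneg by (intro mult_left_mono) (auto simp: \<rho>1_def)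
    also have "\<dots> = (1 / (4 * \<mu>)) * (K / (K + 1))" by simp
    also have "\<dots> \<le> (1 / (4 * \<mu>)) * 1" using K_nonneg \<mu>_pos by (intro mult_left_mono) (auto simp: divide_le_eq)
    finally show "K * \<rho>1 \<le> 1 / (4 * \<mu>)" by simp
  qed
  define A where "A = 4 * \<mu> * (A0 + 2 * K) + 1"
  show thesis
  proof
    show "0 < A" using A0 K_nonneg \<mu>_pos by (simp add: A_def add_nonneg_pos)
    show "0 < \<rho>1" by (fact \<rho>1)
    fix s e \<rho> w assume se: "0 \<le> s" "s < e" "e \<le> T" and "\<rho> \<le> \<rho>1" and near: "\<And>r. r \<in> {s..e} \<Longrightarrow> norm (\<gamma> r - x) \<le> \<rho>"
      and w: "w = (\<gamma> e - \<gamma> s) /\<^sub>R (e - s)"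
    note \<gamma> = optimalD[OF opt se(1,3)]
    have \<rho>: "0 \<le> \<rho>" by (rule order_trans[OF norm_ge_zero near[of s]]) (use se in auto)
    define V where "V = integral {s..e} (\<lambda>r. (norm (vel \<gamma> r - w))\<^sup>2)"
    have "V \<ge> 0" unfolding V_def by (rule integral_nonneg[OF speed_variance(1)[OF \<gamma>(1) se \<gamma>(2) w]]) auto
    define I where "I = integral {s..e} (\<lambda>r. f r x)"
    define W where "W = 1 + (norm w)\<^sup>2"
    have "W > 0" by (simp add: W_def add_pos_nonneg)
    have "cball x \<rho> \<subseteq> U" using A0(3) \<open>\<rho> \<le> \<rho>1\<close> \<rho>1(2) by (meson order_trans subset_cball)
    from cost_lower[OF \<gamma>(1) se \<gamma>(2) x this near w]
    have "I + (e - s) * (L x w - 2 * K * \<rho> * W) + (1 / (2 * \<mu>) - K * \<rho>) * V \<le> integral {s..e} (ell \<gamma>)"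
      by (simp add: I_def V_def W_def)
    also have "\<dots> = u s (\<gamma> s) - u e (\<gamma> e)" using optimal_dpp[OF opt, of s e] se by simp
    also have "\<dots> \<le> I + (e - s) * (L x w + A0 * \<rho> * W)"
      using up[OF se path_in[OF \<gamma>(1)] path_in[OF \<gamma>(1)] _ near near w] \<open>\<rho> \<le> \<rho>1\<close> \<rho>1(2) se
      by (simp add: I_def W_def)
    finally have "(1 / (2 * \<mu>) - K * \<rho>) * V \<le> (A0 + 2 * K) * (\<rho> * (e - s) * W)" by (simp add: algebra_simps)
    moreover have "1 / (4 * \<mu>) * V \<le> (1 / (2 * \<mu>) - K * \<rho>) * V"
    proof (rule mult_right_mono[OF _ \<open>V \<ge> 0\<close>])
      have "K * \<rho> \<le> K * \<rho>1" using \<open>\<rho> \<le> \<rho>1\<close> K_nonneg by (rule mult_left_mono)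
      then have "K * \<rho> \<le> 1 / (4 * \<mu>)" using \<rho>1 by simp
      moreover have "1 / (2 * \<mu>) = 1 / (4 * \<mu>) + 1 / (4 * \<mu>)" by simp
      ultimately show "1 / (4 * \<mu>) \<le> 1 / (2 * \<mu>) - K * \<rho>" by linarith
    qed
    ultimately have "1 / (4 * \<mu>) * V \<le> (A0 + 2 * K) * (\<rho> * (e - s) * W)" by linarith
    then have "V \<le> 4 * \<mu> * (A0 + 2 * K) * (\<rho> * (e - s) * W)" using \<mu>_pos by (simp add: field_simps)
    also have "\<dots> \<le> A * (\<rho> * (e - s) * W)"
      by (rule mult_right_mono) (use \<rho> se \<open>W > 0\<close> in \<open>auto simp: A_def\<close>)
    finally show "integral {s..e} (\<lambda>r. (norm (vel \<gamma> r - w))\<^sup>2) \<le> A * \<rho> * (e - s) * (1 + (norm w)\<^sup>2)"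
      by (simp add: V_def W_def mult.assoc)
  qed
qed

lemma optimal_energy:
  obtains E where "0 < E" "\<And>\<gamma> s e. \<lbrakk>optimal \<gamma>; 0 \<le> s; s \<le> e; e \<le> T\<rbrakk> \<Longrightarrow> integral {s..e} (\<lambda>r. (norm (vel \<gamma> r))\<^sup>2) \<le> E"
proof -
  obtain E where E: "0 < E" "\<And>t s e \<gamma>. \<lbrakk>0 \<le> t; t \<le> s; s \<le> e; e \<le> T; \<gamma> \<in> paths T \<Omega>; fin_cost t T \<gamma>;
      integral {t..T} (ell \<gamma>) + g (\<gamma> T) \<le> u t (\<gamma> t) + 1\<rbrakk>
     \<Longrightarrow> integral {s..e} (\<lambda>r. (norm (vel \<gamma> r))\<^sup>2) \<le> E" using energy_bound by blast
  show thesis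
  proof (rule that[OF E(1)])
    fix \<gamma> s e assume "optimal \<gamma>" "0 \<le> s" "s \<le> e" "e \<le> T"
    then show "integral {s..e} (\<lambda>r. (norm (vel \<gamma> r))\<^sup>2) \<le> E"
      by (intro E(2)[of 0]) (auto simp: optimal_def)
  qed
qed

text \<open>Cauchy-Schwarz with the uniform energy bound; E does not depend on the curve, which also
  gives equicontinuity.\<close>

lemma optimal_hoelder:
  obtains E where "0 < E" "\<And>\<gamma> s e. \<lbrakk>optimal \<gamma>; s \<in> {0..T}; e \<in> {0..T}\<rbrakk> \<Longrightarrow> norm (\<gamma> e - \<gamma> s) \<le> sqrt (E * \<bar>e - s\<bar>)"
proof -
  obtain E where E: "0 < E" "\<And>\<gamma> s e. \<lbrakk>optimal \<gamma>; 0 \<le> s; s \<le> e; e \<le> T\<rbrakk> \<Longrightarrow> integral {s..e} (\<lambda>r. (norm (vel \<gamma> r))\<^sup>2) \<le> E"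
    using optimal_energy by blast
  have *: "norm (\<gamma> e - \<gamma> s) \<le> sqrt (E * (e - s))" if opt: "optimal \<gamma>" and se: "0 \<le> s" "s \<le> e" "e \<le> T" for \<gamma> s e
  proof -
    have "(e - s) * integral {s..e} (\<lambda>r. (norm (vel \<gamma> r))\<^sup>2) \<le> (e - s) * E"
      using E(2)[OF opt se] se by (intro mult_left_mono) auto
    moreover have "(norm (\<gamma> e - \<gamma> s))\<^sup>2 \<le> (e - s) * integral {s..e} (\<lambda>r. (norm (vel \<gamma> r))\<^sup>2)"
      using displacement_square[OF optimalD(1)[OF opt se(1,3)] se optimalD(2)[OF opt se(1,3)]] .
    ultimately show ?thesis by (intro real_le_rsqrt) (simp add: mult.commute)
  qed
  show thesis
  proof (rule that[OF E(1)])
    fix \<gamma> s e assume "optimal \<gamma>" "s \<in> {0..T}" "e \<in> {0..T}"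
    then show "norm (\<gamma> e - \<gamma> s) \<le> sqrt (E * \<bar>e - s\<bar>)"
      using *[of \<gamma> s e] *[of \<gamma> e s] by (cases "s \<le> e") (auto simp: norm_minus_commute)
  qed
qed

text \<open>A Campanato-type iteration: on shrinking intervals around \<open>t\<close> the variance of the velocity
  decays like a power of the length, so the mean velocities converge.\<close>

proposition optimal_differentiable:
  assumes opt: "optimal \<gamma>" and t: "t \<in> {0<..<T}"
  obtains v where "(\<gamma> has_vector_derivative v) (at t)"
proof -
  have \<gamma>: "\<gamma> \<in> paths T \<Omega>" using opt by (simp add: optimal_def)
  define x where "x = \<gamma> t"
  have x: "x \<in> closure \<Omega>" unfolding x_def by (rule path_in[OF \<gamma>]) (use t in auto)
  obtain E where E: "0 < E" "\<And>s e. \<lbrakk>s \<in> {0..T}; e \<in> {0..T}\<rbrakk> \<Longrightarrow> norm (\<gamma> e - \<gamma> s) \<le> sqrt (E * \<bar>e - s\<bar>)"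
    using optimal_hoelder opt by metis
  obtain A \<rho>1 where A: "0 < A" "0 < \<rho>1" and
    var: "\<And>s e \<rho> w. \<lbrakk>0 \<le> s; s < e; e \<le> T; \<rho> \<le> \<rho>1; \<And>r. r \<in> {s..e} \<Longrightarrow> norm (\<gamma> r - x) \<le> \<rho>; w = (\<gamma> e - \<gamma> s) /\<^sub>R (e - s)\<rbrakk>
      \<Longrightarrow> integral {s..e} (\<lambda>r. (norm (vel \<gamma> r - w))\<^sup>2) \<le> A * \<rho> * (e - s) * (1 + (norm w)\<^sup>2)"
    using optimal_variance[OF opt x] by blast
  \<comment> \<open>The last bound makes the Hoelder radius sqrt(E h) at most \<rho>1, where the
    variance estimate applies.\<close>
  define h0 where "h0 = min (min t (T - t)) (\<rho>1\<^sup>2 / E)"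
  have h0: "0 < h0" "h0 \<le> t" "h0 \<le> T - t" "sqrt (E * h0) \<le> \<rho>1"
  proof -
    show "0 < h0" "h0 \<le> t" "h0 \<le> T - t" using t A E by (auto simp: h0_def)
    have "E * h0 \<le> E * (\<rho>1\<^sup>2 / E)" using E by (intro mult_left_mono) (auto simp: h0_def)
    then show "sqrt (E * h0) \<le> \<rho>1" using E A by (intro real_le_lsqrt) auto
  qed
  define W where "W h = (\<gamma> (t + h) - \<gamma> (t - h)) /\<^sub>R (2 * h)" for h
  define \<beta> where "\<beta> h = sqrt (8 * A * sqrt (E * h))" for h
  \<comment> \<open>A subinterval of length at least h/4 cannot have a mean velocity far from
    \<open>W h\<close> without adding to the variance. This covers both the passage to the next
    scale and one-sided difference quotients.\<close>
  have mean: "norm (z - W h) \<le> \<beta> h * (1 + norm (W h))"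
    if h: "0 < h" "h \<le> h0" and ab: "t - h \<le> a" "b \<le> t + h" "h / 4 \<le> b - a" and z: "z = (\<gamma> b - \<gamma> a) /\<^sub>R (b - a)" for h a b z
  proof -
    have I: "0 \<le> t - h" "t - h < t + h" "t + h \<le> T" using h h0 by auto
    have J: "0 \<le> a" "a < b" "b \<le> T" using h ab I by auto
    have V: "integral {t - h..t + h} (\<lambda>r. (norm (vel \<gamma> r - W h))\<^sup>2) \<le> A * sqrt (E * h) * ((t + h) - (t - h)) * (1 + (norm (W h))\<^sup>2)"
    proof (rule var[OF I])
      have "sqrt (E * h) \<le> sqrt (E * h0)" by (intro real_sqrt_le_mono mult_left_mono) (use E h in auto)
      then show "sqrt (E * h) \<le> \<rho>1" using h0(4) by (rule order_trans)
      show "norm (\<gamma> r - x) \<le> sqrt (E * h)" if r: "r \<in> {t - h..t + h}" for r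
      proof -
        have "norm (\<gamma> r - \<gamma> t) \<le> sqrt (E * \<bar>r - t\<bar>)" by (rule E(2)) (use r I t in auto)
        also have "\<dots> \<le> sqrt (E * h)" using r E by (intro real_sqrt_le_mono mult_left_mono) auto
        finally show ?thesis by (simp add: x_def)
      qed
    qed (simp add: W_def)
    have int: "(\<lambda>r. (norm (vel \<gamma> r - W h))\<^sup>2) integrable_on {t - h..t + h}"
      by (rule speed_variance(1)[OF \<gamma> I optimalD(2)[OF opt I(1,3)] refl])
    have "(b - a) * (norm (z - W h))\<^sup>2 \<le> integral {a..b} (\<lambda>r. (norm (vel \<gamma> r - W h))\<^sup>2)"
      by (rule average_speed[OF \<gamma> J optimalD(2)[OF opt J(1,3)] z])
    also have "\<dots> \<le> integral {t - h..t + h} (\<lambda>r. (norm (vel \<gamma> r - W h))\<^sup>2)"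
      by (rule integral_subset_le[OF _ integrable_subinterval_real[OF int] int]) (use ab in auto)
    also note V
    finally have "(b - a) * (norm (z - W h))\<^sup>2 \<le> A * sqrt (E * h) * (2 * h) * (1 + (norm (W h))\<^sup>2)" by simp
    moreover have "(h / 4) * (norm (z - W h))\<^sup>2 \<le> (b - a) * (norm (z - W h))\<^sup>2" using ab by (intro mult_right_mono) auto
    moreover have "(h / 4) * (8 * A * sqrt (E * h) * (1 + (norm (W h))\<^sup>2)) = A * sqrt (E * h) * (2 * h) * (1 + (norm (W h))\<^sup>2)"
      by simp
    ultimately have "(h / 4) * (norm (z - W h))\<^sup>2 \<le> (h / 4) * (8 * A * sqrt (E * h) * (1 + (norm (W h))\<^sup>2))" by linarith
    then have "(norm (z - W h))\<^sup>2 \<le> 8 * A * sqrt (E * h) * (1 + (norm (W h))\<^sup>2)" using h by (simp add: mult_le_cancel_left)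
    also have "\<dots> \<le> 8 * A * sqrt (E * h) * (1 + norm (W h))\<^sup>2"
      using A E h by (intro mult_left_mono) (auto simp: power2_eq_square algebra_simps)
    also have "\<dots> = (\<beta> h * (1 + norm (W h)))\<^sup>2" using A E h by (simp add: \<beta>_def power_mult_distrib)
    finally show ?thesis
      using A E h by (intro power2_le_imp_le[of "norm (z - W h)"]) (auto simp: \<beta>_def add_nonneg_nonneg)
  qed
  \<comment> \<open>Since \<beta> scales like h^(1/4), the ratio 4 between scales makes \<beta>
    decrease by the factor q = 1/sqrt 2.\<close>
  define H where "H k = h0 / 4 ^ k" for k
  have H: "0 < H k" "H k \<le> h0" "H (Suc k) = H k / 4" for k
  proof -
    have "h0 * 1 \<le> h0 * 4 ^ k" using h0 by (intro mult_left_mono) auto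
    then show "0 < H k" "H k \<le> h0" "H (Suc k) = H k / 4" using h0 by (auto simp: H_def field_simps)
  qed
  define q where "q = 1 / sqrt 2"
  have q: "0 \<le> q" "q < 1" by (auto simp: q_def)
  have \<beta>H: "\<beta> (H k) = \<beta> h0 * q ^ k" for k
  proof (induction k)
    case (Suc k)
    have "\<beta> (H (Suc k)) = sqrt (8 * A * sqrt (E * H k) / 2)"
      by (simp add: \<beta>_def H(3) real_sqrt_divide)
    also have "\<dots> = \<beta> (H k) * q" unfolding real_sqrt_divide \<beta>_def q_def by simp
    finally show ?case using Suc by simp
  qed (simp add: H_def)
  have step: "norm (W (H (Suc k)) - W (H k)) \<le> \<beta> h0 * q ^ k * (1 + norm (W (H k)))" for k
    unfolding \<beta>H[symmetric]
    by (rule mean[where a = "t - H (Suc k)" and b = "t + H (Suc k)"])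
       (use H(1)[of k] H(2)[of k] H(3)[of k] in \<open>auto simp: W_def\<close>)
  have "0 \<le> \<beta> h0" using A E h0 by (simp add: \<beta>_def)
  obtain v C where v: "(\<lambda>k. W (H k)) \<longlonglongrightarrow> v" and C: "\<And>k. 1 + norm (W (H k)) \<le> C"
    using perturbed_geometric_convergent[OF \<open>0 \<le> \<beta> h0\<close> q step] by blast
  have C0: "0 \<le> C" using C[of 0] norm_ge_zero[of "W (H 0)"] by linarith
  have err: "(\<lambda>k. \<beta> h0 * q ^ k * C + norm (W (H k) - v)) \<longlonglongrightarrow> 0"
  proof -
    have "(\<lambda>k. \<beta> h0 * q ^ k * C + norm (W (H k) - v)) \<longlonglongrightarrow> \<beta> h0 * 0 * C + norm (v - v)"
      by (intro tendsto_intros v LIMSEQ_power_zero) (use q in auto)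
    then show ?thesis by simp
  qed
  have "(\<gamma> has_vector_derivative v) (at t)"
    unfolding has_vector_derivative_def has_derivative_at_alt
  proof (intro conjI allI impI)
    show "bounded_linear (\<lambda>h. h *\<^sub>R v)" by (rule bounded_linear_scaleR_left)
    fix \<epsilon> :: real assume "0 < \<epsilon>"
    obtain k0 where k0: "\<And>k. k \<ge> k0 \<Longrightarrow> \<beta> h0 * q ^ k * C + norm (W (H k) - v) \<le> \<epsilon>"
      using order_tendstoD(2)[OF err \<open>0 < \<epsilon>\<close>] unfolding eventually_sequentially by (meson less_imp_le)
    have main: "norm (z - v) \<le> \<epsilon>"
      if d: "0 < d" "d < H k0" and z: "z = (\<gamma> b - \<gamma> a) /\<^sub>R (b - a)" "t - d \<le> a" "b \<le> t + d" "b - a = d" for d a b z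
    proof -
      have "H \<longlonglongrightarrow> 0"
      proof -
        have "(\<lambda>k. h0 * (1 / 4) ^ k) \<longlonglongrightarrow> h0 * 0" by (intro tendsto_intros LIMSEQ_power_zero) simp
        then show ?thesis by (simp add: H_def[abs_def] power_divide)
      qed
      then obtain k1 where "H (Suc k1) < d"
        using order_tendstoD(2)[OF _ d(1), of H] by (metis (no_types, lifting) eventually_sequentially le_SucI order_refl)
      \<comment> \<open>The scale with H(k+1) < d \<le> H k: the interval of length d fits into the
        symmetric one of radius H k and is at least a quarter of that radius long.\<close>
      define k where "k = (LEAST k. H (Suc k) < d)"
      have k: "H (Suc k) < d" unfolding k_def by (rule LeastI[of "\<lambda>k. H (Suc k) < d" k1]) fact
      have Hmono: "H j \<le> H i" if "i \<le> j" for i j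
        using that h0 by (auto simp: H_def intro!: divide_left_mono power_increasing)
      have "k0 \<le> k"
      proof (rule ccontr)
        assume "\<not> k0 \<le> k"
        then have "H k0 \<le> H (Suc k)" by (intro Hmono) simp
        then show False using k d by simp
      qed
      have "d \<le> H k"
      proof (cases "k = k0")
        case False
        then obtain j where j: "k = Suc j" using \<open>k0 \<le> k\<close> by (cases k) auto
        then have "\<not> H (Suc j) < d" unfolding k_def using not_less_Least[of j "\<lambda>k. H (Suc k) < d"] by (metis k_def lessI)
        then show ?thesis using j by simp
      qed (use d in simp)
      have "norm (z - W (H k)) \<le> \<beta> (H k) * (1 + norm (W (H k)))"
        by (rule mean[OF H(1,2) _ _ _ z(1)]) (use z k \<open>d \<le> H k\<close> H(3)[of k] in auto)
      also have "\<dots> \<le> \<beta> h0 * q ^ k * C"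
        unfolding \<beta>H using C[of k] \<open>0 \<le> \<beta> h0\<close> q by (intro mult_left_mono) auto
      finally show ?thesis
        using k0[OF \<open>k0 \<le> k\<close>] norm_triangle_ineq[of "z - W (H k)" "W (H k) - v"] by simp
    qed
    have "norm (\<gamma> y - \<gamma> t - (y - t) *\<^sub>R v) \<le> \<epsilon> * norm (y - t)" if y: "norm (y - t) < H k0" for y
    proof -
      consider "y = t" | "t < y" | "y < t" by linarith
      then show ?thesis
      proof cases
        case 2
        define z where "z = (\<gamma> y - \<gamma> t) /\<^sub>R (y - t)"
        have "\<gamma> y - \<gamma> t - (y - t) *\<^sub>R v = (y - t) *\<^sub>R (z - v)" using 2 by (simp add: z_def scaleR_diff_right)
        moreover have "norm (z - v) \<le> \<epsilon>" by (rule main[of "y - t" _ y t]) (use 2 y in \<open>auto simp: z_def\<close>)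
        ultimately show ?thesis using 2 by (simp add: mult.commute)
      next
        case 3
        define z where "z = (\<gamma> t - \<gamma> y) /\<^sub>R (t - y)"
        have "(t - y) *\<^sub>R z = \<gamma> t - \<gamma> y" using 3 by (simp add: z_def)
        then have "\<gamma> y - \<gamma> t - (y - t) *\<^sub>R v = - ((t - y) *\<^sub>R (z - v))" by (simp add: scaleR_diff_right algebra_simps)
        moreover have "norm (z - v) \<le> \<epsilon>" by (rule main[of "t - y" _ t y]) (use 3 y in \<open>auto simp: z_def\<close>)
        ultimately show ?thesis using 3 by (simp add: mult.commute)
      qed simp
    qed
    then show "\<exists>d>0. \<forall>y. norm (y - t) < d \<longrightarrow> norm (\<gamma> y - \<gamma> t - (y - t) *\<^sub>R v) \<le> \<epsilon> * norm (y - t)"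
      using H(1)[of k0] by blast
  qed
  then show thesis by (rule that)
qed

section \<open>Legendre duality\<close>

text \<open>\<open>Ham\<close> is a supremum over the reals and carries information only when
  bounded; quadratic coercivity beats the linear term.\<close>

lemma Ham_bdd: "x \<in> U \<Longrightarrow> bdd_above (range (\<lambda>v. - (p \<bullet> v) - L x v))"
proof -
  assume x: "x \<in> U"
  have "- (p \<bullet> v) - L x v \<le> K + \<mu> * K\<^sup>2 + \<mu> * (norm p)\<^sup>2" for v
  proof -
    have "- (p \<bullet> v) \<le> norm p * norm v" using Cauchy_Schwarz_ineq2[of p v] by linarith
    moreover have "norm p * norm v \<le> (norm v)\<^sup>2 / (4 * \<mu>) + \<mu> * (norm p)\<^sup>2"
    proof -
      have "0 \<le> (norm v - 2 * \<mu> * norm p)\<^sup>2 / (4 * \<mu>)" using \<mu>_pos by simp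
      also have "\<dots> = (norm v)\<^sup>2 / (4 * \<mu>) + \<mu> * (norm p)\<^sup>2 - norm p * norm v"
        using \<mu>_pos by (simp add: field_simps power2_eq_square)
      finally show ?thesis by simp
    qed
    ultimately show ?thesis using L_coercive[OF x, of v] by linarith
  qed
  then show ?thesis unfolding bdd_above_def by blast
qed

lemma Ham_ge: "x \<in> U \<Longrightarrow> - (p \<bullet> v) - L x v \<le> Ham L x p"
  unfolding Ham_def by (intro cSUP_upper Ham_bdd) auto

text \<open>Fenchel's equality. The minus sign reflects the pairing -<p, v> in the Hamiltonian:
  convexity says that v maximises when p = -DvL.\<close>

lemma Ham_dual:
  assumes "x \<in> U" shows "Ham L x (- DvL x v) = DvL x v \<bullet> v - L x v"
proof (rule antisym)
  have "- (- DvL x v \<bullet> w) - L x w \<le> DvL x v \<bullet> v - L x v" for w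
  proof -
    have "0 \<le> (norm (w - v))\<^sup>2 / (2 * \<mu>)" using \<mu>_pos by simp
    then show ?thesis using L_lower[OF assms, of v w] by (simp add: inner_diff_right)
  qed
  then show "Ham L x (- DvL x v) \<le> DvL x v \<bullet> v - L x v" unfolding Ham_def by (intro cSUP_least) auto
  show "DvL x v \<bullet> v - L x v \<le> Ham L x (- DvL x v)" using Ham_ge[OF assms, of "- DvL x v" v] by simp
qed

text \<open>The supremum sees p only through its pairing with tangential vectors, so p may differ
  from -DvL by any normal component; v must itself be tangential to compete.\<close>

lemma Ham_tau_dual:
  assumes "x \<in> U" and v: "v \<bullet> outward_normal \<Omega> x = 0"
    and p: "\<And>w. w \<bullet> outward_normal \<Omega> x = 0 \<Longrightarrow> p \<bullet> w = - (DvL x v \<bullet> w)"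
  shows "Ham_tau L \<Omega> x p = DvL x v \<bullet> v - L x v"
proof (rule antisym)
  have "- (p \<bullet> w) - L x w \<le> DvL x v \<bullet> v - L x v" if "w \<bullet> outward_normal \<Omega> x = 0" for w
  proof -
    have "0 \<le> (norm (w - v))\<^sup>2 / (2 * \<mu>)" using \<mu>_pos by simp
    then show ?thesis using L_lower[OF assms(1), of v w] p[OF that] by (simp add: inner_diff_right)
  qed
  then show "Ham_tau L \<Omega> x p \<le> DvL x v \<bullet> v - L x v" unfolding Ham_tau_def using v by (intro cSUP_least) auto
  have "- (p \<bullet> v) - L x v \<le> Ham_tau L \<Omega> x p"
    unfolding Ham_tau_def by (intro cSUP_upper bdd_above_mono[OF Ham_bdd[OF assms(1)]]) (use v in auto)
  then show "DvL x v \<bullet> v - L x v \<le> Ham_tau L \<Omega> x p" using p[OF v] by simp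
qed

section \<open>First order expansion of the value function\<close>

text \<open>An integral over a reversed interval is zero rather than negative, so the expansions in
  the lower and in the upper limit are stated separately, each with a common far end e.\<close>

lemma running_cost_derivative:
  assumes x: "x \<in> closure \<Omega>" and t: "t \<in> {0<..<T}" and "0 < \<epsilon>"
  obtains d where "0 < d" "\<And>s e. \<lbrakk>\<bar>s - t\<bar> < d; 0 \<le> s; s \<le> e; t \<le> e; e \<le> T\<rbrakk> \<Longrightarrow>
      \<bar>integral {s..e} (\<lambda>r. f r x) - integral {t..e} (\<lambda>r. f r x) + (s - t) * f t x\<bar> \<le> \<epsilon> * \<bar>s - t\<bar>"
    "\<And>s e. \<lbrakk>\<bar>s - t\<bar> < d; s \<le> T; 0 \<le> e; e \<le> s; e \<le> t\<rbrakk> \<Longrightarrow>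
      \<bar>integral {e..s} (\<lambda>r. f r x) - integral {e..t} (\<lambda>r. f r x) - (s - t) * f t x\<bar> \<le> \<epsilon> * \<bar>s - t\<bar>"
proof -
  define \<Phi> where "\<Phi> r = integral {0..r} (\<lambda>r. f r x)" for r
  have \<Phi>: "integral {a..b} (\<lambda>r. f r x) = \<Phi> b - \<Phi> a" if "0 \<le> a" "a \<le> b" "b \<le> T" for a b
  proof -
    have "\<Phi> a + integral {a..b} (\<lambda>r. f r x) = \<Phi> b" unfolding \<Phi>_def
      by (rule Henstock_Kurzweil_Integration.integral_combine) (use that f_path_integrable(2)[OF x] in auto)
    then show ?thesis by simp
  qed
  have "(\<Phi> has_real_derivative f t x) (at t within {0..T})"
    unfolding \<Phi>_def by (rule integral_has_real_derivative) (use f_path_integrable(1)[OF x] t in auto)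
  then obtain d where "d > 0" and d: "\<And>y. \<lbrakk>y \<in> {0..T}; \<bar>y - t\<bar> < d\<rbrakk> \<Longrightarrow> \<bar>\<Phi> y - \<Phi> t - f t x * (y - t)\<bar> \<le> \<epsilon> * \<bar>y - t\<bar>"
    unfolding has_field_derivative_def has_derivative_within_alt using \<open>0 < \<epsilon>\<close> by (metis real_norm_def)
  show thesis
  proof (rule that[OF \<open>d > 0\<close>])
    fix s e assume *: "\<bar>s - t\<bar> < d" "0 \<le> s" "s \<le> e" "t \<le> e" "e \<le> T"
    have "\<bar>\<Phi> s - \<Phi> t - f t x * (s - t)\<bar> \<le> \<epsilon> * \<bar>s - t\<bar>" by (rule d) (use * in auto)
    moreover have "integral {s..e} (\<lambda>r. f r x) - integral {t..e} (\<lambda>r. f r x) + (s - t) * f t x = - (\<Phi> s - \<Phi> t - f t x * (s - t))"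
      using * t \<Phi>[of s e] \<Phi>[of t e] by (simp add: algebra_simps)
    ultimately show "\<bar>integral {s..e} (\<lambda>r. f r x) - integral {t..e} (\<lambda>r. f r x) + (s - t) * f t x\<bar> \<le> \<epsilon> * \<bar>s - t\<bar>" by (metis abs_minus_cancel)
  next
    fix s e assume *: "\<bar>s - t\<bar> < d" "s \<le> T" "0 \<le> e" "e \<le> s" "e \<le> t"
    have "\<bar>\<Phi> s - \<Phi> t - f t x * (s - t)\<bar> \<le> \<epsilon> * \<bar>s - t\<bar>" by (rule d) (use * in auto)
    moreover have "integral {e..s} (\<lambda>r. f r x) - integral {e..t} (\<lambda>r. f r x) - (s - t) * f t x = \<Phi> s - \<Phi> t - f t x * (s - t)"
      using * t \<Phi>[of e s] \<Phi>[of e t] by (simp add: algebra_simps)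
    ultimately show "\<bar>integral {e..s} (\<lambda>r. f r x) - integral {e..t} (\<lambda>r. f r x) - (s - t) * f t x\<bar> \<le> \<epsilon> * \<bar>s - t\<bar>" by metis
  qed
qed

text \<open>The cost \<open>\<tau> L(w)\<close> of covering a displacement \<open>\<tau> w\<close> in time \<open>\<tau>\<close> is a perspective function:
  it is linearised at the pair (time \<open>\<delta>\<close>, displacement \<open>\<delta> v\<close>).\<close>

lemma perspective_expansion:
  assumes x: "x \<in> U" and \<epsilon>: "0 < \<epsilon>" "\<epsilon> \<le> 1 / 2" and \<delta>: "0 < \<delta>"
    and vb: "norm (vb - v) \<le> \<epsilon>" and k: "\<bar>\<sigma>\<bar> + norm \<xi> = \<epsilon> * \<delta>" and \<tau>: "\<tau> = \<delta> - \<sigma>" and w: "\<tau> *\<^sub>R w = \<delta> *\<^sub>R vb - \<xi>"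
  shows "0 < \<tau>" "\<tau> \<le> 2 * \<delta>" "norm w \<le> 4 * (2 + norm v)" "norm vb \<le> 2 + norm v"
    "\<tau> * L x w - \<delta> * L x vb \<le> \<sigma> * (DvL x v \<bullet> v - L x v) - DvL x v \<bullet> \<xi> + 16 * \<mu> * (2 + norm v)\<^sup>2 * \<epsilon> * (\<epsilon> * \<delta>)"
proof -
  have \<sigma>: "\<bar>\<sigma>\<bar> \<le> \<epsilon> * \<delta>" using k norm_ge_zero[of \<xi>] by linarith
  have \<xi>: "norm \<xi> \<le> \<epsilon> * \<delta>" using k abs_ge_zero[of \<sigma>] by linarith
  have \<epsilon>\<delta>: "\<epsilon> * \<delta> \<le> \<delta> / 2" using mult_right_mono[OF \<epsilon>(2), of \<delta>] \<delta> by simp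
  show "0 < \<tau>" "\<tau> \<le> 2 * \<delta>" using \<sigma> \<epsilon>\<delta> \<delta> \<tau> by linarith+
  have \<tau>2: "\<delta> \<le> 2 * \<tau>" using \<sigma> \<epsilon>\<delta> \<tau> by linarith
  have "norm vb \<le> norm v + \<epsilon>" using norm_triangle_ineq[of v "vb - v"] vb by simp
  then show "norm vb \<le> 2 + norm v" using \<epsilon> by simp
  define V where "V = 2 + norm v"
  have "\<tau> *\<^sub>R (w - v) = \<delta> *\<^sub>R (vb - v) - \<xi> + \<sigma> *\<^sub>R v" by (simp add: scaleR_diff_right w) (simp add: \<tau> algebra_simps)
  then have "\<tau> * norm (w - v) = norm (\<delta> *\<^sub>R (vb - v) - \<xi> + \<sigma> *\<^sub>R v)" using \<open>0 < \<tau>\<close> by (metis abs_of_pos norm_scaleR)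
  also have "\<dots> \<le> norm (\<delta> *\<^sub>R (vb - v)) + norm \<xi> + norm (\<sigma> *\<^sub>R v)"
    by (intro order_trans[OF norm_triangle_ineq] add_mono norm_triangle_ineq4) auto
  also have "\<dots> \<le> \<delta> * \<epsilon> + \<epsilon> * \<delta> + (\<epsilon> * \<delta>) * norm v"
    using vb \<xi> \<sigma> \<delta> by (intro add_mono) (auto intro: mult_left_mono mult_right_mono)
  also have "\<dots> = \<delta> * (\<epsilon> * V)" by (simp add: V_def algebra_simps)
  also have "\<dots> \<le> (2 * \<tau>) * (\<epsilon> * V)" using \<tau>2 \<epsilon> by (intro mult_right_mono) (auto simp: V_def)
  finally have "\<tau> * norm (w - v) \<le> \<tau> * (2 * \<epsilon> * V)" by (simp add: algebra_simps)
  then have wv: "norm (w - v) \<le> 2 * \<epsilon> * V" using \<open>0 < \<tau>\<close> by simp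
  have "norm w \<le> norm v + norm (w - v)" using norm_triangle_ineq[of v "w - v"] by simp
  also have "\<dots> \<le> V + 1 * V"
  proof (rule add_mono)
    have "2 * \<epsilon> * V \<le> 1 * V" using \<epsilon> by (intro mult_right_mono) (auto simp: V_def)
    then show "norm (w - v) \<le> 1 * V" using wv by linarith
  qed (simp add: V_def)
  finally have "norm w \<le> V + 1 * V" .
  moreover have "0 \<le> V" by (simp add: V_def)
  ultimately have "norm w \<le> 4 * V" by linarith
  then show "norm w \<le> 4 * (2 + norm v)" by (simp add: V_def)
  have "\<tau> * L x w \<le> \<tau> * (L x v + DvL x v \<bullet> (w - v) + \<mu> / 2 * (norm (w - v))\<^sup>2)"
    using L_upper[OF x] \<open>0 < \<tau>\<close> by (intro mult_left_mono) auto
  moreover have "\<delta> * (L x v + DvL x v \<bullet> (vb - v)) \<le> \<delta> * L x vb"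
  proof (rule mult_left_mono)
    have "0 \<le> (norm (vb - v))\<^sup>2 / (2 * \<mu>)" using \<mu>_pos by simp
    then show "L x v + DvL x v \<bullet> (vb - v) \<le> L x vb" using L_lower[OF x, of v vb] by linarith
  qed (use \<delta> in simp)
  \<comment> \<open>Both values of L are compared with the tangent at the same v, so the linear
    parts combine exactly into the gradient applied to \<sigma>v - \<xi>.\<close>
  moreover have "\<tau> * (DvL x v \<bullet> (w - v)) - \<delta> * (DvL x v \<bullet> (vb - v)) = \<sigma> * (DvL x v \<bullet> v) - DvL x v \<bullet> \<xi>"
  proof -
    have "\<tau> * (DvL x v \<bullet> (w - v)) - \<delta> * (DvL x v \<bullet> (vb - v)) = DvL x v \<bullet> (\<tau> *\<^sub>R w - \<tau> *\<^sub>R v - \<delta> *\<^sub>R vb + \<delta> *\<^sub>R v)"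
      by (simp add: inner_diff_right inner_add_right algebra_simps)
    also have "\<tau> *\<^sub>R w - \<tau> *\<^sub>R v - \<delta> *\<^sub>R vb + \<delta> *\<^sub>R v = \<sigma> *\<^sub>R v - \<xi>" unfolding w by (simp add: \<tau> algebra_simps)
    finally show ?thesis by (simp add: inner_diff_right)
  qed
  moreover have "\<tau> * (\<mu> / 2 * (norm (w - v))\<^sup>2) \<le> 16 * \<mu> * V\<^sup>2 * \<epsilon> * (\<epsilon> * \<delta>)"
  proof -
    have "\<tau> * (\<mu> / 2 * (norm (w - v))\<^sup>2) \<le> (2 * \<delta>) * (\<mu> / 2 * (2 * \<epsilon> * V)\<^sup>2)"
      using \<open>\<tau> \<le> 2 * \<delta>\<close> \<delta> \<mu>_pos wv by (intro mult_mono mult_left_mono power_mono) auto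
    also have "\<dots> = 4 * (\<mu> * V\<^sup>2 * \<epsilon> * (\<epsilon> * \<delta>))" by (simp add: power2_eq_square)
    also have "\<dots> \<le> 16 * (\<mu> * V\<^sup>2 * \<epsilon> * (\<epsilon> * \<delta>))" using \<mu>_pos \<epsilon> \<delta> by (intro mult_right_mono) auto
    finally show ?thesis by simp
  qed
  moreover have "\<tau> * L x v = \<delta> * L x v - \<sigma> * L x v" by (simp add: \<tau> algebra_simps)
  ultimately show "\<tau> * L x w - \<delta> * L x vb \<le> \<sigma> * (DvL x v \<bullet> v - L x v) - DvL x v \<bullet> \<xi> + 16 * \<mu> * (2 + norm v)\<^sup>2 * \<epsilon> * (\<epsilon> * \<delta>)"
    unfolding V_def distrib_left right_diff_distrib by linarith
qed

proposition value_expansion: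
  assumes opt: "optimal \<gamma>" and t: "t \<in> {0<..<T}" and v: "(\<gamma> has_vector_derivative v) (at t)"
    and x: "x = \<gamma> t" and "0 < \<eta>"
  obtains d where "0 < d" "\<And>s y. \<lbrakk>\<bar>s - t\<bar> < d; y \<in> closure \<Omega>; norm (y - x) < d\<rbrakk> \<Longrightarrow>
    \<bar>u s y - u t x - (DvL x v \<bullet> v - L x v - f t x) * (s - t) + DvL x v \<bullet> (y - x)\<bar> \<le> \<eta> * (\<bar>s - t\<bar> + norm (y - x))"
proof -
  have \<gamma>: "\<gamma> \<in> paths T \<Omega>" using opt by (simp add: optimal_def)
  have x_cl: "x \<in> closure \<Omega>" unfolding x by (rule path_in[OF \<gamma>]) (use t in auto)
  have xU: "x \<in> U" using x_cl U_sup by blast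
  obtain A \<rho>0 where A: "0 \<le> A" "0 < \<rho>0" "cball x \<rho>0 \<subseteq> U" and
    up: "\<And>s e y z \<rho> w. \<lbrakk>0 \<le> s; s < e; e \<le> T; y \<in> closure \<Omega>; z \<in> closure \<Omega>; \<rho> \<le> \<rho>0; norm (y - x) \<le> \<rho>; norm (z - x) \<le> \<rho>;
        w = (z - y) /\<^sub>R (e - s)\<rbrakk>
      \<Longrightarrow> u s y \<le> u e z + integral {s..e} (\<lambda>r. f r x) + (e - s) * (L x w + A * \<rho> * (1 + (norm w)\<^sup>2))"
    using cost_upper[OF x_cl] by blast
  define V where "V = 2 + norm v"
  have V: "V \<ge> 2" by (simp add: V_def)
  define q where "q = DvL x v"
  define M where "M = 16 * \<mu> * V\<^sup>2 + 2"
  have M: "M \<ge> 2" using \<mu>_pos by (simp add: M_def)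
  define \<epsilon> where "\<epsilon> = min (1 / 2) (\<eta> / M)"
  have \<epsilon>: "0 < \<epsilon>" "\<epsilon> \<le> 1 / 2" "M * \<epsilon> \<le> \<eta>"
    using \<open>0 < \<eta>\<close> M by (auto simp: \<epsilon>_def min_def field_simps)
  define B where "B = V * (2 * A * (1 + 16 * V\<^sup>2) + 2 * K * (1 + V\<^sup>2))"
  have B: "0 \<le> B" using V A K_nonneg by (simp add: B_def)
  obtain d1 where d1: "0 < d1" "\<And>r. \<bar>r - t\<bar> < d1 \<Longrightarrow> norm (\<gamma> r - x - (r - t) *\<^sub>R v) \<le> \<epsilon> * \<bar>r - t\<bar>"
    using v \<epsilon>(1) unfolding has_vector_derivative_def has_derivative_at_alt x by (metis real_norm_def)
  obtain d2 where d2: "0 < d2" "\<And>s e. \<lbrakk>\<bar>s - t\<bar> < d2; 0 \<le> s; s \<le> e; t \<le> e; e \<le> T\<rbrakk> \<Longrightarrow>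
      \<bar>integral {s..e} (\<lambda>r. f r x) - integral {t..e} (\<lambda>r. f r x) + (s - t) * f t x\<bar> \<le> \<epsilon> * \<bar>s - t\<bar>"
    "\<And>s e. \<lbrakk>\<bar>s - t\<bar> < d2; s \<le> T; 0 \<le> e; e \<le> s; e \<le> t\<rbrakk> \<Longrightarrow>
      \<bar>integral {e..s} (\<lambda>r. f r x) - integral {e..t} (\<lambda>r. f r x) - (s - t) * f t x\<bar> \<le> \<epsilon> * \<bar>s - t\<bar>"
    using running_cost_derivative[OF x_cl t \<epsilon>(1)] by blast
  \<comment> \<open>In order: difference quotients of \<gamma> within \<epsilon> of v, room on both
    sides of t, applicability of the cost comparison at radius V\<delta>, a nonnegative coefficient
    of the variance in \<open>cost_lower\<close>, and quadratic errors B\<delta>^2 at most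
    \<epsilon>^2 \<delta>.\<close>
  define \<delta>0 where "\<delta>0 = Min {d1, t, T - t, \<rho>0 / V, 1 / (2 * \<mu> * (K + 1) * V), \<epsilon>\<^sup>2 / (B + 1)} / 2"
  have \<delta>0: "0 < \<delta>0" "\<delta>0 < d1" "\<delta>0 < t" "\<delta>0 < T - t" "V * \<delta>0 \<le> \<rho>0" "K * (V * \<delta>0) \<le> 1 / (2 * \<mu>)" "B * \<delta>0 \<le> \<epsilon>\<^sup>2"
  proof -
    let ?S = "{d1, t, T - t, \<rho>0 / V, 1 / (2 * \<mu> * (K + 1) * V), \<epsilon>\<^sup>2 / (B + 1)}"
    have "0 < y" if "y \<in> ?S" for y
    proof -
      have "0 < \<rho>0 / V" "0 < 1 / (2 * \<mu> * (K + 1) * V)" "0 < \<epsilon>\<^sup>2 / (B + 1)"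
        using A V \<mu>_pos K_nonneg \<epsilon> B by (auto intro!: divide_pos_pos mult_pos_pos)
      then show ?thesis using that d1(1) t by auto
    qed
    moreover have "Min ?S \<in> ?S" by (rule Min_in) auto
    ultimately have pos: "0 < Min ?S" by blast
    then show "0 < \<delta>0" unfolding \<delta>0_def by linarith
    have le: "\<delta>0 < y" if "y \<in> ?S" for y
    proof -
      have "Min ?S \<le> y" using that by (intro Min_le) auto
      then show ?thesis using pos unfolding \<delta>0_def by linarith
    qed
    show "\<delta>0 < d1" "\<delta>0 < t" "\<delta>0 < T - t" using le by auto
    have "\<delta>0 < \<rho>0 / V" "\<delta>0 < 1 / (2 * \<mu> * (K + 1) * V)" "\<delta>0 < \<epsilon>\<^sup>2 / (B + 1)" using le by auto
    then have 1: "\<delta>0 * V < \<rho>0" "\<delta>0 * (2 * \<mu> * (K + 1) * V) < 1" "\<delta>0 * (B + 1) < \<epsilon>\<^sup>2"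
      using V \<mu>_pos K_nonneg B by (auto simp: pos_less_divide_eq)
    show "V * \<delta>0 \<le> \<rho>0" using 1 by (simp add: mult.commute)
    show "B * \<delta>0 \<le> \<epsilon>\<^sup>2" using 1 \<open>0 < \<delta>0\<close> by (simp add: algebra_simps)
    have "(2 * \<mu>) * (K * (V * \<delta>0)) \<le> \<delta>0 * (2 * \<mu> * (K + 1) * V)"
      using \<open>0 < \<delta>0\<close> \<mu>_pos V by (simp add: algebra_simps)
    then show "K * (V * \<delta>0) \<le> 1 / (2 * \<mu>)" using 1 \<mu>_pos by (simp add: field_simps)
  qed
  have near: "norm (\<gamma> r - x) \<le> V * \<delta>" if "\<bar>r - t\<bar> \<le> \<delta>" "\<delta> \<le> \<delta>0" for r \<delta>
  proof -
    have "norm (\<gamma> r - x) \<le> norm (\<gamma> r - x - (r - t) *\<^sub>R v) + norm ((r - t) *\<^sub>R v)"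
      using norm_triangle_ineq[of "\<gamma> r - x - (r - t) *\<^sub>R v" "(r - t) *\<^sub>R v"] by simp
    also have "\<dots> \<le> \<epsilon> * \<bar>r - t\<bar> + \<bar>r - t\<bar> * norm v" using d1(2)[of r] that \<delta>0 by simp
    also have "\<dots> \<le> 1 * \<delta> + \<delta> * norm v"
      using that \<epsilon> by (intro add_mono mult_mono mult_right_mono) auto
    also have "\<dots> \<le> V * \<delta>" using that by (simp add: V_def algebra_simps)
    finally show ?thesis .
  qed
  show thesis
  proof (rule that)
    define d where "d = min (\<epsilon> * \<delta>0 / 2) d2"
    show "0 < d" using \<epsilon> \<delta>0 d2 by (simp add: d_def)
    fix s y assume s: "\<bar>s - t\<bar> < d" and y: "y \<in> closure \<Omega>" and yx: "norm (y - x) < d"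
    define k where "k = \<bar>s - t\<bar> + norm (y - x)"
    show "\<bar>u s y - u t x - (DvL x v \<bullet> v - L x v - f t x) * (s - t) + DvL x v \<bullet> (y - x)\<bar> \<le> \<eta> * (\<bar>s - t\<bar> + norm (y - x))"
    proof (cases "k = 0")
      case True
      then have "s = t" "y = x" unfolding k_def by (auto simp: add_nonneg_eq_0_iff)
      then show ?thesis by simp
    next
      case False
      then have "k > 0" by (simp add: k_def less_le)
      \<comment> \<open>The joining time: since k = \<epsilon>\<delta>, moving from (t, x) to (s, y)
        changes the mean velocity only by O(\<epsilon>), and an error of order \<epsilon>^2 \<delta>
        is \<epsilon>k, small against k.\<close>
      define \<delta> where "\<delta> = k / \<epsilon>"
      have k\<delta>: "k = \<epsilon> * \<delta>" using \<epsilon> by (simp add: \<delta>_def)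
      have "0 < \<delta>" using \<open>k > 0\<close> \<epsilon> by (simp add: \<delta>_def)
      have "\<delta> \<le> \<delta>0" using s yx \<epsilon> by (simp add: \<delta>_def k_def d_def divide_le_eq mult.commute)
      have d2': "\<bar>s - t\<bar> < d2" using s by (simp add: d_def)
      define \<rho> where "\<rho> = V * \<delta>"
      have "\<delta> \<le> \<rho>" using V \<open>0 < \<delta>\<close> by (simp add: \<rho>_def)
      have "V * \<delta> \<le> V * \<delta>0" using \<open>\<delta> \<le> \<delta>0\<close> V by (intro mult_left_mono) auto
      then have \<rho>: "\<rho> \<le> \<rho>0" "0 \<le> \<rho>" "K * \<rho> \<le> 1 / (2 * \<mu>)"
        using \<delta>0(5,6) V \<open>0 < \<delta>\<close> mult_left_mono[OF \<open>V * \<delta> \<le> V * \<delta>0\<close> K_nonneg] unfolding \<rho>_def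
        by (linarith, simp, linarith)
      have "k \<le> \<delta>" using k\<delta> \<epsilon> \<open>0 < \<delta>\<close> by simp
      then have yx': "norm (y - x) \<le> \<rho>" using \<open>\<delta> \<le> \<rho>\<close> by (simp add: k_def)
      have ball: "cball x \<rho> \<subseteq> U" using A(3) \<rho>(1) by (meson order_trans subset_cball)
      have quad: "\<tau> * (A * \<rho> * (1 + (norm w)\<^sup>2)) + \<delta> * (2 * K * \<rho> * (1 + (norm vb)\<^sup>2)) \<le> \<epsilon> * k"
        if "0 < \<tau>" "\<tau> \<le> 2 * \<delta>" "norm w \<le> 4 * V" "norm vb \<le> V" for \<tau> and w vb :: 'a
      proof -
        have "(norm w)\<^sup>2 \<le> (4 * V)\<^sup>2" "(norm vb)\<^sup>2 \<le> V\<^sup>2" using power_mono[OF that(3), of 2] power_mono[OF that(4), of 2] by simp_all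
        then have "\<tau> * (A * \<rho> * (1 + (norm w)\<^sup>2)) + \<delta> * (2 * K * \<rho> * (1 + (norm vb)\<^sup>2))
            \<le> (2 * \<delta>) * (A * \<rho> * (1 + (4 * V)\<^sup>2)) + \<delta> * (2 * K * \<rho> * (1 + V\<^sup>2))"
          using that A \<rho> K_nonneg \<open>0 < \<delta>\<close> by (intro add_mono mult_mono mult_left_mono) auto
        also have "\<dots> = B * \<delta> * \<delta>" by (simp add: B_def \<rho>_def power2_eq_square algebra_simps)
        also have "\<dots> \<le> \<epsilon>\<^sup>2 * \<delta>"
        proof (rule mult_right_mono)
          have "B * \<delta> \<le> B * \<delta>0" using \<open>\<delta> \<le> \<delta>0\<close> B by (rule mult_left_mono)
          then show "B * \<delta> \<le> \<epsilon>\<^sup>2" using \<delta>0 by simp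
        qed (use \<open>0 < \<delta>\<close> in simp)
        finally show ?thesis by (simp add: k\<delta> power2_eq_square)
      qed
      have fin: "M * \<epsilon> * k \<le> \<eta> * k" using \<epsilon> \<open>k > 0\<close> by (intro mult_right_mono) auto
      have \<epsilon>s: "\<epsilon> * \<bar>s - t\<bar> \<le> \<epsilon> * k" using \<epsilon> by (simp add: k_def)
      have Mk: "M * \<epsilon> * k = 16 * \<mu> * V\<^sup>2 * \<epsilon> * (\<epsilon> * \<delta>) + \<epsilon> * k + \<epsilon> * k" by (simp add: M_def k\<delta> algebra_simps)
      have \<delta>t: "\<delta> < t" "\<delta> < T - t" using \<open>\<delta> \<le> \<delta>0\<close> \<delta>0 by auto
      have "k \<le> \<delta> / 2" using mult_right_mono[OF \<epsilon>(2), of \<delta>] \<open>0 < \<delta>\<close> by (simp add: k\<delta>)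
      then have s\<delta>: "\<bar>s - t\<bar> < \<delta>" using \<open>0 < \<delta>\<close> norm_ge_zero[of "y - x"] unfolding k_def by linarith
      have vb: "norm ((\<gamma> (t + h) - x) /\<^sub>R h - v) \<le> \<epsilon>" if "\<bar>h\<bar> = \<delta>" for h
      proof -
        have "h \<noteq> 0" using that \<open>0 < \<delta>\<close> by auto
        then have "h *\<^sub>R ((\<gamma> (t + h) - x) /\<^sub>R h - v) = \<gamma> (t + h) - x - (t + h - t) *\<^sub>R v" by (simp add: scaleR_diff_right)
        then have "\<bar>h\<bar> * norm ((\<gamma> (t + h) - x) /\<^sub>R h - v) = norm (\<gamma> (t + h) - x - (t + h - t) *\<^sub>R v)" by (metis norm_scaleR)
        also have "\<dots> \<le> \<epsilon> * \<bar>t + h - t\<bar>" by (rule d1(2)) (use that \<open>\<delta> \<le> \<delta>0\<close> \<delta>0 in auto)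
        finally show ?thesis using that \<open>0 < \<delta>\<close> by (simp add: mult.commute)
      qed
      \<comment> \<open>From (s, y) a corrected segment meets \<gamma> at time t + \<delta>; the
        piece of \<gamma> from t to t + \<delta> is the reference.\<close>
      have upper: "u s y - u t x \<le> (q \<bullet> v - L x v - f t x) * (s - t) - q \<bullet> (y - x) + \<eta> * k"
      proof -
        define e where "e = t + \<delta>"
        have e: "0 \<le> t" "t < e" "e \<le> T" "0 \<le> s" "s < e" "e - t = \<delta>" "e - s = \<delta> - (s - t)"
          using \<open>0 < \<delta>\<close> \<delta>t s\<delta> t by (auto simp: e_def)
        define vb where "vb = (\<gamma> e - x) /\<^sub>R \<delta>"
        define w where "w = (\<gamma> e - y) /\<^sub>R (e - s)"
        have "(e - s) *\<^sub>R w = \<gamma> e - y" "\<delta> *\<^sub>R vb = \<gamma> e - x" using e \<open>0 < \<delta>\<close> by (simp_all add: w_def vb_def)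
        then have "(e - s) *\<^sub>R w = \<delta> *\<^sub>R vb - (y - x)" by simp
        note P = perspective_expansion[OF xU \<epsilon>(1,2) \<open>0 < \<delta>\<close> _ _ e(7) this, of v]
        have P1: "norm (vb - v) \<le> \<epsilon>" using vb[of \<delta>] \<open>0 < \<delta>\<close> by (simp add: vb_def e_def)
        have P2: "\<bar>s - t\<bar> + norm (y - x) = \<epsilon> * \<delta>" using k\<delta> by (simp add: k_def)
        note P = P[OF P1 P2]
        have ge: "norm (\<gamma> r - x) \<le> \<rho>" if "r \<in> {t..e}" for r
          unfolding \<rho>_def by (rule near) (use that \<open>\<delta> \<le> \<delta>0\<close> e in auto)
        have e_cl: "\<gamma> e \<in> closure \<Omega>" by (rule path_in[OF \<gamma>]) (use e in auto)
        have 1: "u s y \<le> u e (\<gamma> e) + integral {s..e} (\<lambda>r. f r x) + (e - s) * (L x w + A * \<rho> * (1 + (norm w)\<^sup>2))"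
          by (rule up[OF e(4,5,3) y e_cl \<rho>(1) yx' _ w_def]) (use ge[of e] e in auto)
        have finc: "fin_cost t e \<gamma>" by (rule optimalD(2)[OF opt e(1,3)])
        have vb': "vb = (\<gamma> e - \<gamma> t) /\<^sub>R (e - t)" by (simp add: vb_def x e)
        have "0 \<le> (1 / (2 * \<mu>) - K * \<rho>) * integral {t..e} (\<lambda>r. (norm (vel \<gamma> r - vb))\<^sup>2)"
          using \<rho>(3) integral_nonneg[OF speed_variance(1)[OF \<gamma> e(1-3) finc vb']] by simp
        then have 2: "integral {t..e} (\<lambda>r. f r x) + \<delta> * (L x vb - 2 * K * \<rho> * (1 + (norm vb)\<^sup>2)) \<le> u t x - u e (\<gamma> e)"
          using cost_lower[OF \<gamma> e(1-3) finc x_cl ball ge vb'] optimal_dpp[OF opt e(1), of e] e x by simp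
        have 3: "\<bar>integral {s..e} (\<lambda>r. f r x) - integral {t..e} (\<lambda>r. f r x) + (s - t) * f t x\<bar> \<le> \<epsilon> * \<bar>s - t\<bar>"
          by (rule d2(2)[OF d2']) (use e in auto)
        have 4: "(e - s) * (A * \<rho> * (1 + (norm w)\<^sup>2)) + \<delta> * (2 * K * \<rho> * (1 + (norm vb)\<^sup>2)) \<le> \<epsilon> * k"
          by (rule quad) (use P in \<open>auto simp: V_def\<close>)
        have 5: "(e - s) * L x w - \<delta> * L x vb \<le> (s - t) * (q \<bullet> v - L x v) - q \<bullet> (y - x) + 16 * \<mu> * V\<^sup>2 * \<epsilon> * (\<epsilon> * \<delta>)"
          using P(5) by (simp add: q_def V_def)
        have "(q \<bullet> v - L x v - f t x) * (s - t) = (s - t) * (q \<bullet> v - L x v) - (s - t) * f t x" by (simp add: algebra_simps)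
        then show ?thesis
          using 1 2 3 4 5 Mk fin \<epsilon>s unfolding distrib_left[of "e - s"] right_diff_distrib[of \<delta>] by linarith
      qed
      \<comment> \<open>Now a corrected segment leaves \<gamma> at time t - \<delta> and ends at (s,
        y), so that u(s, y) appears on the larger side; time and space increments enter with
        opposite sign.\<close>
      have lower: "u s y - u t x \<ge> (q \<bullet> v - L x v - f t x) * (s - t) - q \<bullet> (y - x) - \<eta> * k"
      proof -
        define e where "e = t - \<delta>"
        have e: "0 \<le> e" "e < t" "t \<le> T" "e < s" "s \<le> T" "t - e = \<delta>" "s - e = \<delta> - (t - s)"
          using \<open>0 < \<delta>\<close> \<delta>t s\<delta> t by (auto simp: e_def)
        define vb where "vb = (x - \<gamma> e) /\<^sub>R \<delta>"
        define w where "w = (y - \<gamma> e) /\<^sub>R (s - e)"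
        have "(s - e) *\<^sub>R w = y - \<gamma> e" "\<delta> *\<^sub>R vb = x - \<gamma> e" using e \<open>0 < \<delta>\<close> by (simp_all add: w_def vb_def)
        then have "(s - e) *\<^sub>R w = \<delta> *\<^sub>R vb - (x - y)" by simp
        note P = perspective_expansion[OF xU \<epsilon>(1,2) \<open>0 < \<delta>\<close> _ _ e(7) this, of v]
        have P1: "norm (vb - v) \<le> \<epsilon>"
        proof -
          have "vb = (\<gamma> (t + - \<delta>) - x) /\<^sub>R (- \<delta>)" by (simp add: vb_def e_def algebra_simps)
          then show ?thesis using vb[of "- \<delta>"] \<open>0 < \<delta>\<close> by simp
        qed
        have P2: "\<bar>t - s\<bar> + norm (x - y) = \<epsilon> * \<delta>" using k\<delta> by (simp add: k_def norm_minus_commute abs_minus_commute)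
        note P = P[OF P1 P2]
        have ge: "norm (\<gamma> r - x) \<le> \<rho>" if "r \<in> {e..t}" for r
          unfolding \<rho>_def by (rule near) (use that \<open>\<delta> \<le> \<delta>0\<close> e in auto)
        have e_cl: "\<gamma> e \<in> closure \<Omega>" by (rule path_in[OF \<gamma>]) (use e in auto)
        have 1: "u e (\<gamma> e) \<le> u s y + integral {e..s} (\<lambda>r. f r x) + (s - e) * (L x w + A * \<rho> * (1 + (norm w)\<^sup>2))"
          by (rule up[OF e(1,4,5) e_cl y \<rho>(1) _ yx' w_def]) (use ge[of e] e in auto)
        have finc: "fin_cost e t \<gamma>" by (rule optimalD(2)[OF opt e(1,3)])
        have vb': "vb = (\<gamma> t - \<gamma> e) /\<^sub>R (t - e)" by (simp add: vb_def x e)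
        have "0 \<le> (1 / (2 * \<mu>) - K * \<rho>) * integral {e..t} (\<lambda>r. (norm (vel \<gamma> r - vb))\<^sup>2)"
          using \<rho>(3) integral_nonneg[OF speed_variance(1)[OF \<gamma> e(1-3) finc vb']] by simp
        then have 2: "integral {e..t} (\<lambda>r. f r x) + \<delta> * (L x vb - 2 * K * \<rho> * (1 + (norm vb)\<^sup>2)) \<le> u e (\<gamma> e) - u t x"
          using cost_lower[OF \<gamma> e(1-3) finc x_cl ball ge vb'] optimal_dpp[OF opt e(1), of t] e x by simp
        have 3: "\<bar>integral {e..s} (\<lambda>r. f r x) - integral {e..t} (\<lambda>r. f r x) - (s - t) * f t x\<bar> \<le> \<epsilon> * \<bar>s - t\<bar>"
          by (rule d2(3)[OF d2']) (use e in auto)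
        have 4: "(s - e) * (A * \<rho> * (1 + (norm w)\<^sup>2)) + \<delta> * (2 * K * \<rho> * (1 + (norm vb)\<^sup>2)) \<le> \<epsilon> * k"
          by (rule quad) (use P in \<open>auto simp: V_def\<close>)
        have 5: "(s - e) * L x w - \<delta> * L x vb \<le> (t - s) * (q \<bullet> v - L x v) - q \<bullet> (x - y) + 16 * \<mu> * V\<^sup>2 * \<epsilon> * (\<epsilon> * \<delta>)"
          using P(5) by (simp add: q_def V_def)
        have "(q \<bullet> v - L x v - f t x) * (s - t) = - ((t - s) * (q \<bullet> v - L x v)) - (s - t) * f t x"
          "q \<bullet> (x - y) = - (q \<bullet> (y - x))" by (simp_all add: algebra_simps inner_diff_right)
        then show ?thesis
          using 1 2 3 4 5 Mk fin \<epsilon>s unfolding distrib_left[of "s - e"] right_diff_distrib[of \<delta>] by linarith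
      qed
      show ?thesis using upper lower unfolding abs_le_iff q_def[symmetric] k_def[symmetric] by linarith
    qed
  qed
qed

section \<open>Viscosity inequalities\<close>

text \<open>A curve that is optimal up to \<epsilon>h is followed for a time h, and its mean
  velocity is inserted into the supremum defining the Hamiltonian. The test function is replaced by
  its first order expansion, used only for later times. The energy bound keeps the curve near x but
  allows mean velocities as large as h^(-1/2); a bound independent of h comes from coercivity of L +
  <p, .> .\<close>

lemma supersolution_at:
  assumes t: "t \<in> {0<..<T}" and x: "x \<in> closure \<Omega>"
    and touch: "\<And>\<epsilon>. 0 < \<epsilon> \<Longrightarrow> \<exists>d>0. \<forall>s y. t \<le> s \<and> s < t + d \<and> y \<in> closure \<Omega> \<and> norm (y - x) < d \<longrightarrow>
      a * (s - t) + p \<bullet> (y - x) - \<epsilon> * (\<bar>s - t\<bar> + norm (y - x)) \<le> u s y - u t x"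
  shows "f t x \<le> - a + Ham L x p"
proof -
  have xU: "x \<in> U" using x U_sup by blast
  obtain E where E: "0 < E" "\<And>t s e \<gamma>. \<lbrakk>0 \<le> t; t \<le> s; s \<le> e; e \<le> T; \<gamma> \<in> paths T \<Omega>; fin_cost t T \<gamma>;
      integral {t..T} (ell \<gamma>) + g (\<gamma> T) \<le> u t (\<gamma> t) + 1\<rbrakk>
     \<Longrightarrow> integral {s..e} (\<lambda>r. (norm (vel \<gamma> r))\<^sup>2) \<le> E" using energy_bound by blast
  obtain r0 where r0: "r0 > 0" "cball x r0 \<subseteq> U" using U_open xU open_contains_cball by blast
  define C1 where "C1 = K + \<mu> * K\<^sup>2 + 2 * \<mu> * (norm p)\<^sup>2"
  have coerc: "(norm w)\<^sup>2 / (8 * \<mu>) - C1 \<le> L x w + p \<bullet> w" for w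
  proof -
    have "- (norm p * norm w) \<le> p \<bullet> w" using Cauchy_Schwarz_ineq2[of p w] by linarith
    moreover have "norm p * norm w \<le> (norm w)\<^sup>2 / (8 * \<mu>) + 2 * \<mu> * (norm p)\<^sup>2"
    proof -
      have "0 \<le> (norm w - 4 * \<mu> * norm p)\<^sup>2 / (8 * \<mu>)" using \<mu>_pos by simp
      also have "\<dots> = (norm w)\<^sup>2 / (8 * \<mu>) + 2 * \<mu> * (norm p)\<^sup>2 - norm p * norm w"
        using \<mu>_pos by (simp add: field_simps power2_eq_square)
      finally show ?thesis by simp
    qed
    moreover have "(norm w)\<^sup>2 / (4 * \<mu>) = (norm w)\<^sup>2 / (8 * \<mu>) + (norm w)\<^sup>2 / (8 * \<mu>)" by simp
    ultimately show ?thesis using L_coercive[OF xU, of w] unfolding C1_def by linarith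
  qed
  \<comment> \<open>Bounds |w|^2: coercivity gives |w|^2/(8\<mu>), the error term takes at most
    |w|^2/(16\<mu>), and the remaining half is bounded by the constants in brackets.\<close>
  define W where "W = 16 * \<mu> * (5 + \<bar>C1\<bar> + \<bar>f t x\<bar> + \<bar>a\<bar>)"
  have W: "0 \<le> W" using \<mu>_pos by (simp add: W_def)
  have key: "f t x + a - Ham L x p \<le> (5 + 2 * W) * \<epsilon>" if \<epsilon>: "0 < \<epsilon>" "\<epsilon> \<le> 1" "2 * \<epsilon> \<le> 1 / (16 * \<mu>)" for \<epsilon>
  proof -
    obtain d where d0: "d > 0" "\<forall>s y. t \<le> s \<and> s < t + d \<and> y \<in> closure \<Omega> \<and> norm (y - x) < d \<longrightarrow>
      a * (s - t) + p \<bullet> (y - x) - \<epsilon> * (\<bar>s - t\<bar> + norm (y - x)) \<le> u s y - u t x" using touch[OF \<epsilon>(1)] by (elim exE conjE)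
    note d = d0(1) d0(2)[rule_format, OF conjI[OF _ conjI[OF _ conjI]]]
    obtain d2 where d2: "0 < d2" "\<And>s e. \<lbrakk>\<bar>s - t\<bar> < d2; s \<le> T; 0 \<le> e; e \<le> s; e \<le> t\<rbrakk> \<Longrightarrow>
      \<bar>integral {e..s} (\<lambda>r. f r x) - integral {e..t} (\<lambda>r. f r x) - (s - t) * f t x\<bar> \<le> \<epsilon> * \<bar>s - t\<bar>"
      by (rule running_cost_derivative[OF x t \<epsilon>(1)]) (rule that; assumption)
    define \<rho> where "\<rho> = min (min (d / 2) r0) (min (\<epsilon> / (2 * (K + 1))) (1 / (2 * \<mu> * (K + 1))))"
    have \<rho>: "0 < \<rho>" "\<rho> < d" "\<rho> \<le> r0" "2 * K * \<rho> \<le> \<epsilon>" "K * \<rho> \<le> 1 / (2 * \<mu>)"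
    proof -
      have K1: "K + 1 > 0" using K_nonneg by simp
      have "0 < \<epsilon> / (2 * (K + 1))" "0 < 1 / (2 * \<mu> * (K + 1))" using \<epsilon> \<mu>_pos K1 by (auto intro!: divide_pos_pos mult_pos_pos)
      then show "0 < \<rho>" using d(1) r0(1) by (simp add: \<rho>_def)
      show "\<rho> < d" "\<rho> \<le> r0" using d(1) by (auto simp: \<rho>_def)
      have "\<rho> \<le> \<epsilon> / (2 * (K + 1))" "\<rho> \<le> 1 / (2 * \<mu> * (K + 1))" by (auto simp: \<rho>_def)
      then have 1: "\<rho> * (2 * (K + 1)) \<le> \<epsilon>" "\<rho> * (2 * \<mu> * (K + 1)) \<le> 1" using K1 \<mu>_pos by (auto simp: le_divide_eq)
      show "2 * K * \<rho> \<le> \<epsilon>" using 1(1) \<open>0 < \<rho>\<close> by (simp add: algebra_simps)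
      have "2 * \<mu> * (K * \<rho>) \<le> \<rho> * (2 * \<mu> * (K + 1))" using \<open>0 < \<rho>\<close> \<mu>_pos by (simp add: algebra_simps)
      then show "K * \<rho> \<le> 1 / (2 * \<mu>)" using 1 \<mu>_pos by (simp add: field_simps)
    qed
    define h where "h = min (min (d / 2) (d2 / 2)) (min (\<rho>\<^sup>2 / E) (min (T - t) 1))"
    have h: "0 < h" "h < d" "h < d2" "h \<le> T - t" "h \<le> 1" "sqrt (E * h) \<le> \<rho>"
    proof -
      show "0 < h" using d d2 \<rho> E t by (simp add: h_def)
      show "h < d" "h < d2" "h \<le> T - t" "h \<le> 1" using d(1) d2(1) by (auto simp: h_def)
      have "E * h \<le> E * (\<rho>\<^sup>2 / E)" using E by (intro mult_left_mono) (auto simp: h_def)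
      then show "sqrt (E * h) \<le> \<rho>" using E \<rho> by (intro real_le_lsqrt) auto
    qed
    define e where "e = t + h"
    have e: "0 \<le> t" "t < e" "e \<le> T" "e - t = h" using h t by (auto simp: e_def)
    have tT: "t \<in> {0..T}" using t by auto
    have "0 < \<epsilon> * h" using \<epsilon> h by simp
    then obtain \<gamma> where \<gamma>: "\<gamma> \<in> paths T \<Omega>" "\<gamma> t = x" "fin_cost t T \<gamma>" "integral {t..T} (ell \<gamma>) + g (\<gamma> T) \<le> u t x + \<epsilon> * h"
      using near_optimal[OF tT x] by blast
    have eh1: "\<epsilon> * h \<le> 1" using \<epsilon> h mult_mono[of \<epsilon> 1 h 1] by simp
    have near: "norm (\<gamma> r - x) \<le> \<rho>" if r: "r \<in> {t..e}" for r
    proof -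
      have "integral {t..r} (\<lambda>r. (norm (vel \<gamma> r))\<^sup>2) \<le> E"
        by (rule E(2)[of t]) (use \<gamma> r e eh1 in auto)
      then have "(r - t) * integral {t..r} (\<lambda>r. (norm (vel \<gamma> r))\<^sup>2) \<le> h * E"
        using r e E h by (intro mult_mono'[OF _ _ _ integral_nonneg] order_refl) 
          (auto intro!: set_lebesgue_integral_eq_integral(1)[OF speed_square_integrable[OF \<gamma>(1) _ _ fin_cost_sub[OF \<gamma>(3)]]])
      moreover have "(norm (\<gamma> r - \<gamma> t))\<^sup>2 \<le> (r - t) * integral {t..r} (\<lambda>r. (norm (vel \<gamma> r))\<^sup>2)"
        by (rule displacement_square[OF \<gamma>(1) _ _ _ fin_cost_sub[OF \<gamma>(3)]]) (use r e in auto)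
      ultimately have "norm (\<gamma> r - x) \<le> sqrt (E * h)" using \<gamma>(2) by (intro real_le_rsqrt) (simp add: mult.commute)
      then show ?thesis using h(6) by (rule order_trans)
    qed
    define w where "w = (\<gamma> e - \<gamma> t) /\<^sub>R (e - t)"
    have hw: "\<gamma> e - x = h *\<^sub>R w" using e h \<gamma>(2) by (simp add: w_def)
    have finc: "fin_cost t e \<gamma>" by (rule fin_cost_sub[OF \<gamma>(3)]) (use e in auto)
    have ball: "cball x \<rho> \<subseteq> U" using r0(2) \<rho>(3) by (meson order_trans subset_cball)
    have "0 \<le> (1 / (2 * \<mu>) - K * \<rho>) * integral {t..e} (\<lambda>r. (norm (vel \<gamma> r - w))\<^sup>2)"
      using \<rho>(5) integral_nonneg[OF speed_variance(1)[OF \<gamma>(1) e(1-3) finc w_def]] by simp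
    then have 1: "integral {t..e} (\<lambda>r. f r x) + h * (L x w - 2 * K * \<rho> * (1 + (norm w)\<^sup>2)) \<le> integral {t..e} (ell \<gamma>)"
      using cost_lower[OF \<gamma>(1) e(1-3) finc x ball near w_def] e by simp
    have 2: "integral {t..e} (ell \<gamma>) + u e (\<gamma> e) \<le> u t x + \<epsilon> * h"
      using dpp_ge[OF \<gamma>(1) e(1) _ e(3) \<gamma>(3)] \<gamma>(4) e by simp
    have 3: "a * (e - t) + p \<bullet> (\<gamma> e - x) - \<epsilon> * (\<bar>e - t\<bar> + norm (\<gamma> e - x)) \<le> u e (\<gamma> e) - u t x"
      by (rule d(2)) (use e h near[of e] \<rho>(2) path_in[OF \<gamma>(1)] in \<open>auto simp: e_def\<close>)
    have 4: "\<bar>integral {t..e} (\<lambda>r. f r x) - (e - t) * f t x\<bar> \<le> \<epsilon> * \<bar>e - t\<bar>"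
      using d2(2)[of e t] e h t by simp
    have "h * (a + p \<bullet> w - \<epsilon> * (1 + norm w)) \<le> u e (\<gamma> e) - u t x"
      using 3 h e by (simp add: hw algebra_simps)
    moreover have "h * (f t x - \<epsilon>) \<le> integral {t..e} (\<lambda>r. f r x)" using 4 h e by (simp add: algebra_simps abs_le_iff)
    ultimately have "h * (f t x - \<epsilon>) + h * (L x w - 2 * K * \<rho> * (1 + (norm w)\<^sup>2)) + h * (a + p \<bullet> w - \<epsilon> * (1 + norm w)) \<le> \<epsilon> * h"
      using 1 2 by linarith
    then have "h * ((f t x - \<epsilon>) + (L x w - 2 * K * \<rho> * (1 + (norm w)\<^sup>2)) + (a + p \<bullet> w - \<epsilon> * (1 + norm w))) \<le> h * \<epsilon>"
      by (simp add: algebra_simps)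
    then have "(f t x - \<epsilon>) + (L x w - 2 * K * \<rho> * (1 + (norm w)\<^sup>2)) + (a + p \<bullet> w - \<epsilon> * (1 + norm w)) \<le> \<epsilon>"
      using h(1) by simp
    moreover have "2 * K * \<rho> * (1 + (norm w)\<^sup>2) \<le> \<epsilon> * (1 + (norm w)\<^sup>2)" using \<rho>(4) by (intro mult_right_mono) auto
    moreover have "\<epsilon> * (1 + norm w) \<le> \<epsilon> * (2 + (norm w)\<^sup>2)"
    proof (rule mult_left_mono)
      have "0 \<le> (norm w - 1)\<^sup>2" "0 \<le> (norm w)\<^sup>2" by simp_all
      moreover have "(norm w - 1)\<^sup>2 = (norm w)\<^sup>2 - 2 * norm w + 1" by (simp add: power2_eq_square algebra_simps)
      ultimately show "1 + norm w \<le> 2 + (norm w)\<^sup>2" by linarith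
    qed (use \<epsilon> in simp)
    ultimately have main: "f t x + a + (L x w + p \<bullet> w) \<le> 5 * \<epsilon> + 2 * \<epsilon> * (norm w)\<^sup>2" by (simp add: algebra_simps)
    have "(norm w)\<^sup>2 \<le> W"
    proof -
      have "2 * \<epsilon> * (norm w)\<^sup>2 \<le> 1 / (16 * \<mu>) * (norm w)\<^sup>2" using \<epsilon>(3) by (intro mult_right_mono) auto
      moreover have "(norm w)\<^sup>2 / (8 * \<mu>) = 1 / (16 * \<mu>) * (norm w)\<^sup>2 + (norm w)\<^sup>2 / (16 * \<mu>)" by simp
      ultimately have "(norm w)\<^sup>2 / (16 * \<mu>) \<le> 5 + \<bar>C1\<bar> + \<bar>f t x\<bar> + \<bar>a\<bar>"
        using coerc[of w] main \<epsilon>(2) by linarith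
      then show ?thesis using \<mu>_pos by (simp add: W_def divide_le_eq mult.commute)
    qed
    then have "2 * \<epsilon> * (norm w)\<^sup>2 \<le> 2 * \<epsilon> * W" using \<epsilon> by (intro mult_left_mono) auto
    then show ?thesis using main Ham_ge[OF xU, of p w] by (simp add: algebra_simps)
  qed
  have "f t x + a - Ham L x p \<le> 0"
  proof (rule field_le_epsilon)
    fix \<eta> :: real assume "0 < \<eta>"
    define \<epsilon> where "\<epsilon> = min (min 1 (1 / (32 * \<mu>))) (\<eta> / (5 + 2 * W))"
    have "0 < \<epsilon>" using \<open>0 < \<eta>\<close> \<mu>_pos W by (simp add: \<epsilon>_def)
    moreover have "\<epsilon> \<le> 1" by (simp add: \<epsilon>_def)
    moreover have "2 * \<epsilon> \<le> 1 / (16 * \<mu>)"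
    proof -
      have "\<epsilon> \<le> 1 / (32 * \<mu>)" by (simp add: \<epsilon>_def)
      then show ?thesis by simp
    qed
    ultimately have "f t x + a - Ham L x p \<le> (5 + 2 * W) * \<epsilon>" by (rule key)
    also have "\<dots> \<le> (5 + 2 * W) * (\<eta> / (5 + 2 * W))" using W by (intro mult_left_mono) (auto simp: \<epsilon>_def)
    finally show "f t x + a - Ham L x p \<le> 0 + \<eta>" using W by simp
  qed
  then show ?thesis by linarith
qed

text \<open>At an interior point every velocity v is admissible for a short time h, so each v gives
  one inequality, and their supremum is the Hamiltonian. All positions stay within hN of x, which
  makes the error of freezing x of order h^2.\<close>

lemma subsolution_at:
  assumes t: "t \<in> {0<..<T}" and x: "x \<in> \<Omega>" and op: "open \<Omega>"
    and touch: "\<And>\<epsilon>. 0 < \<epsilon> \<Longrightarrow> \<exists>d>0. \<forall>s y. t \<le> s \<and> s < t + d \<and> y \<in> \<Omega> \<and> norm (y - x) < d \<longrightarrow>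
      u s y - u t x \<le> a * (s - t) + p \<bullet> (y - x) + \<epsilon> * (\<bar>s - t\<bar> + norm (y - x))"
  shows "- a + Ham L x p \<le> f t x"
proof -
  have x_cl: "x \<in> closure \<Omega>" using x closure_subset by blast
  obtain r0 where r0: "r0 > 0" "ball x r0 \<subseteq> \<Omega>" using op x openE by blast
  obtain A \<rho>0 where A: "0 \<le> A" "0 < \<rho>0" "cball x \<rho>0 \<subseteq> U" and
    up: "\<And>s e y z \<rho> w. \<lbrakk>0 \<le> s; s < e; e \<le> T; y \<in> closure \<Omega>; z \<in> closure \<Omega>; \<rho> \<le> \<rho>0; norm (y - x) \<le> \<rho>; norm (z - x) \<le> \<rho>;
        w = (z - y) /\<^sub>R (e - s)\<rbrakk>
      \<Longrightarrow> u s y \<le> u e z + integral {s..e} (\<lambda>r. f r x) + (e - s) * (L x w + A * \<rho> * (1 + (norm w)\<^sup>2))"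
    using cost_upper[OF x_cl] by blast
  have "- (p \<bullet> v) - L x v \<le> f t x + a" for v
  proof (rule field_le_epsilon)
    fix \<eta> :: real assume "0 < \<eta>"
    define N where "N = 1 + norm v"
    have N: "N \<ge> 1" "norm v \<le> N" by (auto simp: N_def)
    define \<epsilon> where "\<epsilon> = \<eta> / (4 * (N + 1))"
    have \<epsilon>: "0 < \<epsilon>" using \<open>0 < \<eta>\<close> N by (simp add: \<epsilon>_def)
    obtain d where d0: "d > 0" "\<forall>s y. t \<le> s \<and> s < t + d \<and> y \<in> \<Omega> \<and> norm (y - x) < d \<longrightarrow>
      u s y - u t x \<le> a * (s - t) + p \<bullet> (y - x) + \<epsilon> * (\<bar>s - t\<bar> + norm (y - x))" using touch[OF \<epsilon>] by (elim exE conjE)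
    note d = d0(1) d0(2)[rule_format, OF conjI[OF _ conjI[OF _ conjI]]]
    obtain d2 where d2: "0 < d2" "\<And>s e. \<lbrakk>\<bar>s - t\<bar> < d2; s \<le> T; 0 \<le> e; e \<le> s; e \<le> t\<rbrakk> \<Longrightarrow>
      \<bar>integral {e..s} (\<lambda>r. f r x) - integral {e..t} (\<lambda>r. f r x) - (s - t) * f t x\<bar> \<le> \<epsilon> * \<bar>s - t\<bar>"
      by (rule running_cost_derivative[OF x_cl t \<epsilon>(1)]) (rule that; assumption)
    define B where "B = A * N * (1 + (norm v)\<^sup>2)"
    have B: "0 \<le> B" using A N by (simp add: B_def)
    define h where "h = min (min (d / (2 * N)) (d2 / 2)) (min (min (\<rho>0 / N) (r0 / (2 * N))) (min (T - t) (\<eta> / (2 * (B + 1)))))"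
    have h: "0 < h" "h < d2" "h \<le> T - t" "h * N < d" "h * N < r0" "h * N \<le> \<rho>0" "h * B \<le> \<eta> / 2"
    proof -
      have "0 < d / (2 * N)" "0 < \<rho>0 / N" "0 < r0 / (2 * N)" "0 < \<eta> / (2 * (B + 1))"
        using d(1) N A(2) r0(1) \<open>0 < \<eta>\<close> B by auto
      then show "0 < h" using d2(1) t by (simp add: h_def)
      show "h < d2" "h \<le> T - t" using d2(1) by (auto simp: h_def)
      have "h \<le> d / (2 * N)" "h \<le> \<rho>0 / N" "h \<le> r0 / (2 * N)" "h \<le> \<eta> / (2 * (B + 1))" by (auto simp: h_def)
      then have "h * (2 * N) \<le> d" "h * N \<le> \<rho>0" "h * (2 * N) \<le> r0" "h * (2 * (B + 1)) \<le> \<eta>"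
        using N B by (auto simp: le_divide_eq)
      then show "h * N < d" "h * N < r0" "h * N \<le> \<rho>0" "h * B \<le> \<eta> / 2" using d(1) r0(1) \<open>0 < h\<close> by (auto simp: algebra_simps)
    qed
    define e where "e = t + h"
    have e: "0 \<le> t" "t < e" "e \<le> T" "e - t = h" using h t by (auto simp: e_def)
    define z where "z = x + h *\<^sub>R v"
    have zx: "norm (z - x) \<le> h * N" using h N by (simp add: z_def)
    have z: "z \<in> \<Omega>" using zx h(5) r0(2) by (auto simp: dist_norm norm_minus_commute subset_iff)
    then have z_cl: "z \<in> closure \<Omega>" using closure_subset by blast
    have v: "v = (z - x) /\<^sub>R (e - t)" using e h by (simp add: z_def)
    have "u t x \<le> u e z + integral {t..e} (\<lambda>r. f r x) + (e - t) * (L x v + A * (h * N) * (1 + (norm v)\<^sup>2))"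
      by (rule up[OF e(1-3) x_cl z_cl h(6) _ zx v]) (use h N in simp)
    moreover have "u e z - u t x \<le> a * (e - t) + p \<bullet> (z - x) + \<epsilon> * (\<bar>e - t\<bar> + norm (z - x))"
      by (rule d(2)[OF _ _ z]) (use e h zx N in \<open>auto simp: e_def intro: le_less_trans[OF _ h(4)]\<close>)
    moreover have "\<bar>integral {t..e} (\<lambda>r. f r x) - (e - t) * f t x\<bar> \<le> \<epsilon> * \<bar>e - t\<bar>"
      using d2(2)[of e t] e h t by simp
    moreover have "\<epsilon> * norm (z - x) \<le> \<epsilon> * (h * N)" using zx \<epsilon> by (intro mult_left_mono) auto
    ultimately have "0 \<le> a * h + p \<bullet> (h *\<^sub>R v) + \<epsilon> * h + \<epsilon> * (h * N) + (h * f t x + \<epsilon> * h) + h * (L x v + A * (h * N) * (1 + (norm v)\<^sup>2))"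
      using e h(1) by (simp add: z_def algebra_simps)
    also have "\<dots> = h * (a + p \<bullet> v + \<epsilon> * (2 + N) + f t x + L x v + h * B)" by (simp add: B_def algebra_simps)
    finally have "0 \<le> a + p \<bullet> v + \<epsilon> * (2 + N) + f t x + L x v + h * B" using h(1) by (simp add: zero_le_mult_iff)
    moreover have "\<epsilon> * (2 + N) \<le> \<epsilon> * (2 * (N + 1)) " using \<epsilon> N by (intro mult_left_mono) auto
    moreover have "\<epsilon> * (2 * (N + 1)) = \<eta> / 2"
    proof -
      have "\<epsilon> * (4 * (N + 1)) = \<eta>" using N by (simp add: \<epsilon>_def)
      then show ?thesis by (simp add: algebra_simps)
    qed
    ultimately show "- (p \<bullet> v) - L x v \<le> f t x + a + \<eta>" using h(7) by linarith
  qed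
  then have "Ham L x p \<le> f t x + a" unfolding Ham_def by (intro cSUP_least) auto
  then show ?thesis by linarith
qed

section \<open>Compactness of optimal curves\<close>

text \<open>On one interval of length b and energy I, Cauchy-Schwarz gives D^2 \<le> b I for the
  displacement D, and Young turns this into D \<le> \<alpha> I + b/\<alpha>. Disjointness lets the
  energies add up to at most E, uniformly over optimal curves.\<close>

lemma optimal_energy_sum:
  obtains E where "0 \<le> E" "\<And>\<gamma> (n::nat) s t \<alpha>. \<lbrakk>optimal \<gamma>; \<And>i. i < n \<Longrightarrow> 0 \<le> s i; \<And>i. i < n \<Longrightarrow> s i \<le> t i; \<And>i. i < n \<Longrightarrow> t i \<le> T;
        \<And>i j. \<lbrakk>i < n; j < n; i \<noteq> j\<rbrakk> \<Longrightarrow> t i \<le> s j \<or> t j \<le> s i; \<alpha> > 0\<rbrakk>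
        \<Longrightarrow> (\<Sum>i<n. norm (\<gamma> (t i) - \<gamma> (s i))) \<le> \<alpha> * E + (\<Sum>i<n. t i - s i) / \<alpha>"
proof -
  obtain E where E: "0 < E" "\<And>\<gamma> s e. \<lbrakk>optimal \<gamma>; 0 \<le> s; s \<le> e; e \<le> T\<rbrakk> \<Longrightarrow> integral {s..e} (\<lambda>r. (norm (vel \<gamma> r))\<^sup>2) \<le> E"
    using optimal_energy by blast
  show thesis
  proof (rule that[of E])
    fix \<gamma> and n :: nat and s t and \<alpha> :: real
    assume opt: "optimal \<gamma>" and st: "\<And>i. i < n \<Longrightarrow> 0 \<le> s i" "\<And>i. i < n \<Longrightarrow> s i \<le> t i" "\<And>i. i < n \<Longrightarrow> t i \<le> T"
      and disj: "\<And>i j. \<lbrakk>i < n; j < n; i \<noteq> j\<rbrakk> \<Longrightarrow> t i \<le> s j \<or> t j \<le> s i" and "\<alpha> > 0"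
    define h where "h r = (norm (vel \<gamma> r))\<^sup>2" for r
    have \<gamma>: "\<gamma> \<in> paths T \<Omega>" using opt by (simp add: optimal_def)
    have hint: "h integrable_on {a..b}" if "0 \<le> a" "b \<le> T" for a b
      unfolding h_def
      by (rule set_lebesgue_integral_eq_integral(1)[OF speed_square_integrable[OF \<gamma> that optimalD(2)[OF opt that]]])
    define I where "I i = integral {s i..t i} h" for i
    have one: "norm (\<gamma> (t i) - \<gamma> (s i)) \<le> \<alpha> * I i + (t i - s i) / \<alpha>" if "i < n" for i
    proof (cases "s i = t i")
      case False
      then have lt: "s i < t i" using st(2)[OF that] by simp
      define D where "D = norm (\<gamma> (t i) - \<gamma> (s i))"
      define b where "b = t i - s i"
      have "b > 0" using lt by (simp add: b_def)
      have "D\<^sup>2 \<le> b * I i" unfolding D_def b_def I_def h_def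
        using displacement_square[OF \<gamma> st(1)[OF that] st(2)[OF that] st(3)[OF that] optimalD(2)[OF opt st(1)[OF that] st(3)[OF that]]] .
      then have "\<alpha> * D\<^sup>2 / b \<le> \<alpha> * I i" using \<open>b > 0\<close> \<open>\<alpha> > 0\<close> by (simp add: field_simps)
      moreover have "D \<le> \<alpha> * D\<^sup>2 / b + b / \<alpha>"
      proof -
        have "0 \<le> (\<alpha> * D - b)\<^sup>2 / (\<alpha> * b) " using \<open>b > 0\<close> \<open>\<alpha> > 0\<close> by simp
        also have "\<dots> = \<alpha> * D\<^sup>2 / b + b / \<alpha> - 2 * D" using \<open>b > 0\<close> \<open>\<alpha> > 0\<close> by (simp add: field_simps power2_eq_square)
        finally show ?thesis using norm_ge_zero[of "\<gamma> (t i) - \<gamma> (s i)"] unfolding D_def by linarith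
      qed
      ultimately show ?thesis by (simp add: D_def b_def)
    qed (simp add: I_def)
    \<comment> \<open>Open intervals, since the closed ones may share end points: now every r
      belongs to at most one of them.\<close>
    have "((\<lambda>r. \<Sum>i<n. if r \<in> {s i<..<t i} then h r else 0) has_integral (\<Sum>i<n. I i)) {0..T}"
    proof (rule has_integral_sum)
      fix i assume "i \<in> {..<n}"
      then have i: "i < n" by simp
      have "(h has_integral I i) {s i..t i}" unfolding I_def
        by (rule integrable_integral[OF hint[OF st(1)[OF i] st(3)[OF i]]])
      then have "(h has_integral I i) {s i<..<t i}" using has_integral_open_interval[of h "I i" "s i" "t i"] by simp
      then show "((\<lambda>r. if r \<in> {s i<..<t i} then h r else 0) has_integral I i) {0..T}"
        by (subst has_integral_restrict) (use st[OF i] in auto)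
    qed simp
    moreover have "(h has_integral integral {0..T} h) {0..T}" by (rule integrable_integral[OF hint]) auto
    moreover have "(\<Sum>i<n. if r \<in> {s i<..<t i} then h r else 0) \<le> h r" for r
    proof (cases "\<exists>i<n. r \<in> {s i<..<t i}")
      case True
      then obtain i where i: "i < n" "r \<in> {s i<..<t i}" by blast
      have "(\<Sum>j<n. if r \<in> {s j<..<t j} then h r else 0) = (\<Sum>j<n. if j = i then h r else 0)"
      proof (rule sum.cong[OF refl])
        fix j assume "j \<in> {..<n}"
        then show "(if r \<in> {s j<..<t j} then h r else 0) = (if j = i then h r else 0)"
          using disj[of i j] i by (cases "j = i") auto
      qed
      then show ?thesis using i by simp
    next
      case False
      then have "(\<Sum>j<n. if r \<in> {s j<..<t j} then h r else 0) = 0" by (intro sum.neutral) auto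
      then show ?thesis by (simp add: h_def)
    qed
    ultimately have "(\<Sum>i<n. I i) \<le> integral {0..T} h" by (rule has_integral_le) 
    also have "\<dots> \<le> E" unfolding h_def using E(2)[OF opt, of 0 T] T_pos by simp
    finally have "\<alpha> * (\<Sum>i<n. I i) \<le> \<alpha> * E" using \<open>\<alpha> > 0\<close> by simp
    moreover have "(\<Sum>i<n. norm (\<gamma> (t i) - \<gamma> (s i))) \<le> (\<Sum>i<n. \<alpha> * I i + (t i - s i) / \<alpha>)"
      by (rule sum_mono) (use one in auto)
    moreover have "(\<Sum>i<n. \<alpha> * I i + (t i - s i) / \<alpha>) = \<alpha> * (\<Sum>i<n. I i) + (\<Sum>i<n. t i - s i) / \<alpha>"
      by (simp add: sum.distrib sum_distrib_left sum_divide_distrib)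
    ultimately show "(\<Sum>i<n. norm (\<gamma> (t i) - \<gamma> (s i))) \<le> \<alpha> * E + (\<Sum>i<n. t i - s i) / \<alpha>" by linarith
  qed (use E in simp)
qed

text \<open>Arzela-Ascoli with the uniform Hoelder bound; absolute continuity of the limit comes
  from the energy criterion. The limit is not claimed to be optimal here: that will follow from
  closedness of the support of the equilibrium.\<close>

lemma optimal_sequence_compact:
  assumes opt: "\<And>k. optimal (\<gamma> k)"
  obtains \<phi> r where "\<phi> \<in> paths T \<Omega>" "strict_mono (r :: nat \<Rightarrow> nat)"
    "\<And>e. 0 < e \<Longrightarrow> \<exists>N. \<forall>n\<ge>N. \<forall>t. norm (\<gamma> (r n) t - \<phi> t) < e"
proof -
  have \<gamma>: "\<gamma> k \<in> paths T \<Omega>" for k using opt by (simp add: optimal_def)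
  obtain E where E: "0 < E" "\<And>\<gamma> s e. \<lbrakk>optimal \<gamma>; s \<in> {0..T}; e \<in> {0..T}\<rbrakk> \<Longrightarrow> norm (\<gamma> e - \<gamma> s) \<le> sqrt (E * \<bar>e - s\<bar>)"
    using optimal_hoelder by blast
  obtain B where B: "\<And>x. x \<in> closure \<Omega> \<Longrightarrow> norm x \<le> B" using compact_imp_bounded[OF compact_domain] by (auto simp: bounded_iff)
  obtain G r where G: "continuous_on {0..T} G" "strict_mono (r :: nat \<Rightarrow> nat)"
    "\<And>e. 0 < e \<Longrightarrow> \<exists>N. \<forall>n x. n \<ge> N \<and> x \<in> {0..T} \<longrightarrow> norm (\<gamma> (r n) x - G x) < e"
  proof (rule Arzela_Ascoli[of "{0..T}" \<gamma> B])
    show "norm (\<gamma> n x) \<le> B" if "x \<in> {0..T}" for n x using B path_in[OF \<gamma> that] by blast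
    fix x e :: real assume x: "x \<in> {0..T}" and "0 < e"
    show "\<exists>d. 0 < d \<and> (\<forall>n y. y \<in> {0..T} \<and> norm (x - y) < d \<longrightarrow> norm (\<gamma> n x - \<gamma> n y) < e)"
    proof (intro exI[of _ "e\<^sup>2 / E"] conjI allI impI; (elim conjE)?)
      fix n y assume y: "y \<in> {0..T}" "norm (x - y) < e\<^sup>2 / E"
      have "norm (\<gamma> n x - \<gamma> n y) \<le> sqrt (E * \<bar>x - y\<bar>)" by (rule E(2)[OF opt y(1) x])
      also have "\<dots> < sqrt (e\<^sup>2)" using y(2) E(1) by (intro real_sqrt_less_mono) (simp add: field_simps)
      finally show "norm (\<gamma> n x - \<gamma> n y) < e" using \<open>0 < e\<close> by simp
    qed (use \<open>0 < e\<close> E in simp)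
  qed auto
  \<comment> \<open>\<open>G\<close> is controlled on [0, T] only; clamping restores the convention
    of \<open>paths\<close> and makes the convergence uniform on the whole line, hence in the norm
    of the curve space.\<close>
  define \<phi> where "\<phi> t = G (min T (max 0 t))" for t
  have clamp: "min T (max 0 t) \<in> {0..T}" for t using T_pos by auto
  have unif: "\<exists>N. \<forall>n\<ge>N. \<forall>t. norm (\<gamma> (r n) t - \<phi> t) < e" if "0 < e" for e
  proof -
    obtain N where N: "\<And>n x. n \<ge> N \<Longrightarrow> x \<in> {0..T} \<Longrightarrow> norm (\<gamma> (r n) x - G x) < e" using G(3)[OF \<open>0 < e\<close>] by blast
    have "norm (\<gamma> (r n) t - \<phi> t) < e" if "n \<ge> N" for n t
    proof -
      have "\<gamma> (r n) t = \<gamma> (r n) (min T (max 0 t))" using \<gamma>[of "r n"] unfolding paths_def by blast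
      then show ?thesis using N[OF that clamp[of t]] by (simp add: \<phi>_def)
    qed
    then show ?thesis by blast
  qed
  have lim: "(\<lambda>n. \<gamma> (r n) t) \<longlonglongrightarrow> \<phi> t" for t
    unfolding LIMSEQ_iff using unif by meson
  obtain E2 where E2: "0 \<le> E2" "\<And>\<gamma> (n::nat) s t \<alpha>. \<lbrakk>optimal \<gamma>; \<And>i. i < n \<Longrightarrow> 0 \<le> s i; \<And>i. i < n \<Longrightarrow> s i \<le> t i; \<And>i. i < n \<Longrightarrow> t i \<le> T;
        \<And>i j. \<lbrakk>i < n; j < n; i \<noteq> j\<rbrakk> \<Longrightarrow> t i \<le> s j \<or> t j \<le> s i; \<alpha> > 0\<rbrakk>
        \<Longrightarrow> (\<Sum>i<n. norm (\<gamma> (t i) - \<gamma> (s i))) \<le> \<alpha> * E2 + (\<Sum>i<n. t i - s i) / \<alpha>"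
    by (rule optimal_energy_sum) (rule that, assumption, blast)
  have "\<phi> \<in> paths T \<Omega>"
    unfolding paths_def
  proof (intro CollectI conjI allI ballI)
    show "\<phi> t = \<phi> (min T (max 0 t))" for t
    proof -
      have "min T (max 0 t) = min T (max 0 (min T (max 0 t)))" using T_pos by (auto simp: min_def max_def)
      then show ?thesis unfolding \<phi>_def by (rule arg_cong)
    qed
    show "abs_cont_on 0 T \<phi>"
    proof (rule abs_cont_onI_energy[OF E2(1)])
      fix n :: nat and s t and \<alpha> :: real
      assume *: "\<And>i. i < n \<Longrightarrow> 0 \<le> s i" "\<And>i. i < n \<Longrightarrow> s i \<le> t i" "\<And>i. i < n \<Longrightarrow> t i \<le> T"
        "\<And>i j. \<lbrakk>i < n; j < n; i \<noteq> j\<rbrakk> \<Longrightarrow> t i \<le> s j \<or> t j \<le> s i" "\<alpha> > 0"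
      have "(\<lambda>k. \<Sum>i<n. norm (\<gamma> (r k) (t i) - \<gamma> (r k) (s i))) \<longlonglongrightarrow> (\<Sum>i<n. norm (\<phi> (t i) - \<phi> (s i)))"
        by (intro tendsto_intros lim)
      then show "(\<Sum>i<n. norm (\<phi> (t i) - \<phi> (s i))) \<le> \<alpha> * E2 + (\<Sum>i<n. t i - s i) / \<alpha>"
      proof (rule LIMSEQ_le_const2)
        show "\<exists>N. \<forall>k\<ge>N. (\<Sum>i<n. norm (\<gamma> (r k) (t i) - \<gamma> (r k) (s i))) \<le> \<alpha> * E2 + (\<Sum>i<n. t i - s i) / \<alpha>"
          by (intro exI[of _ 0] allI impI E2(2)[OF opt]) (use * in auto)
      qed
    qed
    show "\<phi> t \<in> closure \<Omega>" if "t \<in> {0..T}" for t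
      using closed_sequentially[OF closed_closure _ lim[of t]] path_in[OF \<gamma> that] by blast
  qed
  then show thesis using that G(2) unif by blast
qed

end

section \<open>Domains with a boundary of class \<open>C\<^sup>2\<close>\<close>

text \<open>The three working properties of a local defining function: the closure is its sublevel
  set at 0, Taylor's formula has a uniform quadratic remainder, and moving against the normal at the
  centre lowers the function at a definite rate.\<close>

lemma local_C2_facts:
  assumes loc: "local_C2_defining \<Omega> x0 R \<psi> \<psi>' \<psi>''" and "0 < R" and op: "open \<Omega>"
  obtains r B where "0 < r" "r < R" "0 \<le> B"
    "\<forall>y\<in>ball x0 r. y \<in> closure \<Omega> \<longleftrightarrow> \<psi> y \<le> 0"
    "\<forall>y\<in>ball x0 r. \<forall>z\<in>ball x0 r. \<bar>\<psi> z - \<psi> y - \<psi>' y \<bullet> (z - y)\<bar> \<le> B * (norm (z - y))\<^sup>2"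
    "\<forall>y\<in>ball x0 r. \<forall>\<tau>\<ge>0. y - \<tau> *\<^sub>R (\<psi>' x0 /\<^sub>R norm (\<psi>' x0)) \<in> ball x0 r \<longrightarrow>
       \<psi> (y - \<tau> *\<^sub>R (\<psi>' x0 /\<^sub>R norm (\<psi>' x0))) \<le> \<psi> y - \<tau> * (norm (\<psi>' x0) / 2)"
proof -
  have d1: "(\<psi> has_derivative (\<lambda>h. \<psi>' x \<bullet> h)) (at x)" and d2: "(\<psi>' has_derivative \<psi>'' x) (at x)" and nz: "\<psi>' x \<noteq> 0"
    if "x \<in> ball x0 R" for x
    using loc that unfolding local_C2_defining_def by auto
  have cont2: "continuous_on (ball x0 R) (\<lambda>x. \<psi>'' x h)" for h
    using loc unfolding local_C2_defining_def by blast
  have \<Omega>: "\<Omega> \<inter> ball x0 R = {x\<in>ball x0 R. \<psi> x < 0}" using loc unfolding local_C2_defining_def by blast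
  have x0: "x0 \<in> ball x0 R" using \<open>0 < R\<close> by simp
  have cl: "y \<in> closure \<Omega> \<longleftrightarrow> \<psi> y \<le> 0" if y: "y \<in> ball x0 R" for y
  proof
    assume "\<psi> y \<le> 0"
    show "y \<in> closure \<Omega>"
    proof (cases "\<psi> y < 0")
      case True then show ?thesis using \<Omega> y closure_subset by blast
    next
      case False
      then have "\<psi> y = 0" using \<open>\<psi> y \<le> 0\<close> by simp
      define k where "k = norm (\<psi>' y)"
      have "k > 0" using nz[OF y] by (simp add: k_def)
      \<comment> \<open>At a zero of \<psi>, moving against the nonvanishing gradient enters
        \<Omega> at once, so the point lies in the closure.\<close>
      have D: "((\<lambda>s. \<psi> (y - s *\<^sub>R \<psi>' y)) has_real_derivative - k\<^sup>2) (at 0)"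
      proof -
        have "((\<lambda>s::real. y - s *\<^sub>R \<psi>' y) has_derivative (\<lambda>h. - (h *\<^sub>R \<psi>' y))) (at 0)"
          by (auto intro!: derivative_eq_intros)
        from has_derivative_compose[OF this, of \<psi> "\<lambda>h. \<psi>' y \<bullet> h"] d1[OF y]
        have "((\<lambda>s. \<psi> (y - s *\<^sub>R \<psi>' y)) has_derivative (\<lambda>h. \<psi>' y \<bullet> (- (h *\<^sub>R \<psi>' y)))) (at 0)" by simp
        then show ?thesis unfolding has_field_derivative_def
          by (rule has_derivative_eq_rhs) (simp add: fun_eq_iff k_def power2_norm_eq_inner)
      qed
      have "- k\<^sup>2 < 0" using \<open>k > 0\<close> by simp
      obtain d where d: "d > 0" "\<And>h. \<lbrakk>0 < h; h < d\<rbrakk> \<Longrightarrow> \<psi> (y - h *\<^sub>R \<psi>' y) < 0"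
        using DERIV_neg_dec_right[OF D \<open>- k\<^sup>2 < 0\<close>] \<open>\<psi> y = 0\<close> by auto
      show ?thesis unfolding closure_approachable
      proof (intro allI impI)
        fix e :: real assume "0 < e"
        define h where "h = min (d / 2) (min e (R - dist x0 y) / (2 * k))"
        have "0 < min e (R - dist x0 y)" using \<open>0 < e\<close> y by simp
        then have h: "0 < h" "h < d" "h * (2 * k) \<le> min e (R - dist x0 y)"
        proof -
          show "0 < h" "h < d" using d \<open>0 < min e (R - dist x0 y)\<close> \<open>k > 0\<close> by (auto simp: h_def)
          have "h \<le> min e (R - dist x0 y) / (2 * k)" unfolding h_def by (rule min.cobounded2)
          then show "h * (2 * k) \<le> min e (R - dist x0 y)" using \<open>k > 0\<close> by (simp add: le_divide_eq)
        qed
        have dy: "dist (y - h *\<^sub>R \<psi>' y) y = h * k" using h by (simp add: dist_norm k_def)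
        have hk: "0 < h * k" using h \<open>k > 0\<close> by simp
        have 1: "h * k < e" "h * k < R - dist x0 y" using h(3) hk by auto
        have "dist x0 (y - h *\<^sub>R \<psi>' y) \<le> dist x0 y + dist (y - h *\<^sub>R \<psi>' y) y" by (metis dist_commute dist_triangle)
        then have "y - h *\<^sub>R \<psi>' y \<in> ball x0 R" using 1 dy by simp
        then have "y - h *\<^sub>R \<psi>' y \<in> \<Omega>" using d(2)[OF h(1,2)] \<Omega> by blast
        then show "\<exists>z\<in>\<Omega>. dist z y < e" using dy 1 by (intro bexI[of _ "y - h *\<^sub>R \<psi>' y"]) auto
      qed
    qed
  next
    assume "y \<in> closure \<Omega>"
    show "\<psi> y \<le> 0"
    proof (rule ccontr)
      assume "\<not> \<psi> y \<le> 0"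
      have "isCont \<psi> y" using d1[OF y] by (rule has_derivative_continuous)
      then obtain d1 where d1: "d1 > 0" "\<And>z. dist z y < d1 \<Longrightarrow> dist (\<psi> z) (\<psi> y) < \<psi> y"
        using \<open>\<not> \<psi> y \<le> 0\<close> unfolding continuous_at_eps_delta by (metis not_le)
      obtain d2 where d2: "d2 > 0" "ball y d2 \<subseteq> ball x0 R" using y openE[OF open_ball] by blast
      define d where "d = min d1 d2"
      have "d > 0" using d1 d2 by (simp add: d_def)
      moreover have "\<psi> z > 0 \<and> z \<in> ball x0 R" if "dist z y < d" for z
      proof
        show "\<psi> z > 0" using d1(2)[of z] that by (auto simp: d_def dist_real_def)
        have "z \<in> ball y d2" using that by (simp add: d_def dist_commute)
        then show "z \<in> ball x0 R" using d2 by blast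
      qed
      moreover obtain z where "z \<in> \<Omega>" "dist z y < d" using \<open>y \<in> closure \<Omega>\<close> \<open>d > 0\<close> closure_approachable by blast
      ultimately have "z \<in> \<Omega>" "\<psi> z > 0" "z \<in> ball x0 R" by auto
      then have "z \<in> {x \<in> ball x0 R. \<psi> x < 0}" unfolding \<Omega>[symmetric] by blast
      then show False using \<open>\<psi> z > 0\<close> by auto
    qed
  qed
  define c0 where "c0 = norm (\<psi>' x0) / 2"
  have c0: "c0 > 0" using nz[OF x0] by (simp add: c0_def)
  \<comment> \<open>Continuity of the second derivative is available for each fixed direction;
    bounds on a compact ball for the basis vectors add up to a bound on the operator.\<close>
  obtain B where B: "0 \<le> B" "\<And>x h. x \<in> cball x0 (R/2) \<Longrightarrow> norm (\<psi>'' x h) \<le> B * norm h"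
  proof -
    have "\<exists>C. \<forall>x\<in>cball x0 (R/2). norm (\<psi>'' x b) \<le> C" for b
    proof -
      have "compact ((\<lambda>x. \<psi>'' x b) ` cball x0 (R/2))"
        by (intro compact_continuous_image continuous_on_subset[OF cont2]) (use \<open>0 < R\<close> in auto)
      then have "bounded ((\<lambda>x. \<psi>'' x b) ` cball x0 (R/2))" by (rule compact_imp_bounded)
      then show ?thesis unfolding bounded_iff by blast
    qed
    then obtain C where C: "\<And>b x. x \<in> cball x0 (R/2) \<Longrightarrow> norm (\<psi>'' x b) \<le> C b" by metis
    have C0: "0 \<le> C b" for b using C[of x0 b] norm_ge_zero[of "\<psi>'' x0 b"] \<open>0 < R\<close> by (meson centre_in_cball divide_nonneg_nonneg less_imp_le order_trans zero_le_numeral)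
    show thesis
    proof (rule that[of "\<Sum>b\<in>Basis. C b"])
      show "0 \<le> (\<Sum>b\<in>Basis. C b)" by (intro sum_nonneg C0)
      fix x h assume x: "x \<in> cball x0 (R/2)"
      then have "x \<in> ball x0 R" using \<open>0 < R\<close> by auto
      then have lin: "linear (\<psi>'' x)" using d2 has_derivative_linear by blast
      have "\<psi>'' x h = \<psi>'' x (\<Sum>b\<in>Basis. (h \<bullet> b) *\<^sub>R b)" by (simp add: euclidean_representation)
      also have "\<dots> = (\<Sum>b\<in>Basis. (h \<bullet> b) *\<^sub>R \<psi>'' x b)" by (simp add: linear_sum[OF lin] linear_cmul[OF lin])
      also have "norm \<dots> \<le> (\<Sum>b\<in>Basis. norm h * C b)"
      proof (rule sum_norm_le)
        fix b :: 'a assume "b \<in> Basis"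
        then show "norm ((h \<bullet> b) *\<^sub>R \<psi>'' x b) \<le> norm h * C b"
          using C[OF x, of b] C0[of b] Basis_le_norm[of b h] by (simp add: mult_mono)
      qed
      finally show "norm (\<psi>'' x h) \<le> (\<Sum>b\<in>Basis. C b) * norm h" unfolding sum_distrib_left[symmetric] by (simp add: mult.commute)
    qed
  qed
  have lip: "norm (\<psi>' y - \<psi>' z) \<le> B * norm (y - z)" if "y \<in> cball x0 (R/2)" "z \<in> cball x0 (R/2)" for y z
  proof (rule differentiable_bound[OF convex_cball[of x0 "R/2"] _ _ that, of \<psi>' \<psi>''])
    fix x assume x: "x \<in> cball x0 (R/2)"
    then have "x \<in> ball x0 R" using \<open>0 < R\<close> by auto
    then show "(\<psi>' has_derivative \<psi>'' x) (at x within cball x0 (R/2))" using d2 has_derivative_at_withinI by blast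
    show "onorm (\<psi>'' x) \<le> B" by (rule onorm_bound[OF B(1) B(2)[OF x]])
  qed
  have mv: "\<exists>\<xi>\<in>closed_segment y z. \<psi> z - \<psi> y = \<psi>' \<xi> \<bullet> (z - y)" if "y \<in> ball x0 R" "z \<in> ball x0 R" for y z
  proof -
    have seg: "closed_segment y z \<subseteq> ball x0 R" using that by (intro closed_segment_subset) auto
    have pt: "y + \<theta> *\<^sub>R (z - y) \<in> closed_segment y z" if "0 \<le> \<theta>" "\<theta> \<le> 1" for \<theta>
      using that unfolding in_segment by (intro exI[of _ \<theta>]) (auto simp: algebra_simps)
    have "\<exists>\<theta>>0. \<theta> < 1 \<and> \<psi> (y + 1 *\<^sub>R (z - y)) - \<psi> (y + 0 *\<^sub>R (z - y)) = (1 - 0) * (\<psi>' (y + \<theta> *\<^sub>R (z - y)) \<bullet> (z - y))"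
    proof (rule MVT2)
      fix \<theta> :: real assume "0 \<le> \<theta>" "\<theta> \<le> 1"
      then have "y + \<theta> *\<^sub>R (z - y) \<in> ball x0 R" using seg pt by blast
      from d1[OF this] have d: "(\<psi> has_derivative (\<lambda>h. \<psi>' (y + \<theta> *\<^sub>R (z - y)) \<bullet> h)) (at (y + \<theta> *\<^sub>R (z - y)))" .
      have "((\<lambda>s. y + s *\<^sub>R (z - y)) has_derivative (\<lambda>h. h *\<^sub>R (z - y))) (at \<theta>)" by (auto intro!: derivative_eq_intros)
      from has_derivative_compose[OF this d]
      show "((\<lambda>\<theta>. \<psi> (y + \<theta> *\<^sub>R (z - y))) has_real_derivative \<psi>' (y + \<theta> *\<^sub>R (z - y)) \<bullet> (z - y)) (at \<theta>)"
        unfolding has_field_derivative_def by (rule has_derivative_eq_rhs) (simp add: fun_eq_iff)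
    qed simp
    then show ?thesis using pt by force
  qed
  \<comment> \<open>On this ball the gradient deviates from its value at the centre by at most half
    of its norm, so its component along the normal stays above c0.\<close>
  define r where "r = min (R / 2) (c0 / (B + 1))"
  have r: "0 < r" "r \<le> R / 2" "r * B \<le> c0"
  proof -
    show "0 < r" using \<open>0 < R\<close> c0 B(1) by (simp add: r_def)
    show "r \<le> R / 2" unfolding r_def by (rule min.cobounded1)
    have "r \<le> c0 / (B + 1)" by (simp add: r_def)
    then have "r * (B + 1) \<le> c0" using B(1) by (simp add: le_divide_eq)
    then show "r * B \<le> c0" using \<open>0 < r\<close> by (simp add: algebra_simps)
  qed
  have sub: "ball x0 r \<subseteq> ball x0 R" "ball x0 r \<subseteq> cball x0 (R/2)" using r \<open>0 < R\<close> by auto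
  show thesis
  proof (rule that)
    show "0 < r" "r < R" "0 \<le> B" using r \<open>0 < R\<close> B by auto
    show "\<forall>y\<in>ball x0 r. y \<in> closure \<Omega> \<longleftrightarrow> \<psi> y \<le> 0" using cl sub by blast
    show "\<forall>y\<in>ball x0 r. \<forall>z\<in>ball x0 r. \<bar>\<psi> z - \<psi> y - \<psi>' y \<bullet> (z - y)\<bar> \<le> B * (norm (z - y))\<^sup>2"
    proof (intro ballI)
      fix y z assume yz: "y \<in> ball x0 r" "z \<in> ball x0 r"
      obtain \<xi> where \<xi>: "\<xi> \<in> closed_segment y z" "\<psi> z - \<psi> y = \<psi>' \<xi> \<bullet> (z - y)" using mv[of y z] yz sub by blast
      have "\<xi> \<in> ball x0 r" using \<xi>(1) closed_segment_subset[OF yz convex_ball] by blast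
      have "norm (\<xi> - y) \<le> norm (z - y)" using segment_bound(1)[OF \<xi>(1)] by (simp add: norm_minus_commute)
      have "\<psi> z - \<psi> y - \<psi>' y \<bullet> (z - y) = (\<psi>' \<xi> - \<psi>' y) \<bullet> (z - y)" by (simp add: \<xi> inner_diff_left)
      also have "\<bar>\<dots>\<bar> \<le> norm (\<psi>' \<xi> - \<psi>' y) * norm (z - y)" by (rule Cauchy_Schwarz_ineq2)
      also have "\<dots> \<le> (B * norm (\<xi> - y)) * norm (z - y)"
        by (intro mult_right_mono lip subsetD[OF sub(2)] \<open>\<xi> \<in> ball x0 r\<close> yz norm_ge_zero)
      also have "\<dots> \<le> (B * norm (z - y)) * norm (z - y)"
        using \<open>norm (\<xi> - y) \<le> norm (z - y)\<close> B(1) by (intro mult_right_mono mult_left_mono) auto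
      finally show "\<bar>\<psi> z - \<psi> y - \<psi>' y \<bullet> (z - y)\<bar> \<le> B * (norm (z - y))\<^sup>2"
        by (simp add: power2_eq_square algebra_simps)
    qed
    show "\<forall>y\<in>ball x0 r. \<forall>\<tau>\<ge>0. y - \<tau> *\<^sub>R (\<psi>' x0 /\<^sub>R norm (\<psi>' x0)) \<in> ball x0 r \<longrightarrow>
       \<psi> (y - \<tau> *\<^sub>R (\<psi>' x0 /\<^sub>R norm (\<psi>' x0))) \<le> \<psi> y - \<tau> * (norm (\<psi>' x0) / 2)"
    proof (intro ballI allI impI)
      fix y \<tau> assume y: "y \<in> ball x0 r" and c: "y - \<tau> *\<^sub>R (\<psi>' x0 /\<^sub>R norm (\<psi>' x0)) \<in> ball x0 r" and "0 \<le> \<tau>"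
      define \<nu> where "\<nu> = \<psi>' x0 /\<^sub>R norm (\<psi>' x0)"
      have n\<nu>: "norm \<nu> = 1" "\<psi>' x0 \<bullet> \<nu> = norm (\<psi>' x0)"
        using nz[OF x0] by (simp_all add: \<nu>_def power2_norm_eq_inner[symmetric] power2_eq_square)
      obtain \<xi> where \<xi>: "\<xi> \<in> closed_segment y (y - \<tau> *\<^sub>R \<nu>)" "\<psi> (y - \<tau> *\<^sub>R \<nu>) - \<psi> y = \<psi>' \<xi> \<bullet> (y - \<tau> *\<^sub>R \<nu> - y)"
        using mv[OF subsetD[OF sub(1) y] subsetD[OF sub(1) c]] unfolding \<nu>_def[symmetric] by blast
      have \<xi>b: "\<xi> \<in> ball x0 r" using \<xi>(1) closed_segment_subset[OF y c convex_ball] by (auto simp: \<nu>_def)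
      have "norm (\<psi>' \<xi> - \<psi>' x0) \<le> B * norm (\<xi> - x0)" using lip[of \<xi> x0] \<xi>b sub \<open>0 < R\<close> by auto
      also have "\<dots> \<le> B * r" using \<xi>b B(1) by (intro mult_left_mono) (auto simp: dist_norm norm_minus_commute)
      finally have "norm (\<psi>' \<xi> - \<psi>' x0) \<le> c0" using r(3) by (simp add: mult.commute)
      moreover have "- norm (\<psi>' \<xi> - \<psi>' x0) \<le> (\<psi>' \<xi> - \<psi>' x0) \<bullet> \<nu>"
        using Cauchy_Schwarz_ineq2[of "\<psi>' \<xi> - \<psi>' x0" \<nu>] n\<nu> by simp
      ultimately have "c0 \<le> \<psi>' \<xi> \<bullet> \<nu>" using n\<nu> by (simp add: inner_diff_left c0_def)
      then have "\<tau> * c0 \<le> \<tau> * (\<psi>' \<xi> \<bullet> \<nu>)" using \<open>0 \<le> \<tau>\<close> by (rule mult_left_mono)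
      then show "\<psi> (y - \<tau> *\<^sub>R (\<psi>' x0 /\<^sub>R norm (\<psi>' x0))) \<le> \<psi> y - \<tau> * (norm (\<psi>' x0) / 2)"
        using \<xi>(2) unfolding \<nu>_def[symmetric] c0_def by simp
    qed
  qed
qed

text \<open>The normal is defined by choice. This recovers the local defining function that produced
  the chosen vector, so that normal and geometry refer to the same chart.\<close>

lemma outward_normal_local:
  assumes "C2_boundary \<Omega>" "x \<in> frontier \<Omega>"
  obtains R \<psi> \<psi>' \<psi>'' where "0 < R" "local_C2_defining \<Omega> x R \<psi> \<psi>' \<psi>''" "outward_normal \<Omega> x = \<psi>' x /\<^sub>R norm (\<psi>' x)"
proof -
  have "\<exists>\<nu>. \<exists>r>0. \<exists>\<psi> \<psi>' \<psi>''. local_C2_defining \<Omega> x r \<psi> \<psi>' \<psi>'' \<and> \<nu> = \<psi>' x /\<^sub>R norm (\<psi>' x)"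
    using assms unfolding C2_boundary_def by blast
  from someI_ex[OF this] show thesis using that unfolding outward_normal_def by blast
qed

text \<open>A segment between two points of the closure leaves it by at most a quadratic amount,
  which is repaired by moving inwards along a fixed vector.\<close>

lemma C2_quadratic_correction:
  fixes \<Omega> :: "'a::euclidean_space set"
  assumes op: "open \<Omega>" and C2: "C2_boundary \<Omega>" and x: "x \<in> closure \<Omega>"
  shows "\<exists>r>0. \<exists>n. \<forall>y\<in>closure \<Omega> \<inter> ball x r. \<forall>z\<in>closure \<Omega> \<inter> ball x r. \<forall>\<theta>\<in>{0..1}.
       y + \<theta> *\<^sub>R (z - y) - (\<theta> * (1 - \<theta>) * (norm (z - y))\<^sup>2) *\<^sub>R n \<in> closure \<Omega>"
proof (cases "x \<in> \<Omega>")
  case True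
  then obtain r where r: "r > 0" "ball x r \<subseteq> \<Omega>" using op openE by blast
  have "y + \<theta> *\<^sub>R (z - y) \<in> closure \<Omega>" if "y \<in> ball x r" "z \<in> ball x r" "\<theta> \<in> {0..1}" for y z \<theta>
  proof -
    have "(1 - \<theta>) *\<^sub>R y + \<theta> *\<^sub>R z \<in> ball x r" by (rule convexD[OF convex_ball that(1,2)]) (use that in auto)
    moreover have "(1 - \<theta>) *\<^sub>R y + \<theta> *\<^sub>R z = y + \<theta> *\<^sub>R (z - y)" by (simp add: algebra_simps)
    ultimately show ?thesis using r closure_subset by (metis subsetD)
  qed
  then show ?thesis using r by (intro exI[of _ r] conjI exI[of _ 0]) auto
next
  case False
  then have "x \<in> frontier \<Omega>" using x op by (simp add: frontier_def interior_open)
  then obtain R \<psi> \<psi>' \<psi>'' where R: "0 < R" and loc: "local_C2_defining \<Omega> x R \<psi> \<psi>' \<psi>''" using C2 unfolding C2_boundary_def by blast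
  define \<nu> where "\<nu> = \<psi>' x /\<^sub>R norm (\<psi>' x)"
  obtain r B where r: "0 < r" "r < R" "0 \<le> B" and
    cl: "\<forall>y\<in>ball x r. y \<in> closure \<Omega> \<longleftrightarrow> \<psi> y \<le> 0" and
    tay: "\<forall>y\<in>ball x r. \<forall>z\<in>ball x r. \<bar>\<psi> z - \<psi> y - \<psi>' y \<bullet> (z - y)\<bar> \<le> B * (norm (z - y))\<^sup>2" and
    push: "\<forall>y\<in>ball x r. \<forall>\<tau>\<ge>0. y - \<tau> *\<^sub>R (\<psi>' x /\<^sub>R norm (\<psi>' x)) \<in> ball x r \<longrightarrow>
       \<psi> (y - \<tau> *\<^sub>R (\<psi>' x /\<^sub>R norm (\<psi>' x))) \<le> \<psi> y - \<tau> * (norm (\<psi>' x) / 2)"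
    by (rule local_C2_facts[OF loc R op]) (rule that; assumption)
  note cl = cl[rule_format] and tay = tay[rule_format] and push = push[rule_format, folded \<nu>_def]
  have nz: "\<psi>' x \<noteq> 0" using loc R unfolding local_C2_defining_def by auto
  then have n\<nu>: "norm \<nu> = 1" by (simp add: \<nu>_def)
  define c0 where "c0 = norm (\<psi>' x) / 2"
  have c0: "c0 > 0" using nz by (simp add: c0_def)
  \<comment> \<open>The quadratic remainder B against the rate c0 at which pushing inwards lowers
    \<psi>.\<close>
  define C where "C = B / c0"
  have C: "0 \<le> C" "C * c0 = B" using r c0 by (auto simp: C_def)
  define r' where "r' = min (r / 2) (min 1 (r / (2 * (C + 1))))"
  have r': "0 < r'" "r' \<le> r / 2" "r' \<le> 1" "r' * C < r / 2"
  proof -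
    show "0 < r'" using r C by (simp add: r'_def)
    show "r' \<le> r / 2" unfolding r'_def by (rule min.cobounded1)
    show "r' \<le> 1" unfolding r'_def by (meson min.cobounded1 min.cobounded2 order_trans)
    have "r' \<le> r / (2 * (C + 1))" by (simp add: r'_def)
    then have "r' * (2 * (C + 1)) \<le> r" using C by (simp add: le_divide_eq)
    then show "r' * C < r / 2" using \<open>0 < r'\<close> by (simp add: algebra_simps)
  qed
  have main: "y + \<theta> *\<^sub>R (z - y) - (\<theta> * (1 - \<theta>) * (norm (z - y))\<^sup>2) *\<^sub>R (C *\<^sub>R \<nu>) \<in> closure \<Omega>"
    if y: "y \<in> closure \<Omega> \<inter> ball x r'" and z: "z \<in> closure \<Omega> \<inter> ball x r'" and \<theta>: "\<theta> \<in> {0..1}" for y z \<theta>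
  proof -
    define l where "l = y + \<theta> *\<^sub>R (z - y)"
    define D where "D = norm (z - y)"
    define \<tau> where "\<tau> = \<theta> * (1 - \<theta>) * D\<^sup>2 * C"
    have th: "0 \<le> \<theta>" "\<theta> \<le> 1" using \<theta> by auto
    have "l = (1 - \<theta>) *\<^sub>R y + \<theta> *\<^sub>R z" by (simp add: l_def algebra_simps)
    also have "\<dots> \<in> ball x r'" by (rule convexD[OF convex_ball]) (use y z th in auto)
    finally have l': "l \<in> ball x r'" .
    have sub: "ball x r' \<subseteq> ball x r" using r' r by auto
    have "D \<le> 2 * r'"
      using norm_triangle_ineq4[of "z - x" "y - x"] y z by (auto simp: D_def dist_norm norm_minus_commute)
    have \<tau>: "0 \<le> \<tau>" "\<tau> \<le> r' * C"
    proof -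
      show "0 \<le> \<tau>" using th C by (simp add: \<tau>_def)
      have "0 \<le> (\<theta> - 1/2)\<^sup>2" by simp
      then have "\<theta> * (1 - \<theta>) \<le> 1 / 4" by (simp add: power2_eq_square algebra_simps)
      moreover have "D\<^sup>2 \<le> (2 * r')\<^sup>2" using \<open>D \<le> 2 * r'\<close> by (intro power_mono) (auto simp: D_def)
      ultimately have "\<theta> * (1 - \<theta>) * D\<^sup>2 \<le> 1 / 4 * (2 * r')\<^sup>2" by (intro mult_mono) auto
      also have "\<dots> = r' * r'" by (simp add: power2_eq_square)
      also have "\<dots> \<le> r' * 1" using r' by (intro mult_left_mono) auto
      finally show "\<tau> \<le> r' * C" unfolding \<tau>_def using C by (intro mult_right_mono) auto
    qed
    have in_r: "l - \<tau> *\<^sub>R \<nu> \<in> ball x r"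
    proof -
      have "dist x (l - \<tau> *\<^sub>R \<nu>) \<le> dist x l + norm (\<tau> *\<^sub>R \<nu>)"
        using norm_triangle_ineq[of "x - l" "\<tau> *\<^sub>R \<nu>"] by (simp add: dist_norm algebra_simps)
      then show ?thesis using l' \<tau> r' n\<nu> by simp
    qed
    \<comment> \<open>Taylor's formula at l towards both end points, combined with weights 1 -
      \<theta> and \<theta>: the gradient terms cancel, and the two remainders add up to the factor
      \<theta>(1 - \<theta>) of the correction.\<close>
    have "\<psi> l \<le> B * (\<theta> * (1 - \<theta>) * D\<^sup>2)"
    proof -
      have "\<psi> y \<le> 0" "\<psi> z \<le> 0" using cl y z sub by blast+
      have dy: "y - l = (- \<theta>) *\<^sub>R (z - y)" and dz: "z - l = (1 - \<theta>) *\<^sub>R (z - y)" by (simp_all add: l_def algebra_simps)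
      have lb: "l \<in> ball x r" "y \<in> ball x r" "z \<in> ball x r" using l' y z sub by blast+
      have "\<psi> l - \<theta> * (\<psi>' l \<bullet> (z - y)) - B * (\<theta>\<^sup>2 * D\<^sup>2) \<le> \<psi> y"
        using tay[OF lb(1,2)] unfolding dy by (simp add: D_def power_mult_distrib abs_le_iff)
      then have 1: "(1 - \<theta>) * (\<psi> l - \<theta> * (\<psi>' l \<bullet> (z - y)) - B * (\<theta>\<^sup>2 * D\<^sup>2)) \<le> (1 - \<theta>) * 0"
        using \<open>\<psi> y \<le> 0\<close> th by (intro mult_left_mono) auto
      have "\<psi> l + (1 - \<theta>) * (\<psi>' l \<bullet> (z - y)) - B * ((1 - \<theta>)\<^sup>2 * D\<^sup>2) \<le> \<psi> z"
        using tay[OF lb(1,3)] unfolding dz by (simp add: D_def power_mult_distrib abs_le_iff)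
      then have 2: "\<theta> * (\<psi> l + (1 - \<theta>) * (\<psi>' l \<bullet> (z - y)) - B * ((1 - \<theta>)\<^sup>2 * D\<^sup>2)) \<le> \<theta> * 0"
        using \<open>\<psi> z \<le> 0\<close> th by (intro mult_left_mono) auto
      have "(1 - \<theta>) * (\<psi> l - \<theta> * (\<psi>' l \<bullet> (z - y)) - B * (\<theta>\<^sup>2 * D\<^sup>2))
          + \<theta> * (\<psi> l + (1 - \<theta>) * (\<psi>' l \<bullet> (z - y)) - B * ((1 - \<theta>)\<^sup>2 * D\<^sup>2))
          = \<psi> l - B * (\<theta> * (1 - \<theta>) * D\<^sup>2)" by (simp add: power2_eq_square algebra_simps)
      then show ?thesis using 1 2 by linarith
    qed
    moreover have "\<psi> (l - \<tau> *\<^sub>R \<nu>) \<le> \<psi> l - \<tau> * c0"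
      unfolding c0_def by (rule push) (use l' sub in_r \<tau> in auto)
    moreover have "\<tau> * c0 = B * (\<theta> * (1 - \<theta>) * D\<^sup>2)" by (simp add: \<tau>_def C(2)[symmetric] algebra_simps)
    ultimately have "\<psi> (l - \<tau> *\<^sub>R \<nu>) \<le> 0" by linarith
    then have "l - \<tau> *\<^sub>R \<nu> \<in> closure \<Omega>" using cl[OF in_r] by simp
    then show ?thesis by (simp add: l_def \<tau>_def D_def)
  qed
  show ?thesis by (rule exI[of _ r'], intro conjI r' exI[of _ "C *\<^sub>R \<nu>"] ballI main)
qed

text \<open>A curve in the closed domain that touches the boundary at time t maximises \<psi> along
  itself there, so the derivative of \<psi> along it vanishes. It is essential that \<gamma> is
  differentiable from both sides.\<close>

lemma normal_derivative_zero:
  assumes op: "open \<Omega>" and C2: "C2_boundary \<Omega>" and x: "\<gamma> t \<in> frontier \<Omega>"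
    and v: "(\<gamma> has_vector_derivative v) (at t)" and "in": "\<forall>\<^sub>F s in nhds t. \<gamma> s \<in> closure \<Omega>"
  shows "v \<bullet> outward_normal \<Omega> (\<gamma> t) = 0"
proof -
  obtain R \<psi> \<psi>' \<psi>'' where R: "0 < R" and loc: "local_C2_defining \<Omega> (\<gamma> t) R \<psi> \<psi>' \<psi>''"
    and \<nu>: "outward_normal \<Omega> (\<gamma> t) = \<psi>' (\<gamma> t) /\<^sub>R norm (\<psi>' (\<gamma> t))" using outward_normal_local[OF C2 x] .
  obtain r where r: "0 < r" "r < R" and
    cl: "\<forall>y\<in>ball (\<gamma> t) r. y \<in> closure \<Omega> \<longleftrightarrow> \<psi> y \<le> 0"
    by (rule local_C2_facts[OF loc R op]) (rule that; assumption)
  note cl = cl[rule_format]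
  have xb: "\<gamma> t \<in> ball (\<gamma> t) R" using R by simp
  have "\<psi> (\<gamma> t) = 0"
  proof -
    have "\<gamma> t \<in> closure \<Omega>" "\<gamma> t \<notin> \<Omega>" using x op by (auto simp: frontier_def interior_open)
    then have "\<psi> (\<gamma> t) \<le> 0" "\<not> \<psi> (\<gamma> t) < 0" using cl r loc xb unfolding local_C2_defining_def by auto
    then show ?thesis by simp
  qed
  have "(\<psi> has_derivative (\<lambda>h. \<psi>' (\<gamma> t) \<bullet> h)) (at (\<gamma> t))" using loc xb unfolding local_C2_defining_def by blast
  from has_derivative_compose[OF v[unfolded has_vector_derivative_def] this]
  have D: "((\<lambda>s. \<psi> (\<gamma> s)) has_real_derivative \<psi>' (\<gamma> t) \<bullet> v) (at t)"
    unfolding has_field_derivative_def by (rule has_derivative_eq_rhs) (simp add: fun_eq_iff)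
  have "isCont \<gamma> t" using v has_vector_derivative_continuous by blast
  then have "\<forall>\<^sub>F s in nhds t. \<gamma> s \<in> ball (\<gamma> t) r"
    using r by (intro topological_tendstoD) (auto simp: isCont_def tendsto_at_iff_tendsto_nhds)
  with "in" have "\<forall>\<^sub>F s in nhds t. \<psi> (\<gamma> s) \<le> \<psi> (\<gamma> t)" 
    by eventually_elim (use cl \<open>\<psi> (\<gamma> t) = 0\<close> in auto)
  then obtain d where "d > 0" "\<And>s. dist s t < d \<Longrightarrow> \<psi> (\<gamma> s) \<le> \<psi> (\<gamma> t)" unfolding eventually_nhds_metric by blast
  then have "\<psi>' (\<gamma> t) \<bullet> v = 0" by (intro DERIV_local_max[OF D]) (auto simp: dist_real_def abs_minus_commute)
  then show ?thesis by (simp add: \<nu> inner_commute)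
qed

text \<open>In a tangential direction \<psi> grows at most quadratically, and an inward shift of
  order h^2 compensates. Every tangential direction is thus the limiting direction of points of the
  closed domain.\<close>

lemma tangential_approach:
  assumes op: "open \<Omega>" and C2: "C2_boundary \<Omega>" and x: "x \<in> frontier \<Omega>" and \<theta>: "\<theta> \<bullet> outward_normal \<Omega> x = 0"
  obtains C d where "0 < d" "0 \<le> C" "\<And>h. \<lbrakk>0 < h; h < d\<rbrakk> \<Longrightarrow> x + h *\<^sub>R \<theta> - (C * h\<^sup>2) *\<^sub>R outward_normal \<Omega> x \<in> closure \<Omega>"
proof -
  obtain R \<psi> \<psi>' \<psi>'' where R: "0 < R" and loc: "local_C2_defining \<Omega> x R \<psi> \<psi>' \<psi>''"
    and \<nu>: "outward_normal \<Omega> x = \<psi>' x /\<^sub>R norm (\<psi>' x)" using outward_normal_local[OF C2 x] .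
  define \<nu> where "\<nu> = outward_normal \<Omega> x"
  obtain r B where r: "0 < r" "r < R" "0 \<le> B" and
    cl: "\<forall>y\<in>ball x r. y \<in> closure \<Omega> \<longleftrightarrow> \<psi> y \<le> 0" and
    tay: "\<forall>y\<in>ball x r. \<forall>z\<in>ball x r. \<bar>\<psi> z - \<psi> y - \<psi>' y \<bullet> (z - y)\<bar> \<le> B * (norm (z - y))\<^sup>2" and
    push: "\<forall>y\<in>ball x r. \<forall>\<tau>\<ge>0. y - \<tau> *\<^sub>R (\<psi>' x /\<^sub>R norm (\<psi>' x)) \<in> ball x r \<longrightarrow>
       \<psi> (y - \<tau> *\<^sub>R (\<psi>' x /\<^sub>R norm (\<psi>' x))) \<le> \<psi> y - \<tau> * (norm (\<psi>' x) / 2)"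
    by (rule local_C2_facts[OF loc R op]) (rule that; assumption)
  note cl = cl[rule_format] and tay = tay[rule_format] and push = push[rule_format, folded \<nu>, folded \<nu>_def]
  have nz: "\<psi>' x \<noteq> 0" using loc R unfolding local_C2_defining_def by auto
  then have n\<nu>: "norm \<nu> = 1" by (simp add: \<nu>_def \<nu>)
  have tang: "\<psi>' x \<bullet> \<theta> = 0" using \<theta> nz by (simp add: \<nu> inner_commute)
  have xb: "x \<in> ball x r" using r by simp
  have "x \<in> closure \<Omega>" using x by (simp add: frontier_def)
  then have "\<psi> x \<le> 0" using cl xb by blast
  define c0 where "c0 = norm (\<psi>' x) / 2"
  have c0: "c0 > 0" using nz by (simp add: c0_def)
  define C where "C = B * (norm \<theta>)\<^sup>2 / c0"
  have C: "0 \<le> C" "C * c0 = B * (norm \<theta>)\<^sup>2" using r c0 by (auto simp: C_def)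
  define d where "d = min 1 (r / (norm \<theta> + C + 1))"
  have N: "0 < norm \<theta> + C + 1" using C norm_ge_zero[of \<theta>] by linarith
  show thesis
  proof (rule that[of d C, folded \<nu>_def])
    show "0 < d" using r N by (simp add: d_def)
    show "0 \<le> C" by (fact C)
    fix h assume h: "0 < h" "h < d"
    have h1: "h < 1" "h * (norm \<theta> + C + 1) < r" using h N by (auto simp: d_def pos_less_divide_eq)
    have h2: "h * norm \<theta> + h * C < r" using h1(2) h(1) by (simp add: algebra_simps)
    have "C * h\<^sup>2 \<le> h * C" using h h1 C mult_left_mono[of h 1 "h * C"] by (simp add: power2_eq_square algebra_simps)
    have hC: "0 \<le> h * C" using h C by simp
    have 1: "x + h *\<^sub>R \<theta> \<in> ball x r" using h h2 hC by (simp add: dist_norm)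
    have 2: "x + h *\<^sub>R \<theta> - (C * h\<^sup>2) *\<^sub>R \<nu> \<in> ball x r"
    proof -
      have "dist x (x + h *\<^sub>R \<theta> - (C * h\<^sup>2) *\<^sub>R \<nu>) = norm (h *\<^sub>R \<theta> - (C * h\<^sup>2) *\<^sub>R \<nu>)" by (simp add: dist_norm norm_minus_commute algebra_simps)
      also have "\<dots> \<le> norm (h *\<^sub>R \<theta>) + norm ((C * h\<^sup>2) *\<^sub>R \<nu>)" by (rule norm_triangle_ineq4)
      also have "\<dots> = h * norm \<theta> + C * h\<^sup>2" using h C n\<nu> by simp
      finally show ?thesis using h2 \<open>C * h\<^sup>2 \<le> h * C\<close> by simp
    qed
    have "\<psi> (x + h *\<^sub>R \<theta>) \<le> B * (h\<^sup>2 * (norm \<theta>)\<^sup>2)"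
      using tay[OF xb 1] \<open>\<psi> x \<le> 0\<close> tang by (simp add: power_mult_distrib abs_le_iff)
    moreover have "\<psi> (x + h *\<^sub>R \<theta> - (C * h\<^sup>2) *\<^sub>R \<nu>) \<le> \<psi> (x + h *\<^sub>R \<theta>) - (C * h\<^sup>2) * c0"
      unfolding c0_def by (rule push[OF 1 _ 2]) (use C in simp)
    moreover have "(C * h\<^sup>2) * c0 = B * (h\<^sup>2 * (norm \<theta>)\<^sup>2)" using C(2) by (metis mult.assoc mult.commute)
    ultimately have "\<psi> (x + h *\<^sub>R \<theta> - (C * h\<^sup>2) *\<^sub>R \<nu>) \<le> 0" by linarith
    then show "x + h *\<^sub>R \<theta> - (C * h\<^sup>2) *\<^sub>R \<nu> \<in> closure \<Omega>" using cl[OF 2] by simp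
  qed
qed

section \<open>Mean field games\<close>

lemma has_derivative_snd_argument:
  assumes "((\<lambda>(y,w). \<phi> y w) has_derivative (\<lambda>(h,k). A h + B k)) (at (x, v + \<theta> *\<^sub>R d))"
  shows "((\<lambda>s. \<phi> x (v + s *\<^sub>R d)) has_derivative (\<lambda>s. A 0 + B (s *\<^sub>R d))) (at \<theta>)"
proof -
  have "((\<lambda>s. (x, v + s *\<^sub>R d)) has_derivative (\<lambda>s. (0, s *\<^sub>R d))) (at \<theta>)"
    by (auto intro!: derivative_eq_intros)
  from has_derivative_compose[OF this assms] show ?thesis by simp
qed

lemma has_derivative_fst_argument:
  assumes "((\<lambda>(y,w). \<phi> y w) has_derivative (\<lambda>(h,k). A h + B k)) (at (x, v))"
  shows "((\<lambda>y. \<phi> y v) has_derivative (\<lambda>h. A h + B 0)) (at x)"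
proof -
  have "((\<lambda>y. (y, v)) has_derivative (\<lambda>h. (h, 0))) (at x)" by (auto intro!: derivative_eq_intros)
  from has_derivative_compose[OF this assms] show ?thesis by simp
qed

text \<open>Taylor with Lagrange remainder along the segment from v to w; the bounds on
  \<open>Lvv\<close> turn it into the two quadratic inequalities of the control problem.\<close>

lemma lagrangian_taylor:
  fixes L :: "'a::euclidean_space \<Rightarrow> 'a \<Rightarrow> real"
  assumes dL: "\<And>v. ((\<lambda>(y,w). L y w) has_derivative (\<lambda>(h,k). DxL x v \<bullet> h + DvL x v \<bullet> k)) (at (x,v))"
    and dD: "\<And>v. ((\<lambda>(y,w). DvL y w) has_derivative (\<lambda>(h,k). Lvx x v h + Lvv x v k)) (at (x,v))"
    and z: "\<And>v. Lvx x v 0 = 0"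
  obtains \<xi> where "L x w = L x v + DvL x v \<bullet> (w - v) + (w - v) \<bullet> Lvv x \<xi> (w - v) / 2"
proof -
  define d where "d = w - v"
  define diff where "diff m \<theta> = (if m = (0::nat) then L x (v + \<theta> *\<^sub>R d) else if m = 1 then DvL x (v + \<theta> *\<^sub>R d) \<bullet> d
    else d \<bullet> Lvv x (v + \<theta> *\<^sub>R d) d)" for m \<theta>
  \<comment> \<open>Linearity is given for the pair of partial derivatives jointly;
    \<open>Lvx x u 0 = 0\<close> isolates the second slot.\<close>
  have sc: "Lvv x u (s *\<^sub>R d) = s *\<^sub>R Lvv x u d" for u s
  proof -
    have "linear (\<lambda>(h,k). Lvx x u h + Lvv x u k)" using dD has_derivative_linear by blast
    from linear_cmul[OF this, of s "(0,d)"] show ?thesis by (simp add: z)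
  qed
  have "\<exists>t>0. t < 1 \<and> L x (v + 1 *\<^sub>R d) = (\<Sum>m<2. diff m 0 / fact m * (1 - 0) ^ m) + diff 2 t / fact 2 * (1 - 0)\<^sup>2"
  proof (rule Taylor_up[where b = 1])
    show "diff 0 = (\<lambda>\<theta>. L x (v + \<theta> *\<^sub>R d))" by (simp add: diff_def fun_eq_iff)
    show "\<forall>m t. m < 2 \<and> 0 \<le> t \<and> t \<le> 1 \<longrightarrow> (diff m has_real_derivative diff (Suc m) t) (at t)"
    proof (intro allI impI, elim conjE)
      fix m :: nat and t :: real assume "m < 2"
      then consider "m = 0" | "m = 1" by linarith
      then show "(diff m has_real_derivative diff (Suc m) t) (at t)"
      proof cases
        case 1
        have dd: "((\<lambda>s. L x (v + s *\<^sub>R d)) has_derivative (\<lambda>s. DxL x (v + t *\<^sub>R d) \<bullet> 0 + DvL x (v + t *\<^sub>R d) \<bullet> (s *\<^sub>R d))) (at t)"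
          by (rule has_derivative_snd_argument[OF dL])
        have e: "diff 0 = (\<lambda>s. L x (v + s *\<^sub>R d))" by (simp add: diff_def fun_eq_iff)
        show ?thesis unfolding 1 e has_field_derivative_def
          by (rule has_derivative_eq_rhs[OF dd]) (simp add: diff_def fun_eq_iff)
      next
        case 2
        have "((\<lambda>s. DvL x (v + s *\<^sub>R d)) has_derivative (\<lambda>s. Lvx x (v + t *\<^sub>R d) 0 + Lvv x (v + t *\<^sub>R d) (s *\<^sub>R d))) (at t)"
          by (rule has_derivative_snd_argument[OF dD])
        from has_derivative_inner_left[OF this, of d]
        have dd: "((\<lambda>s. DvL x (v + s *\<^sub>R d) \<bullet> d) has_derivative (\<lambda>s. (Lvx x (v + t *\<^sub>R d) 0 + Lvv x (v + t *\<^sub>R d) (s *\<^sub>R d)) \<bullet> d)) (at t)" .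
        have e: "diff 1 = (\<lambda>s. DvL x (v + s *\<^sub>R d) \<bullet> d)" by (simp add: diff_def fun_eq_iff)
        show ?thesis unfolding 2 e has_field_derivative_def
          by (rule has_derivative_eq_rhs[OF dd]) (simp add: diff_def fun_eq_iff z sc inner_commute)
      qed
    qed
  qed auto
  then obtain t where "L x w = L x v + DvL x v \<bullet> d + d \<bullet> Lvv x (v + t *\<^sub>R d) d / 2"
    by (auto simp: numeral_2_eq_2 diff_def d_def)
  then show thesis using that by (simp add: d_def)
qed

text \<open>The mean value theorem in v writes the difference as its value at velocity 0 plus the
  difference of the velocity gradients applied to v. The latter is Lipschitz in x with constant
  \<mu>(1 + |w|) by the mixed derivative, whence growth of order |v|^2.\<close>

lemma lagrangian_lipschitz:
  fixes L :: "'a::euclidean_space \<Rightarrow> 'a \<Rightarrow> real"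
  assumes seg: "closed_segment x y \<subseteq> U" and M: "0 \<le> M" "0 \<le> \<mu>"
    and dL: "\<And>x v. x \<in> U \<Longrightarrow> ((\<lambda>(y,w). L y w) has_derivative (\<lambda>(h,k). DxL x v \<bullet> h + DvL x v \<bullet> k)) (at (x,v))"
    and dD: "\<And>x v. x \<in> U \<Longrightarrow> ((\<lambda>(y,w). DvL y w) has_derivative (\<lambda>(h,k). Lvx x v h + Lvv x v k)) (at (x,v))"
    and b0: "\<And>x. x \<in> U \<Longrightarrow> norm (DxL x 0) \<le> M"
    and bvx: "\<And>x v h. x \<in> U \<Longrightarrow> norm (Lvx x v h) \<le> \<mu> * (1 + norm v) * norm h"
  shows "\<bar>L x v - L y v\<bar> \<le> (M + 2 * \<mu>) * (1 + (norm v)\<^sup>2) * norm (x - y)"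
proof -
  have xy: "x \<in> closed_segment x y" "y \<in> closed_segment x y" by auto
  have D0: "norm (L x 0 - L y 0) \<le> M * norm (x - y)"
  proof (rule differentiable_bound[OF convex_closed_segment _ _ xy])
    fix z assume "z \<in> closed_segment x y"
    then have z: "z \<in> U" using seg by blast
    have "((\<lambda>y. L y 0) has_derivative (\<lambda>h. DxL z 0 \<bullet> h + DvL z 0 \<bullet> 0)) (at z)"
      by (rule has_derivative_fst_argument[OF dL[OF z]])
    then show "((\<lambda>y. L y 0) has_derivative (\<lambda>h. DxL z 0 \<bullet> h)) (at z within closed_segment x y)"
      by (simp add: has_derivative_at_withinI)
    show "onorm (\<lambda>h. DxL z 0 \<bullet> h) \<le> M"
    proof (rule onorm_bound[OF M(1)])
      fix h have "norm (DxL z 0 \<bullet> h) \<le> norm (DxL z 0) * norm h" using Cauchy_Schwarz_ineq2 by simp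
      also have "\<dots> \<le> M * norm h" using b0[OF z] by (rule mult_right_mono) simp
      finally show "norm (DxL z 0 \<bullet> h) \<le> M * norm h" .
    qed
  qed
  have Dv: "norm (DvL x w - DvL y w) \<le> \<mu> * (1 + norm w) * norm (x - y)" for w
  proof (rule differentiable_bound[OF convex_closed_segment _ _ xy])
    fix z assume "z \<in> closed_segment x y"
    then have z: "z \<in> U" using seg by blast
    have "Lvx z w 0 = 0" using bvx[OF z, of w 0] by simp
    moreover have "linear (\<lambda>(h,k). Lvx z w h + Lvv z w k)" using dD[OF z] has_derivative_linear by blast
    from linear_0[OF this] have "Lvx z w 0 + Lvv z w 0 = 0" by (simp add: zero_prod_def)
    ultimately have "Lvv z w 0 = 0" by simp
    moreover have "((\<lambda>y. DvL y w) has_derivative (\<lambda>h. Lvx z w h + Lvv z w 0)) (at z)"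
      by (rule has_derivative_fst_argument[OF dD[OF z]])
    ultimately show "((\<lambda>y. DvL y w) has_derivative Lvx z w) (at z within closed_segment x y)"
      by (simp add: has_derivative_at_withinI)
    show "onorm (Lvx z w) \<le> \<mu> * (1 + norm w)"
      by (rule onorm_bound) (use M bvx[OF z] in \<open>auto simp: add_nonneg_nonneg\<close>)
  qed
  have "\<exists>\<theta>>0. \<theta> < 1 \<and> (L x (0 + 1 *\<^sub>R v) - L y (0 + 1 *\<^sub>R v)) - (L x (0 + 0 *\<^sub>R v) - L y (0 + 0 *\<^sub>R v)) =
      (1 - 0) * (DvL x (0 + \<theta> *\<^sub>R v) \<bullet> v - DvL y (0 + \<theta> *\<^sub>R v) \<bullet> v)"
  proof (rule MVT2)
    fix \<theta> :: real
    have "((\<lambda>s. L z (0 + s *\<^sub>R v)) has_real_derivative DvL z (0 + \<theta> *\<^sub>R v) \<bullet> v) (at \<theta>)" if "z \<in> closed_segment x y" for z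
    proof -
      have "((\<lambda>s. L z (0 + s *\<^sub>R v)) has_derivative (\<lambda>s. DxL z (0 + \<theta> *\<^sub>R v) \<bullet> 0 + DvL z (0 + \<theta> *\<^sub>R v) \<bullet> (s *\<^sub>R v))) (at \<theta>)"
        by (rule has_derivative_snd_argument[OF dL]) (use that seg in blast)
      then show ?thesis unfolding has_field_derivative_def by (rule has_derivative_eq_rhs) (simp add: fun_eq_iff)
    qed
    then show "((\<lambda>s. L x (0 + s *\<^sub>R v) - L y (0 + s *\<^sub>R v)) has_real_derivative DvL x (0 + \<theta> *\<^sub>R v) \<bullet> v - DvL y (0 + \<theta> *\<^sub>R v) \<bullet> v) (at \<theta>)"
      using xy by (intro DERIV_diff) auto
  qed simp
  then obtain \<theta> where \<theta>: "0 < \<theta>" "\<theta> < 1" "L x v - L y v - (L x 0 - L y 0) = (DvL x (\<theta> *\<^sub>R v) - DvL y (\<theta> *\<^sub>R v)) \<bullet> v"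
    by (auto simp: inner_diff_left)
  have "\<bar>(DvL x (\<theta> *\<^sub>R v) - DvL y (\<theta> *\<^sub>R v)) \<bullet> v\<bar> \<le> norm (DvL x (\<theta> *\<^sub>R v) - DvL y (\<theta> *\<^sub>R v)) * norm v" by (rule Cauchy_Schwarz_ineq2)
  also have "\<dots> \<le> (\<mu> * (1 + norm (\<theta> *\<^sub>R v)) * norm (x - y)) * norm v" by (rule mult_right_mono[OF Dv]) simp
  also have "\<dots> \<le> (\<mu> * (1 + norm v) * norm (x - y)) * norm v"
    using \<theta> M by (intro mult_right_mono mult_left_mono) (auto simp: mult_left_le_one_le)
  also have "\<dots> = \<mu> * norm (x - y) * ((1 + norm v) * norm v)" by (simp add: algebra_simps)
  also have "\<dots> \<le> \<mu> * norm (x - y) * (2 * (1 + (norm v)\<^sup>2))"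
  proof (rule mult_left_mono)
    have "0 \<le> (norm v - 1)\<^sup>2" "0 \<le> (norm v)\<^sup>2" by simp_all
    moreover have "(norm v - 1)\<^sup>2 = (norm v)\<^sup>2 - 2 * norm v + 1" "(1 + norm v) * norm v = norm v + (norm v)\<^sup>2"
      by (simp_all add: power2_eq_square algebra_simps)
    ultimately show "(1 + norm v) * norm v \<le> 2 * (1 + (norm v)\<^sup>2)" by argo
  qed (use M in simp)
  finally have 1: "\<bar>L x v - L y v - (L x 0 - L y 0)\<bar> \<le> 2 * \<mu> * (1 + (norm v)\<^sup>2) * norm (x - y)" unfolding \<theta> by (simp add: algebra_simps)
  have "M * norm (x - y) \<le> M * norm (x - y) * (1 + (norm v)\<^sup>2)" using M(1) by (simp add: algebra_simps)
  then have "\<bar>L x v - L y v\<bar> \<le> M * norm (x - y) * (1 + (norm v)\<^sup>2) + 2 * \<mu> * (1 + (norm v)\<^sup>2) * norm (x - y)"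
    using 1 D0 unfolding real_norm_def by linarith
  then show ?thesis by (simp add: algebra_simps)
qed

section \<open>Separability and supports in the space of curves\<close>

lemma curves_clamp: "c \<in> curves T \<Omega> \<Longrightarrow> apply_bcontfun c t = apply_bcontfun c (min T (max 0 t))"
  by (auto simp: curves_def)

text \<open>Bounded continuous functions on the line are not separable, but curves are determined by
  uniformly continuous restrictions to [0, T]. These are encoded, up to a tolerance, by finitely
  many samples from a countable dense set, and one curve is picked for each code that
  occurs.\<close>

lemma curves_separable:
  fixes \<Omega> :: "'a::euclidean_space set"
  assumes "0 < T"
  obtains D where "countable D" "\<And>c \<epsilon>. \<lbrakk>c \<in> curves T \<Omega>; 0 < \<epsilon>\<rbrakk> \<Longrightarrow> \<exists>d\<in>D. dist c d < \<epsilon>"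
proof -
  obtain Q :: "'a set" where Q: "countable Q" "\<And>X. open X \<Longrightarrow> X \<noteq> {} \<Longrightarrow> \<exists>d\<in>Q. d \<in> X"
    using countable_dense_setE by blast
  \<comment> \<open>A code consists of a tolerance, a number of grid points per unit time and a list
    of samples; \<open>S i\<close> holds the curves that stay within the tolerance of the resulting
    step function.\<close>
  define S where "S i = {c\<in>curves T \<Omega>. \<forall>r\<in>{0..T}. norm (apply_bcontfun c r - snd (snd i) ! nat \<lfloor>r * real (fst (snd i))\<rfloor>) \<le> fst i}"
    for i :: "real \<times> nat \<times> 'a list"
  define I where "I = {i \<in> (\<rat> \<times> (UNIV :: nat set) \<times> lists Q). S i \<noteq> {}}"
  have cI: "countable (\<rat> \<times> (UNIV :: nat set) \<times> lists Q)"
    by (intro countable_SIGMA countable_rat countable_lists Q) auto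
  have "countable I" by (rule countable_subset[OF _ cI]) (auto simp: I_def)
  show thesis
  proof (rule that[of "(\<lambda>i. SOME c. c \<in> S i) ` I"])
    show "countable ((\<lambda>i. SOME c. c \<in> S i) ` I)" using \<open>countable I\<close> by simp
    fix c and \<epsilon> :: real assume c: "c \<in> curves T \<Omega>" and "0 < \<epsilon>"
    obtain a where a: "a \<in> \<rat>" "0 < a" "a < \<epsilon> / 2" using Rats_dense_in_real[of 0 "\<epsilon> / 2"] \<open>0 < \<epsilon>\<close> by auto
    have "uniformly_continuous_on {0..T} (apply_bcontfun c)"
      by (intro compact_uniformly_continuous continuous_on_apply_bcontfun compact_Icc)
    then obtain \<delta> where \<delta>: "\<delta> > 0" "\<And>r r'. \<lbrakk>r \<in> {0..T}; r' \<in> {0..T}; dist r' r < \<delta>\<rbrakk> \<Longrightarrow> dist (apply_bcontfun c r') (apply_bcontfun c r) < a / 2"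
      unfolding uniformly_continuous_on_def using a(2) half_gt_zero by metis
    obtain N0 where N0: "inverse (real (Suc N0)) < \<delta>" using reals_Archimedean[OF \<delta>(1)] by blast
    define N where "N = Suc N0"
    have N: "0 < real N" "1 / real N < \<delta>" using N0 by (simp_all add: N_def inverse_eq_divide)
    have "\<exists>q\<in>Q. q \<in> ball (apply_bcontfun c (real j / N)) (a / 2)" for j :: nat
      using Q(2)[of "ball (apply_bcontfun c (real j / N)) (a / 2)"] a(2) by auto
    then obtain q where q: "\<And>j::nat. q j \<in> Q" "\<And>j::nat. q j \<in> ball (apply_bcontfun c (real j / N)) (a / 2)" by metis
    \<comment> \<open>\<open>Suc\<close> because the last grid index, attained at time T, is
      included.\<close>
    define qs where "qs = map q [0..<Suc (nat \<lfloor>T * real N\<rfloor>)]"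
    have "norm (apply_bcontfun c r - qs ! nat \<lfloor>r * real N\<rfloor>) \<le> a" if r: "r \<in> {0..T}" for r
    proof -
      define j where "j = nat \<lfloor>r * real N\<rfloor>"
      have rN: "0 \<le> r * real N" using r by simp
      have "\<lfloor>r * real N\<rfloor> \<le> \<lfloor>T * real N\<rfloor>" using r by (intro floor_mono mult_right_mono) auto
      then have "qs ! j = q j" unfolding qs_def j_def by (subst nth_map) (auto simp: less_Suc_eq_le nat_mono simp del: upt_Suc)
      have jr: "real j \<le> r * real N" "r * real N < real j + 1" using rN unfolding j_def by linarith+
      have "real j / N \<le> r" using jr N by (simp add: pos_divide_le_eq)
      moreover have "r < (real j + 1) / N" using jr N by (simp add: pos_less_divide_eq)
      ultimately have 1: "real j / N \<le> r" "r - real j / N < 1 / N" by (simp_all add: add_divide_distrib)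
      have "dist (apply_bcontfun c (real j / N)) (apply_bcontfun c r) < a / 2"
        by (rule \<delta>(2)[OF r]) (use 1 r N in \<open>auto simp: dist_real_def\<close>)
      moreover have "dist (apply_bcontfun c (real j / N)) (q j) < a / 2" using q(2)[of j] by simp
      ultimately have "dist (apply_bcontfun c r) (q j) < a" by (rule dist_triangle_half_r)
      then show ?thesis using \<open>qs ! j = q j\<close> by (simp add: j_def dist_norm)
    qed
    then have cS: "c \<in> S (a, N, qs)" using c by (simp add: S_def)
    have "(a, N, qs) \<in> I" using a(1) q(1) cS by (auto simp: I_def qs_def)
    define d where "d = (SOME c. c \<in> S (a, N, qs))"
    have dS: "d \<in> S (a, N, qs)" unfolding d_def by (rule someI[of _ c]) (rule cS)
    have "dist c d \<le> 2 * a"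
    proof (rule dist_bound)
      fix t
      define r where "r = min T (max 0 t)"
      have r: "r \<in> {0..T}" using \<open>0 < T\<close> by (auto simp: r_def)
      have "norm (apply_bcontfun c r - qs ! nat \<lfloor>r * real N\<rfloor>) \<le> a" "norm (apply_bcontfun d r - qs ! nat \<lfloor>r * real N\<rfloor>) \<le> a"
        using cS dS r by (auto simp: S_def)
      then have "norm (apply_bcontfun c r - apply_bcontfun d r) \<le> 2 * a"
        using norm_triangle_ineq4[of "apply_bcontfun c r - qs ! nat \<lfloor>r * real N\<rfloor>" "apply_bcontfun d r - qs ! nat \<lfloor>r * real N\<rfloor>"] by simp
      moreover have "apply_bcontfun c t = apply_bcontfun c r" "apply_bcontfun d t = apply_bcontfun d r"
        using curves_clamp[OF c, of t] curves_clamp[of d T \<Omega> t] dS by (auto simp: r_def S_def)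
      ultimately show "dist (apply_bcontfun c t) (apply_bcontfun d t) \<le> 2 * a" by (simp add: dist_norm)
    qed
    then have "dist c d < \<epsilon>" using a by simp
    then show "\<exists>d\<in>(\<lambda>i. SOME c. c \<in> S i) ` I. dist c d < \<epsilon>" using \<open>(a, N, qs) \<in> I\<close> by (auto simp: d_def)
  qed
qed

text \<open>Curves outside the support have null neighbourhoods; separability covers all of those in
  V by countably many null balls. As \<eta> is carried by \<open>curves\<close>, an open set V
  without support points would be null.\<close>

lemma supp_in_curves_meets_open:
  fixes \<Omega> :: "'a::euclidean_space set"
  assumes "0 < T" and \<eta>: "prob_space \<eta>" "sets \<eta> = sets borel" "emeasure \<eta> (curves T \<Omega>) = 1"
    and V: "open V" "emeasure \<eta> V > 0"
  obtains c where "c \<in> supp_in (curves T \<Omega>) \<eta>" "c \<in> V"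
proof (rule ccontr)
  assume "\<not> thesis"
  then have null: "\<exists>N. open N \<and> c \<in> N \<and> emeasure \<eta> N = 0" if "c \<in> curves T \<Omega>" "c \<in> V" for c
    using that \<open>\<And>c. \<lbrakk>c \<in> supp_in (curves T \<Omega>) \<eta>; c \<in> V\<rbrakk> \<Longrightarrow> thesis\<close> by (force simp: supp_in_def)
  obtain D where D: "countable D" "\<And>c \<epsilon>. \<lbrakk>c \<in> curves T \<Omega>; 0 < \<epsilon>\<rbrakk> \<Longrightarrow> \<exists>d\<in>D. dist c d < \<epsilon>"
    using curves_separable[OF \<open>0 < T\<close>] by blast
  \<comment> \<open>Null balls with centre in the dense set and radius 1/(k + 1): a countable
    family.\<close>
  define B where "B = {(d, k)\<in>D \<times> (UNIV :: nat set). emeasure \<eta> (ball d (inverse (real (Suc k)))) = 0}"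
  have "countable B" unfolding B_def by (rule countable_subset[OF _ countable_SIGMA[OF D(1)]]) auto
  have ball_sets: "ball d e \<in> sets \<eta>" for d e unfolding \<eta>(2) by auto
  have "(\<Union>(d,k)\<in>B. ball d (inverse (real (Suc k)))) \<in> null_sets \<eta>"
    by (rule null_sets_UN'[OF \<open>countable B\<close>]) (auto simp: B_def null_sets_def ball_sets)
  moreover have "curves T \<Omega> \<inter> V \<subseteq> (\<Union>(d,k)\<in>B. ball d (inverse (real (Suc k))))"
  proof
    fix c assume c: "c \<in> curves T \<Omega> \<inter> V"
    obtain N where N: "open N" "c \<in> N" "emeasure \<eta> N = 0" using null c by blast
    obtain e where e: "e > 0" "ball c e \<subseteq> N" using N openE by blast
    obtain k where k: "inverse (real (Suc k)) < e / 2" using reals_Archimedean[of "e / 2"] e by auto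
    obtain d where d: "d \<in> D" "dist c d < inverse (real (Suc k))" using D(2)[of c "inverse (real (Suc k))"] c by auto
    have "ball d (inverse (real (Suc k))) \<subseteq> N"
    proof
      fix z assume "z \<in> ball d (inverse (real (Suc k)))"
      then have "dist c z < e" using d k dist_triangle[of c z d] by simp
      then show "z \<in> N" using e by auto
    qed
    then have "emeasure \<eta> (ball d (inverse (real (Suc k)))) \<le> 0"
      unfolding N(3)[symmetric] using N(1) \<eta>(2) by (intro emeasure_mono) auto
    then have "(d, k) \<in> B" using d by (simp add: B_def)
    moreover have "c \<in> ball d (inverse (real (Suc k)))" using d by (simp add: dist_commute)
    ultimately show "c \<in> (\<Union>(d,k)\<in>B. ball d (inverse (real (Suc k))))" by blast
  qed
  moreover have cm: "curves T \<Omega> \<in> sets \<eta>" using \<eta>(3) emeasure_notin_sets by fastforce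
  moreover have "space \<eta> - curves T \<Omega> \<in> null_sets \<eta>"
  proof (rule null_setsI)
    show "emeasure \<eta> (space \<eta> - curves T \<Omega>) = 0"
      using emeasure_compl[OF cm] \<eta>(3) prob_space.emeasure_space_1[OF \<eta>(1)] by simp
  qed (rule sets.compl_sets[OF cm])
  ultimately have "(\<Union>(d,k)\<in>B. ball d (inverse (real (Suc k)))) \<union> (space \<eta> - curves T \<Omega>) \<in> null_sets \<eta>" by blast
  moreover have "V \<subseteq> (\<Union>(d,k)\<in>B. ball d (inverse (real (Suc k)))) \<union> (space \<eta> - curves T \<Omega>)"
    using \<open>curves T \<Omega> \<inter> V \<subseteq> _\<close> sets_eq_imp_space_eq[OF \<eta>(2)] by auto
  moreover have "V \<in> sets \<eta>" using V \<eta>(2) by auto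
  ultimately have "emeasure \<eta> V = 0" by (meson null_setsD1 null_sets_subset)
  then show False using V by simp
qed

text \<open>A limit of support curves thereby inherits optimality, since an equilibrium makes every
  element of the support optimal.\<close>

lemma supp_in_closed:
  assumes "\<And>k. c k \<in> supp_in S \<eta>" "c \<longlonglongrightarrow> l" "l \<in> S"
  shows "l \<in> supp_in S \<eta>"
  unfolding supp_in_def
proof (intro CollectI conjI allI impI assms(3); elim conjE)
  fix N assume "open N" "l \<in> N"
  then have "\<forall>\<^sub>F k in sequentially. c k \<in> N" using assms(2) by (rule topological_tendstoD[rotated 1])
  then obtain k where "c k \<in> N" by (meson eventually_sequentially order_refl)
  then show "0 < emeasure \<eta> N" using assms(1)[of k] \<open>open N\<close> by (auto simp: supp_in_def)
qed

lemma KR_dist_continuity: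
  assumes "measure_path_cont K T m" "t \<in> {0..T}" "0 < \<epsilon>" "0 \<le> \<kappa>"
  obtains \<delta> where "0 < \<delta>" "\<And>s. \<lbrakk>s \<in> {0..T}; \<bar>s - t\<bar> < \<delta>\<rbrakk> \<Longrightarrow> \<kappa> * KR_dist K (m s) (m t) < \<epsilon>"
proof -
  have "\<epsilon> / (\<kappa> + 1) > 0" using assms by simp
  then obtain \<delta> where \<delta>: "\<delta> > 0" "\<And>s. \<lbrakk>s \<in> {0..T}; \<bar>s - t\<bar> < \<delta>\<rbrakk> \<Longrightarrow> KR_dist K (m s) (m t) < \<epsilon> / (\<kappa> + 1)"
    using assms(1,2) unfolding measure_path_cont_def by metis
  show thesis
  proof (rule that[OF \<delta>(1)])
    fix s assume "s \<in> {0..T}" "\<bar>s - t\<bar> < \<delta>"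
    then have "KR_dist K (m s) (m t) < \<epsilon> / (\<kappa> + 1)" by (rule \<delta>(2))
    then have "\<kappa> * KR_dist K (m s) (m t) \<le> \<kappa> * (\<epsilon> / (\<kappa> + 1))" using assms(4) by (intro mult_left_mono) auto
    also have "\<dots> < \<epsilon>" using assms(3,4) by (simp add: field_simps)
    finally show "\<kappa> * KR_dist K (m s) (m t) < \<epsilon>" .
  qed
qed

section \<open>From the equilibrium to the control problem and back\<close>

theorem theorem4p17:
  fixes \<Omega> U :: "'a::euclidean_space set"
    and T \<kappa> M \<mu> :: real
    and F G :: "'a \<Rightarrow> 'a measure \<Rightarrow> real"
    and DF DG :: "'a \<Rightarrow> 'a measure \<Rightarrow> 'a"
    and L :: "'a \<Rightarrow> 'a \<Rightarrow> real"
    and DxL DvL :: "'a \<Rightarrow> 'a \<Rightarrow> 'a"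
    and Lvx Lvv :: "'a \<Rightarrow> 'a \<Rightarrow> 'a \<Rightarrow> 'a"
    and m0 :: "'a measure"
    and u :: "real \<Rightarrow> 'a \<Rightarrow> real"
    and m :: "real \<Rightarrow> 'a measure"
  assumes T_pos: "T > 0"
    and \<Omega>_open: "open \<Omega>" and \<Omega>_bdd: "bounded \<Omega>" and \<Omega>_C2: "C2_boundary \<Omega>"
    and U_open: "open U" and U_sup: "closure \<Omega> \<subseteq> U"
    \<comment> \<open>(D1)\<close>
    and D1: "\<forall>x\<in>U. \<forall>m1 m2. prob_on (closure \<Omega>) m1 \<and> prob_on (closure \<Omega>) m2 \<longrightarrow>
               \<bar>F x m1 - F x m2\<bar> + \<bar>G x m1 - G x m2\<bar> \<le> \<kappa> * KR_dist (closure \<Omega>) m1 m2"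
    \<comment> \<open>(D2): F(.,m), G(.,m) in C^1_b(U) with gradients DF, DG, |DF|+|DG| \<le> \<kappa>\<close>
    and D2: "\<forall>\<nu>. prob_on (closure \<Omega>) \<nu> \<longrightarrow>
               (\<forall>x\<in>U. ((\<lambda>y. F y \<nu>) has_derivative (\<lambda>h. DF x \<nu> \<bullet> h)) (at x) \<and>
                       ((\<lambda>y. G y \<nu>) has_derivative (\<lambda>h. DG x \<nu> \<bullet> h)) (at x) \<and>
                       norm (DF x \<nu>) + norm (DG x \<nu>) \<le> \<kappa>) \<and>
               continuous_on U (\<lambda>x. DF x \<nu>) \<and> continuous_on U (\<lambda>x. DG x \<nu>) \<and>
               bounded ((\<lambda>x. F x \<nu>) ` U) \<and> bounded ((\<lambda>x. G x \<nu>) ` U)"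
    \<comment> \<open>(D3)\<close>
    and D3: "\<exists>C\<ge>0. \<forall>\<nu>. prob_on (closure \<Omega>) \<nu> \<longrightarrow> semiconcave_lin U C (\<lambda>x. F x \<nu>)"
    \<comment> \<open>(L0): L in C^1(U \<times> R^n) with partial gradients DxL, DvL\<close>
    and L0_diff: "\<forall>x\<in>U. \<forall>v. ((\<lambda>(y,w). L y w) has_derivative
                      (\<lambda>(h,k). DxL x v \<bullet> h + DvL x v \<bullet> k)) (at (x,v))"
    and L0_cont: "continuous_on (U \<times> UNIV) (\<lambda>(x,v). DxL x v)"
                 "continuous_on (U \<times> UNIV) (\<lambda>(x,v). DvL x v)"
    and L0_bd: "\<forall>x\<in>U. \<bar>L x 0\<bar> + norm (DxL x 0) + norm (DvL x 0) \<le> M"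
    \<comment> \<open>(L1): D_vL differentiable with D^2_{vx}L = Lvx, D^2_{vv}L = Lvv\<close>
    and \<mu>_pos: "\<mu> > 0"
    and L1: "\<forall>x\<in>U. \<forall>v. ((\<lambda>(y,w). DvL y w) has_derivative (\<lambda>(h,k). Lvx x v h + Lvv x v k)) (at (x,v)) \<and>
               (\<forall>\<xi>. (norm \<xi>)\<^sup>2 / \<mu> \<le> \<xi> \<bullet> Lvv x v \<xi> \<and> \<xi> \<bullet> Lvv x v \<xi> \<le> \<mu> * (norm \<xi>)\<^sup>2) \<and>
               (\<forall>h. norm (Lvx x v h) \<le> \<mu> * (1 + norm v) * norm h)"
    \<comment> \<open>(L2)\<close>
    and L2: "\<forall>R>0. \<exists>C. \<forall>x\<in>U. \<forall>v\<in>ball 0 R. \<forall>w\<in>ball 0 R.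
               norm (DxL x v - DxL x w) \<le> C * norm (v - w)"
    \<comment> \<open>(L3)\<close>
    and L3: "\<forall>R>0. \<exists>C\<ge>0. \<forall>v\<in>ball 0 R. semiconcave_lin U C (\<lambda>x. L x v)"
    \<comment> \<open>(u,m) mild solution with initial distribution m0\<close>
    and m0: "prob_on (closure \<Omega>) m0"
    and mild: "mild_solution L F G T \<Omega> m0 u m"
  shows "constrained_visc_sol L F T \<Omega> m u
       \<and> (\<forall>x\<in>closure \<Omega>. u T x = G x (m T))
       \<and> (\<forall>t\<in>{0<..<T}. \<forall>x\<in>\<Omega>. x \<in> msupp (m t) \<longrightarrow>
            (\<exists>ut ux. ((\<lambda>(s,y). u s y) has_derivative (\<lambda>(ds,dy). ut * ds + ux \<bullet> dy)) (at (t,x)) \<and>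
                     - ut + Ham L x ux = F x (m t)))
       \<and> (\<forall>t\<in>{0<..<T}. \<forall>x\<in>frontier \<Omega>. x \<in> msupp (m t) \<longrightarrow>
            (\<exists>ut p\<tau>. ((\<lambda>s. u s x) has_real_derivative ut) (at t) \<and>
                     superdiff_x \<Omega> u t x \<noteq> {} \<and>
                     (\<forall>p\<in>superdiff_x \<Omega> u t x. tangential (outward_normal \<Omega> x) p = p\<tau>) \<and>
                     - ut + Ham_tau L \<Omega> x p\<tau> = F x (m t)))"
proof -
  obtain \<eta> where m_cont: "measure_path_cont (closure \<Omega>) T m" and eq: "MFG_equilibrium L F G T \<Omega> m0 \<eta>"
    and m_flow: "\<forall>t\<in>{0..T}. m t = flow \<eta> t"
    and u_val: "\<forall>t\<in>{0..T}. \<forall>x\<in>closure \<Omega>. ereal (u t x) = (INF \<gamma>\<in>{\<gamma>\<in>curves T \<Omega>. apply_bcontfun \<gamma> t = x}.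
                              cost L F G m T t (apply_bcontfun \<gamma>))"
    using mild unfolding mild_solution_def by blast
  have prob_m: "prob_on (closure \<Omega>) (m s)" if "s \<in> {0..T}" for s using m_cont that unfolding measure_path_cont_def by blast
  \<comment> \<open>The initial distribution has mass one on the closure; a point in it is wanted to
    read off \<kappa> \<ge> 0 and M \<ge> 0 from the bounds.\<close>
  have "closure \<Omega> \<noteq> {}"
  proof
    assume "closure \<Omega> = {}"
    then show False using m0 unfolding prob_on_def by simp
  qed
  then obtain x1 where x1: "x1 \<in> closure \<Omega>" by (metis ex_in_conv)
  then have x1U: "x1 \<in> U" using U_sup by blast
  have TT: "T \<in> {0..T}" "0 \<in> {0..T}" using T_pos by auto
  have dF: "((\<lambda>y. F y \<nu>) has_derivative (\<lambda>h. DF x \<nu> \<bullet> h)) (at x)" "norm (DF x \<nu>) \<le> \<kappa>" and Gb: "bounded ((\<lambda>x. G x \<nu>) ` U)"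
    if "prob_on (closure \<Omega>) \<nu>" "x \<in> U" for \<nu> x
  proof -
    note D2\<nu> = D2[THEN spec, THEN mp, OF that(1)]
    note D2x = D2\<nu>[THEN conjunct1, THEN bspec, OF that(2)]
    show "((\<lambda>y. F y \<nu>) has_derivative (\<lambda>h. DF x \<nu> \<bullet> h)) (at x)" by (rule D2x[THEN conjunct1])
    show "bounded ((\<lambda>x. G x \<nu>) ` U)" by (rule D2\<nu>[THEN conjunct2, THEN conjunct2, THEN conjunct2, THEN conjunct2])
    show "norm (DF x \<nu>) \<le> \<kappa>" using D2x[THEN conjunct2, THEN conjunct2] norm_ge_zero[of "DG x \<nu>"] by linarith
  qed
  have \<kappa>: "0 \<le> \<kappa>" by (rule order_trans[OF norm_ge_zero dF(2)[OF m0 x1U]])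
  have M: "0 \<le> M" "\<And>x. x \<in> U \<Longrightarrow> \<bar>L x 0\<bar> \<le> M" "\<And>x. x \<in> U \<Longrightarrow> norm (DxL x 0) \<le> M" "\<And>x. x \<in> U \<Longrightarrow> norm (DvL x 0) \<le> M"
  proof -
    have *: "\<bar>L x 0\<bar> + norm (DxL x 0) + norm (DvL x 0) \<le> M" if "x \<in> U" for x using L0_bd that by blast
    show "\<bar>L x 0\<bar> \<le> M" "norm (DxL x 0) \<le> M" "norm (DvL x 0) \<le> M" if "x \<in> U" for x
      using *[OF that] norm_ge_zero[of "DxL x 0"] norm_ge_zero[of "DvL x 0"] abs_ge_zero[of "L x 0"] by linarith+
    then show "0 \<le> M" using x1U by (meson abs_ge_zero order_trans)
  qed
  have dL: "((\<lambda>(y,w). L y w) has_derivative (\<lambda>(h,k). DxL x v \<bullet> h + DvL x v \<bullet> k)) (at (x,v))" if "x \<in> U" for x v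
    using L0_diff that by blast
  have dD: "((\<lambda>(y,w). DvL y w) has_derivative (\<lambda>(h,k). Lvx x v h + Lvv x v k)) (at (x,v))"
    and vv: "(norm \<xi>)\<^sup>2 / \<mu> \<le> \<xi> \<bullet> Lvv x v \<xi>" "\<xi> \<bullet> Lvv x v \<xi> \<le> \<mu> * (norm \<xi>)\<^sup>2"
    and vx: "norm (Lvx x v h) \<le> \<mu> * (1 + norm v) * norm h" if "x \<in> U" for x v \<xi> h
  proof -
    note L1x = bspec[OF L1 that]
    show "((\<lambda>(y,w). DvL y w) has_derivative (\<lambda>(h,k). Lvx x v h + Lvv x v k)) (at (x,v))"
      by (rule L1x[THEN spec, THEN conjunct1])
    show "(norm \<xi>)\<^sup>2 / \<mu> \<le> \<xi> \<bullet> Lvv x v \<xi>" by (rule L1x[THEN spec, THEN conjunct2, THEN conjunct1, THEN spec, THEN conjunct1])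
    show "\<xi> \<bullet> Lvv x v \<xi> \<le> \<mu> * (norm \<xi>)\<^sup>2" by (rule L1x[THEN spec, THEN conjunct2, THEN conjunct1, THEN spec, THEN conjunct2])
    show "norm (Lvx x v h) \<le> \<mu> * (1 + norm v) * norm h" by (rule L1x[THEN spec, THEN conjunct2, THEN conjunct2, THEN spec])
  qed
  \<comment> \<open>M + 2\<mu> is the Lipschitz constant of the Lagrangian in x, and \<kappa> that
    of the coupling.\<close>
  define K where "K = M + 2 * \<mu> + \<kappa>"
  define f where "f s x = F x (m s)" for s x
  define g where "g x = G x (m T)" for x
  have cost_paths: "ereal (u t x) = (INF \<gamma>\<in>{\<gamma>\<in>paths T \<Omega>. \<gamma> t = x}.
        ext_lint {t..T} (\<lambda>s. L (\<gamma> s) (vector_derivative \<gamma> (at s)) + f s (\<gamma> s)) + ereal (g (\<gamma> T)))"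
    if "t \<in> {0..T}" "x \<in> closure \<Omega>" for t x
  proof -
    have "{\<gamma>\<in>paths T \<Omega>. \<gamma> t = x} = apply_bcontfun ` {\<gamma>\<in>curves T \<Omega>. apply_bcontfun \<gamma> t = x}"
      unfolding paths_eq_curves[OF less_imp_le[OF T_pos]] by blast
    then show ?thesis using u_val that by (simp add: cost_def f_def g_def image_image)
  qed
  interpret control \<Omega> U T \<mu> K L DvL f g u
  proof (rule control.intro)
    show "0 < T" "open U" "closure \<Omega> \<subseteq> U" "bounded \<Omega>" "0 < \<mu>" by fact+
    show "0 \<le> K" using M \<mu>_pos \<kappa> by (simp add: K_def)
    show "continuous_on (U \<times> UNIV) (\<lambda>(x, v). L x v)"
    proof (rule continuous_at_imp_continuous_on, clarify)
      fix x v assume "x \<in> U"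
      from has_derivative_continuous[OF dL[OF this]] show "isCont (\<lambda>(x, v). L x v) (x, v)" .
    qed
    fix x v w assume x: "x \<in> U"
    have z: "Lvx x v 0 = 0" for v using vx[OF x, of v 0] by simp
    obtain \<xi> where \<xi>: "L x w = L x v + DvL x v \<bullet> (w - v) + (w - v) \<bullet> Lvv x \<xi> (w - v) / 2"
      using lagrangian_taylor[where L = L and x = x and DxL = DxL and DvL = DvL and Lvx = Lvx and Lvv = Lvv and v = v and w = w, OF dL[OF x] dD[OF x] z] .
    show "L x v + DvL x v \<bullet> (w - v) + (norm (w - v))\<^sup>2 / (2 * \<mu>) \<le> L x w" using vv(1)[OF x, of "w - v" \<xi>] \<xi> by simp
  next
    fix x v w assume x: "x \<in> U"
    have z: "Lvx x v 0 = 0" for v using vx[OF x, of v 0] by simp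
    obtain \<xi> where \<xi>: "L x w = L x v + DvL x v \<bullet> (w - v) + (w - v) \<bullet> Lvv x \<xi> (w - v) / 2"
      using lagrangian_taylor[where L = L and x = x and DxL = DxL and DvL = DvL and Lvx = Lvx and Lvv = Lvv and v = v and w = w, OF dL[OF x] dD[OF x] z] .
    show "L x w \<le> L x v + DvL x v \<bullet> (w - v) + \<mu> / 2 * (norm (w - v))\<^sup>2" using vv(2)[OF x, of "w - v" \<xi>] \<xi> by simp
  next
    fix x assume x: "x \<in> U"
    show "\<bar>L x 0\<bar> \<le> K \<and> norm (DvL x 0) \<le> K" using M(2,4)[OF x] \<mu>_pos \<kappa> by (simp add: K_def)
  next
    fix x y v assume seg: "closed_segment x y \<subseteq> U"
    have "\<bar>L x v - L y v\<bar> \<le> (M + 2 * \<mu>) * (1 + (norm v)\<^sup>2) * norm (x - y)"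
      by (rule lagrangian_lipschitz[where L = L and DxL = DxL and DvL = DvL and Lvx = Lvx and Lvv = Lvv and U = U, OF seg M(1) less_imp_le[OF \<mu>_pos] dL dD M(3) vx])
    also have "\<dots> \<le> K * (1 + (norm v)\<^sup>2) * norm (x - y)"
      using \<kappa> by (intro mult_right_mono) (auto simp: K_def add_nonneg_nonneg)
    finally show "\<bar>L x v - L y v\<bar> \<le> K * (1 + (norm v)\<^sup>2) * norm (x - y)" .
  next
    \<comment> \<open>(D1) compares two times at the same point uniformly in that point, and
      differentiability of F at the fixed measure m(t) compares two points.\<close>
    show "continuous_on ({0..T} \<times> closure \<Omega>) (\<lambda>(s, x). f s x)"
      unfolding continuous_on_iff
    proof (intro ballI allI impI)
      fix p :: "real \<times> 'a" and e :: real assume p: "p \<in> {0..T} \<times> closure \<Omega>" and "0 < e"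
      obtain t x where tx: "p = (t, x)" "t \<in> {0..T}" "x \<in> closure \<Omega>" using p by auto
      have "0 < e / 2" using \<open>0 < e\<close> by simp
      obtain d1 where d1: "0 < d1" "\<And>s. \<lbrakk>s \<in> {0..T}; \<bar>s - t\<bar> < d1\<rbrakk> \<Longrightarrow> \<kappa> * KR_dist (closure \<Omega>) (m s) (m t) < e / 2"
        using KR_dist_continuity[OF m_cont tx(2) \<open>0 < e / 2\<close> \<kappa>] by blast
      have "isCont (\<lambda>y. F y (m t)) x"
        using has_derivative_continuous[OF dF(1)[OF prob_m[OF tx(2)]]] tx(3) U_sup by blast
      then obtain d2 where d2: "0 < d2" "\<And>y. dist y x < d2 \<Longrightarrow> dist (F y (m t)) (F x (m t)) < e / 2"
        unfolding continuous_at_eps_delta using \<open>0 < e / 2\<close> by blast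
      show "\<exists>d>0. \<forall>p'\<in>{0..T} \<times> closure \<Omega>. dist p' p < d \<longrightarrow> dist (case p' of (s, x) \<Rightarrow> f s x) (case p of (s, x) \<Rightarrow> f s x) < e"
      proof (intro exI[of _ "min d1 d2"] conjI ballI impI)
        fix p' assume p': "p' \<in> {0..T} \<times> closure \<Omega>" "dist p' p < min d1 d2"
        obtain s y where sy: "p' = (s, y)" "s \<in> {0..T}" "y \<in> closure \<Omega>" using p' by auto
        have "dist s t < min d1 d2" "dist y x < min d1 d2"
          using p'(2) dist_fst_le[of p' p] dist_snd_le[of p' p] by (auto simp: sy tx)
        then have 1: "\<kappa> * KR_dist (closure \<Omega>) (m s) (m t) < e / 2" "dist (F y (m t)) (F x (m t)) < e / 2"
          using d1(2)[OF sy(2)] d2(2) by (auto simp: dist_real_def)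
        have "\<bar>F y (m s) - F y (m t)\<bar> + \<bar>G y (m s) - G y (m t)\<bar> \<le> \<kappa> * KR_dist (closure \<Omega>) (m s) (m t)"
          using D1 sy U_sup prob_m[OF sy(2)] prob_m[OF tx(2)] by blast
        then have "dist (F y (m s)) (F y (m t)) < e / 2" using 1(1) abs_ge_zero[of "G y (m s) - G y (m t)"] unfolding dist_real_def by linarith
        then have "dist (F y (m s)) (F x (m t)) < e" using 1(2) dist_triangle[of "F y (m s)" "F x (m t)" "F y (m t)"] by linarith
        then show "dist (case p' of (s, x) \<Rightarrow> f s x) (case p of (s, x) \<Rightarrow> f s x) < e" by (simp add: sy tx f_def)
      qed (use d1 d2 in simp)
    qed
  next
    fix s x y assume s: "s \<in> {0..T}" and seg: "closed_segment x y \<subseteq> U"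
    have "norm (F x (m s) - F y (m s)) \<le> \<kappa> * norm (x - y)"
    proof (rule differentiable_bound[OF convex_closed_segment])
      fix z assume "z \<in> closed_segment x y"
      then have z: "z \<in> U" using seg by blast
      show "((\<lambda>x. F x (m s)) has_derivative (\<lambda>h. DF z (m s) \<bullet> h)) (at z within closed_segment x y)"
        by (rule has_derivative_at_withinI[OF dF(1)[OF prob_m[OF s] z]])
      show "onorm (\<lambda>h. DF z (m s) \<bullet> h) \<le> \<kappa>"
      proof (rule onorm_bound[OF \<kappa>])
        fix h have "norm (DF z (m s) \<bullet> h) \<le> norm (DF z (m s)) * norm h" using Cauchy_Schwarz_ineq2 by simp
        also have "\<dots> \<le> \<kappa> * norm h" using dF(2)[OF prob_m[OF s] z] by (rule mult_right_mono) simp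
        finally show "norm (DF z (m s) \<bullet> h) \<le> \<kappa> * norm h" .
      qed
    qed auto
    also have "\<dots> \<le> K * norm (x - y)" using M(1) \<mu>_pos by (intro mult_right_mono) (auto simp: K_def)
    finally show "\<bar>f s x - f s y\<bar> \<le> K * norm (x - y)" by (simp add: f_def)
  next
    show "bounded (g ` closure \<Omega>)"
      unfolding g_def by (rule bounded_subset[OF Gb[OF prob_m[OF TT(1)] x1U]]) (use U_sup in auto)
  next
    fix x assume "x \<in> closure \<Omega>"
    then show "\<exists>r>0. \<exists>n. \<forall>y\<in>closure \<Omega> \<inter> ball x r. \<forall>z\<in>closure \<Omega> \<inter> ball x r. \<forall>\<theta>\<in>{0..1}.
       y + \<theta> *\<^sub>R (z - y) - (\<theta> * (1 - \<theta>) * (norm (z - y))\<^sup>2) *\<^sub>R n \<in> closure \<Omega>"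
      by (rule C2_quadratic_correction[OF \<Omega>_open \<Omega>_C2])
  next
    fix t x assume "t \<in> {0..T}" "x \<in> closure \<Omega>"
    then show "ereal (u t x) = (INF \<gamma>\<in>{\<gamma>\<in>paths T \<Omega>. \<gamma> t = x}.
        ext_lint {t..T} (\<lambda>s. L (\<gamma> s) (vector_derivative \<gamma> (at s)) + f s (\<gamma> s)) + ereal (g (\<gamma> T)))"
      by (rule cost_paths)
  qed
  \<comment> \<open>Converts the Frechet derivative of a test function into the additive norm |s -
    t| + |y - x| used by the control lemmas.\<close>
  have test_expansion: "\<exists>d>0. \<forall>s y. \<bar>s - t\<bar> < d \<and> norm (y - x) < d \<longrightarrow>
      \<bar>\<phi> s y - \<phi> t x - (\<phi>t t x * (s - t) + \<phi>x t x \<bullet> (y - x))\<bar> \<le> \<epsilon> * (\<bar>s - t\<bar> + norm (y - x))"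
    if \<phi>: "C1_test \<phi> \<phi>t \<phi>x" and "0 < \<epsilon>" for \<phi> \<phi>t \<phi>x t x \<epsilon>
  proof -
    have "((\<lambda>(s,y). \<phi> s y) has_derivative (\<lambda>(ds,dy). \<phi>t t x * ds + \<phi>x t x \<bullet> dy)) (at (t,x))"
      using \<phi> unfolding C1_test_def by blast
    then obtain d where d: "0 < d" "\<And>p. norm (p - (t,x)) < d \<Longrightarrow>
        norm ((case p of (s,y) \<Rightarrow> \<phi> s y) - (case (t,x) of (s,y) \<Rightarrow> \<phi> s y) - (case p - (t,x) of (ds,dy) \<Rightarrow> \<phi>t t x * ds + \<phi>x t x \<bullet> dy)) \<le> \<epsilon> * norm (p - (t,x))"
      unfolding has_derivative_at_alt using \<open>0 < \<epsilon>\<close> by blast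
    show ?thesis
    proof (intro exI[of _ "d / 2"] conjI allI impI; (elim conjE)?)
      fix s y assume sy: "\<bar>s - t\<bar> < d / 2" "norm (y - x) < d / 2"
      have n: "norm ((s,y) - (t,x)) \<le> \<bar>s - t\<bar> + norm (y - x)" using norm_Pair_le[of "s - t" "y - x"] by simp
      then have "norm ((s,y) - (t,x)) < d" using sy by simp
      from d(2)[OF this] have "\<bar>\<phi> s y - \<phi> t x - (\<phi>t t x * (s - t) + \<phi>x t x \<bullet> (y - x))\<bar> \<le> \<epsilon> * norm ((s,y) - (t,x))" by simp
      also have "\<dots> \<le> \<epsilon> * (\<bar>s - t\<bar> + norm (y - x))" using n \<open>0 < \<epsilon>\<close> by (intro mult_left_mono) auto
      finally show "\<bar>\<phi> s y - \<phi> t x - (\<phi>t t x * (s - t) + \<phi>x t x \<bullet> (y - x))\<bar> \<le> \<epsilon> * (\<bar>s - t\<bar> + norm (y - x))" .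
    qed (use d in simp)
  qed
  have sub: "visc_subsol L F T \<Omega> m u"
    unfolding visc_subsol_def
  proof (intro allI impI, elim conjE exE)
    fix \<phi> \<phi>t \<phi>x t x r assume \<phi>: "C1_test \<phi> \<phi>t \<phi>x" and t: "t \<in> {0<..<T}" and x: "x \<in> \<Omega>" and r: "0 < (r::real)"
      and mx: "\<forall>s y. s \<in> {0<..<T} \<and> y \<in> \<Omega> \<and> \<bar>s - t\<bar> < r \<and> dist y x < r \<longrightarrow> u s y - \<phi> s y \<le> u t x - \<phi> t x"
    have "- \<phi>t t x + Ham L x (\<phi>x t x) \<le> f t x"
    proof (rule subsolution_at[OF t x \<Omega>_open])
      fix \<epsilon> :: real assume "0 < \<epsilon>"
      from test_expansion[OF \<phi> this] obtain d where d: "0 < d" "\<forall>s y. \<bar>s - t\<bar> < d \<and> norm (y - x) < d \<longrightarrow>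
        \<bar>\<phi> s y - \<phi> t x - (\<phi>t t x * (s - t) + \<phi>x t x \<bullet> (y - x))\<bar> \<le> \<epsilon> * (\<bar>s - t\<bar> + norm (y - x))" by blast
      show "\<exists>d>0. \<forall>s y. t \<le> s \<and> s < t + d \<and> y \<in> \<Omega> \<and> norm (y - x) < d \<longrightarrow>
        u s y - u t x \<le> \<phi>t t x * (s - t) + \<phi>x t x \<bullet> (y - x) + \<epsilon> * (\<bar>s - t\<bar> + norm (y - x))"
      \<comment> \<open>T - t keeps the times inside (0, T), where alone the extremality at (t, x)
        is given.\<close>
      proof (intro exI[of _ "min (min d r) (T - t)"] conjI allI impI; (elim conjE)?)
        fix s y assume sy: "t \<le> s" "s < t + min (min d r) (T - t)" "y \<in> \<Omega>" "norm (y - x) < min (min d r) (T - t)"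
        have "u s y - \<phi> s y \<le> u t x - \<phi> t x" by (rule mx[rule_format]) (use sy t in \<open>auto simp: dist_norm\<close>)
        moreover have "\<bar>\<phi> s y - \<phi> t x - (\<phi>t t x * (s - t) + \<phi>x t x \<bullet> (y - x))\<bar> \<le> \<epsilon> * (\<bar>s - t\<bar> + norm (y - x))"
          by (rule d(2)[rule_format]) (use sy in auto)
        ultimately show "u s y - u t x \<le> \<phi>t t x * (s - t) + \<phi>x t x \<bullet> (y - x) + \<epsilon> * (\<bar>s - t\<bar> + norm (y - x))" by linarith
      qed (use d r t in auto)
    qed
    then show "- \<phi>t t x + Ham L x (\<phi>x t x) \<le> F x (m t)" by (simp add: f_def)
  qed
  have super: "visc_supersol L F T (closure \<Omega>) m u"
    unfolding visc_supersol_def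
  proof (intro allI impI, elim conjE exE)
    fix \<phi> \<phi>t \<phi>x t x r assume \<phi>: "C1_test \<phi> \<phi>t \<phi>x" and t: "t \<in> {0<..<T}" and x: "x \<in> closure \<Omega>" and r: "0 < (r::real)"
      and mx: "\<forall>s y. s \<in> {0<..<T} \<and> y \<in> closure \<Omega> \<and> \<bar>s - t\<bar> < r \<and> dist y x < r \<longrightarrow> u t x - \<phi> t x \<le> u s y - \<phi> s y"
    have "f t x \<le> - \<phi>t t x + Ham L x (\<phi>x t x)"
    proof (rule supersolution_at[OF t x])
      fix \<epsilon> :: real assume "0 < \<epsilon>"
      from test_expansion[OF \<phi> this] obtain d where d: "0 < d" "\<forall>s y. \<bar>s - t\<bar> < d \<and> norm (y - x) < d \<longrightarrow>
        \<bar>\<phi> s y - \<phi> t x - (\<phi>t t x * (s - t) + \<phi>x t x \<bullet> (y - x))\<bar> \<le> \<epsilon> * (\<bar>s - t\<bar> + norm (y - x))" by blast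
      show "\<exists>d>0. \<forall>s y. t \<le> s \<and> s < t + d \<and> y \<in> closure \<Omega> \<and> norm (y - x) < d \<longrightarrow>
        \<phi>t t x * (s - t) + \<phi>x t x \<bullet> (y - x) - \<epsilon> * (\<bar>s - t\<bar> + norm (y - x)) \<le> u s y - u t x"
      proof (intro exI[of _ "min (min d r) (T - t)"] conjI allI impI; (elim conjE)?)
        fix s y assume sy: "t \<le> s" "s < t + min (min d r) (T - t)" "y \<in> closure \<Omega>" "norm (y - x) < min (min d r) (T - t)"
        have "u t x - \<phi> t x \<le> u s y - \<phi> s y" by (rule mx[rule_format]) (use sy t in \<open>auto simp: dist_norm\<close>)
        moreover have "\<bar>\<phi> s y - \<phi> t x - (\<phi>t t x * (s - t) + \<phi>x t x \<bullet> (y - x))\<bar> \<le> \<epsilon> * (\<bar>s - t\<bar> + norm (y - x))"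
          by (rule d(2)[rule_format]) (use sy in auto)
        ultimately show "\<phi>t t x * (s - t) + \<phi>x t x \<bullet> (y - x) - \<epsilon> * (\<bar>s - t\<bar> + norm (y - x)) \<le> u s y - u t x" by linarith
      qed (use d r t in auto)
    qed
    then show "F x (m t) \<le> - \<phi>t t x + Ham L x (\<phi>x t x)" by (simp add: f_def)
  qed
  have \<eta>: "prob_space \<eta>" "sets \<eta> = sets borel" "emeasure \<eta> (curves T \<Omega>) = 1"
    and supp: "supp_in (curves T \<Omega>) \<eta> \<subseteq> (\<Union>x\<in>closure \<Omega>. optimal_curves L F G T \<Omega> \<eta> x)"
    using eq unfolding MFG_equilibrium_def by auto
  have supp_opt: "optimal (apply_bcontfun c)" if "c \<in> supp_in (curves T \<Omega>) \<eta>" for c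
  proof -
    have "c \<in> (\<Union>x\<in>closure \<Omega>. optimal_curves L F G T \<Omega> \<eta> x)" by (rule subsetD[OF supp that])
    then obtain x where "c \<in> optimal_curves L F G T \<Omega> \<eta> x" by (rule UN_E)
    then have c: "c \<in> curves T \<Omega>" "apply_bcontfun c 0 = x" and
      min: "\<forall>\<gamma>'\<in>curves T \<Omega>. apply_bcontfun \<gamma>' 0 = x \<longrightarrow> cost L F G (flow \<eta>) T 0 (apply_bcontfun c) \<le> cost L F G (flow \<eta>) T 0 (apply_bcontfun \<gamma>')"
      unfolding optimal_curves_def by simp_all
    have x: "x \<in> closure \<Omega>" using c TT by (auto simp: curves_def)
    have cp: "apply_bcontfun c \<in> paths T \<Omega>" using c T_pos by (simp add: paths_eq_curves)
    \<comment> \<open>The two measure flows agree on [0, T] only; the indicator in the integral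
      removes all other times.\<close>
    have same: "cost L F G (flow \<eta>) T 0 \<gamma> = cost L F G m T 0 \<gamma>" for \<gamma>
    proof -
      have "ennreal (L (\<gamma> s) (vector_derivative \<gamma> (at s)) + F (\<gamma> s) (flow \<eta> s)) * indicator {0..T} s =
         ennreal (L (\<gamma> s) (vector_derivative \<gamma> (at s)) + F (\<gamma> s) (m s)) * indicator {0..T} s"
         "ennreal (- (L (\<gamma> s) (vector_derivative \<gamma> (at s)) + F (\<gamma> s) (flow \<eta> s))) * indicator {0..T} s =
         ennreal (- (L (\<gamma> s) (vector_derivative \<gamma> (at s)) + F (\<gamma> s) (m s))) * indicator {0..T} s" for s
        using m_flow by (simp_all split: split_indicator)
      then show ?thesis using m_flow TT by (simp add: cost_def ext_lint_def)
    qed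
    have "cost L F G m T 0 (apply_bcontfun c) \<le> ereal (u 0 x)"
      using u_val TT x min c unfolding same by (auto intro!: INF_greatest)
    then have "ext_lint {0..T} (\<lambda>s. L (apply_bcontfun c s) (vector_derivative (apply_bcontfun c) (at s)) + f s (apply_bcontfun c s)) + ereal (g (apply_bcontfun c T)) \<le> ereal (u 0 x)"
      by (simp add: cost_def f_def g_def)
    then show ?thesis
      unfolding fin_cost_iff[OF cp order_refl] optimal_def using cp c by (auto split: if_splits)
  qed
  \<comment> \<open>Every ball around x has positive mass under m(t), so curves in the support of
    \<eta> pass arbitrarily close to x at time t. A uniform limit of such curves passes through x
    and stays in the support.\<close>
  have through: "\<exists>\<gamma>. optimal \<gamma> \<and> \<gamma> t = x" if t: "t \<in> {0<..<T}" and x: "x \<in> msupp (m t)" for t x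
  proof -
    have "\<exists>c\<in>supp_in (curves T \<Omega>) \<eta>. dist (apply_bcontfun c t) x < inverse (real (Suc k))" for k
    proof -
      define B where "B = ball x (inverse (real (Suc k)))"
      define V where "V = {c::real \<Rightarrow>\<^sub>C 'a. apply_bcontfun c t \<in> B}"
      have cont: "continuous_on UNIV (\<lambda>c::real \<Rightarrow>\<^sub>C 'a. apply_bcontfun c t)"
        unfolding continuous_on_iff
      proof (intro ballI allI impI)
        fix c :: "real \<Rightarrow>\<^sub>C 'a" and e :: real assume "0 < e"
        then show "\<exists>d>0. \<forall>c'\<in>UNIV. dist c' c < d \<longrightarrow> dist (apply_bcontfun c' t) (apply_bcontfun c t) < e"
          using dist_bounded le_less_trans by blast
      qed
      have V: "open V" using open_vimage[OF _ cont, of B] by (simp add: V_def B_def vimage_def)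
      have meas: "(\<lambda>c. apply_bcontfun c t) \<in> measurable \<eta> borel"
        using borel_measurable_continuous_onI[OF cont] \<eta>(2) by (simp cong: measurable_cong_sets)
      have "0 < emeasure (m t) B" using x by (simp add: msupp_def B_def)
      also have "m t = flow \<eta> t" using m_flow t by simp
      also have "emeasure (flow \<eta> t) B = emeasure \<eta> V"
        unfolding flow_def using sets_eq_imp_space_eq[OF \<eta>(2)] by (subst emeasure_distr[OF meas]) (auto simp: V_def B_def vimage_def)
      finally obtain c where "c \<in> supp_in (curves T \<Omega>) \<eta>" "c \<in> V"
        using supp_in_curves_meets_open[OF T_pos \<eta> V] by blast
      then show ?thesis by (auto simp: V_def B_def dist_commute)
    qed
    then obtain c where c: "\<And>k. c k \<in> supp_in (curves T \<Omega>) \<eta>" "\<And>k. dist (apply_bcontfun (c k) t) x < inverse (real (Suc k))" by metis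
    obtain \<phi> r where \<phi>: "\<phi> \<in> paths T \<Omega>" "strict_mono (r :: nat \<Rightarrow> nat)"
      "\<And>e. 0 < e \<Longrightarrow> \<exists>N. \<forall>n\<ge>N. \<forall>t. norm (apply_bcontfun (c (r n)) t - \<phi> t) < e"
      using optimal_sequence_compact[of "\<lambda>k. apply_bcontfun (c k)"] supp_opt[OF c(1)] by blast
    obtain l where l: "l \<in> curves T \<Omega>" "\<phi> = apply_bcontfun l" using \<phi>(1) T_pos by (auto simp: paths_eq_curves)
    have "(\<lambda>n. c (r n)) \<longlonglongrightarrow> l"
      unfolding lim_sequentially
    proof (intro allI impI)
      fix e :: real assume "0 < e"
      then obtain N where N: "\<forall>n\<ge>N. \<forall>t. norm (apply_bcontfun (c (r n)) t - \<phi> t) < e / 2" using \<phi>(3)[of "e / 2"] by auto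
      have "dist (c (r n)) l < e" if "n \<ge> N" for n
      proof -
        have "dist (c (r n)) l \<le> e / 2" by (rule dist_bound) (use N that l in \<open>auto simp: dist_norm less_imp_le\<close>)
        then show ?thesis using \<open>0 < e\<close> by simp
      qed
      then show "\<exists>N. \<forall>n\<ge>N. dist (c (r n)) l < e" by blast
    qed
    then have "l \<in> supp_in (curves T \<Omega>) \<eta>" by (rule supp_in_closed[rotated 1]) (use c l in auto)
    then have "optimal \<phi>" using supp_opt l by simp
    moreover have "\<phi> t = x"
    proof (rule LIMSEQ_unique)
      show "(\<lambda>n. apply_bcontfun (c (r n)) t) \<longlonglongrightarrow> \<phi> t" unfolding LIMSEQ_iff using \<phi>(3) by meson
      have "(\<lambda>k. apply_bcontfun (c k) t) \<longlonglongrightarrow> x"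
        unfolding lim_sequentially
      proof (intro allI impI)
        fix e :: real assume "0 < e"
        then obtain N where N: "inverse (real (Suc N)) < e" using reals_Archimedean by blast
        have "dist (apply_bcontfun (c n) t) x < e" if "n \<ge> N" for n
        proof -
          have "inverse (real (Suc n)) \<le> inverse (real (Suc N))" using that by simp
          then show ?thesis using c(2)[of n] N by linarith
        qed
        then show "\<exists>N. \<forall>n\<ge>N. dist (apply_bcontfun (c n) t) x < e" by blast
      qed
      from LIMSEQ_subseq_LIMSEQ[OF this \<phi>(2)] show "(\<lambda>n. apply_bcontfun (c (r n)) t) \<longlonglongrightarrow> x" by (simp add: o_def)
    qed
    ultimately show ?thesis by blast
  qed
  \<comment> \<open>The curve is kept in the conclusion because at the boundary the tangency of v is
    read off from it.\<close>
  have expansion: "\<exists>v. \<exists>\<gamma>. \<gamma> \<in> paths T \<Omega> \<and> \<gamma> t = x \<and> (\<gamma> has_vector_derivative v) (at t) \<and>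
      (\<forall>\<epsilon>>0. \<exists>d>0. \<forall>s y. \<bar>s - t\<bar> < d \<and> y \<in> closure \<Omega> \<and> norm (y - x) < d \<longrightarrow>
      \<bar>u s y - u t x - (DvL x v \<bullet> v - L x v - F x (m t)) * (s - t) + DvL x v \<bullet> (y - x)\<bar> \<le> \<epsilon> * (\<bar>s - t\<bar> + norm (y - x)))"
    if t: "t \<in> {0<..<T}" and x: "x \<in> msupp (m t)" for t x
  proof -
    obtain \<gamma> where \<gamma>: "optimal \<gamma>" "\<gamma> t = x" using through[OF t x] by blast
    obtain v where v: "(\<gamma> has_vector_derivative v) (at t)" using optimal_differentiable[OF \<gamma>(1) t] .
    have "\<exists>d>0. \<forall>s y. \<bar>s - t\<bar> < d \<and> y \<in> closure \<Omega> \<and> norm (y - x) < d \<longrightarrow>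
      \<bar>u s y - u t x - (DvL x v \<bullet> v - L x v - F x (m t)) * (s - t) + DvL x v \<bullet> (y - x)\<bar> \<le> \<epsilon> * (\<bar>s - t\<bar> + norm (y - x))"
      if "0 < \<epsilon>" for \<epsilon>
    proof -
      obtain d where "0 < d" and d: "\<And>s y. \<lbrakk>\<bar>s - t\<bar> < d; y \<in> closure \<Omega>; norm (y - x) < d\<rbrakk> \<Longrightarrow>
        \<bar>u s y - u t x - (DvL x v \<bullet> v - L x v - f t x) * (s - t) + DvL x v \<bullet> (y - x)\<bar> \<le> \<epsilon> * (\<bar>s - t\<bar> + norm (y - x))"
        by (rule value_expansion[OF \<gamma>(1) t v \<gamma>(2)[symmetric] \<open>0 < \<epsilon>\<close>]) (rule that; assumption)
      show ?thesis by (intro exI[of _ d] conjI \<open>0 < d\<close>) (use d in \<open>auto simp: f_def\<close>)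
    qed
    then show ?thesis using \<gamma> v by (auto simp: optimal_def)
  qed
  have interior: "\<exists>ut ux. ((\<lambda>(s,y). u s y) has_derivative (\<lambda>(ds,dy). ut * ds + ux \<bullet> dy)) (at (t,x)) \<and> - ut + Ham L x ux = F x (m t)"
    if t: "t \<in> {0<..<T}" and x\<Omega>: "x \<in> \<Omega>" and x: "x \<in> msupp (m t)" for t x
  proof -
    obtain v where ex: "\<forall>\<epsilon>>0. \<exists>d>0. \<forall>s y. \<bar>s - t\<bar> < d \<and> y \<in> closure \<Omega> \<and> norm (y - x) < d \<longrightarrow>
      \<bar>u s y - u t x - (DvL x v \<bullet> v - L x v - F x (m t)) * (s - t) + DvL x v \<bullet> (y - x)\<bar> \<le> \<epsilon> * (\<bar>s - t\<bar> + norm (y - x))"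
      using expansion[OF t x] by blast
    define a where "a = DvL x v \<bullet> v - L x v - F x (m t)"
    have xU: "x \<in> U" using x\<Omega> U_sup closure_subset by blast
    obtain r where r: "0 < r" "ball x r \<subseteq> \<Omega>" using \<Omega>_open x\<Omega> openE by blast
    have "((\<lambda>(s,y). u s y) has_derivative (\<lambda>(ds,dy). a * ds + (- DvL x v) \<bullet> dy)) (at (t,x))"
      unfolding has_derivative_at_alt
    proof (intro conjI allI impI)
      have "bounded_linear (\<lambda>p::real \<times> 'a. a * fst p + (- DvL x v) \<bullet> snd p)"
        by (intro bounded_linear_add bounded_linear_compose[OF bounded_linear_mult_right] bounded_linear_compose[OF bounded_linear_inner_right] bounded_linear_fst bounded_linear_snd)
      then show "bounded_linear (\<lambda>(ds,dy). a * ds + (- DvL x v) \<bullet> dy)" by (simp add: case_prod_unfold)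
      fix \<epsilon> :: real assume "0 < \<epsilon>"
      then obtain d where d: "0 < d" "\<forall>s y. \<bar>s - t\<bar> < d \<and> y \<in> closure \<Omega> \<and> norm (y - x) < d \<longrightarrow>
        \<bar>u s y - u t x - a * (s - t) + DvL x v \<bullet> (y - x)\<bar> \<le> \<epsilon> / 2 * (\<bar>s - t\<bar> + norm (y - x))"
        using ex half_gt_zero unfolding a_def by blast
      show "\<exists>d>0. \<forall>p. norm (p - (t,x)) < d \<longrightarrow> norm ((case p of (s,y) \<Rightarrow> u s y) - (case (t,x) of (s,y) \<Rightarrow> u s y) -
          (case p - (t,x) of (ds,dy) \<Rightarrow> a * ds + (- DvL x v) \<bullet> dy)) \<le> \<epsilon> * norm (p - (t,x))"
      proof (intro exI[of _ "min d r"] conjI allI impI)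
        fix p assume p: "norm (p - (t,x)) < min d r"
        obtain s y where sy: "p = (s,y)" by fastforce
        have n: "\<bar>s - t\<bar> \<le> norm (p - (t,x))" "norm (y - x) \<le> norm (p - (t,x))"
          using norm_fst_le[of "s - t" "y - x"] norm_snd_le[of "y - x" "s - t"] by (simp_all add: sy)
        have "y \<in> ball x r" using n p by (simp add: dist_norm norm_minus_commute)
        then have "y \<in> closure \<Omega>" using r closure_subset by blast
        then have "\<bar>u s y - u t x - a * (s - t) + DvL x v \<bullet> (y - x)\<bar> \<le> \<epsilon> / 2 * (\<bar>s - t\<bar> + norm (y - x))"
          using d(2) n p by simp
        also have "\<dots> \<le> \<epsilon> / 2 * (norm (p - (t,x)) + norm (p - (t,x)))" using n \<open>0 < \<epsilon>\<close> by (intro mult_left_mono add_mono) auto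
        finally show "norm ((case p of (s,y) \<Rightarrow> u s y) - (case (t,x) of (s,y) \<Rightarrow> u s y) -
          (case p - (t,x) of (ds,dy) \<Rightarrow> a * ds + (- DvL x v) \<bullet> dy)) \<le> \<epsilon> * norm (p - (t,x))"
          by (simp add: sy algebra_simps)
      qed (use d r in simp)
    qed
    moreover have "- a + Ham L x (- DvL x v) = F x (m t)" using Ham_dual[OF xU, of v] by (simp add: a_def)
    ultimately show ?thesis by blast
  qed
  have bdry: "\<exists>ut p\<tau>. ((\<lambda>s. u s x) has_real_derivative ut) (at t) \<and> superdiff_x \<Omega> u t x \<noteq> {} \<and>
        (\<forall>p\<in>superdiff_x \<Omega> u t x. tangential (outward_normal \<Omega> x) p = p\<tau>) \<and> - ut + Ham_tau L \<Omega> x p\<tau> = F x (m t)"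
    if t: "t \<in> {0<..<T}" and xf: "x \<in> frontier \<Omega>" and x: "x \<in> msupp (m t)" for t x
  proof -
    obtain v \<gamma> where \<gamma>: "\<gamma> \<in> paths T \<Omega>" "\<gamma> t = x" "(\<gamma> has_vector_derivative v) (at t)" and
      ex: "\<forall>\<epsilon>>0. \<exists>d>0. \<forall>s y. \<bar>s - t\<bar> < d \<and> y \<in> closure \<Omega> \<and> norm (y - x) < d \<longrightarrow>
      \<bar>u s y - u t x - (DvL x v \<bullet> v - L x v - F x (m t)) * (s - t) + DvL x v \<bullet> (y - x)\<bar> \<le> \<epsilon> * (\<bar>s - t\<bar> + norm (y - x))"
      using expansion[OF t x] by blast
    define a where "a = DvL x v \<bullet> v - L x v - F x (m t)"
    define q where "q = DvL x v"
    define \<nu> where "\<nu> = outward_normal \<Omega> x"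
    have x_cl: "x \<in> closure \<Omega>" using xf by (simp add: frontier_def)
    then have xU: "x \<in> U" using U_sup by blast
    have n\<nu>: "norm \<nu> = 1"
    proof -
      obtain R \<psi> \<psi>' \<psi>'' where "0 < R" "local_C2_defining \<Omega> x R \<psi> \<psi>' \<psi>''" "\<nu> = \<psi>' x /\<^sub>R norm (\<psi>' x)"
        using outward_normal_local[OF \<Omega>_C2 xf] unfolding \<nu>_def .
      moreover from this have "\<psi>' x \<noteq> 0" unfolding local_C2_defining_def by auto
      ultimately show ?thesis by simp
    qed
    \<comment> \<open>An interior time is decisive: \<gamma> stays in the closed domain both before
      and after t.\<close>
    have v\<nu>: "v \<bullet> \<nu> = 0"
    proof -
      have "\<forall>\<^sub>F s in nhds t. s \<in> {0<..<T}" using t by (intro eventually_nhds_in_open) auto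
      then have "\<forall>\<^sub>F s in nhds t. \<gamma> s \<in> closure \<Omega>" by eventually_elim (use path_in[OF \<gamma>(1)] in auto)
      then show ?thesis using normal_derivative_zero[OF \<Omega>_open \<Omega>_C2 _ \<gamma>(3)] xf \<gamma>(2) by (simp add: \<nu>_def)
    qed
    have ex_x: "\<exists>d>0. \<forall>y\<in>closure \<Omega>. norm (y - x) < d \<longrightarrow> \<bar>u t y - u t x + q \<bullet> (y - x)\<bar> \<le> \<epsilon> * norm (y - x)" if "0 < \<epsilon>" for \<epsilon>
    proof -
      obtain d where d: "0 < d" "\<forall>s y. \<bar>s - t\<bar> < d \<and> y \<in> closure \<Omega> \<and> norm (y - x) < d \<longrightarrow>
        \<bar>u s y - u t x - a * (s - t) + DvL x v \<bullet> (y - x)\<bar> \<le> \<epsilon> * (\<bar>s - t\<bar> + norm (y - x))"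
        using ex \<open>0 < \<epsilon>\<close> unfolding a_def by blast
      show ?thesis using d(1) d(2)[rule_format, of t] by (intro exI[of _ d]) (auto simp: q_def)
    qed
    have "((\<lambda>s. u s x) has_real_derivative a) (at t)"
      unfolding has_field_derivative_def has_derivative_at_alt
    proof (intro conjI allI impI)
      show "bounded_linear ((*) a)" by (rule bounded_linear_mult_right)
      fix \<epsilon> :: real assume "0 < \<epsilon>"
      then obtain d where d: "0 < d" "\<forall>s y. \<bar>s - t\<bar> < d \<and> y \<in> closure \<Omega> \<and> norm (y - x) < d \<longrightarrow>
        \<bar>u s y - u t x - a * (s - t) + DvL x v \<bullet> (y - x)\<bar> \<le> \<epsilon> * (\<bar>s - t\<bar> + norm (y - x))"
        using ex unfolding a_def by blast
      show "\<exists>d>0. \<forall>s. norm (s - t) < d \<longrightarrow> norm (u s x - u t x - a * (s - t)) \<le> \<epsilon> * norm (s - t)"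
        using d(1) d(2)[rule_format, of _ x] x_cl by (intro exI[of _ d]) auto
    qed
    moreover have "- q \<in> superdiff_x \<Omega> u t x"
      unfolding superdiff_x_def
    proof (intro CollectI allI impI)
      fix \<epsilon> :: real assume "0 < \<epsilon>"
      then obtain d where d: "0 < d" "\<forall>y\<in>closure \<Omega>. norm (y - x) < d \<longrightarrow> \<bar>u t y - u t x + q \<bullet> (y - x)\<bar> \<le> \<epsilon> * norm (y - x)"
        using ex_x by blast
      show "\<exists>\<delta>>0. \<forall>y\<in>closure \<Omega>. 0 < dist y x \<and> dist y x < \<delta> \<longrightarrow> (u t y - u t x - - q \<bullet> (y - x)) / norm (y - x) \<le> \<epsilon>"
      proof (intro exI[of _ d] conjI ballI impI d(1); elim conjE)
        fix y assume y: "y \<in> closure \<Omega>" "0 < dist y x" "dist y x < d"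
        then have "u t y - u t x + q \<bullet> (y - x) \<le> \<epsilon> * norm (y - x)" using d(2) by (force simp: dist_norm)
        then show "(u t y - u t x - - q \<bullet> (y - x)) / norm (y - x) \<le> \<epsilon>" using y by (simp add: dist_norm pos_divide_le_eq)
      qed
    qed
    moreover have "tangential \<nu> p = tangential \<nu> (- q)" if p: "p \<in> superdiff_x \<Omega> u t x" for p
    proof -
      \<comment> \<open>The expansion of u says that -q is a gradient relative to the closed domain;
        a supergradient p then satisfies <p + q, y - x> \<ge> -o(|y - x|). Approaching x along the
        direction \<theta> yields -|\<theta>|^2 \<ge> 0, so p and -q have the same tangential
        part.\<close>
      define \<theta> where "\<theta> = - tangential \<nu> (p + q)"
      have \<theta>\<nu>: "\<theta> \<bullet> \<nu> = 0" using n\<nu> by (simp add: \<theta>_def tangential_def inner_diff_left power2_norm_eq_inner[symmetric])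
      have pq: "(p + q) \<bullet> \<theta> = - (norm \<theta>)\<^sup>2"
      proof -
        have "p + q = - \<theta> + ((p + q) \<bullet> \<nu>) *\<^sub>R \<nu>" by (simp add: \<theta>_def tangential_def)
        then have "(p + q) \<bullet> \<theta> = - (\<theta> \<bullet> \<theta>) + ((p + q) \<bullet> \<nu>) * (\<nu> \<bullet> \<theta>)" by (metis inner_add_left inner_minus_left inner_scaleR_left)
        then show ?thesis using \<theta>\<nu> by (simp add: power2_norm_eq_inner inner_commute)
      qed
      obtain C d0 where d0: "0 < d0" "0 \<le> C" "\<And>h. \<lbrakk>0 < h; h < d0\<rbrakk> \<Longrightarrow> x + h *\<^sub>R \<theta> - (C * h\<^sup>2) *\<^sub>R \<nu> \<in> closure \<Omega>"
        using tangential_approach[OF \<Omega>_open \<Omega>_C2 xf] \<theta>\<nu> unfolding \<nu>_def by blast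
      define Z where "Z = norm \<theta> + C"
      have Z: "0 \<le> Z" using d0 by (simp add: Z_def)
      have "(norm \<theta>)\<^sup>2 \<le> 0"
      proof (rule field_le_epsilon)
        fix e :: real assume "0 < e"
        define \<epsilon> where "\<epsilon> = e / (4 * (Z + 1))"
        have \<epsilon>: "0 < \<epsilon>" using \<open>0 < e\<close> Z by (simp add: \<epsilon>_def)
        obtain d1 where d1: "0 < d1" "\<forall>y\<in>closure \<Omega>. norm (y - x) < d1 \<longrightarrow> \<bar>u t y - u t x + q \<bullet> (y - x)\<bar> \<le> \<epsilon> * norm (y - x)"
          using ex_x[OF \<epsilon>] by blast
        obtain d2 where d2: "0 < d2" "\<forall>y\<in>closure \<Omega>. 0 < dist y x \<and> dist y x < d2 \<longrightarrow> (u t y - u t x - p \<bullet> (y - x)) / norm (y - x) \<le> \<epsilon>"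
          using p \<epsilon> unfolding superdiff_x_def by blast
        define N where "N = C * norm (p + q)"
        have N: "0 \<le> N" using d0 by (simp add: N_def)
        \<comment> \<open>The test point lies within hZ of x, so the bounds put it inside the
          neighbourhoods of both estimates; h N \<le> e/2 absorbs the inward shift of order h^2,
          along which p + q is not controlled in sign.\<close>
        define h where "h = min (min (d0 / 2) 1) (min (min d1 d2 / (2 * (Z + 1))) (e / (2 * (N + 1))))"
        have h: "0 < h" "h < d0" "h \<le> 1" "h * Z < d1" "h * Z < d2" "h * N \<le> e / 2"
        proof -
          have pos: "0 < min d1 d2 / (2 * (Z + 1))" "0 < e / (2 * (N + 1))" using d1(1) d2(1) Z N \<open>0 < e\<close> by auto
          then show "0 < h" using d0(1) by (simp add: h_def)
          show "h < d0" "h \<le> 1" using d0(1) by (auto simp: h_def)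
          have "h \<le> min d1 d2 / (2 * (Z + 1))" "h \<le> e / (2 * (N + 1))" by (auto simp: h_def)
          moreover have "0 < 2 * (Z + 1)" "0 < 2 * (N + 1)" using Z N by auto
          ultimately have 1: "h * (2 * (Z + 1)) \<le> min d1 d2" and 2: "h * (2 * (N + 1)) \<le> e" by (simp_all only: pos_le_divide_eq)
          have 3: "h * (2 * (Z + 1)) \<le> d1" "h * (2 * (Z + 1)) \<le> d2" using 1 by simp_all
          have 4: "h * (2 * (Z + 1)) = 2 * (h * Z) + 2 * h" "h * (2 * (N + 1)) = 2 * (h * N) + 2 * h" "0 \<le> h * Z"
            using \<open>0 < h\<close> Z by (simp_all add: algebra_simps)
          show "h * Z < d1" "h * Z < d2" "h * N \<le> e / 2" using \<open>0 < h\<close> 2 3 4 by linarith+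
        qed
        define y where "y = x + h *\<^sub>R \<theta> - (C * h\<^sup>2) *\<^sub>R \<nu>"
        have y: "y \<in> closure \<Omega>" unfolding y_def by (rule d0(3)[OF h(1,2)])
        have yx: "y - x = h *\<^sub>R (\<theta> - (C * h) *\<^sub>R \<nu>)" by (simp add: y_def algebra_simps power2_eq_square)
        have nyx: "norm (y - x) \<le> h * Z"
        proof -
          have "norm (\<theta> - (C * h) *\<^sub>R \<nu>) \<le> norm \<theta> + norm ((C * h) *\<^sub>R \<nu>)" by (rule norm_triangle_ineq4)
          also have "\<dots> \<le> Z" using n\<nu> d0 h mult_left_mono[of h 1 C] by (simp add: Z_def)
          finally show ?thesis unfolding yx using h by simp
        qed
        have 1: "\<bar>u t y - u t x + q \<bullet> (y - x)\<bar> \<le> \<epsilon> * norm (y - x)" using d1(2) y nyx h by force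
        have 2: "u t y - u t x - p \<bullet> (y - x) \<le> \<epsilon> * norm (y - x)"
        proof (cases "y = x")
          case False
          then have "0 < dist y x \<and> dist y x < d2" using nyx h by (simp add: dist_norm)
          then have "(u t y - u t x - p \<bullet> (y - x)) / norm (y - x) \<le> \<epsilon>" using d2(2) y by blast
          then show ?thesis using False by (simp add: pos_divide_le_eq)
        qed simp
        have "- (2 * \<epsilon> * norm (y - x)) \<le> (p + q) \<bullet> (y - x)" using 1 2 unfolding inner_add_left by linarith
        also have "(p + q) \<bullet> (y - x) = h * (- (norm \<theta>)\<^sup>2 - C * h * ((p + q) \<bullet> \<nu>))"
          unfolding yx using pq by (simp add: inner_diff_right)
        finally have "h * ((norm \<theta>)\<^sup>2 + C * h * ((p + q) \<bullet> \<nu>)) \<le> 2 * \<epsilon> * norm (y - x)" by (simp add: algebra_simps)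
        also have "\<dots> \<le> 2 * \<epsilon> * (h * Z)" using nyx \<epsilon> by (intro mult_left_mono) auto
        also have "\<dots> = h * (2 * \<epsilon> * Z)" by simp
        finally have "(norm \<theta>)\<^sup>2 + C * h * ((p + q) \<bullet> \<nu>) \<le> 2 * \<epsilon> * Z" using h by simp
        moreover have "- (h * N) \<le> C * h * ((p + q) \<bullet> \<nu>)"
        proof -
          have "\<bar>(p + q) \<bullet> \<nu>\<bar> \<le> norm (p + q)" using Cauchy_Schwarz_ineq2[of "p + q" \<nu>] n\<nu> by simp
          then have "- norm (p + q) \<le> (p + q) \<bullet> \<nu>" by linarith
          then have "C * h * (- norm (p + q)) \<le> C * h * ((p + q) \<bullet> \<nu>)" using h d0 by (intro mult_left_mono) auto
          then show ?thesis by (simp add: N_def algebra_simps)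
        qed
        moreover have "2 * \<epsilon> * Z \<le> e / 2"
        proof -
          have "\<epsilon> * (4 * (Z + 1)) = e" using Z by (simp add: \<epsilon>_def)
          then show ?thesis using \<epsilon> by (simp add: algebra_simps)
        qed
        ultimately show "(norm \<theta>)\<^sup>2 \<le> 0 + e" using h by linarith
      qed
      then have "tangential \<nu> (p + q) = 0" by (simp add: \<theta>_def)
      then show ?thesis by (simp add: tangential_def inner_add_left algebra_simps)
    qed
    moreover have "- a + Ham_tau L \<Omega> x (tangential \<nu> (- q)) = F x (m t)"
    proof -
      have "Ham_tau L \<Omega> x (tangential \<nu> (- q)) = DvL x v \<bullet> v - L x v"
      proof (rule Ham_tau_dual[OF xU])
        show "v \<bullet> outward_normal \<Omega> x = 0" using v\<nu> by (simp add: \<nu>_def)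
        fix w assume "w \<bullet> outward_normal \<Omega> x = 0"
        then have "\<nu> \<bullet> w = 0" by (simp add: \<nu>_def inner_commute)
        moreover have "tangential \<nu> (- q) \<bullet> w = (- q) \<bullet> w - ((- q) \<bullet> \<nu>) * (\<nu> \<bullet> w)"
          unfolding tangential_def inner_diff_left inner_scaleR_left ..
        ultimately show "tangential \<nu> (- q) \<bullet> w = - (DvL x v \<bullet> w)" by (simp add: q_def)
      qed
      then show ?thesis by (simp add: a_def)
    qed
    ultimately show ?thesis unfolding \<nu>_def by blast
  qed
  show ?thesis
    unfolding constrained_visc_sol_def
    using sub super value_terminal interior bdry by (auto simp: g_def)
qed

end
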